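(* For $m\in\{2,3,4\}$ and $n$ with $m\le \binom{n+1}{2}$, let $ML_m$ denote the ML-degree of a generic $m$-dimensional linear subspace $\mathcal{L}\subset \mathbb{S}_n$ of the space of complex symmetric $n\times n$ matrices (the ML-degree of a generic linear covariance model of dimension $m$). Then $$ML_2 = 2n-3,$$ $$ML_3 = 3n^2-9n+7,$$ $$ML_4 = \frac{11}{3}n^3-18n^2+\frac{85}{3}n-15.$$
   Context: $\mathbb{S}_n$ denotes the complex vector space of symmetric $n\times n$ matrices with complex entries, endowed with the bilinear form $\langle A,B\rangle=\mathrm{Tr}(AB)$. For a linear subspace $\mathcal{L}\subset\mathbb{S}_n$, $\mathcal{L}^\perp\subset\mathbb{S}_n$ is its orthogonal with respect to this form, and $I_n$ is the identity matrix. The ML-degree of a linear subspace $\mathcal{L}\subset\mathbb{S}_n$ of dimension $m$ is the number of solutions $(K,\Sigma)\in\mathbb{S}_n\times\mathbb{S}_n$, for $S\in\mathbb{S}_n$ a generic symmetric matrix, of the system $$\Sigma\in\mathcal{L},\qquad K\Sigma=I_n,\qquad KSK-K\in\mathcal{L}^\perp.$$ Here "for $S$ generic" means for all $S$ in some nonempty Zariski open subset of $\mathbb{S}_n$ (depending on $\mathcal{L}$). "Generic $\mathcal{L}$ of dimension $m$" means all $\mathcal{L}$ in some nonempty Zariski open subset of the Grassmannian of $m$-dimensional subspaces of $\mathbb{S}_n$; $ML_m$ (which depends on $n$) is the common value of the ML-degree for such $\mathcal{L}$. *)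

theory Defs
  imports "HOL-Analysis.Analysis"
begin

text \<open>The library's scalar multiplications on \<open>complex^'n^'n\<close> are the one by reals and the
  row-wise one by \<open>complex^'n\<close>, so the complex one is introduced here; \<open>mat_cvs.subspace\<close>,
  \<open>mat_cvs.span\<close> and \<open>mat_cvs.dim\<close> are the library notions over the complex numbers.\<close>

definition cscale :: "complex \<Rightarrow> complex^'n^'n \<Rightarrow> complex^'n^'n" where
  "cscale c A = (\<chi> i j. c * A $ i $ j)"

global_interpretation mat_cvs: vector_space "cscale :: complex \<Rightarrow> complex^'n^'n \<Rightarrow> _"
  by unfold_locales (simp_all add: cscale_def vec_eq_iff algebra_simps)

definition sym_matrices :: "(complex^'n^'n) set" where
  "sym_matrices = {A. transpose A = A}"

definition orth_compl :: "(complex^'n^'n) set \<Rightarrow> (complex^'n^'n) set" where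
  "orth_compl L = {A \<in> sym_matrices. \<forall>B\<in>L. trace (A ** B) = 0}"

text \<open>Polynomial functions in complex variables indexed by \<open>'i\<close>. Each one involves only finitely
  many variables, even if \<open>'i\<close> is infinite.\<close>

inductive poly_fun :: "(('i \<Rightarrow> complex) \<Rightarrow> complex) \<Rightarrow> bool" where
  const: "poly_fun (\<lambda>x. c)"
| var: "poly_fun (\<lambda>x. x i)"
| add: "poly_fun f \<Longrightarrow> poly_fun g \<Longrightarrow> poly_fun (\<lambda>x. f x + g x)"
| mult: "poly_fun f \<Longrightarrow> poly_fun g \<Longrightarrow> poly_fun (\<lambda>x. f x * g x)"

inductive hom_poly_fun :: "nat \<Rightarrow> (('i \<Rightarrow> complex) \<Rightarrow> complex) \<Rightarrow> bool" where
  zero: "hom_poly_fun d (\<lambda>x. 0)"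
| const: "hom_poly_fun 0 (\<lambda>x. c)"
| var: "hom_poly_fun 1 (\<lambda>x. x i)"
| add: "hom_poly_fun d f \<Longrightarrow> hom_poly_fun d g \<Longrightarrow> hom_poly_fun d (\<lambda>x. f x + g x)"
| mult: "hom_poly_fun d f \<Longrightarrow> hom_poly_fun e g \<Longrightarrow> hom_poly_fun (d + e) (\<lambda>x. f x * g x)"

definition zariski_closed_sym :: "(complex^'n^'n) set \<Rightarrow> bool" where
  "zariski_closed_sym Z \<longleftrightarrow>
     (\<exists>F. (\<forall>f\<in>F. poly_fun f) \<and>
          Z = {S \<in> sym_matrices. \<forall>f\<in>F. f (\<lambda>(i, j). S $ i $ j) = 0})"

definition zariski_open_sym :: "(complex^'n^'n) set \<Rightarrow> bool" where
  "zariski_open_sym U \<longleftrightarrow> U \<subseteq> sym_matrices \<and> zariski_closed_sym (sym_matrices - U)"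

definition grassmannian :: "nat \<Rightarrow> (complex^'n^'n) set set" where
  "grassmannian m = {L. mat_cvs.subspace L \<and> L \<subseteq> sym_matrices \<and> mat_cvs.dim L = m}"

text \<open>Pluecker coordinates of the span of \<open>B 0, \<dots>, B (m - 1)\<close>: the \<open>m\<close> by \<open>m\<close> minor on the matrix
  positions \<open>c 0, \<dots>, c (m - 1)\<close>. All positions, not only those on and above the diagonal, and
  unordered or repeated choices of positions are allowed; this only repeats coordinates up to sign
  and adds zeros. The values of \<open>c\<close> from \<open>m\<close> on are irrelevant.\<close>

definition pluecker :: "nat \<Rightarrow> (nat \<Rightarrow> complex^'n^'n) \<Rightarrow> (nat \<Rightarrow> 'n \<times> 'n) \<Rightarrow> complex" where
  "pluecker m B c =
     (\<Sum>p | p permutes {..<m}.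
        of_int (sign p) * (\<Prod>k<m. B k $ fst (c (p k)) $ snd (c (p k))))"

text \<open>Another choice of the basis \<open>B\<close> multiplies all Pluecker coordinates by the same nonzero
  number, so that it does not matter whether one quantifies universally or existentially over
  \<open>B\<close>.\<close>

definition zariski_closed_gr :: "nat \<Rightarrow> (complex^'n^'n) set set \<Rightarrow> bool" where
  "zariski_closed_gr m Z \<longleftrightarrow>
     (\<exists>F. (\<forall>f\<in>F. \<exists>d. hom_poly_fun d f) \<and>
          Z = {L \<in> grassmannian m.
                 \<forall>B. mat_cvs.span (B ` {..<m}) = L \<longrightarrow> (\<forall>f\<in>F. f (pluecker m B) = 0)})"

definition zariski_open_gr :: "nat \<Rightarrow> (complex^'n^'n) set set \<Rightarrow> bool" where
  "zariski_open_gr m U \<longleftrightarrow> U \<subseteq> grassmannian m \<and> zariski_closed_gr m (grassmannian m - U)"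

definition ml_solutions ::
    "(complex^'n^'n) set \<Rightarrow> complex^'n^'n \<Rightarrow> ((complex^'n^'n) \<times> (complex^'n^'n)) set" where
  "ml_solutions L S =
     {(K, \<Sigma>). K \<in> sym_matrices \<and> \<Sigma> \<in> sym_matrices \<and>
        \<Sigma> \<in> L \<and> K ** \<Sigma> = mat 1 \<and> K ** S ** K - K \<in> orth_compl L}"

text \<open>Relational, because it is not clear a priori that the number of solutions is generically
  finite and constant. Two nonempty Zariski open sets meet, so there is at most one such \<open>d\<close>.\<close>

definition has_ml_degree :: "(complex^'n^'n) set \<Rightarrow> nat \<Rightarrow> bool" where
  "has_ml_degree L d \<longleftrightarrow>
     (\<exists>U. zariski_open_sym U \<and> U \<noteq> {} \<and>
          (\<forall>S\<in>U. finite (ml_solutions L S) \<and> card (ml_solutions L S) = d))"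

definition has_generic_ml_degree :: "'n::finite itself \<Rightarrow> nat \<Rightarrow> nat \<Rightarrow> bool" where
  "has_generic_ml_degree _ m d \<longleftrightarrow>
     (\<exists>U :: (complex^'n^'n) set set. zariski_open_gr m U \<and> U \<noteq> {} \<and>
        (\<forall>L\<in>U. has_ml_degree L d))"

end

theory Submission
  imports Defs "HOL-Computational_Algebra.Fundamental_Theorem_Algebra"
begin

text \<open>For a basis \<open>B\<close> of \<open>L\<close> the system becomes \<open>F x = G x\<close>, where \<open>F\<close> and \<open>G\<close> are the gradients of
  \<open>d/dt det (\<Sigma> x + t S)\<close> and of \<open>(n - 1) det (\<Sigma> x)\<close>, homogeneous of degrees \<open>n - 2\<close> and \<open>n - 1\<close>. If neither has a
  zero other than the origin, the number of nonzero solutions is the number \<open>(n - 1)\<^sup>m - (n - 2)\<^sup>m\<close> found for a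
  product system.

  As a special pencil take generic combinations of \<open>n + 1\<close> rank one matrices in general position. For \<open>m \<le> 3\<close> its
  gradients have no common zero; for \<open>m = 4\<close> the zeros of \<open>G\<close> are the \<open>n + 1 choose 3\<close> points where three of the
  \<open>n + 1\<close> coefficients vanish (for general pencils these are the matrices of rank \<open>n - 2\<close>), and each of them absorbs
  exactly two solutions when the product system is deformed into the given one.

  For data near the special ones no solution escapes, so the count is constant on an open set in the classical
  topology. It is a constructible function of the data (elimination of quantifiers), hence constant off a hypersurface.\<close>


section \<open>Polynomial functions and constructible predicates\<close>

text \<open>By Bezout, \<open>F x = G x\<close> has (n - 1)^m solutions with multiplicity, of which
  (n - 2)^m sit at the origin, provided that \<open>G\<close> has no zero at infinity. For m = 4
  this proviso fails for every pencil with n \<ge> 3: \<open>G\<close> is a gradient of the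
  determinant, and symmetric matrices of rank at most n - 2 have codimension 3, so they meet every
  projective 3-space. This obstacle forces two separate arguments at the nodes. The product system
  has no such zeros, so deforming towards it lets solutions come in from infinity, and they have to
  be counted by a blow-up; nearby pencils still have nodes, and there the equations themselves
  forbid any solution to come in. Rank one matrices make this explicit: the determinant becomes an
  elementary symmetric polynomial in n + 1 linear forms, and the blown-up equations reduce to one
  quadratic equation, whose two roots explain the factor 2. Counts at different parameters are
  compared through constructibility in a single complex variable, which replaces intersection
  multiplicities and the continuation of solutions along paths.\<close>

type_synonym 'i cfun = "('i => complex) => complex"

lemma poly_fun_sum:
  assumes "\<And>k. k \<in> I ==> poly_fun (f k)"
  shows "poly_fun (\<lambda>z. \<Sum>k\<in>I. f k z)"
  using assms
proof (induction I rule: infinite_finite_induct)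
  case (insert k I)
  then show ?case by (simp add: poly_fun.add)
qed (simp_all add: poly_fun.const)

lemma poly_fun_prod:
  assumes "\<And>k. k \<in> I ==> poly_fun (f k)"
  shows "poly_fun (\<lambda>z. \<Prod>k\<in>I. f k z)"
  using assms
proof (induction I rule: infinite_finite_induct)
  case (insert k I)
  then show ?case by (simp add: poly_fun.mult)
qed (simp_all add: poly_fun.const)

lemma poly_fun_uminus: "poly_fun f ==> poly_fun (\<lambda>z. - f z)"
  using poly_fun.mult[OF poly_fun.const[of "-1"], of f] by simp

lemma poly_fun_diff: "poly_fun f ==> poly_fun g ==> poly_fun (\<lambda>z. f z - g z)"
  using poly_fun.add[of f "\<lambda>z. - g z"] by (simp add: poly_fun_uminus)

lemma poly_fun_power: "poly_fun f ==> poly_fun (\<lambda>z. f z ^ k)"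
  by (induction k) (auto intro: poly_fun.const poly_fun.mult)

lemmas poly_fun_intros = poly_fun.intros poly_fun_sum poly_fun_prod poly_fun_uminus
  poly_fun_diff poly_fun_power

lemma poly_fun_subst:
  assumes "poly_fun f" "\<And>i. poly_fun (g i)"
  shows "poly_fun (\<lambda>z. f (\<lambda>i. g i z))"
  using assms(1)
proof induction
  case (add f h)
  show ?case by (rule poly_fun.add[OF add.IH])
next
  case (mult f h)
  show ?case by (rule poly_fun.mult[OF mult.IH])
qed (auto intro: assms(2) poly_fun.const)

lemma poly_fun_line:
  assumes "poly_fun f"
  obtains p where "\<And>t. f (\<lambda>i. a i + t * b i) = poly p t"
proof -
  have "\<exists>p. \<forall>t. f (\<lambda>i. a i + t * b i) = poly p t"
    using assms
  proof induction
    case (const c)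
    show ?case by (rule exI[of _ "[:c:]"]) simp
  next
    case (var i)
    show ?case by (rule exI[of _ "[:a i, b i:]"]) simp
  next
    case (add f g)
    then show ?case by (metis poly_add)
  next
    case (mult f g)
    then show ?case by (metis poly_mult)
  qed
  with that show ?thesis by blast
qed

text \<open>Polynomial functions form an integral domain: on the line through \<open>a\<close> and
  \<open>b\<close> both factors restrict to nonzero univariate polynomials.\<close>

lemma poly_fun_mult_nonzero:
  assumes "poly_fun f" "poly_fun g" "f a \<noteq> 0" "g b \<noteq> 0"
  shows "\<exists>z. f z * g z \<noteq> 0"
proof -
  obtain p where p: "\<And>t. f (\<lambda>i. a i + t * (b i - a i)) = poly p t"
    using poly_fun_line[OF assms(1)] by metis
  obtain q where q: "\<And>t. g (\<lambda>i. a i + t * (b i - a i)) = poly q t"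
    using poly_fun_line[OF assms(2)] by metis
  have "poly p 0 \<noteq> 0" "poly q 1 \<noteq> 0"
    using p[of 0] q[of 1] assms by simp_all
  then have "p * q \<noteq> 0" by auto
  then obtain t where "poly (p * q) t \<noteq> 0"
    using poly_all_0_iff_0 by blast
  then show ?thesis using p[of t] q[of t] by (intro exI[of _ "\<lambda>i. a i + t * (b i - a i)"]) auto
qed

section \<open>Boolean combinations of polynomial equations\<close>

inductive constructible :: "(('i => complex) => bool) => bool" where
  zero: "poly_fun f ==> constructible (\<lambda>z. f z = 0)"
| neg: "constructible P ==> constructible (\<lambda>z. \<not> P z)"
| conj: "constructible P ==> constructible Q ==> constructible (\<lambda>z. P z \<and> Q z)"

lemma constructible_cong: "constructible P ==> (\<And>z. P z = Q z) ==> constructible Q"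
  using ext[of P Q] by simp

lemma constructible_disj:
  assumes "constructible P" "constructible Q"
  shows "constructible (\<lambda>z. P z \<or> Q z)"
  by (rule constructible_cong[OF constructible.neg[OF constructible.conj[OF constructible.neg[OF assms(1)]
        constructible.neg[OF assms(2)]]]]) simp

lemma constructible_const: "constructible (\<lambda>z. b)"
proof (cases b)
  case True
  then show ?thesis using constructible.zero[OF poly_fun.const[of 0]] by simp
next
  case False
  then show ?thesis using constructible.zero[OF poly_fun.const[of 1]] by simp
qed

lemma constructible_Ball:
  assumes "finite A" "\<And>a. a \<in> A ==> constructible (P a)"
  shows "constructible (\<lambda>z. \<forall>a\<in>A. P a z)"
  using assms
proof (induction A rule: finite_induct)
  case (insert a A)
  then show ?case using constructible.conj[of "P a" "\<lambda>z. \<forall>a\<in>A. P a z"] by simp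
qed (simp add: constructible_const)

lemma constructible_Bex:
  assumes "finite A" "\<And>a. a \<in> A ==> constructible (P a)"
  shows "constructible (\<lambda>z. \<exists>a\<in>A. P a z)"
  using assms
proof (induction A rule: finite_induct)
  case (insert a A)
  then show ?case using constructible_disj[of "P a" "\<lambda>z. \<exists>a\<in>A. P a z"] by simp
qed (simp add: constructible_const)

lemma constructible_subst:
  assumes "constructible P" "\<And>i. poly_fun (g i)"
  shows "constructible (\<lambda>z. P (\<lambda>i. g i z))"
  using assms(1)
proof induction
  case (zero f)
  show ?case by (rule constructible.zero[OF poly_fun_subst[OF zero assms(2)]])
next
  case (neg P)
  show ?case by (rule constructible.neg[OF neg.IH])
next
  case (conj P Q)
  show ?case by (rule constructible.conj[OF conj.IH])
qed

text \<open>A family of univariate polynomials of degree \<open>< d\<close> whose coefficients are polynomial functions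
  of the parameters; for \<open>d = 0\<close> it vanishes.\<close>

definition poly_family :: "nat => (('i => complex) => complex poly) => bool" where
  "poly_family d q \<longleftrightarrow> (\<forall>z k. k \<ge> d \<longrightarrow> coeff (q z) k = 0) \<and> (\<forall>k. poly_fun (\<lambda>z. coeff (q z) k))"

lemma poly_family_0: "poly_family 0 q ==> q z = 0"
  by (auto simp: poly_family_def poly_eq_iff)

lemma poly_family_mult:
  assumes "poly_family d q" "poly_family e r"
  shows "poly_family (d + e) (\<lambda>z. q z * r z)"
  unfolding poly_family_def coeff_mult
proof (intro conjI allI impI)
  fix z k assume k: "k \<ge> d + e"
  show "(\<Sum>i\<le>k. coeff (q z) i * coeff (r z) (k - i)) = 0"
  proof (rule sum.neutral, intro ballI)
    fix i assume "i \<in> {..k}"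
    then have "i \<ge> d \<or> k - i \<ge> e" using k by auto
    then show "coeff (q z) i * coeff (r z) (k - i) = 0" using assms by (auto simp: poly_family_def)
  qed
qed (use assms in \<open>auto simp: poly_family_def intro!: poly_fun_intros\<close>)

lemma poly_family_power:
  assumes "poly_family d q"
  shows "\<exists>e. poly_family e (\<lambda>z. q z ^ k)"
proof (induction k)
  case 0
  have "poly_family 1 (\<lambda>z. 1)"
    by (auto simp: poly_family_def intro!: poly_fun.const)
  then show ?case by auto
next
  case (Suc k)
  then show ?case using poly_family_mult[OF assms] by auto
qed

text \<open>Used where the formal leading coefficient vanishes: the polynomial is unchanged there,
  while the degree bound drops.\<close>

lemma poly_family_truncate:
  assumes "poly_family (Suc d) q"
  shows "poly_family d (\<lambda>z. q z - monom (coeff (q z) d) d)"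
  unfolding poly_family_def
proof (intro conjI allI impI)
  fix z k assume "k \<ge> d"
  then show "coeff (q z - monom (coeff (q z) d) d) k = 0"
    using assms by (cases "k = d") (auto simp: poly_family_def)
next
  fix k
  have "poly_fun (\<lambda>z. coeff (q z) k - (if d = k then coeff (q z) d else 0))"
    using assms by (cases "d = k") (auto simp: poly_family_def intro!: poly_fun_intros)
  then show "poly_fun (\<lambda>z. coeff (q z - monom (coeff (q z) d) d) k)" by simp
qed

text \<open>One step of pseudo-division: multiplying by the leading coefficient of \<open>r\<close>
  avoids dividing by a function of the parameters, and the two terms of formal degree
  \<open>d\<close> cancel.\<close>

lemma poly_family_reduce:
  assumes q: "poly_family (Suc d) q" and r: "poly_family (Suc e) r" and "e \<le> d"
  shows "poly_family d (\<lambda>z. smult (coeff (r z) e) (q z) - monom (coeff (q z) d) (d - e) * r z)"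
  unfolding poly_family_def
proof (intro conjI allI impI)
  fix z k assume k: "k \<ge> d"
  have "coeff (r z) (k - (d - e)) = (if k = d then coeff (r z) e else 0)"
    using k r \<open>e \<le> d\<close> by (auto simp: poly_family_def)
  then show "coeff (smult (coeff (r z) e) (q z) - monom (coeff (q z) d) (d - e) * r z) k = 0"
    using q k \<open>e \<le> d\<close> by (auto simp: poly_family_def coeff_monom_mult)
next
  fix k
  show "poly_fun (\<lambda>z. coeff (smult (coeff (r z) e) (q z) - monom (coeff (q z) d) (d - e) * r z) k)"
    using q r by (cases "d - e \<le> k") (auto simp: poly_family_def coeff_monom_mult intro!: poly_fun_intros)
qed

section \<open>Elimination of an existential quantifier\<close>

lemma constructible_coeff_nz: "poly_family d q ==> constructible (\<lambda>z. coeff (q z) k \<noteq> 0)"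
  by (auto simp: poly_family_def intro!: constructible.intros)

lemma constructible_poly_nz:
  assumes "poly_family d q"
  shows "constructible (\<lambda>z. q z \<noteq> 0)"
proof (rule constructible_cong[OF constructible_Bex[of "{..<d}" "\<lambda>k z. coeff (q z) k \<noteq> 0"]])
  fix z
  show "(\<exists>k\<in>{..<d}. coeff (q z) k \<noteq> 0) = (q z \<noteq> 0)"
    using assms unfolding poly_family_def poly_eq_iff by (metis coeff_0 lessThan_iff linorder_not_le)
qed (auto intro: constructible_coeff_nz assms)

text \<open>Pseudo-division lowers the bound \<open>e\<close> without changing divisibility, because
  the leading coefficient of \<open>q z\<close> is a nonzero constant. Below the degree of
  \<open>q z\<close> only the zero polynomial is divisible.\<close>

lemma constructible_dvd:
  assumes q: "poly_family (Suc d) q" and "poly_family e g"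
  shows "constructible (\<lambda>z. coeff (q z) d \<noteq> 0 \<and> q z dvd g z)"
  using assms(2)
proof (induction e arbitrary: g)
  case 0
  show ?case
    by (rule constructible_cong[OF constructible_coeff_nz[OF q]]) (use poly_family_0[OF 0] in auto)
next
  case (Suc e)
  have lead: "degree (q z) = d" "q z \<noteq> 0" if "coeff (q z) d \<noteq> 0" for z
  proof -
    have "degree (q z) \<le> d"
      using q by (intro degree_le) (auto simp: poly_family_def)
    then show "degree (q z) = d" using le_degree[OF that] by auto
    show "q z \<noteq> 0" using that by auto
  qed
  show ?case
  proof (cases "d \<le> e")
    case True
    define g' where "g' = (\<lambda>z. smult (coeff (q z) d) (g z) - monom (coeff (g z) e) (e - d) * q z)"
    have "poly_family e g'"
      unfolding g'_def by (rule poly_family_reduce[OF Suc.prems q True])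
    from Suc.IH[OF this] show ?thesis
    proof (rule constructible_cong)
      fix z
      have "q z dvd g' z \<longleftrightarrow> q z dvd g z" if "coeff (q z) d \<noteq> 0"
        unfolding g'_def using that
        by (subst dvd_diff_left_iff) (auto simp: dvd_smult_iff)
      then show "(coeff (q z) d \<noteq> 0 \<and> q z dvd g' z) = (coeff (q z) d \<noteq> 0 \<and> q z dvd g z)"
        by blast
    qed
  next
    case False
    have "constructible (\<lambda>z. coeff (q z) d \<noteq> 0 \<and> \<not> g z \<noteq> 0)"
      by (intro constructible.conj constructible.neg[OF constructible_poly_nz[OF Suc.prems]] constructible_coeff_nz[OF q])
    then show ?thesis
    proof (rule constructible_cong)
      fix z
      have "g z = 0" if "q z dvd g z" "coeff (q z) d \<noteq> 0"
      proof (rule ccontr)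
        assume g: "g z \<noteq> 0"
        then have "d \<le> degree (g z)" using that lead dvd_imp_degree_le by metis
        moreover have "degree (g z) \<le> e"
          using Suc.prems by (intro degree_le) (auto simp: poly_family_def)
        ultimately show False using False by auto
      qed
      then show "(coeff (q z) d \<noteq> 0 \<and> \<not> g z \<noteq> 0) = (coeff (q z) d \<noteq> 0 \<and> q z dvd g z)" by auto
    qed
  qed
qed

text \<open>A Euclidean algorithm with parameters. Of two families, the one with the larger bound is
  reduced by the other wherever the leading coefficient of the other is nonzero; elsewhere that
  coefficient is dropped. A single polynomial is decided by the univariate Nullstellensatz, and an
  empty list by \<open>g z \<noteq> 0\<close>.\<close>

lemma constructible_ex_poly:
  assumes "list_all2 poly_family ds qs" and g: "poly_family e g"
  shows "constructible (\<lambda>z. \<exists>y. (\<forall>q\<in>set qs. poly (q z) y = 0) \<and> poly (g z) y \<noteq> 0)"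
  using assms(1)
\<comment> \<open>\<open>Suc\<close> makes the measure drop also when a family with bound 0 is
  removed.\<close>
proof (induction "sum_list (map Suc ds)" arbitrary: ds qs rule: less_induct)
  case less
  define Ex where "Ex = (\<lambda>qs z. \<exists>y. (\<forall>q\<in>set qs. poly (q z) y = 0) \<and> poly (g z) y \<noteq> 0)"
  have IH: "constructible (Ex qs')"
    if "sum_list (map Suc ds') < sum_list (map Suc ds)" "list_all2 poly_family ds' qs'" for ds' qs'
    unfolding Ex_def by (rule less.hyps[OF that])
  have lead_cases: "constructible (Ex (q # qs'))"
    if "poly_family (Suc d) q" "constructible (\<lambda>z. coeff (q z) d \<noteq> 0 \<and> Ex (q # qs') z)"
      "constructible (Ex ((\<lambda>z. q z - monom (coeff (q z) d) d) # qs'))" for q d qs'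
  proof -
    let ?q' = "\<lambda>z. q z - monom (coeff (q z) d) d"
    have "constructible (\<lambda>z. (coeff (q z) d \<noteq> 0 \<and> Ex (q # qs') z) \<or>
        (\<not> coeff (q z) d \<noteq> 0 \<and> Ex (?q' # qs') z))"
      by (intro constructible_disj that constructible.conj constructible.neg constructible_coeff_nz[OF that(1)])
    then show ?thesis
      by (rule constructible_cong) (auto simp: Ex_def)
  qed
  consider "qs = []" | d q where "ds = [d]" "qs = [q]" "poly_family d q"
    | d1 d2 ds' q1 q2 qs' where "ds = d1 # d2 # ds'" "qs = q1 # q2 # qs'"
    using less.prems by (cases qs; cases "tl qs") (auto simp: list_all2_Cons2)
  then have "constructible (Ex qs)"
  proof cases
    case 1
    have "constructible (\<lambda>z. g z \<noteq> 0)" by (rule constructible_poly_nz[OF g])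
    then show ?thesis
      by (rule constructible_cong) (use poly_all_0_iff_0 in \<open>fastforce simp: 1 Ex_def\<close>)
  next
    case 2
    show ?thesis
    proof (cases d)
      case 0
      then have "q z = 0" for z using 2 poly_family_0 by blast
      then have "Ex qs = Ex []" by (simp add: Ex_def 2)
      moreover have "constructible (Ex [])" by (rule IH[of "[]"]) (auto simp: 2)
      ultimately show ?thesis by simp
    next
      case (Suc d')
      note q = 2(3)[unfolded Suc]
      show ?thesis
        unfolding 2
      proof (rule lead_cases[OF q])
        \<comment> \<open>Where the leading coefficient is nonzero, \<open>d'\<close> is the degree
          of \<open>q z\<close>; then all roots of \<open>q z\<close> are roots of
          \<open>g z\<close> exactly if \<open>q z\<close> divides \<open>g z ^ d'\<close>.\<close>
        obtain e' where e': "poly_family e' (\<lambda>z. g z ^ d')" using poly_family_power[OF g] by blast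
        have "constructible (\<lambda>z. coeff (q z) d' \<noteq> 0 \<and>
            \<not> (coeff (q z) d' \<noteq> 0 \<and> q z dvd g z ^ d'))"
          by (intro constructible.conj constructible.neg[OF constructible_dvd[OF q e']] constructible_coeff_nz[OF q])
        then show "constructible (\<lambda>z. coeff (q z) d' \<noteq> 0 \<and> Ex [q] z)"
        proof (rule constructible_cong)
          fix z
          have "Ex [q] z \<longleftrightarrow> \<not> q z dvd g z ^ d'" if "coeff (q z) d' \<noteq> 0"
          proof -
            have "degree (q z) \<le> d'"
              using q by (intro degree_le) (auto simp: poly_family_def)
            then have "degree (q z) = d'" using le_degree[OF that] by auto
            moreover have "q z \<noteq> 0" using that by auto
            ultimately show ?thesis
              using nullstellensatz_univariate[of "q z" "g z"] by (auto simp: Ex_def)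
          qed
          then show "(coeff (q z) d' \<noteq> 0 \<and> \<not> (coeff (q z) d' \<noteq> 0 \<and> q z dvd g z ^ d')) =
              (coeff (q z) d' \<noteq> 0 \<and> Ex [q] z)" by blast
        qed
        show "constructible (Ex [\<lambda>z. q z - monom (coeff (q z) d') d'])"
          by (rule IH[of "[d']"]) (auto simp: 2 Suc poly_family_truncate[OF q])
      qed
    qed
  next
    case 3
    have main: "constructible (Ex (q2 # q1 # qs'))"
      if "poly_family d1 q1" "poly_family d2 q2" "list_all2 poly_family ds' qs'" "d2 \<le> d1"
        "Suc d1 + Suc d2 + sum_list (map Suc ds') = sum_list (map Suc ds)" for d1 d2 q1 q2
    proof (cases d2)
      case 0
      then have "q2 z = 0" for z using that poly_family_0 by blast
      then have "Ex (q2 # q1 # qs') = Ex (q1 # qs')" by (simp add: Ex_def)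
      moreover have "constructible (Ex (q1 # qs'))"
        by (rule IH[of "d1 # ds'"]) (use that in auto)
      ultimately show ?thesis by simp
    next
      case (Suc d2')
      then obtain d1' where d1': "d1 = Suc d1'" using \<open>d2 \<le> d1\<close> Suc by (cases d1) auto
      note q1 = that(1)[unfolded d1'] and q2 = that(2)[unfolded Suc]
      show ?thesis
      proof (rule lead_cases[OF q2])
        define q1' where "q1' = (\<lambda>z. smult (coeff (q2 z) d2') (q1 z) - monom (coeff (q1 z) d1') (d1' - d2') * q2 z)"
        have q1': "poly_family d1' q1'"
          unfolding q1'_def by (rule poly_family_reduce[OF q1 q2]) (use that Suc d1' in auto)
        have "constructible (\<lambda>z. coeff (q2 z) d2' \<noteq> 0 \<and> Ex (q2 # q1' # qs') z)"
          by (intro constructible.conj constructible_coeff_nz[OF q2] IH[of "d2 # d1' # ds'"])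
            (use that q1' d1' in auto)
        then show "constructible (\<lambda>z. coeff (q2 z) d2' \<noteq> 0 \<and> Ex (q2 # q1 # qs') z)"
          by (rule constructible_cong) (auto simp: Ex_def q1'_def)
        show "constructible (Ex ((\<lambda>z. q2 z - monom (coeff (q2 z) d2') d2') # q1 # qs'))"
          by (rule IH[of "d2' # d1 # ds'"]) (use that Suc poly_family_truncate[OF q2] in auto)
      qed
    qed
    have all: "poly_family d1 q1" "poly_family d2 q2" "list_all2 poly_family ds' qs'"
      using less.prems 3 by auto
    show ?thesis
    proof (cases "d2 \<le> d1")
      case True
      have "constructible (Ex (q2 # q1 # qs'))"
        by (rule main[OF all True]) (simp add: 3)
      then show ?thesis by (rule constructible_cong) (auto simp: Ex_def 3)
    next
      case False
      have "constructible (Ex (q1 # q2 # qs'))"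
        by (rule main[OF all(2,1,3)]) (use False in \<open>auto simp: 3\<close>)
      then show ?thesis by (simp add: 3)
    qed
  qed
  then show ?case by (simp add: Ex_def)
qed

lemma poly_fun_as_family:
  assumes "poly_fun f"
  shows "\<exists>d q. poly_family d q \<and> (\<forall>z y. f (z(i := y)) = poly (q z) y)"
  using assms
proof induction
  case (const c)
  show ?case
    by (rule exI[of _ 1], rule exI[of _ "\<lambda>z. [:c:]"])
      (auto simp: poly_family_def coeff_pCons intro: poly_fun.const split: nat.split)
next
  case (var j)
  show ?case
  proof (cases "j = i")
    case True
    show ?thesis
      by (rule exI[of _ 2], rule exI[of _ "\<lambda>z. [:0, 1:]"])
        (auto simp: True poly_family_def coeff_pCons intro: poly_fun.const split: nat.split)
  next
    case False
    have "poly_fun (\<lambda>z. coeff [:z j:] k)" for k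
      by (cases k) (auto intro: poly_fun.intros)
    then show ?thesis
      by (intro exI[of _ 1] exI[of _ "\<lambda>z. [:z j:]"])
        (auto simp: False poly_family_def coeff_pCons split: nat.split)
  qed
next
  case (add f g)
  then obtain d q e r where *: "poly_family d q" "\<forall>z y. f (z(i := y)) = poly (q z) y"
    "poly_family e r" "\<forall>z y. g (z(i := y)) = poly (r z) y" by blast
  have "poly_family (max d e) (\<lambda>z. q z + r z)"
    using * by (auto simp: poly_family_def intro: poly_fun.add)
  then show ?case using * by (metis poly_add)
next
  case (mult f g)
  then obtain d q e r where *: "poly_family d q" "\<forall>z y. f (z(i := y)) = poly (q z) y"
    "poly_family e r" "\<forall>z y. g (z(i := y)) = poly (r z) y" by blast
  then show ?case using poly_family_mult[OF *(1,3)] by (metis poly_mult)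
qed

text \<open>An existential quantifier commutes with the disjunction, and one inequation per disjunct
  suffices because several can be multiplied together.\<close>

inductive disj_normal :: "(('i => complex) => bool) => bool" where
  basic: "\<forall>f\<in>set fs. poly_fun f ==> poly_fun g ==> disj_normal (\<lambda>z. (\<forall>f\<in>set fs. f z = 0) \<and> g z \<noteq> 0)"
| disj: "disj_normal P ==> disj_normal Q ==> disj_normal (\<lambda>z. P z \<or> Q z)"

lemma disj_normal_conj:
  assumes "disj_normal P" "disj_normal Q" shows "disj_normal (\<lambda>z. P z \<and> Q z)"
  using assms
proof (induction arbitrary: Q)
  case (basic fs g)
  from basic(3) show ?case
  proof induction
    case (basic fs' g')
    have "disj_normal (\<lambda>z. (\<forall>f\<in>set (fs @ fs'). f z = 0) \<and> g z * g' z \<noteq> 0)"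
      using basic \<open>poly_fun g\<close> \<open>\<forall>f\<in>set fs. poly_fun f\<close> by (intro disj_normal.basic poly_fun.mult) auto
    then show ?case by (rule back_subst[of disj_normal]) auto
  next
    case (disj P Q)
    show ?case by (rule back_subst[of disj_normal, OF disj_normal.disj[OF disj.IH]]) auto
  qed
next
  case (disj P1 P2)
  show ?case
    by (rule back_subst[of disj_normal, OF disj_normal.disj[OF disj.IH(1)[OF disj.prems] disj.IH(2)[OF disj.prems]]]) auto
qed

lemma constructible_disj_normal: "constructible P ==> disj_normal P \<and> disj_normal (\<lambda>z. \<not> P z)"
proof (induction rule: constructible.induct)
  case (zero f)
  then show ?case
    using disj_normal.basic[of "[f]" "\<lambda>_. 1"] disj_normal.basic[of "[]" f] by (simp add: poly_fun.const)
next
  case (conj P Q)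
  then show ?case using disj_normal_conj[of P Q] disj_normal.disj[of "\<lambda>z. \<not> P z" "\<lambda>z. \<not> Q z"] by simp
qed simp

text \<open>Chevalley's theorem for the projection along one coordinate: each disjunct of the normal
  form asks for a common root of polynomials in \<open>y\<close> at which one further polynomial
  does not vanish.\<close>

lemma constructible_ex:
  assumes "constructible P"
  shows "constructible (\<lambda>z. \<exists>y. P (z(i := y)))"
  using constructible_disj_normal[OF assms, THEN conjunct1]
proof induction
  case (basic fs g)
  have "\<exists>ds qs. list_all2 poly_family ds qs \<and>
      (\<forall>z y. (\<forall>f\<in>set fs. f (z(i := y)) = 0) \<longleftrightarrow> (\<forall>q\<in>set qs. poly (q z) y = 0))"
    using basic(1)
  proof (induction fs)
    case (Cons f fs)
    then have "poly_fun f" "\<forall>f\<in>set fs. poly_fun f" by simp_all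
    from Cons.IH[OF this(2)] obtain ds qs where qs: "list_all2 poly_family ds qs"
      "\<And>z y. (\<forall>f\<in>set fs. f (z(i := y)) = 0) \<longleftrightarrow> (\<forall>q\<in>set qs. poly (q z) y = 0)" by blast
    from poly_fun_as_family[OF \<open>poly_fun f\<close>] obtain d q
      where q: "poly_family d q" "\<And>z y. f (z(i := y)) = poly (q z) y" by blast
    show ?case
      using qs(1) q(1) by (intro exI[of _ "d # ds"] exI[of _ "q # qs"]) (simp only: list.set ball_simps qs(2) q(2) list.rel_inject simp_thms)
  qed (intro exI[of _ "[]"], simp)
  then obtain ds qs where qs: "list_all2 poly_family ds qs"
    "\<And>z y. (\<forall>f\<in>set fs. f (z(i := y)) = 0) \<longleftrightarrow> (\<forall>q\<in>set qs. poly (q z) y = 0)" by blast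
  obtain e q where q: "poly_family e q" "\<And>z y. g (z(i := y)) = poly (q z) y"
    using poly_fun_as_family[OF basic(2)] by blast
  show ?case unfolding qs(2) q(2) by (rule constructible_ex_poly[OF qs(1) q(1)])
next
  case (disj P Q)
  show ?case by (rule constructible_cong[OF constructible_disj[OF disj.IH]]) auto
qed

lemma constructible_ex_finite:
  assumes "finite J" "constructible P"
  shows "constructible (\<lambda>z. \<exists>y. P (\<lambda>i. if i \<in> J then y i else z i))"
  using assms
proof (induction J arbitrary: P rule: finite_induct)
  case (insert j J)
  have "constructible (\<lambda>z. \<exists>y. P (z(j := y)))" by (rule constructible_ex[OF insert.prems])
  from insert.IH[OF this] show ?case
  proof (rule constructible_cong)
    fix z :: "'a => complex"
    have *: "(\<lambda>i. if i \<in> J then y i else z i)(j := u) = (\<lambda>i. if i \<in> insert j J then (y(j := u)) i else z i)" for y :: "'a => complex" and u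
      using insert.hyps by auto
    show "(\<exists>y u. P ((\<lambda>i. if i \<in> J then y i else z i)(j := u))) =
        (\<exists>y. P (\<lambda>i. if i \<in> insert j J then y i else z i))"
      unfolding *
    proof (intro iffI; elim exE)
      fix y assume "P (\<lambda>i. if i \<in> insert j J then y i else z i)"
      then show "\<exists>y u. P (\<lambda>i. if i \<in> insert j J then (y(j := u)) i else z i)"
        by (intro exI[of _ y] exI[of _ "y j"]) (simp only: fun_upd_triv)
    qed (rule exI)
  qed
qed simp

text \<open>Irreducibility of affine space in logical form. At a conjunction the two exceptional
  hypersurfaces are united by multiplying their equations.\<close>

lemma constructible_generic:
  assumes "constructible P"
  obtains h where "poly_fun h" "\<exists>z. h z \<noteq> 0" "(\<forall>z. h z \<noteq> 0 \<longrightarrow> P z) \<or> (\<forall>z. h z \<noteq> 0 \<longrightarrow> \<not> P z)"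
proof -
  have "\<exists>h. poly_fun h \<and> (\<exists>z. h z \<noteq> 0) \<and> ((\<forall>z. h z \<noteq> 0 \<longrightarrow> P z) \<or> (\<forall>z. h z \<noteq> 0 \<longrightarrow> \<not> P z))"
    using assms
  proof induction
    case (zero f)
    show ?case
    proof (cases "\<exists>z. f z \<noteq> 0")
      case True
      with zero show ?thesis by blast
    next
      case False
      then show ?thesis by (intro exI[of _ "\<lambda>z. 1"]) (simp add: poly_fun.const)
    qed
  next
    case (neg P)
    then show ?case by blast
  next
    case (conj P Q)
    then obtain h k where hk: "poly_fun h" "poly_fun k" "\<exists>z. h z \<noteq> 0" "\<exists>z. k z \<noteq> 0"
      "(\<forall>z. h z \<noteq> 0 \<longrightarrow> P z) \<or> (\<forall>z. h z \<noteq> 0 \<longrightarrow> \<not> P z)"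
      "(\<forall>z. k z \<noteq> 0 \<longrightarrow> Q z) \<or> (\<forall>z. k z \<noteq> 0 \<longrightarrow> \<not> Q z)" by blast
    then have "\<exists>z. h z * k z \<noteq> 0" using poly_fun_mult_nonzero by blast
    with hk show ?case
      by (intro exI[of _ "\<lambda>z. h z * k z"]) (auto intro: poly_fun.mult)
  qed
  then show ?thesis using that by blast
qed

section \<open>Counting solutions generically\<close>

lemma at_least_iff:
  "(\<exists>x. inj_on x {..<N} \<and> x ` {..<N} \<subseteq> S) \<longleftrightarrow> infinite S \<or> N \<le> card S"
proof
  assume "\<exists>x. inj_on x {..<N} \<and> x ` {..<N} \<subseteq> S"
  then obtain x where x: "inj_on x {..<N}" "x ` {..<N} \<subseteq> S" by blast
  then have "finite S \<longrightarrow> N \<le> card S"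
    using card_mono[of S "x ` {..<N}"] by (simp add: card_image)
  then show "infinite S \<or> N \<le> card S" by blast
next
  assume *: "infinite S \<or> N \<le> card S"
  obtain T where T: "T \<subseteq> S" "finite T" "card T = N"
    using * infinite_arbitrarily_large[of S N] obtain_subset_with_card_n[of N S] by metis
  obtain x where "bij_betw x {0..<N} T"
    using ex_bij_betw_nat_finite[OF T(2)] T(3) by blast
  then show "\<exists>x. inj_on x {..<N} \<and> x ` {..<N} \<subseteq> S"
    using T(1) by (auto simp: bij_betw_def atLeast0LessThan)
qed

text \<open>Having at least \<open>N\<close> solutions is an existential statement about
  \<open>N\<close> pairwise distinct points, so quantifiers can be eliminated.\<close>

lemma constructible_at_least:
  fixes N :: nat and R :: "('p + 'm::finite => complex) => bool"
  assumes R: "constructible R"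
  shows "constructible (\<lambda>z. \<exists>x. inj_on x {..<N} \<and> x ` {..<N} \<subseteq> {x. R (case_sum z x)})"
proof -
  \<comment> \<open>\<open>Inr (j, b)\<close> is coordinate \<open>b\<close> of the point number
    \<open>j\<close>; \<open>sub j\<close> combines the parameters with that point.\<close>
  define J :: "('p + nat \<times> 'm) set" where "J = Inr ` ({..<N} \<times> UNIV)"
  define sub :: "nat => ('p + nat \<times> 'm => complex) => 'p + 'm => complex"
    where "sub = (\<lambda>j v i. case i of Inl a => v (Inl a) | Inr b => v (Inr (j, b)))"
  define Q where "Q = (\<lambda>v. (\<forall>j\<in>{..<N}. R (sub j v)) \<and>
      (\<forall>j\<in>{..<N}. \<forall>l\<in>{..<N} - {j}. \<not> (\<forall>b\<in>UNIV. v (Inr (j, b)) - v (Inr (l, b)) = 0)))"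
  have inl: "poly_fun (\<lambda>z. case i of Inl a => z a | Inr _ => 0)" for i :: "'p + nat \<times> 'm"
    by (cases i) (auto intro: poly_fun.intros)
  have "poly_fun (\<lambda>v. sub j v i)" for j i
    unfolding sub_def by (cases i) (auto intro: poly_fun.var)
  then have sub: "constructible (\<lambda>v. R (sub j v))" for j
    using constructible_subst[OF R, of "\<lambda>i v. sub j v i"] by simp
  have "constructible Q"
    unfolding Q_def
    by (intro constructible.conj constructible_Ball sub constructible.neg constructible.zero poly_fun_intros)
      auto
  then have "constructible (\<lambda>v. \<exists>y. Q (\<lambda>i. if i \<in> J then y i else v i))"
    by (intro constructible_ex_finite) (auto simp: J_def)
  then have "constructible (\<lambda>z. \<exists>y. Q (\<lambda>i. if i \<in> J then y i else (case i of Inl a => z a | Inr _ => 0)))"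
    by (rule constructible_subst[where g="\<lambda>i z. case i of Inl a => z a | Inr _ => 0"]) (rule inl)
  then show ?thesis
  proof (rule constructible_cong)
    fix z :: "'p => complex"
    have *: "Q (\<lambda>i. if i \<in> J then y i else (case i of Inl a => z a | Inr _ => 0)) \<longleftrightarrow>
        inj_on (\<lambda>j b. y (Inr (j, b))) {..<N} \<and> (\<lambda>j b. y (Inr (j, b))) ` {..<N} \<subseteq> {x. R (case_sum z x)}" for y
    proof -
      define v where "v = (\<lambda>i. if i \<in> J then y i else (case i of Inl a => z a | Inr _ => 0))"
      have v: "v (Inr (j, b)) = y (Inr (j, b))" if "j < N" for j b
        using that by (simp add: v_def J_def)
      have "v (Inl a) = z a" for a by (auto simp: v_def J_def)
      then have "sub j v = case_sum z (\<lambda>b. y (Inr (j, b)))" if "j < N" for j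
        using that by (auto simp: sub_def v fun_eq_iff split: sum.split)
      moreover have "(\<forall>b\<in>UNIV. v (Inr (j, b)) - v (Inr (l, b)) = 0) \<longleftrightarrow>
          (\<lambda>b. y (Inr (j, b))) = (\<lambda>b. y (Inr (l, b)))" if "j < N" "l < N" for j l
        using that by (auto simp: v fun_eq_iff)
      ultimately have "Q v \<longleftrightarrow> (\<forall>j\<in>{..<N}. R (case_sum z (\<lambda>b. y (Inr (j, b))))) \<and>
          (\<forall>j\<in>{..<N}. \<forall>l\<in>{..<N} - {j}. (\<lambda>b. y (Inr (j, b))) \<noteq> (\<lambda>b. y (Inr (l, b))))"
        unfolding Q_def by simp
      also have "\<dots> \<longleftrightarrow> inj_on (\<lambda>j b. y (Inr (j, b))) {..<N} \<and> (\<lambda>j b. y (Inr (j, b))) ` {..<N} \<subseteq> {x. R (case_sum z x)}"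
        unfolding inj_on_def by blast
      finally show ?thesis unfolding v_def .
    qed
    show "(\<exists>y. Q (\<lambda>i. if i \<in> J then y i else (case i of Inl a => z a | Inr _ => 0))) =
        (\<exists>x. inj_on x {..<N} \<and> x ` {..<N} \<subseteq> {x. R (case_sum z x)})"
      unfolding *
    proof
      assume "\<exists>x. inj_on x {..<N} \<and> x ` {..<N} \<subseteq> {x. R (case_sum z x)}"
      then obtain x where "inj_on x {..<N} \<and> x ` {..<N} \<subseteq> {x. R (case_sum z x)}" ..
      then show "\<exists>y :: 'p + nat \<times> 'm => complex. inj_on (\<lambda>j b. y (Inr (j, b))) {..<N} \<and>
          (\<lambda>j b. y (Inr (j, b))) ` {..<N} \<subseteq> {x. R (case_sum z x)}"
        by (intro exI[of _ "case_sum z (\<lambda>(j, b). x j b)"]) simp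
    qed blast
  qed
qed

text \<open>An infinite set also has at least \<open>Suc N\<close> elements in the sense used here,
  so denying that yields finiteness together with the upper bound.\<close>

lemma constructible_card:
  fixes R :: "('p + 'm::finite => complex) => bool"
  assumes "constructible R"
  shows "constructible (\<lambda>z. finite {x. R (case_sum z x)} \<and> card {x. R (case_sum z x)} = N)"
proof (rule constructible_cong[OF constructible.conj[OF constructible_at_least[OF assms, of N]
        constructible.neg[OF constructible_at_least[OF assms, of "Suc N"]]]])
  fix z
  show "((\<exists>x. inj_on x {..<N} \<and> x ` {..<N} \<subseteq> {x. R (case_sum z x)}) \<and>
      \<not> (\<exists>x. inj_on x {..<Suc N} \<and> x ` {..<Suc N} \<subseteq> {x. R (case_sum z x)})) =
      (finite {x. R (case_sum z x)} \<and> card {x. R (case_sum z x)} = N)"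
    unfolding at_least_iff by auto
qed

section \<open>From classical neighbourhoods to generic statements\<close>

lemma poly_fun_nonzero_near:
  fixes h :: "('k::finite) cfun"
  assumes h: "poly_fun h" "h w \<noteq> 0" and P: "eventually P (nhds (x::complex^'k))"
  shows "\<exists>y. P y \<and> h (vec_nth y) \<noteq> 0"
proof -
  obtain p where p: "\<And>t. h (\<lambda>i. x $ i + t * (w i - x $ i)) = poly p t"
    using poly_fun_line[OF h(1)] by metis
  have "poly p 1 \<noteq> 0" using p[of 1] h(2) by simp
  then have fin: "finite {t. poly p t = 0}" by (intro poly_roots_finite) auto
  define y where "y t = (\<chi> i. x $ i + t * (w i - x $ i))" for t :: complex
  have "(y \<longlongrightarrow> x) (at 0)"
  proof (rule vec_tendstoI)
    fix i
    have "((\<lambda>t. x $ i + t * (w i - x $ i)) \<longlongrightarrow> x $ i + 0 * (w i - x $ i)) (at 0)"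
      by (intro tendsto_intros)
    then show "((\<lambda>t. y t $ i) \<longlongrightarrow> x $ i) (at 0)" by (simp add: y_def)
  qed
  then have "eventually (\<lambda>t. P (y t)) (at 0)"
    using P by (auto simp: filterlim_iff)
  moreover have "eventually (\<lambda>t. t \<notin> {t. poly p t = 0}) (at (0::complex))"
    using islimpt_finite[OF fin] by (simp add: islimpt_iff_eventually)
  ultimately have "eventually (\<lambda>t. P (y t) \<and> poly p t \<noteq> 0) (at 0)"
    by eventually_elim auto
  then obtain t where "P (y t)" "poly p t \<noteq> 0"
    using eventually_happens[of _ "at (0::complex)"] by auto
  moreover have "vec_nth (y t) = (\<lambda>i. x $ i + t * (w i - x $ i))"
    by (auto simp: y_def)
  ultimately show ?thesis using p[of t] by metis
qed

text \<open>A classical neighbourhood does not fit into a hypersurface. It therefore meets the set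
  where \<open>Q\<close> takes its generic truth value, and decides which value that is.\<close>

lemma constructible_near_generic:
  fixes Q :: "('k::finite => complex) => bool"
  assumes "constructible Q" "eventually (\<lambda>y. Q (vec_nth y)) (nhds (x::complex^'k))"
  obtains h where "poly_fun h" "\<exists>z. h z \<noteq> 0" "\<And>z. h z \<noteq> 0 ==> Q z"
proof -
  obtain h where h: "poly_fun h" "\<exists>z. h z \<noteq> 0" "(\<forall>z. h z \<noteq> 0 \<longrightarrow> Q z) \<or> (\<forall>z. h z \<noteq> 0 \<longrightarrow> \<not> Q z)"
    using constructible_generic[OF assms(1)] by blast
  moreover obtain y where "Q (vec_nth y)" "h (vec_nth y) \<noteq> 0"
    using poly_fun_nonzero_near[OF h(1) _ assms(2)] h(2) by blast
  ultimately show ?thesis using that by blast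
qed

lemma constructible_line_cofinite:
  assumes "constructible (Q :: (unit => complex) => bool)"
  shows "finite {t. Q (\<lambda>_. t)} \<or> finite {t. \<not> Q (\<lambda>_. t)}"
proof -
  obtain h where h: "poly_fun h" "\<exists>z. h z \<noteq> 0" "(\<forall>z. h z \<noteq> 0 \<longrightarrow> Q z) \<or> (\<forall>z. h z \<noteq> 0 \<longrightarrow> \<not> Q z)"
    using constructible_generic[OF assms] by blast
  obtain p where "\<And>t. h (\<lambda>i. 0 + t * 1) = poly p t"
    using poly_fun_line[OF h(1), of "\<lambda>_. 0" "\<lambda>_. 1"] by blast
  then have p: "h (\<lambda>i. t) = poly p t" for t by simp
  obtain z where "h z \<noteq> 0" using h(2) ..
  moreover have "h (\<lambda>_. z ()) = h z" by (rule arg_cong[of _ _ h]) (simp add: fun_eq_iff)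
  ultimately have "poly p (z ()) \<noteq> 0" using p[of "z ()"] by simp
  then have fin: "finite {t. poly p t = 0}" by (intro poly_roots_finite) auto
  from h(3) have "{t. Q (\<lambda>_. t)} \<subseteq> {t. poly p t = 0} \<or> {t. \<not> Q (\<lambda>_. t)} \<subseteq> {t. poly p t = 0}"
    unfolding p[symmetric] by blast
  then show ?thesis using fin finite_subset by blast
qed

lemma card_vec_sol:
  "finite {x::complex^'m. P (vec_nth x)} = finite {x. P x}"
  "card {x::complex^'m::finite. P (vec_nth x)} = card {x. P x}"
proof -
  have "bij_betw vec_nth {x::complex^'m. P (vec_nth x)} {x. P x}"
    by (rule bij_betw_byWitness[where f'=vec_lambda]) (auto simp: vec_lambda_inverse)
  then show "finite {x::complex^'m. P (vec_nth x)} = finite {x. P x}"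
    "card {x::complex^'m. P (vec_nth x)} = card {x. P x}"
    using bij_betw_finite bij_betw_same_card by blast+
qed

text \<open>Each count holds on an infinite set of parameters, hence by constructibility for all but
  finitely many \<open>t\<close>, and two cofinite sets meet. No solution has to be followed from
  \<open>a\<close> to \<open>b\<close>.\<close>

lemma card_line_const:
  fixes R :: "complex => complex^'m::finite => bool"
  assumes R: "constructible R'" "\<And>t x. R t x \<longleftrightarrow> R' (case_sum (\<lambda>_::unit. t) (vec_nth x))"
    and a: "eventually (\<lambda>t. finite {x. R t x} \<and> card {x. R t x} = N) (at a)"
    and b: "eventually (\<lambda>t. finite {x. R t x} \<and> card {x. R t x} = M) (at b)"
  shows "N = M"
proof -
  have eq: "(finite {x. R t x} \<and> card {x. R t x} = N) = (finite {x. R' (case_sum (\<lambda>_. t) x)} \<and>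
      card {x. R' (case_sum (\<lambda>_. t) x)} = N)" for t N
    unfolding R(2) using card_vec_sol[of "\<lambda>x. R' (case_sum (\<lambda>_. t) x)"] by simp
  have inf: "infinite {t. P t}" if P: "eventually P (at (c::complex))" for P c
  proof
    assume "finite {t. P t}"
    then have "\<not> c islimpt {t. P t}" by (rule islimpt_finite)
    then have "eventually (\<lambda>t. t \<notin> {t. P t}) (at c)"
      by (simp add: islimpt_iff_eventually)
    with P have "eventually (\<lambda>t. False) (at c)" by eventually_elim simp
    then show False by simp
  qed
  have "finite {t. \<not> (finite {x. R t x} \<and> card {x. R t x} = N)}"
    using constructible_line_cofinite[OF constructible_card[OF R(1), of N]] inf[OF a]
    unfolding eq by blast
  moreover have "finite {t. \<not> (finite {x. R t x} \<and> card {x. R t x} = M)}"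
    using constructible_line_cofinite[OF constructible_card[OF R(1), of M]] inf[OF b]
    unfolding eq by blast
  ultimately have "finite ({t. \<not> (finite {x. R t x} \<and> card {x. R t x} = N)} \<union>
      {t. \<not> (finite {x. R t x} \<and> card {x. R t x} = M)})" by blast
  then obtain t where "t \<notin> {t. \<not> (finite {x. R t x} \<and> card {x. R t x} = N)} \<union>
      {t. \<not> (finite {x. R t x} \<and> card {x. R t x} = M)}"
    using ex_new_if_finite[OF infinite_UNIV_char_0] by blast
  then show ?thesis by auto
qed

section \<open>Persistence of nondegenerate solutions\<close>

lemma poly_fun_has_derivative:
  fixes f :: "('k::finite) cfun"
  assumes "poly_fun f"
  shows "\<exists>f'. (\<forall>i. poly_fun (f' i)) \<and>
    (\<forall>x. ((\<lambda>x::complex^'k. f (vec_nth x)) has_derivative (\<lambda>h. \<Sum>i\<in>UNIV. f' i (vec_nth x) * h $ i)) (at x))"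
  using assms
proof induction
  case (const c)
  show ?case by (rule exI[of _ "\<lambda>i x. 0"]) (auto intro: poly_fun.const)
next
  case (var i)
  have "(\<Sum>j\<in>UNIV. (if j = i then 1 else 0) * h $ j) = h $ i" for h :: "complex^'k"
    by (simp add: if_distrib[of "\<lambda>c. c * _"] cong: if_cong)
  then show ?case
    by (intro exI[of _ "\<lambda>j x. if j = i then 1 else 0"]) (auto intro: poly_fun.const bounded_linear_vec_nth
        bounded_linear_imp_has_derivative)
next
  case (add f g)
  then obtain f' g' where f: "\<And>i. poly_fun (f' i)" "\<And>x. ((\<lambda>x::complex^'k. f (vec_nth x)) has_derivative (\<lambda>h. \<Sum>i\<in>UNIV. f' i (vec_nth x) * h $ i)) (at x)"
    and g: "\<And>i. poly_fun (g' i)" "\<And>x. ((\<lambda>x::complex^'k. g (vec_nth x)) has_derivative (\<lambda>h. \<Sum>i\<in>UNIV. g' i (vec_nth x) * h $ i)) (at x)"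
    by blast
  show ?case
    by (rule exI[of _ "\<lambda>i x. f' i x + g' i x"])
      (auto intro!: poly_fun.add f g has_derivative_eq_rhs[OF has_derivative_add[OF f(2) g(2)]]
        simp: algebra_simps sum.distrib)
next
  case (mult f g)
  then obtain f' g' where f: "\<And>i. poly_fun (f' i)" "\<And>x. ((\<lambda>x::complex^'k. f (vec_nth x)) has_derivative (\<lambda>h. \<Sum>i\<in>UNIV. f' i (vec_nth x) * h $ i)) (at x)"
    and g: "\<And>i. poly_fun (g' i)" "\<And>x. ((\<lambda>x::complex^'k. g (vec_nth x)) has_derivative (\<lambda>h. \<Sum>i\<in>UNIV. g' i (vec_nth x) * h $ i)) (at x)"
    by blast
  show ?case
    by (rule exI[of _ "\<lambda>i x. f x * g' i x + f' i x * g x"])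
      (auto intro!: poly_fun.intros f g mult.hyps has_derivative_eq_rhs[OF has_derivative_mult[OF f(2) g(2)]]
        simp: algebra_simps sum.distrib sum_distrib_left)
qed

lemma poly_fun_continuous:
  fixes f :: "('k::finite) cfun"
  assumes "poly_fun f"
  shows "continuous_on S (\<lambda>x::complex^'k. f (vec_nth x))"
  using assms by induction (auto intro!: continuous_intros)

definition join :: "complex^'p => complex^'m => complex^('p + 'm)" where
  "join p x = (\<chi> i. case_sum (vec_nth p) (vec_nth x) i)"

lemma vec_nth_join [simp]: "vec_nth (join p x) = case_sum (vec_nth p) (vec_nth x)"
  by (simp add: join_def fun_eq_iff)

lemma continuous_join:
  fixes f :: "'a::topological_space => complex^'p::finite" and g :: "'a => complex^'m::finite"
  assumes "continuous_on S f" "continuous_on S g"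
  shows "continuous_on S (\<lambda>z. join (f z) (g z))"
  unfolding join_def
proof (rule continuous_on_vec_lambda)
  fix i :: "'p + 'm"
  show "continuous_on S (\<lambda>x. case_sum (($) (f x)) (($) (g x)) i)"
    using assms by (cases i) (auto intro!: continuous_intros)
qed

definition sys :: "('m => ('p + 'm) cfun) => complex^'p => complex^'m => complex^'m" where
  "sys e p x = (\<chi> k. e k (case_sum (vec_nth p) (vec_nth x)))"

text \<open>For polynomial maps this is the nonvanishing of the Jacobian determinant; at a zero it
  says that the zero is simple.\<close>

definition nondegenerate :: "(complex^'m => complex^'m) => complex^'m => bool" where
  "nondegenerate f x \<longleftrightarrow> (\<exists>f'. (f has_derivative f') (at x) \<and> (\<forall>h. f' h = 0 \<longrightarrow> h = 0))"

lemma has_derivative_vec_lambda: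
  fixes f :: "'k::finite => 'a::real_normed_vector => 'b::euclidean_space"
  assumes "\<And>k. (f k has_derivative f' k) (at x within S)"
  shows "((\<lambda>x. \<chi> k. f k x) has_derivative (\<lambda>h. \<chi> k. f' k h)) (at x within S)"
proof -
  have "((\<lambda>x. (\<chi> k. f k x) \<bullet> b) has_derivative (\<lambda>h. (\<chi> k. f' k h) \<bullet> b)) (at x within S)"
    if bB: "b \<in> Basis" for b :: "'b^'k"
  proof -
    obtain i u where b: "b = axis i u" "u \<in> Basis"
      using bB unfolding Basis_vec_def by blast
    show ?thesis
      unfolding b inner_axis by (simp add: assms has_derivative_inner_left)
  qed
  then show ?thesis by (subst has_derivative_componentwise_within) blast
qed

lemma poly_map_has_derivative:
  fixes g :: "'i => ('k::finite) cfun"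
  assumes g: "\<And>k. poly_fun (g k)"
  obtains g' where "\<And>k i. poly_fun (g' k i)"
    "\<And>k x. ((\<lambda>x::complex^'k. g k (vec_nth x)) has_derivative (\<lambda>h. \<Sum>i\<in>UNIV. g' k i (vec_nth x) * h $ i)) (at x)"
proof -
  have "\<exists>G. \<forall>k. (\<forall>i. poly_fun (G k i)) \<and>
    (\<forall>x. ((\<lambda>x::complex^'k. g k (vec_nth x)) has_derivative (\<lambda>h. \<Sum>i\<in>UNIV. G k i (vec_nth x) * h $ i)) (at x))"
    using poly_fun_has_derivative[OF g] by (intro choice allI) blast
  then show ?thesis using that by blast
qed

lemma continuous_sys:
  fixes e :: "'m::finite => ('p::finite + 'm) cfun"
  assumes "\<And>k. poly_fun (e k)"
  shows "continuous_on UNIV (\<lambda>z. sys e (fst z) (snd z))"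
proof -
  have "continuous_on UNIV (\<lambda>z :: (complex^'p) \<times> (complex^'m). e k (vec_nth (join (fst z) (snd z))))" for k
    by (rule continuous_on_compose2[OF poly_fun_continuous[OF assms, of UNIV] continuous_join])
      (auto intro!: continuous_intros)
  then show ?thesis
    unfolding sys_def by (intro continuous_on_vec_lambda) simp
qed

text \<open>The solution is the fixed point of \<open>x \<mapsto> x - L (sys e p x)\<close>, where \<open>L\<close> inverts the derivative at \<open>x0\<close>.\<close>

lemma persistence:
  fixes e :: "'m::finite => ('p::finite + 'm) cfun"
  assumes e: "\<And>k. poly_fun (e k)" and sol: "sys e p0 x0 = 0" and nd: "nondegenerate (sys e p0) x0"
  obtains r0 where "r0 > 0"
    "\<And>r. 0 < r ==> r \<le> r0 ==> eventually (\<lambda>p. \<exists>!x. x \<in> ball x0 r \<and> sys e p x = 0) (nhds p0)"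
proof -
  obtain e' where e': "\<And>k i. poly_fun (e' k i)"
    "\<And>k x. ((\<lambda>x::complex^('p+'m). e k (vec_nth x)) has_derivative (\<lambda>h. \<Sum>i\<in>UNIV. e' k i (vec_nth x) * h $ i)) (at x)"
    by (rule poly_map_has_derivative[of e, OF e]) (rule that)
  define D :: "complex^'p => complex^'m => complex^'m => complex^'m"
    where "D p x h = (\<chi> k. \<Sum>i\<in>UNIV. e' k i (vec_nth (join p x)) * join 0 h $ i)" for p x h
  have D: "(sys e p has_derivative D p x) (at x)" for p x
  proof -
    have "bounded_linear (\<lambda>x. join 0 x :: complex^('p+'m))"
      by (rule linear_conv_bounded_linear[THEN iffD1], rule linearI)
        (auto simp: join_def vec_eq_iff split: sum.split)
    then have "((\<lambda>x. join p 0 + join 0 x) has_derivative (\<lambda>x. join 0 x)) (at x)"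
      by (auto intro!: derivative_eq_intros bounded_linear_imp_has_derivative)
    moreover have "join p 0 + join 0 x = join p x" for x :: "complex^'m"
      by (auto simp: join_def vec_eq_iff split: sum.split)
    ultimately have "(join p has_derivative (\<lambda>x. join 0 x)) (at x)" by simp
    from has_derivative_compose[OF this e'(2)]
    have "((\<lambda>x. \<chi> k. e k (vec_nth (join p x))) has_derivative D p x) (at x)"
      unfolding D_def by (rule has_derivative_vec_lambda)
    then show ?thesis by (simp add: sys_def[abs_def])
  qed
  have inj: "D p0 x0 h = 0 ==> h = 0" for h
    using nd has_derivative_unique[OF D] unfolding nondegenerate_def by metis
  interpret D0: bounded_linear "D p0 x0" using D by (rule has_derivative_bounded_linear)
  have "inj (D p0 x0)" using inj by (simp add: linear_injective_0[OF D0.linear])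
  then obtain L where L: "linear L" "L \<circ> D p0 x0 = id" "D p0 x0 \<circ> L = id"
    using linear_injective_isomorphism[OF D0.linear] by (metis comp_apply eq_id_iff)
  interpret L: bounded_linear L using L(1) linear_conv_bounded_linear by blast
  obtain B where B: "B > 0" "\<And>x. norm (L x) \<le> norm x * B" using L.pos_bounded by blast
  have L0: "L x = 0 \<longleftrightarrow> x = 0" for x using L(3) L.zero by (metis comp_apply id_apply D0.zero)
  define s where "s z = (\<Sum>k\<in>UNIV. \<Sum>i\<in>UNIV. norm (e' k i (vec_nth (join (fst z) (snd z))) - e' k i (vec_nth (join p0 x0))))" for z
  have "continuous_on UNIV (\<lambda>z :: (complex^'p) \<times> (complex^'m). e' k i (vec_nth (join (fst z) (snd z))))" for k i
    by (rule continuous_on_compose2[OF poly_fun_continuous[OF e'(1), of UNIV] continuous_join])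
      (auto intro!: continuous_intros)
  then have "continuous_on UNIV s" unfolding s_def by (intro continuous_intros)
  then have "isCont s (p0, x0)" by (simp add: continuous_on_eq_continuous_at)
  moreover have "s (p0, x0) = 0" by (simp add: s_def)
  \<comment> \<open>With this bound on the change of the partial derivatives, \<open>L\<close>
    applied to the change of \<open>D\<close> has norm at most 1/2, which makes \<open>T p\<close> a
    contraction.\<close>
  moreover have "1 / (2 * B) > 0" using B by simp
  ultimately obtain d where "d > 0" "\<forall>z. dist z (p0, x0) < d \<longrightarrow> \<bar>s z - 0\<bar> < 1 / (2 * B)"
    unfolding continuous_at_eps_delta dist_real_def by metis
  then have d: "d > 0" "\<And>p x. dist (p, x) (p0, x0) < d ==> \<bar>s (p, x)\<bar> < 1 / (2 * B)" by auto
  define T where "T p x = x - L (sys e p x)" for p x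
  have fp: "T p x = x \<longleftrightarrow> sys e p x = 0" for p x using L0 by (simp add: T_def)
  have lip: "norm (T p x - T p y) \<le> 1 / 2 * norm (x - y)"
    if p: "dist p p0 < d / 2" and xy: "x \<in> ball x0 (d / 2)" "y \<in> ball x0 (d / 2)" for p x y
  proof (rule differentiable_bound[OF convex_ball])
    fix z assume z: "z \<in> ball x0 (d / 2)"
    show "(T p has_derivative (\<lambda>h. h - L (D p z h))) (at z within ball x0 (d / 2))"
      unfolding T_def[abs_def]
      by (intro has_derivative_diff has_derivative_ident L.has_derivative has_derivative_at_withinI[OF D])
    show "onorm (\<lambda>h. h - L (D p z h)) \<le> 1 / 2"
    proof (rule onorm_bound)
      fix h
      have "dist (p, z) (p0, x0) \<le> dist p p0 + dist z x0"
        unfolding dist_Pair_Pair by (rule sqrt_sum_squares_le_sum) auto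
      then have s: "\<bar>s (p, z)\<bar> < 1 / (2 * B)" using p z by (intro d(2)) (simp add: dist_commute)
      have "norm (D p0 x0 h - D p z h) \<le> (\<Sum>k\<in>UNIV. norm ((D p0 x0 h - D p z h) $ k))"
        unfolding norm_vec_def by (rule L2_set_le_sum) simp
      also have "\<dots> \<le> (\<Sum>k\<in>UNIV. \<Sum>i\<in>UNIV. norm (e' k i (vec_nth (join p z)) - e' k i (vec_nth (join p0 x0))) * norm h)"
      proof (rule sum_mono)
        fix k
        have "norm (join 0 h $ i) \<le> norm h" for i :: "'p + 'm"
          by (cases i) (simp_all add: Finite_Cartesian_Product.norm_nth_le)
        then have "norm (\<Sum>i\<in>UNIV. (e' k i (vec_nth (join p0 x0)) - e' k i (vec_nth (join p z))) * join 0 h $ i) \<le>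
            (\<Sum>i\<in>UNIV. norm (e' k i (vec_nth (join p z)) - e' k i (vec_nth (join p0 x0))) * norm h)"
          by (intro order_trans[OF norm_sum] sum_mono) (simp add: norm_mult mult_left_mono norm_minus_commute del: vec_nth_join)
        then show "norm ((D p0 x0 h - D p z h) $ k) \<le>
            (\<Sum>i\<in>UNIV. norm (e' k i (vec_nth (join p z)) - e' k i (vec_nth (join p0 x0))) * norm h)"
          by (simp add: D_def sum_subtractf left_diff_distrib del: vec_nth_join)
      qed
      also have "\<dots> = s (p, z) * norm h" by (simp add: s_def sum_distrib_right)
      also have "\<dots> \<le> 1 / (2 * B) * norm h" using s by (intro mult_right_mono) auto
      finally have "norm (L (D p0 x0 h - D p z h)) \<le> 1 / (2 * B) * norm h * B"
        using B by (meson mult_right_mono less_imp_le order_trans)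
      moreover have "L (D p0 x0 h - D p z h) = h - L (D p z h)"
        using fun_cong[OF L(2), of h] by (simp add: L.diff)
      ultimately show "norm (h - L (D p z h)) \<le> 1 / 2 * norm h" using B(1) by simp
    qed simp
  qed (use xy in auto)
  show ?thesis
  proof (rule that[of "d / 2"])
    fix r assume r: "0 < r" "r \<le> d / 2"
    have "continuous_on UNIV (\<lambda>p. sys e p x0)"
      using continuous_on_compose2[OF continuous_sys[of e, OF e], of UNIV "\<lambda>p. (p, x0)"]
      by (simp add: continuous_on_Pair)
    then have "((\<lambda>p. sys e p x0) \<longlongrightarrow> sys e p0 x0) (nhds p0)"
      by (metis continuous_on_eq_continuous_at open_UNIV UNIV_I isCont_def tendsto_at_iff_tendsto_nhds)
    from L.tendsto[OF this] have "((\<lambda>p. L (sys e p x0)) \<longlongrightarrow> L (sys e p0 x0)) (nhds p0)" .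
    \<comment> \<open>The centre moves by less than r/4 and distances are halved, so the closed ball
      of radius r/2 is mapped into itself and contains a fixed point. Uniqueness follows from the
      contraction on the whole open ball of radius \<open>r\<close>.\<close>
    then have "eventually (\<lambda>p. norm (L (sys e p x0)) < r / 4) (nhds p0)"
      by (rule order_tendstoD[OF tendsto_norm]) (use r(1) in \<open>simp add: sol L.zero\<close>)
    moreover have "eventually (\<lambda>p. dist p p0 < d / 2) (nhds p0)"
      using d(1) by (auto simp: eventually_nhds_metric intro!: exI[of _ "d / 2"])
    ultimately show "eventually (\<lambda>p. \<exists>!x. x \<in> ball x0 r \<and> sys e p x = 0) (nhds p0)"
    proof eventually_elim
      case (elim p)
      have lip': "norm (T p x - T p y) \<le> 1 / 2 * norm (x - y)" if "x \<in> ball x0 r" "y \<in> ball x0 r" for x y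
        using that r by (intro lip elim(2)) auto
      have "\<exists>!x\<in>cball x0 (r / 2). T p x = x"
      proof (rule Banach_fix[where c="1 / 2"])
        show "T p ` cball x0 (r / 2) \<subseteq> cball x0 (r / 2)"
        proof clarify
          fix x assume x: "x \<in> cball x0 (r / 2)"
          have "norm (x0 - T p x) \<le> norm (T p x0 - T p x) + norm (L (sys e p x0))"
            using norm_triangle_ineq[of "T p x0 - T p x" "L (sys e p x0)"] by (simp add: T_def algebra_simps)
          also have "norm (T p x0 - T p x) \<le> 1 / 2 * norm (x0 - x)" using x r by (intro lip') auto
          finally show "T p x \<in> cball x0 (r / 2)" using x elim(1) by (simp add: dist_norm)
        qed
        show "\<And>x y. x \<in> cball x0 (r / 2) ==> y \<in> cball x0 (r / 2) ==> dist (T p x) (T p y) \<le> 1 / 2 * dist x y"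
          unfolding dist_norm using r by (intro lip') auto
      qed (use r in \<open>auto simp: complete_eq_closed\<close>)
      then obtain x where x: "x \<in> cball x0 (r / 2)" "T p x = x" by blast
      show ?case
      proof (rule ex1I[of _ x])
        show "x \<in> ball x0 r \<and> sys e p x = 0" using x r fp by auto
        fix y assume y: "y \<in> ball x0 r \<and> sys e p y = 0"
        then have "norm (T p x - T p y) \<le> 1 / 2 * norm (x - y)" using x r by (intro lip') auto
        then show "y = x" using x(2) y fp[of p y] by simp
      qed
    qed
  qed (use d in auto)
qed

text \<open>The regions \<open>N i p\<close> may depend on \<open>p\<close>, because solutions that
  run off to infinity have no fixed neighbourhood.\<close>

lemma card_eq_branches:
  assumes I: "finite I"
    and ex1: "\<And>i. i \<in> I ==> eventually (\<lambda>p. \<exists>!x. x \<in> N i p \<inter> S p) F"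
    and disj: "\<And>i j. i \<in> I ==> j \<in> I ==> i \<noteq> j ==> eventually (\<lambda>p. N i p \<inter> N j p = {}) F"
    and cover: "eventually (\<lambda>p. S p \<subseteq> (\<Union>i\<in>I. N i p)) F"
  shows "eventually (\<lambda>p. finite (S p) \<and> card (S p) = card I) F"
proof -
  have "eventually (\<lambda>p. \<forall>i\<in>I. \<exists>!x. x \<in> N i p \<inter> S p) F"
    using I ex1 by (simp add: eventually_ball_finite)
  moreover have "eventually (\<lambda>p. \<forall>i\<in>I. \<forall>j\<in>I. i \<noteq> j \<longrightarrow> N i p \<inter> N j p = {}) F"
  proof (intro eventually_ball_finite I ballI)
    fix i j assume "i \<in> I" "j \<in> I"
    then show "eventually (\<lambda>p. i \<noteq> j \<longrightarrow> N i p \<inter> N j p = {}) F"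
      using disj by (cases "i = j") simp_all
  qed
  ultimately show ?thesis using cover
  proof eventually_elim
    case (elim p)
    define x where "x i = (THE x. x \<in> N i p \<inter> S p)" for i
    have x: "x i \<in> N i p \<inter> S p" if "i \<in> I" for i
      unfolding x_def by (rule theI'[OF bspec[OF elim(1) that]])
    have u: "y = x i" if "i \<in> I" "y \<in> N i p \<inter> S p" for i y
    proof -
      have "\<exists>!x. x \<in> N i p \<inter> S p" using elim(1) that(1) by (rule bspec)
      from the1_equality[OF this that(2)] show ?thesis by (simp add: x_def)
    qed
    have "bij_betw x I (S p)"
      unfolding bij_betw_def
    proof
      show "inj_on x I"
        using x elim(2) by (intro inj_onI) (metis Int_iff disjoint_iff)
      show "x ` I = S p"
        using x u elim(3) by fastforce
    qed
    then show ?case using I bij_betw_finite bij_betw_same_card by metis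
  qed
qed

lemma not_eventually_nhds_sequence:
  fixes a :: "'a::metric_space"
  assumes "\<not> eventually P (nhds a)"
  obtains f where "f \<longlonglongrightarrow> a" "\<And>k. \<not> P (f k)"
proof -
  have "\<exists>x. dist x a < inverse (real (Suc k)) \<and> \<not> P x" for k
    using assms unfolding eventually_nhds_metric by (metis inverse_positive_iff_positive of_nat_0_less_iff zero_less_Suc)
  then obtain f where f: "\<And>k. dist (f k) a < inverse (real (Suc k))" "\<And>k. \<not> P (f k)" by metis
  have "f \<longlonglongrightarrow> a"
    by (rule metric_tendsto_imp_tendsto[OF LIMSEQ_inverse_real_of_nat])
      (use f(1) in \<open>auto intro!: always_eventually less_imp_le simp: dist_norm[where 'a=real]\<close>)
  then show ?thesis using f(2) that by blast
qed

lemma not_eventually_at_sequence: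
  fixes a :: "'a::metric_space"
  assumes "\<not> eventually P (at a)"
  obtains f where "f \<longlonglongrightarrow> a" "\<And>k. f k \<noteq> a" "\<And>k. \<not> P (f k)"
proof -
  have "\<not> eventually (\<lambda>x. x \<noteq> a \<longrightarrow> P x) (nhds a)"
    using assms by (simp add: eventually_at_filter)
  then show ?thesis
    using not_eventually_nhds_sequence[of "\<lambda>x. x \<noteq> a \<longrightarrow> P x" a] that by metis
qed

section \<open>A parametric transversality theorem\<close>

text \<open>The library states Sard's theorem for index types of class \<open>wellorder\<close>; this copy of a finite
  type provides one.\<close>

typedef 'a wo = "UNIV :: 'a set" ..

instance wo :: (finite) finite
proof
  have "(UNIV :: 'a wo set) = range Abs_wo"
    by (metis Rep_wo_inverse surj_def)
  then show "finite (UNIV :: 'a wo set)" by (metis finite_code finite_imageI)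
qed

definition wo_index :: "'a::finite wo => nat" where
  "wo_index = (SOME f. inj f)"

lemma inj_wo_index: "inj (wo_index :: 'a::finite wo => nat)"
proof -
  have "\<exists>f :: 'a wo => nat. inj f"
    using finite_imp_inj_to_nat_seg[of "UNIV :: 'a wo set"] by auto
  then show ?thesis unfolding wo_index_def by (rule someI_ex)
qed

instantiation wo :: (finite) wellorder
begin

definition "less_eq_wo (x :: 'a wo) (y :: 'a wo) \<longleftrightarrow> wo_index x \<le> wo_index y"
definition "less_wo (x :: 'a wo) (y :: 'a wo) \<longleftrightarrow> wo_index x < wo_index y"

instance
proof
  fix P :: "'a wo => bool" and a :: "'a wo"
  assume *: "\<And>x. (\<And>y. y < x ==> P y) ==> P x"
  show "P a"
    by (induction a rule: measure_induct_rule[of wo_index]) (auto intro: * simp: less_wo_def)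
qed (use injD[OF inj_wo_index] in \<open>auto simp: less_eq_wo_def less_wo_def\<close>)

end

lemma CARD_wo: "CARD('a wo) = CARD('a)"
  using type_definition.card[OF type_definition_wo] by simp

text \<open>\<open>baby_Sard\<close> transported along a linear isomorphism. Dimensions are real, so
  \<open>complex^'e\<close> calls for an index type of twice the size of \<open>'e\<close>.\<close>

lemma Sard_euclidean:
  fixes f :: "'a::euclidean_space => 'a"
  assumes "CARD('k::{finite,wellorder}) = DIM('a)"
    and der: "\<And>x. x \<in> S ==> (f has_derivative f' x) (at x)"
    and sing: "\<And>x. x \<in> S ==> \<exists>h. h \<noteq> 0 \<and> f' x h = 0"
  shows "negligible (f ` S)"
proof -
  have "DIM('a) = DIM((real, 'k) vec)" using assms(1) by simp
  then obtain T :: "'a => (real, 'k) vec" and U where TU: "linear T" "linear U" "\<And>x. U (T x) = x" "\<And>y. T (U y) = y"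
    using isomorphisms_UNIV_UNIV by metis
  have bl: "bounded_linear T" "bounded_linear U"
    using TU linear_conv_bounded_linear by blast+
  define g where "g = (\<lambda>y. T (f (U y)))"
  define g' where "g' y = (\<lambda>h. T (f' (U y) (U h)))" for y
  have g': "(g has_derivative g' y) (at y)" if "U y \<in> S" for y
    unfolding g_def g'_def
    by (rule bounded_linear.has_derivative[OF bl(1)],
        rule has_derivative_compose[OF bounded_linear_imp_has_derivative[OF bl(2)] der[OF that]])
  have "negligible (g ` (T ` S))"
  proof (rule baby_Sard)
    fix y assume "y \<in> T ` S"
    then have y: "U y \<in> S" using TU by auto
    show "(g has_derivative g' y) (at y within T ` S)"
      using g'[OF y] has_derivative_at_withinI by blast
    obtain h where h: "h \<noteq> 0" "f' (U y) h = 0" using sing[OF y] by blast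
    have "T h \<noteq> 0" using h(1) TU(3)[of h] linear_0[OF TU(2)] by metis
    have lin: "linear (g' y)" using g'[OF y] has_derivative_linear by blast
    have "\<not> inj ((*v) (matrix (g' y)))"
    proof
      assume "inj ((*v) (matrix (g' y)))"
      then have "inj (g' y)" using lin by (simp add: matrix_vector_mul)
      moreover have "g' y (T h) = g' y 0"
        using h TU linear_0[OF lin] linear_0[OF TU(1)] by (simp add: g'_def)
      ultimately show False using \<open>T h \<noteq> 0\<close> by (auto dest: injD)
    qed
    then have "rank (matrix (g' y)) \<noteq> CARD('k)" by (simp add: full_rank_injective)
    moreover have "rank (matrix (g' y)) \<le> CARD('k)"
      using rank_bound[of "matrix (g' y)"] by simp
    ultimately show "rank (matrix (g' y)) < CARD('k)" by simp
  qed simp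
  then have "negligible (U ` g ` (T ` S))"
    by (rule negligible_differentiable_image_negligible[rotated])
      (use bl(2) assms(1) in \<open>auto intro: bounded_linear_imp_differentiable_on\<close>)
  moreover have "U ` g ` (T ` S) = f ` S"
    by (auto simp: g_def TU image_image)
  ultimately show ?thesis by simp
qed

lemma poly_fun_differentiable:
  fixes f :: "('k::finite) cfun"
  shows "poly_fun f ==> \<exists>F. ((\<lambda>x::complex^'k. f (vec_nth x)) has_derivative F) (at x)"
  using poly_fun_has_derivative by blast

lemma poly_fun_det:
  assumes "\<And>i j. poly_fun (\<lambda>z. M z $ i $ j)"
  shows "poly_fun (\<lambda>z. det (M z :: complex^'n^'n::finite))"
  unfolding det_def by (intro poly_fun_intros assms)

text \<open>Averaging in place of Fubini: \<open>T\<close> translates of a bounded piece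
  \<open>B\<close> of \<open>Z\<close> along \<open>u\<close> have equal measure, lie in one ball
  \<open>V\<close> and cover each point at most \<open>N\<close> times. So \<open>T\<close> times
  the measure of \<open>B\<close> is bounded independently of \<open>T\<close>.\<close>

lemma negligible_few_on_lines:
  fixes Z :: "'a::euclidean_space set"
  assumes "closed Z" and few: "\<And>z. finite {t::real. z + t *\<^sub>R u \<in> Z} \<and> card {t. z + t *\<^sub>R u \<in> Z} \<le> N"
  shows "negligible Z"
proof -
  have "emeasure lborel (Z \<inter> cball 0 R) = 0" if "R > 0" for R
  proof -
    define B where "B = Z \<inter> cball 0 R"
    have B: "B \<in> sets borel" unfolding B_def using \<open>closed Z\<close> by (intro borel_closed closed_Int) auto
    define V where "V = cball (0::'a) (R + norm u)"
    have V: "emeasure lborel V < \<infinity>" unfolding V_def by (rule emeasure_bounded_finite) simp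
    have step: "of_nat T * emeasure lborel B \<le> of_nat N * emeasure lborel V" if "T > 0" for T :: nat
    proof -
      define c where "c t = (real t / real T) *\<^sub>R u" for t
      define B' where "B' t = (\<lambda>y. y - c t) -` B" for t
      have B': "B' t \<in> sets lborel" for t
        using measurable_sets[of "\<lambda>y. y - c t" borel borel B] B by (auto simp: B'_def)
      have "emeasure lborel (B' t) = emeasure lborel B" for t
      proof -
        have "emeasure lborel B = emeasure (distr lborel borel ((+) (- c t))) B"
          by (simp only: lborel_distr_plus)
        also have "\<dots> = emeasure lborel ((+) (- c t) -` B \<inter> space lborel)"
          using B by (intro emeasure_distr) auto
        also have "(+) (- c t) -` B \<inter> space lborel = B' t" by (auto simp: B'_def)
        finally show ?thesis ..
      qed
      then have "of_nat T * emeasure lborel B = (\<Sum>t<T. emeasure lborel (B' t))" by simp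
      also have "\<dots> = (\<Sum>t<T. \<integral>\<^sup>+y. indicator (B' t) y \<partial>lborel)"
        using B' by simp
      also have "\<dots> = (\<integral>\<^sup>+y. (\<Sum>t<T. indicator (B' t) y) \<partial>lborel)"
        using B' by (intro nn_integral_sum[symmetric]) auto
      also have "\<dots> \<le> (\<integral>\<^sup>+y. of_nat N * indicator V y \<partial>lborel)"
      proof (rule nn_integral_mono)
        fix y
        have "(\<Sum>t<T. indicator (B' t) y :: ennreal) = of_nat (card {t\<in>{..<T}. y \<in> B' t})"
          by (simp add: indicator_def sum.If_cases Int_def)
        moreover have "card {t\<in>{..<T}. y \<in> B' t} \<le> N"
        proof -
          have "inj_on (\<lambda>t. - (real t / real T)) {t\<in>{..<T}. y \<in> B' t}"
            using that by (auto simp: inj_on_def)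
          moreover have "(\<lambda>t. - (real t / real T)) ` {t\<in>{..<T}. y \<in> B' t} \<subseteq> {t. y + t *\<^sub>R u \<in> Z}"
            by (auto simp: B'_def B_def c_def)
          ultimately have "card {t\<in>{..<T}. y \<in> B' t} \<le> card {t. y + t *\<^sub>R u \<in> Z}"
            using few by (intro card_inj_on_le) auto
          then show ?thesis using few[of y] by linarith
        qed
        moreover have "y \<in> V" if "t < T" "y \<in> B' t" for t
        proof -
          have "norm (c t) \<le> norm u"
            using that mult_right_mono[of "real t / real T" 1 "norm u"] by (simp add: c_def)
          moreover have "norm (y - c t) \<le> R" using that by (simp add: B'_def B_def)
          ultimately show ?thesis using norm_triangle_ineq[of "y - c t" "c t"] by (simp add: V_def)
        qed
        ultimately show "(\<Sum>t<T. indicator (B' t) y :: ennreal) \<le> of_nat N * indicator V y"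
          by (cases "{t\<in>{..<T}. y \<in> B' t} = {}") (auto simp: indicator_def)
      qed
      also have "\<dots> = of_nat N * emeasure lborel V"
        by (rule nn_integral_cmult_indicator) (simp add: V_def)
      finally show ?thesis .
    qed
    have "emeasure lborel B = 0"
    proof (rule ccontr)
      assume ne: "emeasure lborel B \<noteq> 0"
      have "emeasure lborel B \<le> emeasure lborel V"
        by (rule emeasure_mono) (auto simp: B_def V_def add_increasing2)
      then have Bfin: "emeasure lborel B = ennreal (measure lborel B)"
        using V by (intro emeasure_eq_ennreal_measure) (auto simp: top_unique)
      have Vfin: "emeasure lborel V = ennreal (measure lborel V)"
        using V by (intro emeasure_eq_ennreal_measure) auto
      have pos: "measure lborel B > 0" using ne Bfin by (metis ennreal_0 measure_nonneg order_less_le)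
      obtain T :: nat where T: "real N * measure lborel V / measure lborel B < real T"
        using reals_Archimedean2 by blast
      have "real N * measure lborel V / measure lborel B \<ge> 0"
        by (intro divide_nonneg_nonneg mult_nonneg_nonneg measure_nonneg) simp
      with T have "real T > 0" by linarith
      then have "T > 0" by simp
      from step[OF this] have "ennreal (real T * measure lborel B) \<le> ennreal (real N * measure lborel V)"
        unfolding Bfin Vfin by (simp add: ennreal_mult' ennreal_of_nat_eq_real_of_nat)
      then have "real T * measure lborel B \<le> real N * measure lborel V"
        by (subst (asm) ennreal_le_iff) auto
      then show False using T pos by (simp add: field_simps)
    qed
    then show ?thesis by (simp add: B_def)
  qed
  note ball0 = this
  have "negligible (Z \<inter> cball 0 (real (Suc n)))" for n
    using ball0[of "real (Suc n)"] \<open>closed Z\<close>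
    by (intro negligible_iff_null_sets[THEN iffD2] null_sets_completionI null_setsI)
      (auto intro!: borel_closed closed_Int)
  then have "negligible (\<Union>n. Z \<inter> cball 0 (real (Suc n)))"
    by (intro negligible_countable_Union) auto
  moreover have "Z \<subseteq> (\<Union>n. Z \<inter> cball 0 (real (Suc n)))"
  proof
    fix z assume "z \<in> Z"
    obtain n where "norm z \<le> real n" using real_arch_simple by blast
    then show "z \<in> (\<Union>n. Z \<inter> cball 0 (real (Suc n)))" using \<open>z \<in> Z\<close> by (auto intro!: exI[of _ n])
  qed
  ultimately show ?thesis using negligible_subset by blast
qed

text \<open>The hypothesis says that the vectors \<open>c e\<close> span; a basis taken among them
  supplies the columns of the minor.\<close>

lemma invertible_minor:
  fixes c :: "'e::finite => complex^'m::finite"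
  assumes span: "\<And>h. (\<And>e. (\<Sum>k\<in>UNIV. h $ k * c e $ k) = 0) ==> h = 0"
  shows "\<exists>\<sigma> :: 'm => 'e. det (\<chi> k l. c (\<sigma> l) $ k) \<noteq> 0"
proof -
  obtain B where B: "B \<subseteq> range c" "vec.independent B" "range c \<subseteq> vec.span B"
    using vec.maximal_independent_subset[of "range c"] by blast
  define C :: "complex^'m^'e" where "C = (\<chi> e. c e)"
  have "h = 0" if "C *v h = 0" for h
    using that by (intro span) (simp add: C_def matrix_vector_mult_def vec_eq_iff mult.commute)
  then have "\<exists>B. B ** C = mat 1" using matrix_left_invertible_ker[of C] by blast
  then have "vec.span (rows C) = UNIV" unfolding matrix_left_invertible_span_rows_gen .
  moreover have "rows C = range c" by (auto simp: rows_def row_def C_def)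
  ultimately have "vec.span B = UNIV"
    using vec.span_minimal[OF B(3) vec.subspace_span] by auto
  have "card B = CARD('m)"
    using B(2) \<open>vec.span B = UNIV\<close> by (metis vec.dim_eq_card_independent vec.dim_span vec_dim_card)
  moreover have fB: "finite B" using B(2) vec.finiteI_independent by blast
  ultimately obtain f where f: "bij_betw f (UNIV :: 'm set) B"
    using finite_same_card_bij[of "UNIV :: 'm set" B] by auto
  have "\<forall>l. \<exists>e. f l = c e" using f B(1) by (auto simp: bij_betw_def)
  then obtain \<sigma> where \<sigma>: "\<And>l. f l = c (\<sigma> l)" by metis
  have "columns (\<chi> k l. c (\<sigma> l) $ k) = B"
    using f by (auto simp: columns_def column_def \<sigma>[symmetric] bij_betw_def)
  then have "\<exists>C. (\<chi> k l. c (\<sigma> l) $ k) ** C = mat 1"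
    using \<open>vec.span B = UNIV\<close> by (simp add: matrix_right_invertible_span_columns)
  then show ?thesis by (metis invertible_det_nz invertible_right_inverse)
qed

definition linear_family ::
  "('e => 'm => 'm cfun) => ('m => 'm cfun) =>
    complex^'e => complex^'m => complex^'m" where
  "linear_family c g A x = (\<chi> k. (\<Sum>e\<in>UNIV. A $ e * c e k (vec_nth x)) - g k (vec_nth x))"

text \<open>The coefficient vectors at \<open>x\<close> span the whole space, so that the equations
  at \<open>x\<close> can be solved for \<open>CARD('m)\<close> suitable parameters.\<close>

definition spanning :: "('e => 'm::finite => 'm cfun) => complex^'m => bool" where
  "spanning c x \<longleftrightarrow> (\<forall>h :: complex^'m. (\<forall>e. (\<Sum>k\<in>UNIV. h $ k * c e k (vec_nth x)) = 0) \<longrightarrow> h = 0)"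

text \<open>Near a solution where the coefficient vectors span, \<open>m\<close> of the parameters are functions of the
  solution and of the other parameters; this gives a map between spaces of the same dimension whose
  critical values are the parameters with a degenerate solution.\<close>

lemma negligible_degenerate:
  fixes c :: "'e::finite => 'm::finite => 'm cfun"
  assumes c: "\<And>e k. poly_fun (c e k)" and g: "\<And>k. poly_fun (g k)"
    and Z: "closed Z" "\<And>z. finite {t::real. z + t *\<^sub>R u \<in> Z} \<and> card {t. z + t *\<^sub>R u \<in> Z} \<le> N"
  shows "negligible {A. \<exists>x. spanning c x \<and> linear_family c g A x = 0 \<and>
    (\<not> nondegenerate (linear_family c g A) x \<or> x \<in> Z)}"
proof -
  \<comment> \<open>A vector \<open>z\<close> stores a point in the slots
    \<open>range \<sigma>\<close> and parameters in the remaining slots; \<open>pt\<close> reads off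
    the point.\<close>
  define pt where "pt \<sigma> z = (\<chi> k. z $ \<sigma> k)" for \<sigma> :: "'m => 'e" and z :: "complex^'e"
  define M :: "('m => 'e) => complex^'e => complex^'m^'m"
    where "M \<sigma> z = (\<chi> k l. c (\<sigma> l) k (vec_nth (pt \<sigma> z)))" for \<sigma> z
  define b where "b \<sigma> z k = g k (vec_nth (pt \<sigma> z)) - (\<Sum>e\<in>- range \<sigma>. z $ e * c e k (vec_nth (pt \<sigma> z)))"
    for \<sigma> :: "'m => 'e" and z and k :: 'm
  define Num where "Num \<sigma> z l = det (\<chi> i j. if j = l then (\<chi> k. b \<sigma> z k) $ i else M \<sigma> z $ i $ j)" for \<sigma> z l
  \<comment> \<open>\<open>\<Phi>\<close> replaces the stored point by those parameters that make it
    a solution, obtained from the other slots by Cramer's rule.\<close>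
  define \<Phi> where "\<Phi> \<sigma> z = (\<chi> e. if e \<in> range \<sigma> then Num \<sigma> z (inv \<sigma> e) / det (M \<sigma> z) else z $ e)" for \<sigma> z
  define S where "S \<sigma> = {z. inj \<sigma> \<and> det (M \<sigma> z) \<noteq> 0}" for \<sigma>
  have pt: "vec_nth (pt \<sigma> z) = (\<lambda>k. z $ \<sigma> k)" for \<sigma> z
    by (simp add: pt_def fun_eq_iff)
  have poly_c: "poly_fun (\<lambda>z. f (\<lambda>k. z (\<sigma> k)))" if "poly_fun f" for f :: "'m cfun" and \<sigma> :: "'m => 'e"
    using that by (rule poly_fun_subst) (rule poly_fun.var)
  have solves: "linear_family c g (\<Phi> \<sigma> z) (pt \<sigma> z) = 0" if "z \<in> S \<sigma>" for \<sigma> z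
  proof -
    have d: "det (M \<sigma> z) \<noteq> 0" and inj: "inj \<sigma>" using that by (auto simp: S_def)
    define y where "y = (\<chi> l. Num \<sigma> z l / det (M \<sigma> z))"
    have "M \<sigma> z *v y = (\<chi> k. b \<sigma> z k)"
      using cramer[OF d, of y "\<chi> k. b \<sigma> z k"] by (simp add: y_def Num_def)
    then have "(\<Sum>l\<in>UNIV. M \<sigma> z $ k $ l * y $ l) = b \<sigma> z k" for k
      by (simp add: matrix_vector_mult_def vec_eq_iff)
    moreover have "(\<Sum>e\<in>UNIV. \<Phi> \<sigma> z $ e * c e k (vec_nth (pt \<sigma> z))) =
        (\<Sum>l\<in>UNIV. M \<sigma> z $ k $ l * y $ l) + (\<Sum>e\<in>- range \<sigma>. z $ e * c e k (vec_nth (pt \<sigma> z)))" for k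
    proof -
      have "(\<Sum>e\<in>UNIV. \<Phi> \<sigma> z $ e * c e k (vec_nth (pt \<sigma> z))) =
          (\<Sum>e\<in>range \<sigma>. \<Phi> \<sigma> z $ e * c e k (vec_nth (pt \<sigma> z))) +
          (\<Sum>e\<in>- range \<sigma>. \<Phi> \<sigma> z $ e * c e k (vec_nth (pt \<sigma> z)))"
        by (subst sum.union_disjoint[symmetric]) auto
      moreover have "(\<Sum>e\<in>range \<sigma>. \<Phi> \<sigma> z $ e * c e k (vec_nth (pt \<sigma> z))) = (\<Sum>l\<in>UNIV. M \<sigma> z $ k $ l * y $ l)"
        by (simp add: sum.reindex[OF inj] \<Phi>_def inv_f_f[OF inj] M_def y_def mult.commute)
      moreover have "(\<Sum>e\<in>- range \<sigma>. \<Phi> \<sigma> z $ e * c e k (vec_nth (pt \<sigma> z))) =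
          (\<Sum>e\<in>- range \<sigma>. z $ e * c e k (vec_nth (pt \<sigma> z)))"
        by (intro sum.cong) (auto simp: \<Phi>_def)
      ultimately show ?thesis by simp
    qed
    ultimately show ?thesis by (simp add: linear_family_def vec_eq_iff b_def)
  qed
  have param: "\<exists>\<sigma> z. z \<in> S \<sigma> \<and> \<Phi> \<sigma> z = A \<and> pt \<sigma> z = x" if "spanning c x" "linear_family c g A x = 0" for A x
  proof -
    obtain \<sigma> :: "'m => 'e" where d: "det (\<chi> k l. c (\<sigma> l) k (vec_nth x)) \<noteq> 0"
      using invertible_minor[of "\<lambda>e. \<chi> k. c e k (vec_nth x)"] \<open>spanning c x\<close> by (auto simp: spanning_def)
    have inj: "inj \<sigma>"
    proof (rule injI, rule ccontr)
      fix i j assume "\<sigma> i = \<sigma> j" "i \<noteq> j"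
      then have "det (\<chi> k l. c (\<sigma> l) k (vec_nth x)) = 0"
        by (intro det_identical_columns[of i j]) (auto simp: column_def vec_eq_iff)
      with d show False by simp
    qed
    define z where "z = (\<chi> e. if e \<in> range \<sigma> then x $ inv \<sigma> e else A $ e)"
    have x: "pt \<sigma> z = x" by (simp add: pt_def z_def inv_f_f[OF inj] vec_eq_iff)
    have M: "M \<sigma> z = (\<chi> k l. c (\<sigma> l) k (vec_nth x))" by (simp add: M_def x)
    have "M \<sigma> z *v (\<chi> l. A $ \<sigma> l) = (\<chi> k. b \<sigma> z k)"
    proof -
      have "(\<Sum>e\<in>UNIV. A $ e * c e k (vec_nth x)) =
          (\<Sum>e\<in>range \<sigma>. A $ e * c e k (vec_nth x)) + (\<Sum>e\<in>- range \<sigma>. A $ e * c e k (vec_nth x))" for k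
        by (subst sum.union_disjoint[symmetric]) auto
      moreover have "(\<Sum>e\<in>range \<sigma>. A $ e * c e k (vec_nth x)) = (\<Sum>l\<in>UNIV. A $ \<sigma> l * c (\<sigma> l) k (vec_nth x))" for k
        by (simp add: sum.reindex[OF inj])
      moreover have "(\<Sum>e\<in>- range \<sigma>. A $ e * c e k (vec_nth x)) = (\<Sum>e\<in>- range \<sigma>. z $ e * c e k (vec_nth x))" for k
        by (intro sum.cong) (auto simp: z_def)
      moreover have "(\<Sum>e\<in>UNIV. A $ e * c e k (vec_nth x)) = g k (vec_nth x)" for k
        using that(2) by (simp add: linear_family_def vec_eq_iff)
      ultimately show ?thesis
        by (simp add: matrix_vector_mult_def M b_def x vec_eq_iff mult.commute)
    qed
    then have "(\<chi> l. A $ \<sigma> l) = (\<chi> l. Num \<sigma> z l / det (M \<sigma> z))"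
      using d M by (subst (asm) cramer) (auto simp: Num_def)
    then have "A $ \<sigma> l = Num \<sigma> z l / det (M \<sigma> z)" for l by (simp add: vec_eq_iff)
    then have "\<Phi> \<sigma> z = A"
      by (auto simp: \<Phi>_def z_def vec_eq_iff inv_f_f[OF inj])
    moreover have "z \<in> S \<sigma>" using d inj by (simp add: S_def M)
    ultimately show ?thesis using x by blast
  qed
  have diff: "\<exists>\<Phi>'. (\<Phi> \<sigma> has_derivative \<Phi>') (at z)" if "z \<in> S \<sigma>" for \<sigma> z
  proof -
    have pM: "poly_fun (\<lambda>w. M \<sigma> (vec_lambda w) $ i $ j)" for i j
      by (auto simp: M_def pt vec_lambda_inverse intro!: poly_c c)
    have pb: "poly_fun (\<lambda>w. b \<sigma> (vec_lambda w) i)" for i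
      by (auto simp: b_def pt vec_lambda_inverse intro!: poly_fun_intros poly_c c g)
    have "\<exists>f'. ((\<lambda>z. \<Phi> \<sigma> z $ e) has_derivative f') (at z)" for e
    proof (cases "e \<in> range \<sigma>")
      case True
      have "poly_fun (\<lambda>w. if j = inv \<sigma> e then b \<sigma> (vec_lambda w) i else M \<sigma> (vec_lambda w) $ i $ j)" for i j
        by (cases "j = inv \<sigma> e") (simp_all add: pM pb)
      then have "poly_fun (\<lambda>w. Num \<sigma> (vec_lambda w) (inv \<sigma> e))"
        unfolding Num_def by (intro poly_fun_det) (simp cong: if_cong)
      then obtain n' where n': "((\<lambda>z. Num \<sigma> z (inv \<sigma> e)) has_derivative n') (at z)"
        using poly_fun_has_derivative by fastforce
      have "poly_fun (\<lambda>w. det (M \<sigma> (vec_lambda w)))"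
        by (intro poly_fun_det pM)
      then obtain d' where d': "((\<lambda>z. det (M \<sigma> z)) has_derivative d') (at z)"
        using poly_fun_has_derivative by fastforce
      show ?thesis
        using has_derivative_divide[OF n' d'] that True by (auto simp: S_def \<Phi>_def)
    next
      case False
      then show ?thesis
        using bounded_linear_imp_has_derivative[OF bounded_linear_vec_nth] by (auto simp: \<Phi>_def)
    qed
    then obtain F where "\<And>e. ((\<lambda>z. \<Phi> \<sigma> z $ e) has_derivative F e) (at z)" by metis
    then have "((\<lambda>z. \<chi> e. \<Phi> \<sigma> z $ e) has_derivative (\<lambda>h. \<chi> e. F e h)) (at z)"
      by (rule has_derivative_vec_lambda)
    then show ?thesis by auto
  qed
  define D where "D \<sigma> z = (SOME \<Phi>'. (\<Phi> \<sigma> has_derivative \<Phi>') (at z))" for \<sigma> z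
  have D: "(\<Phi> \<sigma> has_derivative D \<sigma> z) (at z)" if "z \<in> S \<sigma>" for \<sigma> z
    unfolding D_def using diff[OF that] by (rule someI_ex)
  define Crit where "Crit \<sigma> = {z \<in> S \<sigma>. \<exists>h. h \<noteq> 0 \<and> D \<sigma> z h = 0}" for \<sigma>
  \<comment> \<open>The vectors whose stored point lies in \<open>Z\<close> are negligible already,
    and a differentiable map between spaces of equal dimension preserves this.\<close>
  define Bad where "Bad \<sigma> = {z \<in> S \<sigma>. pt \<sigma> z \<in> Z}" for \<sigma>
  have "negligible (\<Phi> \<sigma> ` Crit \<sigma>)" for \<sigma>
  proof (rule Sard_euclidean)
    show "CARD(('e \<times> bool) wo) = DIM(complex^'e)" by (simp add: CARD_wo)
  qed (use D in \<open>auto simp: Crit_def\<close>)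
  moreover have "negligible (\<Phi> \<sigma> ` Bad \<sigma>)" for \<sigma>
  proof (rule negligible_differentiable_image_negligible)
    show "\<Phi> \<sigma> differentiable_on Bad \<sigma>"
      unfolding differentiable_on_def Bad_def
      using D differentiableI has_derivative_at_withinI by (metis (no_types, lifting) mem_Collect_eq)
    show "negligible (Bad \<sigma>)"
    proof (cases "inj \<sigma>")
      case True
      have "negligible {z. pt \<sigma> z \<in> Z}"
      proof (rule negligible_few_on_lines)
        have "continuous_on UNIV (pt \<sigma>)"
          unfolding pt_def by (intro continuous_on_vec_lambda continuous_intros)
        then show "closed {z. pt \<sigma> z \<in> Z}"
          using closed_vimage[OF Z(1)] by (simp add: vimage_def)
        define v :: "complex^'e" where "v = (\<chi> e. if e \<in> range \<sigma> then u $ inv \<sigma> e else 0)"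
        have "pt \<sigma> (z + t *\<^sub>R v) = pt \<sigma> z + t *\<^sub>R u" for z and t :: real
          by (simp add: pt_def v_def vec_eq_iff inv_f_f[OF True])
        then show "finite {t::real. z + t *\<^sub>R v \<in> {z. pt \<sigma> z \<in> Z}} \<and>
            card {t::real. z + t *\<^sub>R v \<in> {z. pt \<sigma> z \<in> Z}} \<le> N" for z
          using Z(2)[of "pt \<sigma> z"] by simp
      qed
      then show ?thesis by (rule negligible_subset) (auto simp: Bad_def)
    qed (simp add: Bad_def S_def)
  qed simp
  ultimately have "negligible (\<Union>\<sigma>\<in>UNIV. \<Phi> \<sigma> ` Crit \<sigma> \<union> \<Phi> \<sigma> ` Bad \<sigma>)"
    by (intro negligible_Union) auto
  moreover have "{A. \<exists>x. spanning c x \<and> linear_family c g A x = 0 \<and>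
      (\<not> nondegenerate (linear_family c g A) x \<or> x \<in> Z)} \<subseteq> (\<Union>\<sigma>\<in>UNIV. \<Phi> \<sigma> ` Crit \<sigma> \<union> \<Phi> \<sigma> ` Bad \<sigma>)"
  proof clarify
    fix A x
    assume sp: "spanning c x" and sol: "linear_family c g A x = 0"
      and *: "\<not> nondegenerate (linear_family c g A) x \<or> x \<in> Z"
    obtain \<sigma> z where z: "z \<in> S \<sigma>" and A: "\<Phi> \<sigma> z = A" and x: "pt \<sigma> z = x"
      using param[OF sp sol] by blast
    have "z \<in> Crit \<sigma>" if nd: "\<not> nondegenerate (linear_family c g A) x"
    proof -
      define dc where "dc e k = (SOME F. ((\<lambda>x. c e k (vec_nth x)) has_derivative F) (at x))" for e k
      have dc: "((\<lambda>x. c e k (vec_nth x)) has_derivative dc e k) (at x)" for e k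
        unfolding dc_def by (rule someI_ex[OF poly_fun_differentiable[OF c]])
      define dg where "dg k = (SOME F. ((\<lambda>x. g k (vec_nth x)) has_derivative F) (at x))" for k
      have dg: "((\<lambda>x. g k (vec_nth x)) has_derivative dg k) (at x)" for k
        unfolding dg_def by (rule someI_ex[OF poly_fun_differentiable[OF g]])
      have "(linear_family c g A has_derivative (\<lambda>h. \<chi> k. (\<Sum>e\<in>UNIV. A $ e * dc e k h) - dg k h)) (at x)"
        unfolding linear_family_def by (intro has_derivative_vec_lambda derivative_intros dc dg)
      with nd obtain h where h0: "h \<noteq> 0" "(\<chi> k. (\<Sum>e\<in>UNIV. A $ e * dc e k h) - dg k h) = 0"
        unfolding nondegenerate_def by blast
      have h: "h \<noteq> 0" "(\<Sum>e\<in>UNIV. A $ e * dc e k h) - dg k h = 0" for k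
        using h0(1) arg_cong[OF h0(2), of "\<lambda>v. v $ k"] by simp_all
      have inj: "inj \<sigma>" using z by (simp add: S_def)
      \<comment> \<open>\<open>v\<close> moves only the stored point, in the direction of a kernel
        vector \<open>h\<close>. Differentiating \<open>solves\<close> in this direction shows that
        the recovered parameters do not change to first order, so \<open>z\<close> is critical for
        \<open>\<Phi>\<close>.\<close>
      define v :: "complex^'e" where "v = (\<chi> e. if e \<in> range \<sigma> then h $ inv \<sigma> e else 0)"
      have pv: "pt \<sigma> v = h" by (simp add: pt_def v_def vec_eq_iff inv_f_f[OF inj])
      have "pt \<sigma> 0 = 0" by (simp add: pt_def vec_eq_iff)
      with pv h(1) have "v \<noteq> 0" by metis
      have "bounded_linear (pt \<sigma>)"
        unfolding linear_conv_bounded_linear[symmetric] by (rule linearI) (auto simp: pt_def vec_eq_iff)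
      then have dpt: "(pt \<sigma> has_derivative pt \<sigma>) (at z)" by (rule bounded_linear_imp_has_derivative)
      have dc': "((\<lambda>w. c e k (vec_nth (pt \<sigma> w))) has_derivative (\<lambda>h. dc e k (pt \<sigma> h))) (at z)" for e k
        using has_derivative_compose[OF dpt] dc[of e k] x by blast
      have dg': "((\<lambda>w. g k (vec_nth (pt \<sigma> w))) has_derivative (\<lambda>h. dg k (pt \<sigma> h))) (at z)" for k
        using has_derivative_compose[OF dpt] dg[of k] x by blast
      have d\<Phi>: "((\<lambda>w. \<Phi> \<sigma> w $ e) has_derivative (\<lambda>h. D \<sigma> z h $ e)) (at z)" for e
        by (rule bounded_linear.has_derivative[OF bounded_linear_vec_nth D[OF z]])
      have "open (S \<sigma>)"
      proof -
        have "poly_fun (\<lambda>w. det (M \<sigma> (vec_lambda w)))"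
          by (intro poly_fun_det) (auto simp: M_def pt vec_lambda_inverse intro!: poly_c c)
        from poly_fun_continuous[OF this, of UNIV] have "continuous_on UNIV (\<lambda>w. det (M \<sigma> w))" by simp
        then have "open ((\<lambda>w. det (M \<sigma> w)) -` (- {0}))" by (intro open_vimage) auto
        then show ?thesis using inj by (simp add: S_def vimage_def Compl_eq)
      qed
      have "(\<Sum>e\<in>UNIV. D \<sigma> z v $ e * c e k (vec_nth x)) = 0" for k
      proof -
        have 1: "((\<lambda>w. linear_family c g (\<Phi> \<sigma> w) (pt \<sigma> w) $ k) has_derivative (\<lambda>h. (\<Sum>e\<in>UNIV.
            \<Phi> \<sigma> z $ e * dc e k (pt \<sigma> h) + D \<sigma> z h $ e * c e k (vec_nth (pt \<sigma> z))) - dg k (pt \<sigma> h))) (at z)"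
          unfolding linear_family_def vec_lambda_beta by (intro derivative_intros d\<Phi> dc' dg')
        have 2: "((\<lambda>w. linear_family c g (\<Phi> \<sigma> w) (pt \<sigma> w) $ k) has_derivative (\<lambda>h. 0)) (at z)"
          by (rule has_derivative_transform_within_open[OF has_derivative_const \<open>open (S \<sigma>)\<close> z, of 0])
            (simp add: solves)
        have "(\<Sum>e\<in>UNIV. \<Phi> \<sigma> z $ e * dc e k (pt \<sigma> v) + D \<sigma> z v $ e * c e k (vec_nth (pt \<sigma> z)))
            - dg k (pt \<sigma> v) = 0"
          using fun_cong[OF has_derivative_unique[OF 1 2], of v] .
        then show ?thesis using h(2)[of k] by (simp add: pv A x sum.distrib)
      qed
      moreover have outside: "D \<sigma> z v $ e = 0" if "e \<notin> range \<sigma>" for e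
      proof -
        have "((\<lambda>w. \<Phi> \<sigma> w $ e) has_derivative (\<lambda>h. h $ e)) (at z)"
          using that bounded_linear_imp_has_derivative[OF bounded_linear_vec_nth] by (simp add: \<Phi>_def)
        from fun_cong[OF has_derivative_unique[OF d\<Phi>[of e] this], of v] have "D \<sigma> z v $ e = v $ e" .
        then show ?thesis using that by (simp add: v_def)
      qed
      ultimately have "M \<sigma> z *v (\<chi> l. D \<sigma> z v $ \<sigma> l) = 0"
      proof -
        have "(\<Sum>e\<in>UNIV. D \<sigma> z v $ e * c e k (vec_nth x)) = (\<Sum>l\<in>UNIV. D \<sigma> z v $ \<sigma> l * c (\<sigma> l) k (vec_nth x))" for k
        proof -
          have "(\<Sum>e\<in>UNIV. D \<sigma> z v $ e * c e k (vec_nth x)) = (\<Sum>e\<in>range \<sigma>. D \<sigma> z v $ e * c e k (vec_nth x))"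
            using outside by (intro sum.mono_neutral_right) auto
          then show ?thesis by (simp add: sum.reindex[OF inj])
        qed
        then show ?thesis
          using \<open>\<And>k. (\<Sum>e\<in>UNIV. D \<sigma> z v $ e * c e k (vec_nth x)) = 0\<close>
          by (simp add: matrix_vector_mult_def M_def x vec_eq_iff mult.commute)
      qed
      moreover have "\<exists>C. C ** M \<sigma> z = mat 1"
        using z by (simp add: S_def invertible_left_inverse[symmetric] invertible_det_nz)
      ultimately have "(\<chi> l. D \<sigma> z v $ \<sigma> l) = 0"
        unfolding matrix_left_invertible_ker by blast
      then have "D \<sigma> z v $ e = 0" for e
        using outside by (cases "e \<in> range \<sigma>") (auto simp: vec_eq_iff)
      then have "D \<sigma> z v = 0" by (simp add: vec_eq_iff)
      then show ?thesis using z \<open>v \<noteq> 0\<close> by (auto simp: Crit_def)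
    qed
    moreover have "z \<in> Bad \<sigma>" if "x \<in> Z" using that z x by (simp add: Bad_def)
    ultimately show "A \<in> (\<Union>\<sigma>\<in>UNIV. \<Phi> \<sigma> ` Crit \<sigma> \<union> \<Phi> \<sigma> ` Bad \<sigma>)" using * A by blast
  qed
  ultimately show ?thesis by (rule negligible_subset)
qed

section \<open>Counting solutions near a special parameter\<close>

lemma sys_limit:
  fixes e :: "'m::finite => ('p::finite + 'm) cfun"
  assumes e: "\<And>k. poly_fun (e k)" and lim: "p \<longlonglongrightarrow> p0" "x \<longlonglongrightarrow> x0" and sol: "\<And>k. sys e (p k) (x k) = 0"
  shows "sys e p0 x0 = 0"
proof -
  have "isCont (\<lambda>z. sys e (fst z) (snd z)) (p0, x0)"
    using continuous_sys[OF e] by (simp add: continuous_on_eq_continuous_at)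
  moreover have "(\<lambda>k. (p k, x k)) \<longlonglongrightarrow> (p0, x0)" using lim by (rule tendsto_Pair)
  ultimately have "(\<lambda>k. sys e (fst (p k, x k)) (snd (p k, x k))) \<longlonglongrightarrow> sys e (fst (p0, x0)) (snd (p0, x0))"
    by (rule isCont_tendsto_compose)
  then have "(\<lambda>k. 0) \<longlonglongrightarrow> sys e p0 x0" using sol by simp
  then show ?thesis by (simp add: LIMSEQ_const_iff)
qed

text \<open>Solutions at \<open>p0\<close> persist; the regions \<open>N j p\<close> hold the
  additional ones that exist only for \<open>p \<noteq> p0\<close>. Uncounted solutions for
  parameters tending to \<open>p0\<close> would by \<open>cover\<close> accumulate at a solution for
  \<open>p0\<close>, and so enter a ball that is already counted.\<close>

lemma card_near:
  fixes e :: "'m::finite => ('p::finite + 'm) cfun" and N :: "'j => complex^'p => (complex^'m) set"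
  assumes e: "\<And>k. poly_fun (e k)" and \<Omega>: "open (Sigma UNIV \<Omega>)"
    and nd: "\<And>x. x \<in> \<Omega> p0 ==> sys e p0 x = 0 ==> nondegenerate (sys e p0) x"
    and J: "finite J"
    and Nex: "\<And>j. j \<in> J ==> eventually (\<lambda>p. \<exists>!x. x \<in> N j p \<inter> {x \<in> \<Omega> p. sys e p x = 0}) (at p0)"
    and Ndisj: "\<And>i j. i \<in> J ==> j \<in> J ==> i \<noteq> j ==> eventually (\<lambda>p. N i p \<inter> N j p = {}) (at p0)"
    and Nfar: "\<And>j x. j \<in> J ==> x \<in> \<Omega> p0 ==> \<exists>r>0. eventually (\<lambda>p. N j p \<inter> ball x r = {}) (at p0)"
    and cover: "\<And>p x. p \<longlonglongrightarrow> p0 ==> (\<And>k. x k \<in> \<Omega> (p k) \<and> sys e (p k) (x k) = 0) ==>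
      (\<exists>r l. strict_mono (r :: nat => nat) \<and> l \<in> \<Omega> p0 \<and> (x \<circ> r) \<longlonglongrightarrow> l) \<or> (\<exists>k. p k \<noteq> p0 \<and> (\<exists>j\<in>J. x k \<in> N j (p k)))"
  shows "finite {x \<in> \<Omega> p0. sys e p0 x = 0}"
    "eventually (\<lambda>p. finite {x \<in> \<Omega> p. sys e p x = 0} \<and>
      card {x \<in> \<Omega> p. sys e p x = 0} = card {x \<in> \<Omega> p0. sys e p0 x = 0} + card J) (at p0)"
proof -
  define S where "S p = {x \<in> \<Omega> p. sys e p x = 0}" for p
  have pers: "\<exists>r0>0. \<forall>r. 0 < r \<and> r \<le> r0 \<longrightarrow> eventually (\<lambda>p. \<exists>!x. x \<in> ball x0 r \<and> sys e p x = 0) (nhds p0)"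
    if "x0 \<in> S p0" for x0
  proof -
    have "sys e p0 x0 = 0" "nondegenerate (sys e p0) x0" using nd[of x0] that by (auto simp: S_def)
    then obtain r0 where "r0 > 0"
      "\<And>r. 0 < r ==> r \<le> r0 ==> eventually (\<lambda>p. \<exists>!x. x \<in> ball x0 r \<and> sys e p x = 0) (nhds p0)"
      by (rule persistence[where e=e, OF e]) (rule that)
    then show ?thesis by (intro exI[of _ r0]) simp
  qed
  show fin: "finite {x \<in> \<Omega> p0. sys e p0 x = 0}"
  proof (rule ccontr)
    assume "infinite {x \<in> \<Omega> p0. sys e p0 x = 0}"
    then obtain x :: "nat => complex^'m" where x: "inj x" "range x \<subseteq> S p0"
      using infinite_countable_subset unfolding S_def by blast
    have sol: "x k \<in> \<Omega> p0 \<and> sys e p0 (x k) = 0" for k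
      using x(2) by (auto simp: S_def)
    \<comment> \<open>For the constant sequence \<open>p0\<close> the second alternative of
      \<open>cover\<close> is impossible, so an infinite solution set would accumulate at a
      solution, which \<open>pers\<close> shows to be isolated.\<close>
    obtain r l where rl: "strict_mono (r :: nat => nat)" "l \<in> \<Omega> p0" "(x \<circ> r) \<longlonglongrightarrow> l"
      using cover[of "\<lambda>_. p0" x] sol by auto
    have "sys e p0 l = 0"
      by (rule sys_limit[OF e tendsto_const rl(3)]) (simp add: sol)
    then have "l \<in> S p0" using rl by (simp add: S_def)
    from pers[OF this] obtain r0 where "r0 > 0"
      and "eventually (\<lambda>p. \<exists>!x. x \<in> ball l r0 \<and> sys e p x = 0) (nhds p0)" by auto
    then have u: "\<exists>!x. x \<in> ball l r0 \<and> sys e p0 x = 0" using eventually_nhds_x_imp_x by fast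
    have "eventually (\<lambda>k. (x \<circ> r) k \<in> ball l r0) sequentially"
      using rl(3) \<open>r0 > 0\<close> by (auto simp: tendsto_iff dist_commute)
    then obtain k where k: "\<And>i. i \<ge> k ==> x (r i) \<in> ball l r0"
      unfolding eventually_sequentially by auto
    have "x (r k) = x (r (Suc k))" using u k[of k] k[of "Suc k"] sol by auto
    then have "r k = r (Suc k)" using x(1) by (auto dest: injD)
    then show False using rl(1) by (metis n_not_Suc_n strict_mono_eq)
  qed
  \<comment> \<open>Each requirement holds for all small radii, so that a single radius can serve
    all of the finitely many solutions at \<open>p0\<close>.\<close>
  define good where "good x0 \<rho> \<longleftrightarrow> eventually (\<lambda>p. \<exists>!x. x \<in> ball x0 \<rho> \<and> sys e p x = 0) (nhds p0) \<and>
      eventually (\<lambda>p. ball x0 \<rho> \<subseteq> \<Omega> p) (nhds p0) \<and> (\<forall>j\<in>J. eventually (\<lambda>p. N j p \<inter> ball x0 \<rho> = {}) (at p0)) \<and>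
      (\<forall>x1\<in>S p0. x1 \<noteq> x0 \<longrightarrow> 2 * \<rho> \<le> dist x0 x1)" for x0 \<rho>
  have small: "eventually P (at_right 0)" if "r > 0" "\<And>\<rho>. 0 < \<rho> ==> \<rho> \<le> r ==> P \<rho>" for P and r :: real
    unfolding eventually_at_right_field using that by (metis less_imp_le)
  have "eventually (good x0) (at_right 0)" if x0: "x0 \<in> S p0" for x0
    unfolding good_def
  proof (intro eventually_conj eventually_ball_finite ballI)
    obtain r0 where "r0 > 0" "\<And>r. 0 < r ==> r \<le> r0 ==> eventually (\<lambda>p. \<exists>!x. x \<in> ball x0 r \<and> sys e p x = 0) (nhds p0)"
      using pers[OF x0] by blast
    then show "eventually (\<lambda>\<rho>. eventually (\<lambda>p. \<exists>!x. x \<in> ball x0 \<rho> \<and> sys e p x = 0) (nhds p0)) (at_right 0)"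
      by (rule small)
    have "(p0, x0) \<in> Sigma UNIV \<Omega>" using x0 by (simp add: S_def)
    then obtain U V where UV: "open U" "open V" "p0 \<in> U" "x0 \<in> V" "U \<times> V \<subseteq> Sigma UNIV \<Omega>"
      using open_prod_elim[OF \<Omega>] by (metis mem_Sigma_iff)
    then obtain r where r: "r > 0" "ball x0 r \<subseteq> V" by (auto simp: open_contains_ball)
    show "eventually (\<lambda>\<rho>. eventually (\<lambda>p. ball x0 \<rho> \<subseteq> \<Omega> p) (nhds p0)) (at_right 0)"
    proof (rule small[OF r(1)])
      fix \<rho> assume "\<rho> \<le> r"
      then have "ball x0 \<rho> \<subseteq> V" using r(2) subset_ball by blast
      then have "\<forall>p\<in>U. ball x0 \<rho> \<subseteq> \<Omega> p" using UV(5) by blast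
      then show "eventually (\<lambda>p. ball x0 \<rho> \<subseteq> \<Omega> p) (nhds p0)" using UV(1,3) unfolding eventually_nhds by blast
    qed
    fix j assume "j \<in> J"
    then obtain r where r: "r > 0" "eventually (\<lambda>p. N j p \<inter> ball x0 r = {}) (at p0)"
      using Nfar[of j x0] x0 by (auto simp: S_def)
    show "eventually (\<lambda>\<rho>. eventually (\<lambda>p. N j p \<inter> ball x0 \<rho> = {}) (at p0)) (at_right 0)"
    proof (rule small[OF r(1)])
      fix \<rho> assume "\<rho> \<le> r"
      then show "eventually (\<lambda>p. N j p \<inter> ball x0 \<rho> = {}) (at p0)"
        using r(2) by (auto elim!: eventually_mono)
    qed
  next
    fix x1
    show "eventually (\<lambda>\<rho>. x1 \<noteq> x0 \<longrightarrow> 2 * \<rho> \<le> dist x0 x1) (at_right 0)"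
      by (cases "x1 = x0") (auto intro!: small[of "dist x0 x1 / 2"])
  qed (use fin J in \<open>simp_all add: S_def\<close>)
  then have "eventually (\<lambda>\<rho>. \<forall>x0\<in>S p0. good x0 \<rho>) (at_right 0)"
    using fin by (intro eventually_ball_finite ballI) (simp_all add: S_def)
  then obtain \<rho> where good: "\<rho> > 0" "\<And>x0. x0 \<in> S p0 ==> good x0 \<rho>"
    using eventually_happens'[OF trivial_limit_at_right_real eventually_conj[OF eventually_at_right_less]] by blast
  define B where "B i p = (case i of Inl x0 => ball x0 \<rho> | Inr j => N j p)" for i p
  have "eventually (\<lambda>p. finite (S p) \<and> card (S p) = card (S p0 <+> J)) (at p0)"
  proof (rule card_eq_branches)
    show "finite (S p0 <+> J)" using fin J by (simp add: S_def)
  next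
    fix i assume i: "i \<in> S p0 <+> J"
    show "eventually (\<lambda>p. \<exists>!x. x \<in> B i p \<inter> S p) (at p0)"
    proof (cases i)
      case (Inl x0)
      then have x0: "x0 \<in> S p0" using i by auto
      have "eventually (\<lambda>p. \<exists>!x. x \<in> ball x0 \<rho> \<and> sys e p x = 0) (at p0)"
        using good(2)[OF x0] by (simp add: good_def eventually_nhds_conv_at)
      moreover have "eventually (\<lambda>p. ball x0 \<rho> \<subseteq> \<Omega> p) (at p0)"
        using good(2)[OF x0] by (simp add: good_def eventually_nhds_conv_at)
      ultimately show ?thesis
      proof eventually_elim
        case (elim p)
        have "x \<in> B i p \<inter> S p \<longleftrightarrow> x \<in> ball x0 \<rho> \<and> sys e p x = 0" for x
          using elim(2) by (auto simp: B_def Inl S_def)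
        then show ?case using elim(1) by presburger
      qed
    next
      case (Inr j)
      then show ?thesis using Nex[of j] i by (auto simp: B_def S_def)
    qed
  next
    fix i i' assume i: "i \<in> S p0 <+> J" "i' \<in> S p0 <+> J" "i \<noteq> i'"
    have mixed: "eventually (\<lambda>p. B (Inl x0) p \<inter> B (Inr j) p = {}) (at p0)" if "x0 \<in> S p0" "j \<in> J" for x0 j
      using good(2)[OF that(1)] that(2) by (simp add: B_def good_def Int_commute)
    show "eventually (\<lambda>p. B i p \<inter> B i' p = {}) (at p0)"
    proof (cases i; cases i')
      fix x0 x1 assume *: "i = Inl x0" "i' = Inl x1"
      then have "x0 \<in> S p0" "x1 \<in> S p0" "x0 \<noteq> x1" using i by auto
      then have "\<rho> + \<rho> \<le> dist x0 x1" using good(2)[of x0] by (simp add: good_def)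
      then have "ball x0 \<rho> \<inter> ball x1 \<rho> = {}" by (rule disjoint_ballI)
      then show ?thesis by (simp add: * B_def)
    next
      fix x0 j assume "i = Inl x0" "i' = Inr j"
      then show ?thesis using mixed[of x0 j] i by auto
    next
      fix x0 j assume "i' = Inl x0" "i = Inr j"
      then show ?thesis using mixed[of x0 j] i by (auto simp: Int_commute)
    next
      fix j j' assume "i = Inr j" "i' = Inr j'"
      then show ?thesis using Ndisj[of j j'] i by (auto simp: B_def)
    qed
  next
    show "eventually (\<lambda>p. S p \<subseteq> (\<Union>i\<in>S p0 <+> J. B i p)) (at p0)"
    proof (rule ccontr)
      assume "\<not> ?thesis"
      then obtain p where p: "p \<longlonglongrightarrow> p0" "\<And>k. p k \<noteq> p0" "\<And>k. \<not> S (p k) \<subseteq> (\<Union>i\<in>S p0 <+> J. B i (p k))"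
        using not_eventually_at_sequence by blast
      then have "\<exists>x. x \<in> S (p k) \<and> (\<forall>i\<in>S p0 <+> J. x \<notin> B i (p k))" for k
        by blast
      then obtain x where x: "\<And>k. x k \<in> S (p k)" "\<And>k i. i \<in> S p0 <+> J ==> x k \<notin> B i (p k)"
        by metis
      have sol: "x k \<in> \<Omega> (p k) \<and> sys e (p k) (x k) = 0" for k using x(1) by (auto simp: S_def)
      have "x k \<notin> N j (p k)" if "j \<in> J" for j k
        using x(2)[of "Inr j" k] that by (auto simp: B_def)
      then obtain r l where rl: "strict_mono (r :: nat => nat)" "l \<in> \<Omega> p0" "(x \<circ> r) \<longlonglongrightarrow> l"
        using cover[OF p(1) sol] by blast
      have "sys e p0 l = 0"
        by (rule sys_limit[OF e LIMSEQ_subseq_LIMSEQ[OF p(1) rl(1)] rl(3)]) (simp add: sol)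
      then have l: "l \<in> S p0" using rl by (simp add: S_def)
      have "eventually (\<lambda>k. (x \<circ> r) k \<in> ball l \<rho>) sequentially"
        using rl(3) good(1) by (auto simp: tendsto_iff dist_commute)
      then obtain k where "x (r k) \<in> ball l \<rho>"
        using eventually_happens' by force
      then show False using x(2)[of "Inl l" "r k"] l by (auto simp: B_def)
    qed
  qed
  then show "eventually (\<lambda>p. finite {x \<in> \<Omega> p. sys e p x = 0} \<and>
      card {x \<in> \<Omega> p. sys e p x = 0} = card {x \<in> \<Omega> p0. sys e p0 x = 0} + card J) (at p0)"
    using fin J by (simp add: card_Plus S_def)
qed

section \<open>Pairs of homogeneous systems\<close>

text \<open>The equations \<open>F x = G x\<close> with \<open>F\<close> and \<open>G\<close> homogeneous of degrees \<open>d\<close> and \<open>d + 1\<close>.\<close>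

definition homog :: "nat => 'm cfun => bool" where
  "homog d f \<longleftrightarrow> (\<forall>c x. f (\<lambda>i. c * x i) = c ^ d * f x)"

definition vfun :: "('m => 'm cfun) => complex^'m => complex^'m" where
  "vfun F x = (\<chi> k. F k (vec_nth x))"

lemma vfun_scale:
  assumes "\<And>k. homog d (F k)"
  shows "vfun F (c *s x) = c ^ d *s vfun F x"
proof -
  have "vec_nth (c *s x) = (\<lambda>i. c * x $ i)" by (simp add: fun_eq_iff)
  then show ?thesis using assms by (simp add: vfun_def homog_def vec_eq_iff)
qed

text \<open>Real scaling to the unit sphere and compactness of \<open>[0, \<infinity>]\<close>.\<close>

lemma sphere_subsequence:
  fixes x :: "nat => complex^'m::finite"
  assumes "\<And>k. x k \<noteq> 0"
  obtains r u where "strict_mono (r :: nat => nat)" "norm u = 1"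
    "(\<lambda>k. x (r k) /\<^sub>R norm (x (r k))) \<longlonglongrightarrow> u"
    "(\<exists>l>0. (\<lambda>k. norm (x (r k))) \<longlonglongrightarrow> l) \<or> (\<lambda>k. norm (x (r k))) \<longlonglongrightarrow> 0 \<or>
      (\<lambda>k. inverse (norm (x (r k)))) \<longlonglongrightarrow> 0"
proof -
  define a where "a k = (x k /\<^sub>R norm (x k), norm (x k) / (1 + norm (x k)))" for k
  have "a k \<in> sphere 0 1 \<times> {0..1}" for k
  proof -
    have "norm (x k) > 0" using assms by simp
    then show ?thesis by (simp add: a_def divide_le_eq add_pos_nonneg less_asym)
  qed
  moreover have "compact (sphere (0::complex^'m) 1 \<times> {0..1::real})" by (intro compact_Times) auto
  ultimately obtain l r where l: "l \<in> sphere (0::complex^'m) 1 \<times> {0..1::real}" "strict_mono (r :: nat => nat)" "(a \<circ> r) \<longlonglongrightarrow> l"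
    unfolding compact_def by blast
  obtain u s where us: "l = (u, s)" by (cases l)
  have 1: "(\<lambda>k. x (r k) /\<^sub>R norm (x (r k))) \<longlonglongrightarrow> u"
    using tendsto_fst[OF l(3)] by (simp add: a_def o_def us)
  have 2: "(\<lambda>k. norm (x (r k)) / (1 + norm (x (r k)))) \<longlonglongrightarrow> s"
    using tendsto_snd[OF l(3)] by (simp add: a_def o_def us)
  have s: "0 \<le> s" "s \<le> 1" using l(1) us by auto
  have inv: "t / (1 + t) / (1 - t / (1 + t)) = t" "(1 - t / (1 + t)) / (t / (1 + t)) = inverse t" if "t > 0" for t :: real
    using that by (simp_all add: field_simps)
  have "(\<exists>l>0. (\<lambda>k. norm (x (r k))) \<longlonglongrightarrow> l) \<or> (\<lambda>k. norm (x (r k))) \<longlonglongrightarrow> 0 \<or>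
      (\<lambda>k. inverse (norm (x (r k)))) \<longlonglongrightarrow> 0"
  proof (cases "s = 1")
    case True
    have "(\<lambda>k. (1 - norm (x (r k)) / (1 + norm (x (r k)))) / (norm (x (r k)) / (1 + norm (x (r k))))) \<longlonglongrightarrow> (1 - s) / s"
      using 2 True by (intro tendsto_intros) auto
    moreover have "(\<lambda>k. (1 - norm (x (r k)) / (1 + norm (x (r k)))) / (norm (x (r k)) / (1 + norm (x (r k))))) =
        (\<lambda>k. inverse (norm (x (r k))))"
      by (intro ext inv) (simp add: assms)
    ultimately show ?thesis using True by simp
  next
    case False
    have "(\<lambda>k. (norm (x (r k)) / (1 + norm (x (r k)))) / (1 - norm (x (r k)) / (1 + norm (x (r k))))) \<longlonglongrightarrow> s / (1 - s)"
      using 2 False by (intro tendsto_intros) auto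
    moreover have "(\<lambda>k. (norm (x (r k)) / (1 + norm (x (r k)))) / (1 - norm (x (r k)) / (1 + norm (x (r k))))) =
        (\<lambda>k. norm (x (r k)))"
      by (intro ext inv) (simp add: assms)
    ultimately have "(\<lambda>k. norm (x (r k))) \<longlonglongrightarrow> s / (1 - s)" by simp
    moreover have "s / (1 - s) > 0 \<or> s / (1 - s) = 0" using s False by (cases "s = 0") auto
    ultimately show ?thesis by auto
  qed
  then show ?thesis using that[OF l(2) _ 1] l(1) us by auto
qed

text \<open>Homogeneity in the variables \<open>Inr\<close>; those of the form \<open>Inl\<close> are parameters.\<close>

definition homog_param :: "nat => ('p + 'm) cfun => bool" where
  "homog_param d f \<longleftrightarrow> (\<forall>c p x. f (case_sum p (\<lambda>i. c * x i)) = c ^ d * f (case_sum p x))"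

lemma sys_scale:
  fixes p :: "complex^'p" and x :: "complex^'m"
  assumes "\<And>k. homog_param d (F k)"
  shows "sys F p (c *s x) = c ^ d *s sys F p x"
proof -
  have "vec_nth (c *s x) = (\<lambda>i. c * x $ i)" by (simp add: fun_eq_iff)
  then show ?thesis using assms by (simp add: sys_def homog_param_def vec_eq_iff)
qed

lemma scaleR_eq_smult: "r *\<^sub>R x = complex_of_real r *s (x :: complex^'m)"
  unfolding vec_eq_iff by (simp add: scaleR_conv_of_real[where 'a=complex])

text \<open>For \<open>x = n u\<close> with \<open>u\<close> of norm one, homogeneity turns the
  equation into \<open>F u = n G u\<close>. Norms tending to 0 force \<open>F\<close> to vanish in
  the limit direction, and norms tending to infinity force \<open>G\<close> to vanish there. So
  zeros of \<open>F\<close> account for collapse into the origin and zeros of \<open>G\<close> for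
  escape to infinity.\<close>

lemma escape:
  fixes F G :: "'m::finite => ('p::finite + 'm) cfun"
  assumes poly: "\<And>k. poly_fun (F k)" "\<And>k. poly_fun (G k)"
    and hom: "\<And>k. homog_param d (F k)" "\<And>k. homog_param (Suc d) (G k)"
    and p: "p \<longlonglongrightarrow> p0" and x: "\<And>k. x k \<noteq> 0" "\<And>k. sys F (p k) (x k) = sys G (p k) (x k)"
  obtains r u where "strict_mono (r :: nat => nat)" "norm u = 1" "(\<lambda>k. x (r k) /\<^sub>R norm (x (r k))) \<longlonglongrightarrow> u"
    "(\<exists>l. l \<noteq> 0 \<and> (x \<circ> r) \<longlonglongrightarrow> l) \<or> sys F p0 u = 0 \<or>
      (sys G p0 u = 0 \<and> (\<lambda>k. inverse (norm (x (r k)))) \<longlonglongrightarrow> 0)"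
proof -
  obtain r u where ru: "strict_mono (r :: nat => nat)" "norm u = 1" "(\<lambda>k. x (r k) /\<^sub>R norm (x (r k))) \<longlonglongrightarrow> u"
    and lim: "(\<exists>l>0. (\<lambda>k. norm (x (r k))) \<longlonglongrightarrow> l) \<or> (\<lambda>k. norm (x (r k))) \<longlonglongrightarrow> 0 \<or>
      (\<lambda>k. inverse (norm (x (r k)))) \<longlonglongrightarrow> 0"
    by (rule sphere_subsequence[of x, OF x(1)]) (rule that)
  define n where "n k = norm (x (r k))" for k
  define u' where "u' k = x (r k) /\<^sub>R n k" for k
  have n: "n k > 0" for k using x(1) by (simp add: n_def)
  have xu: "x (r k) = complex_of_real (n k) *s u' k" for k
    using n[of k] by (simp add: u'_def scaleR_eq_smult vec_eq_iff)
  have "u' = (\<lambda>k. x (r k) /\<^sub>R norm (x (r k)))" by (simp add: u'_def n_def fun_eq_iff)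
  then have u': "u' \<longlonglongrightarrow> u" using ru(3) by simp
  have eq: "sys F (p (r k)) (u' k) = n k *\<^sub>R sys G (p (r k)) (u' k)" for k
  proof -
    have "sys F (p (r k)) (x (r k)) = complex_of_real (n k) ^ d *s sys F (p (r k)) (u' k)"
      unfolding xu by (rule sys_scale[where F=F, OF hom(1)])
    moreover have "sys G (p (r k)) (x (r k)) = complex_of_real (n k) ^ Suc d *s sys G (p (r k)) (u' k)"
      unfolding xu by (rule sys_scale[where F=G, OF hom(2)])
    ultimately have "complex_of_real (n k) ^ d *s sys F (p (r k)) (u' k) =
        complex_of_real (n k) ^ d *s (complex_of_real (n k) *s sys G (p (r k)) (u' k))"
      using x(2)[of "r k"] by (simp add: mult.commute)
    then show ?thesis using n[of k] by (simp add: scaleR_eq_smult vec_eq_iff)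
  qed
  have pr: "(p \<circ> r) \<longlonglongrightarrow> p0" by (rule LIMSEQ_subseq_LIMSEQ[OF p ru(1)])
  have cont: "(\<lambda>k. sys H (p (r k)) (u' k)) \<longlonglongrightarrow> sys H p0 u"
    if H: "\<And>k. poly_fun (H k)" for H :: "'m => ('p + 'm) cfun"
  proof -
    have "isCont (\<lambda>z. sys H (fst z) (snd z)) (p0, u)"
      using continuous_sys[of H, OF H] by (simp add: continuous_on_eq_continuous_at)
    moreover have "(\<lambda>k. ((p \<circ> r) k, u' k)) \<longlonglongrightarrow> (p0, u)" by (rule tendsto_Pair[OF pr u'])
    ultimately have "(\<lambda>k. sys H (fst ((p \<circ> r) k, u' k)) (snd ((p \<circ> r) k, u' k))) \<longlonglongrightarrow> sys H (fst (p0, u)) (snd (p0, u))"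
      by (rule isCont_tendsto_compose)
    then show ?thesis by simp
  qed
  note F = cont[of F, OF poly(1)] and G = cont[of G, OF poly(2)]
  have "(\<exists>l. l \<noteq> 0 \<and> (x \<circ> r) \<longlonglongrightarrow> l) \<or> sys F p0 u = 0 \<or>
      (sys G p0 u = 0 \<and> (\<lambda>k. inverse (norm (x (r k)))) \<longlonglongrightarrow> 0)"
    using lim[folded n_def]
  proof (elim disjE exE conjE)
    fix l assume l: "0 < l" "n \<longlonglongrightarrow> l"
    have "(\<lambda>k. n k *\<^sub>R u' k) \<longlonglongrightarrow> l *\<^sub>R u" by (rule tendsto_scaleR[OF l(2) u'])
    moreover have "(\<lambda>k. n k *\<^sub>R u' k) = x \<circ> r" using xu by (simp add: scaleR_eq_smult fun_eq_iff)
    moreover have "l *\<^sub>R u \<noteq> 0" using l ru(2) by auto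
    ultimately show ?thesis by metis
  next
    assume "n \<longlonglongrightarrow> 0"
    from tendsto_scaleR[OF this G] have "(\<lambda>k. sys F (p (r k)) (u' k)) \<longlonglongrightarrow> 0" by (simp add: eq)
    then show ?thesis using LIMSEQ_unique[OF F] by blast
  next
    assume inv: "(\<lambda>k. inverse (n k)) \<longlonglongrightarrow> 0"
    have "sys G (p (r k)) (u' k) = inverse (n k) *\<^sub>R sys F (p (r k)) (u' k)" for k
      using n[of k] by (simp add: eq)
    then have "(\<lambda>k. sys G (p (r k)) (u' k)) \<longlonglongrightarrow> 0"
      using tendsto_scaleR[OF inv F] by simp
    then have "sys G p0 u = 0" using LIMSEQ_unique[OF G] by blast
    then show ?thesis using inv by (simp add: n_def)
  qed
  then show ?thesis using that[OF ru] by blast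
qed

section \<open>Straight-line deformations of a pair\<close>

definition poly_pair :: "nat => ('m => 'm cfun) => ('m => 'm cfun) => bool" where
  "poly_pair d F G \<longleftrightarrow> (\<forall>k. poly_fun (F k) \<and> poly_fun (G k) \<and> homog d (F k) \<and> homog (Suc d) (G k))"

definition pair_solutions :: "('m => 'm cfun) => ('m => 'm cfun) => (complex^'m) set" where
  "pair_solutions F G = {x. x \<noteq> 0 \<and> vfun F x = vfun G x}"

definition good_pair :: "nat => ('m::finite => 'm cfun) => ('m => 'm cfun) => bool" where
  "good_pair d F G \<longleftrightarrow> poly_pair d F G \<and> (\<forall>x. x \<noteq> 0 \<longrightarrow> vfun F x \<noteq> 0 \<and> vfun G x \<noteq> 0) \<and>
    (\<forall>x\<in>pair_solutions F G. nondegenerate (\<lambda>x. vfun F x - vfun G x) x)"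

definition segment_fun :: "('m => 'm cfun) => ('m => 'm cfun) =>
    'm => (unit + 'm) cfun" where
  "segment_fun F F' k z = (1 - z (Inl ())) * F k (\<lambda>i. z (Inr i)) + z (Inl ()) * F' k (\<lambda>i. z (Inr i))"

definition vseg :: "('m => 'm cfun) => ('m => 'm cfun) => complex => complex^'m => complex^'m" where
  "vseg F F' t x = (1 - t) *s vfun F x + t *s vfun F' x"

lemma vseg_ends [simp]: "vseg F F' 0 = vfun F" "vseg F F' 1 = vfun F'"
  by (simp_all add: vseg_def fun_eq_iff)

lemma segment_fun_props:
  assumes "\<And>k. poly_fun (F k)" "\<And>k. poly_fun (F' k)"
  shows "poly_fun (segment_fun F F' k)"
    "homog d (F k) ==> homog d (F' k) ==> homog_param d (segment_fun F F' k)"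
    "sys (segment_fun F F') t x = vseg F F' (t $ ()) x"
proof -
  have sub: "poly_fun (\<lambda>z. H k (\<lambda>i. z (Inr i)))" if "\<And>k. poly_fun (H k)" for H :: "'a => 'a cfun"
    by (rule poly_fun_subst[OF that]) (rule poly_fun.var)
  show "poly_fun (segment_fun F F' k)"
    unfolding segment_fun_def by (intro poly_fun_intros sub assms)
  show "homog d (F k) ==> homog d (F' k) ==> homog_param d (segment_fun F F' k)"
    by (simp add: homog_def homog_param_def segment_fun_def algebra_simps)
  show "sys (segment_fun F F') t x = vseg F F' (t $ ()) x"
    by (simp add: sys_def segment_fun_def vseg_def vfun_def vec_eq_iff algebra_simps)
qed

lemma eventually_at_vec1:
  "eventually (\<lambda>p. P (p $ ())) (at (vec a :: complex^unit)) \<longleftrightarrow> eventually P (at a)"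
proof
  have "filterlim (vec :: complex => complex^unit) (at (vec a)) (at a)"
    unfolding filterlim_at by (auto simp: eventually_at_filter vec_eq_iff intro: vec_tendstoI)
  moreover assume "eventually (\<lambda>p. P (p $ ())) (at (vec a :: complex^unit))"
  ultimately show "eventually P (at a)" by (auto simp: filterlim_iff)
next
  have "((\<lambda>p. p $ ()) \<longlongrightarrow> a) (at (vec a :: complex^unit))"
    using tendsto_vec_nth[OF tendsto_ident_at[of "vec a :: complex^unit" UNIV], of "()"] by simp
  then have "filterlim (\<lambda>p. p $ ()) (at a) (at (vec a :: complex^unit))"
    unfolding filterlim_at by (auto simp: eventually_at_filter vec_eq_iff)
  moreover assume "eventually P (at a)"
  ultimately show "eventually (\<lambda>p. P (p $ ())) (at (vec a :: complex^unit))" by (auto simp: filterlim_iff)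
qed

definition diff_fun :: "('m => 'z => complex) => ('m => 'z => complex) => 'm => 'z => complex" where
  "diff_fun F G k z = F k z - G k z"

lemma sys_diff_fun: "sys (diff_fun F G) p x = sys F p x - sys G p x"
  by (simp add: sys_def diff_fun_def vec_eq_iff)

definition path_solutions where
  "path_solutions F G F' G' t = {x. x \<noteq> 0 \<and> vseg F F' t x = vseg G G' t x}"

lemma path_solutions_ends [simp]:
  "path_solutions F G F' G' 0 = pair_solutions F G" "path_solutions F G F' G' 1 = pair_solutions F' G'"
  by (simp_all add: path_solutions_def pair_solutions_def)

lemma path_card_near:
  fixes F G F' G' :: "'m::finite => 'm cfun" and N :: "'j => complex => (complex^'m) set"
  defines "S \<equiv> path_solutions F G F' G'"
  assumes pair: "poly_pair d F G" "poly_pair d F' G'" and F_nz: "\<And>x. x \<noteq> 0 ==> vseg F F' t0 x \<noteq> 0"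
    and nd: "\<And>x. x \<in> S t0 ==> nondegenerate (\<lambda>x. vseg F F' t0 x - vseg G G' t0 x) x"
    and J: "finite J" and Nex: "\<And>j. j \<in> J ==> eventually (\<lambda>t. \<exists>!x. x \<in> N j t \<inter> S t) (at t0)"
    and Ndisj: "\<And>i j. i \<in> J ==> j \<in> J ==> i \<noteq> j ==> eventually (\<lambda>t. N i t \<inter> N j t = {}) (at t0)"
    and Nfar: "\<And>j x. j \<in> J ==> \<exists>r>0. eventually (\<lambda>t. N j t \<inter> ball x r = {}) (at t0)"
    and cover: "\<And>t x u. t \<longlonglongrightarrow> t0 ==> (\<And>k. x k \<in> S (t k)) ==> (\<lambda>k. inverse (norm (x k))) \<longlonglongrightarrow> 0 ==>
      (\<lambda>k. x k /\<^sub>R norm (x k)) \<longlonglongrightarrow> u ==> u \<noteq> 0 ==> vseg G G' t0 u = 0 ==> \<exists>k. t k \<noteq> t0 \<and> (\<exists>j\<in>J. x k \<in> N j (t k))"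
  shows "eventually (\<lambda>t. finite (S t) \<and> card (S t) = card (S t0) + card J) (at t0)"
proof -
  define P where "P = segment_fun F F'"
  define Q where "Q = segment_fun G G'"
  have pf: "\<And>k. poly_fun (F k)" "\<And>k. poly_fun (F' k)" "\<And>k. poly_fun (G k)" "\<And>k. poly_fun (G' k)"
    using pair by (simp_all add: poly_pair_def)
  have poly: "\<And>k. poly_fun (P k)" "\<And>k. poly_fun (Q k)"
    unfolding P_def Q_def using segment_fun_props(1) pf by blast+
  have hom: "\<And>k. homog_param d (P k)" "\<And>k. homog_param (Suc d) (Q k)"
    unfolding P_def Q_def using pair by (auto simp: poly_pair_def intro: segment_fun_props(2))
  define o0 :: "complex^unit" where "o0 = vec t0"
  have o0: "o0 $ () = t0" by (simp add: o0_def)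
  have sys: "sys P p x = vseg F F' (p $ ()) x" "sys Q p x = vseg G G' (p $ ()) x" for p x
    unfolding P_def Q_def by (rule segment_fun_props(3), fact pf, fact pf)+
  define e where "e = diff_fun P Q"
  have e: "poly_fun (e k)" for k unfolding e_def diff_fun_def by (intro poly_fun_intros poly)
  have sys_e: "sys e p x = vseg F F' (p $ ()) x - vseg G G' (p $ ()) x" for p x
    unfolding e_def sys_diff_fun sys ..
  have S: "{x \<in> - {0}. sys e p x = 0} = S (p $ ())" for p
    by (auto simp: sys_e S_def path_solutions_def)
  have ev: "eventually (\<lambda>p. R (p $ ())) (at o0) \<longleftrightarrow> eventually R (at t0)" for R
    unfolding o0_def by (rule eventually_at_vec1)
  have "eventually (\<lambda>p. finite {x \<in> - {0}. sys e p x = 0} \<and> card {x \<in> - {0}. sys e p x = 0} =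
      card {x \<in> - {0}. sys e o0 x = 0} + card J) (at o0)"
  proof (rule card_near(2)[where N="\<lambda>j p. N j (p $ ())" and \<Omega>="\<lambda>_. - {0}"])
    show "nondegenerate (sys e o0) x" if "x \<in> - {0}" "sys e o0 x = 0" for x
    proof -
      have "x \<in> S t0" using that S[of o0] o0 by auto
      moreover have "sys e o0 = (\<lambda>x. vseg F F' t0 x - vseg G G' t0 x)" by (simp add: sys_e o0 fun_eq_iff)
      ultimately show ?thesis using nd by simp
    qed
    show "eventually (\<lambda>p. \<exists>!x. x \<in> N j (p $ ()) \<inter> {x \<in> - {0}. sys e p x = 0}) (at o0)" if "j \<in> J" for j
      unfolding S ev[where R="\<lambda>t. \<exists>!x. x \<in> N j t \<inter> S t"] by (rule Nex[OF that])
    show "eventually (\<lambda>p. N i (p $ ()) \<inter> N j (p $ ()) = {}) (at o0)" if "i \<in> J" "j \<in> J" "i \<noteq> j" for i j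
      unfolding ev[where R="\<lambda>t. N i t \<inter> N j t = {}"] by (rule Ndisj[OF that])
    show "\<exists>r>0. eventually (\<lambda>p. N j (p $ ()) \<inter> ball x r = {}) (at o0)" if "j \<in> J" for j x
      unfolding ev[where R="\<lambda>t. N j t \<inter> ball x r = {}" for r] by (rule Nfar[OF that])
    fix p and x :: "nat => complex^'m"
    assume p: "p \<longlonglongrightarrow> o0" and x: "\<And>k. x k \<in> - {0} \<and> sys e (p k) (x k) = 0"
    have nz: "x k \<noteq> 0" and eq: "sys P (p k) (x k) = sys Q (p k) (x k)" for k
      using x[of k] by (auto simp: sys sys_e)
    obtain r u where ru: "strict_mono (r :: nat => nat)" "norm u = 1" "(\<lambda>k. x (r k) /\<^sub>R norm (x (r k))) \<longlonglongrightarrow> u"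
      "(\<exists>l. l \<noteq> 0 \<and> (x \<circ> r) \<longlonglongrightarrow> l) \<or> sys P o0 u = 0 \<or>
        (sys Q o0 u = 0 \<and> (\<lambda>k. inverse (norm (x (r k)))) \<longlonglongrightarrow> 0)"
      by (rule escape[of P Q, OF poly hom p nz eq]) (rule that)
    have u: "u \<noteq> 0" using ru(2) by auto
    then have "sys P o0 u \<noteq> 0" using F_nz by (simp add: sys o0)
    then consider "\<exists>l. l \<noteq> 0 \<and> (x \<circ> r) \<longlonglongrightarrow> l" | "sys Q o0 u = 0" "(\<lambda>k. inverse (norm (x (r k)))) \<longlonglongrightarrow> 0"
      using ru(4) by blast
    then show "(\<exists>r l. strict_mono (r :: nat => nat) \<and> l \<in> - {0} \<and> (x \<circ> r) \<longlonglongrightarrow> l) \<or>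
        (\<exists>k. p k \<noteq> o0 \<and> (\<exists>j\<in>J. x k \<in> N j (p k $ ())))"
    proof cases
      case 1
      then show ?thesis using ru(1) by auto
    next
      case 2
      have "(\<lambda>k. p (r k) $ ()) \<longlonglongrightarrow> t0"
        using tendsto_vec_nth[OF LIMSEQ_subseq_LIMSEQ[OF p ru(1)], of "()"] by (simp add: o_def o0)
      then have "\<exists>k. p (r k) $ () \<noteq> t0 \<and> (\<exists>j\<in>J. x (r k) \<in> N j (p (r k) $ ()))"
      proof (rule cover[OF _ _ 2(2) ru(3) u])
        show "x (r k) \<in> S (p (r k) $ ())" for k using x[of "r k"] S[of "p (r k)"] by blast
      qed (use 2(1) in \<open>simp add: sys o0\<close>)
      then show ?thesis using o0 by metis
    qed
  qed (use e J in \<open>auto intro: open_Times\<close>)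
  then show ?thesis unfolding S o0 ev[where R="\<lambda>t. finite (S t) \<and> card (S t) = card (S t0) + card J"] .
qed

corollary good_pair_near:
  fixes F G F' G' :: "'m::finite => 'm cfun"
  assumes pair: "poly_pair d F G" "poly_pair d F' G'"
    and nz: "\<And>x. x \<noteq> 0 ==> vseg F F' t0 x \<noteq> 0" "\<And>x. x \<noteq> 0 ==> vseg G G' t0 x \<noteq> 0"
    and nd: "\<And>x. x \<in> path_solutions F G F' G' t0 ==> nondegenerate (\<lambda>x. vseg F F' t0 x - vseg G G' t0 x) x"
  shows "eventually (\<lambda>t. finite (path_solutions F G F' G' t) \<and>
    card (path_solutions F G F' G' t) = card (path_solutions F G F' G' t0)) (at t0)"
  using path_card_near[OF pair nz(1) nd, of "{} :: unit set" "\<lambda>_ _. {}"] nz(2) by auto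

text \<open>Near \<open>t = 1\<close> the count is constant because the pair there is good;
  constructibility in \<open>t\<close> carries the number over to the neighbourhood of 0. Nothing is
  assumed about intermediate values of \<open>t\<close>.\<close>

theorem good_pair_card:
  fixes F G F' G' :: "'m::finite => 'm cfun"
  assumes near: "eventually (\<lambda>t. finite (path_solutions F G F' G' t) \<and> card (path_solutions F G F' G' t) = N) (at 0)"
    and pair: "poly_pair d F G" and good: "good_pair d F' G'"
  shows "N = card (pair_solutions F' G')"
proof -
  have pair': "poly_pair d F' G'" using good by (simp add: good_pair_def)
  have pf: "\<And>k. poly_fun (F k)" "\<And>k. poly_fun (F' k)" "\<And>k. poly_fun (G k)" "\<And>k. poly_fun (G' k)"
    using pair pair' by (simp_all add: poly_pair_def)
  define R where "R = (\<lambda>z. \<not> (\<forall>k\<in>UNIV. z (Inr k :: unit + 'm) = 0) \<and>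
      (\<forall>k\<in>UNIV. segment_fun F F' k z - segment_fun G G' k z = 0))"
  have R: "constructible R"
    unfolding R_def
    by (intro constructible.conj constructible.neg constructible_Ball constructible.zero poly_fun_intros
        segment_fun_props(1) pf) auto
  have eq: "(x \<noteq> 0 \<and> vseg F F' t x = vseg G G' t x) \<longleftrightarrow> R (case_sum (\<lambda>_. t) (vec_nth x))" for t x
    by (auto simp: R_def segment_fun_def vseg_def vfun_def vec_eq_iff algebra_simps)
  have "eventually (\<lambda>t. finite (path_solutions F G F' G' t) \<and>
      card (path_solutions F G F' G' t) = card (pair_solutions F' G')) (at 1)"
    using good_pair_near[OF pair pair', of 1] good by (simp add: good_pair_def)
  then show ?thesis using card_line_const[OF R eq] near unfolding path_solutions_def by blast
qed

section \<open>A system with explicit solutions\<close>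

text \<open>The solutions of \<open>(x i - 1) * (\<Prod>j<d. x i - c j * s) = 0\<close>, where \<open>s\<close> is the sum of the \<open>x i\<close>, are
  found by choosing a factor for each \<open>i\<close>; all choices except those avoiding the factors \<open>x i - 1\<close> give a
  nonzero solution. The constants \<open>c j\<close> are small enough for no other factor to vanish.\<close>

context
  fixes d :: nat and c :: "nat => real" and F G :: "'m::finite => 'm cfun"
  assumes c_inj: "inj c" and c_pos: "\<And>j. c j > 0" and c_small: "\<And>j. c j < 1 / (2 * CARD('m))"
    and F_def: "\<And>k x. F k x = (\<Prod>j<d. x k - of_real (c j) * (\<Sum>i\<in>UNIV. x i))"
    and G_def: "\<And>k x. G k x = x k * F k x"
begin

lemma product_pair_poly: "poly_pair d F G"
proof -
  have F: "poly_fun (F k)" for k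
    unfolding F_def by (intro poly_fun_intros)
  have G: "poly_fun (G k)" for k
    unfolding G_def by (intro poly_fun_intros F)
  have hF: "F k (\<lambda>i. a * x i) = a ^ d * F k x" for a k x
  proof -
    have "a * x k - of_real (c j) * (\<Sum>i\<in>UNIV. a * x i) = a * (x k - of_real (c j) * (\<Sum>i\<in>UNIV. x i))" for j
      by (simp add: sum_distrib_left[symmetric] right_diff_distrib mult.left_commute)
    then show ?thesis by (simp add: F_def prod.distrib)
  qed
  then show ?thesis using F G by (simp add: poly_pair_def homog_def G_def algebra_simps)
qed

lemma sum_c_less:
  assumes "T \<noteq> (UNIV :: 'm set)" shows "(\<Sum>i\<in>T. c (\<phi> i)) < 1 / 2"
proof -
  have "(\<Sum>i\<in>T. c (\<phi> i)) \<le> (\<Sum>i\<in>T. 1 / (2 * CARD('m)))"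
    by (intro sum_mono less_imp_le c_small)
  also have "\<dots> = card T * (1 / (2 * CARD('m)))" by simp
  also have "\<dots> < CARD('m) * (1 / (2 * CARD('m)))"
    using assms by (intro mult_strict_right_mono) (use assms psubset_card_mono[of UNIV T] in auto)
  finally show ?thesis by simp
qed

lemma sum_c_le: "(\<Sum>i\<in>T. c (\<phi> i)) \<le> 1 / 2" for T :: "'m set"
proof (cases "T = UNIV")
  case True
  have "(\<Sum>i\<in>T. c (\<phi> i)) \<le> (\<Sum>i\<in>T. 1 / (2 * CARD('m)))"
    by (intro sum_mono less_imp_le c_small)
  then show ?thesis using True by simp
qed (use sum_c_less[of T \<phi>] in simp)

text \<open>A zero of \<open>G\<close> has coordinates \<open>a k * s\<close> with small real
  \<open>a k\<close>. Adding them up gives \<open>s\<close> as a multiple of itself by a number at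
  most 1/2, so \<open>s = 0\<close>.\<close>

lemma product_pair_nonvanishing:
  assumes "x \<noteq> 0" shows "\<exists>k. F k (vec_nth x) \<noteq> 0" "\<exists>k. G k (vec_nth x) \<noteq> 0"
proof -
  have "\<exists>k. G k (vec_nth x) \<noteq> 0"
  proof (rule ccontr)
    define s where "s = (\<Sum>i\<in>UNIV. x $ i)"
    assume "\<not> ?thesis"
    then have "\<forall>k. \<exists>a. x $ k = of_real a * s \<and> (a = 0 \<or> (\<exists>j. a = c j))"
      by (auto simp: G_def F_def s_def) (metis mult_eq_0_iff of_real_0)
    then obtain a where a: "\<And>k. x $ k = of_real (a k) * s" "\<And>k. a k = 0 \<or> (\<exists>j. a k = c j)" by metis
    have "s = of_real (\<Sum>k\<in>UNIV. a k) * s"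
      unfolding s_def[symmetric] by (subst s_def) (simp add: a(1) sum_distrib_right)
    moreover have "a k \<le> 1 / (2 * CARD('m))" for k
      using a(2)[of k] c_small less_imp_le by (metis divide_nonneg_nonneg of_nat_0_le_iff zero_le_one)
    then have "(\<Sum>k\<in>UNIV. a k) \<le> (\<Sum>k\<in>(UNIV :: 'm set). 1 / (2 * CARD('m)))" by (intro sum_mono)
    then have "(\<Sum>k\<in>UNIV. a k) \<le> 1 / 2" by simp
    then have "complex_of_real (\<Sum>k\<in>UNIV. a k) \<noteq> 1" by (metis of_real_eq_1_iff one_le_numeral half_gt_zero_iff
      less_numeral_extra(1) linorder_not_le field_sum_of_halves less_add_same_cancel1)
    ultimately have "s = 0" by simp
    then show False using a(1) assms by (simp add: vec_eq_iff)
  qed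
  then show "\<exists>k. F k (vec_nth x) \<noteq> 0" "\<exists>k. G k (vec_nth x) \<noteq> 0" by (auto simp: G_def)
qed

text \<open>The value \<open>\<phi> i = d\<close> stands for the factor \<open>x i - 1\<close>, a
  smaller value for the factor with that index. The sum of the coordinates then satisfies a linear
  equation \<open>s = card {i. \<phi> i = d} + q * s\<close>, where \<open>q\<close> is the sum of
  the remaining \<open>c (\<phi> i)\<close>; this is its solution.\<close>

definition choice_sum :: "('m => nat) => real" where
  "choice_sum \<phi> = real (card {i. \<phi> i = d}) / (1 - (\<Sum>i\<in>{i. \<phi> i \<noteq> d}. c (\<phi> i)))"

definition choice_point :: "('m => nat) => complex^'m" where
  "choice_point \<phi> = (\<chi> i. if \<phi> i = d then 1 else of_real (c (\<phi> i) * choice_sum \<phi>))"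

lemma choice_sum_bounds:
  assumes "\<phi> i0 = d" shows "choice_sum \<phi> > 0" "c j * choice_sum \<phi> < 1"
proof -
  define q where "q = (\<Sum>i\<in>{i. \<phi> i \<noteq> d}. c (\<phi> i))"
  have q: "q \<le> 1 / 2" unfolding q_def by (rule sum_c_le)
  have pos: "card {i. \<phi> i = d} > 0" using assms by (auto simp: card_gt_0_iff)
  then show "choice_sum \<phi> > 0" unfolding choice_sum_def q_def[symmetric] using q by simp
  have "choice_sum \<phi> \<le> real (card {i. \<phi> i = d}) / (1 / 2)"
    unfolding choice_sum_def q_def[symmetric] using q by (intro divide_left_mono) auto
  also have "\<dots> \<le> 2 * CARD('m)" by (simp add: card_mono)
  finally have le: "choice_sum \<phi> \<le> 2 * CARD('m)" .
  have "c j * choice_sum \<phi> < 1 / (2 * CARD('m)) * choice_sum \<phi>"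
    using c_small[of j] \<open>choice_sum \<phi> > 0\<close> by (rule mult_strict_right_mono)
  also have "\<dots> \<le> 1 / (2 * CARD('m)) * (2 * CARD('m))" using le by (intro mult_left_mono) auto
  finally show "c j * choice_sum \<phi> < 1" by simp
qed

lemma choice_point_sum:
  assumes "\<phi> i0 = d" shows "(\<Sum>i\<in>UNIV. choice_point \<phi> $ i) = of_real (choice_sum \<phi>)"
proof -
  define q where "q = (\<Sum>i\<in>{i. \<phi> i \<noteq> d}. c (\<phi> i))"
  have q: "q \<le> 1 / 2" unfolding q_def by (rule sum_c_le)
  have "(\<Sum>i\<in>UNIV. choice_point \<phi> $ i) = of_nat (card {i. \<phi> i = d}) + of_real (q * choice_sum \<phi>)"
    unfolding choice_point_def q_def by (simp add: sum.If_cases Collect_neg_eq sum_distrib_right)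
  also have "\<dots> = of_real (real (card {i. \<phi> i = d}) + q * choice_sum \<phi>)" by simp
  also have "real (card {i. \<phi> i = d}) = (1 - q) * choice_sum \<phi>"
    unfolding choice_sum_def q_def[symmetric] using q by simp
  finally show ?thesis by (simp add: algebra_simps)
qed

lemma choice_point_eq_1: "\<phi> i0 = d ==> choice_point \<phi> $ i = 1 \<longleftrightarrow> \<phi> i = d"
  using choice_sum_bounds(2)[of \<phi> i0 "\<phi> i"] unfolding choice_point_def vec_lambda_beta
  by (metis less_irrefl of_real_eq_1_iff)


lemma product_pair_solutions:
  "pair_solutions F G = choice_point ` {\<phi>. (\<forall>i. \<phi> i \<le> d) \<and> (\<exists>i. \<phi> i = d)}"
proof (intro subset_antisym subsetI)
  fix x assume x: "x \<in> pair_solutions F G"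
  define s where "s = (\<Sum>i\<in>UNIV. x $ i)"
  have "x $ k = 1 \<or> (\<exists>j<d. x $ k = of_real (c j) * s)" for k
  proof -
    have "F k (vec_nth x) = x $ k * F k (vec_nth x)"
      using x by (simp add: pair_solutions_def vfun_def vec_eq_iff G_def)
    then show ?thesis by (auto simp: F_def s_def)
  qed
  then obtain \<psi> where \<psi>: "\<And>k. x $ k \<noteq> 1 ==> \<psi> k < d \<and> x $ k = of_real (c (\<psi> k)) * s" by metis
  define \<phi> where "\<phi> k = (if x $ k = 1 then d else \<psi> k)" for k
  have \<phi>_d: "\<phi> k = d \<longleftrightarrow> x $ k = 1" for k using \<psi>[of k] by (auto simp: \<phi>_def)
  define q where "q = (\<Sum>i\<in>{i. \<phi> i \<noteq> d}. c (\<phi> i))"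
  have q: "q \<le> 1 / 2" unfolding q_def by (rule sum_c_le)
  have xk: "x $ k = (if \<phi> k = d then 1 else of_real (c (\<phi> k)) * s)" for k
    using \<psi>[of k] \<phi>_d[of k] by (auto simp: \<phi>_def)
  have "s = of_nat (card {i. \<phi> i = d}) + of_real q * s"
    unfolding q_def by (subst s_def) (simp add: xk sum.If_cases Collect_neg_eq sum_distrib_right)
  then have s1: "s * of_real (1 - q) = of_nat (card {i. \<phi> i = d})"
    by (simp add: algebra_simps)
  have "\<exists>i. \<phi> i = d"
  proof (rule ccontr)
    assume no: "\<nexists>i. \<phi> i = d"
    then have "s * of_real (1 - q) = 0" using s1 by simp
    then have "s = 0" using q by auto
    then have "x = 0" using no by (simp add: vec_eq_iff xk)
    then show False using x by (simp add: pair_solutions_def)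
  qed
  moreover have "s = of_real (choice_sum \<phi>)"
    unfolding choice_sum_def q_def[symmetric] using s1 q by (simp add: field_simps)
  then have "x = choice_point \<phi>" by (simp add: choice_point_def vec_eq_iff xk)
  moreover have "\<phi> i \<le> d" for i using \<psi>[of i] by (auto simp: \<phi>_def)
  ultimately show "x \<in> choice_point ` {\<phi>. (\<forall>i. \<phi> i \<le> d) \<and> (\<exists>i. \<phi> i = d)}" by blast
next
  fix x assume "x \<in> choice_point ` {\<phi>. (\<forall>i. \<phi> i \<le> d) \<and> (\<exists>i. \<phi> i = d)}"
  then obtain \<phi> i0 where \<phi>: "x = choice_point \<phi>" "\<And>i. \<phi> i \<le> d" "\<phi> i0 = d" by blast
  have "F k (vec_nth x) = G k (vec_nth x)" for k
  proof (cases "\<phi> k = d")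
    case True
    then have "x $ k = 1" by (simp add: \<phi>(1) choice_point_def)
    then show ?thesis by (simp add: G_def)
  next
    case False
    then have "\<phi> k < d" using \<phi>(2)[of k] by simp
    moreover have "x $ k - of_real (c (\<phi> k)) * (\<Sum>i\<in>UNIV. x $ i) = 0"
      using False choice_point_sum[of \<phi> i0, OF \<phi>(3)] by (simp add: \<phi>(1) choice_point_def)
    ultimately have "F k (vec_nth x) = 0" unfolding F_def by (intro prod_zero bexI[of _ "\<phi> k"]) auto
    then show ?thesis by (simp add: G_def)
  qed
  moreover have "x $ i0 = 1" by (simp add: \<phi> choice_point_def)
  then have "x \<noteq> 0" by auto
  ultimately show "x \<in> pair_solutions F G" by (simp add: pair_solutions_def vfun_def)
qed

lemma inj_on_choice_point: "inj_on choice_point {\<phi>. (\<forall>i. \<phi> i \<le> d) \<and> (\<exists>i. \<phi> i = d)}"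
proof (rule inj_onI)
  fix \<phi> \<psi> assume "\<phi> \<in> {\<phi>. (\<forall>i. \<phi> i \<le> d) \<and> (\<exists>i. \<phi> i = d)}" "\<psi> \<in> {\<phi>. (\<forall>i. \<phi> i \<le> d) \<and> (\<exists>i. \<phi> i = d)}"
    and eq: "choice_point \<phi> = choice_point \<psi>"
  then obtain i0 i1 where i: "\<phi> i0 = d" "\<psi> i1 = d" by blast
  have "complex_of_real (choice_sum \<phi>) = of_real (choice_sum \<psi>)"
    using choice_point_sum[of \<phi>, OF i(1)] choice_point_sum[of \<psi>, OF i(2)] eq by simp
  then have s: "choice_sum \<phi> = choice_sum \<psi>" by simp
  show "\<phi> = \<psi>"
  proof
    fix k
    have "\<phi> k = d \<longleftrightarrow> \<psi> k = d"
      using choice_point_eq_1[of \<phi> i0 k, OF i(1)] choice_point_eq_1[of \<psi> i1 k, OF i(2)] eq by simp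
    moreover have "\<phi> k = \<psi> k" if "\<phi> k \<noteq> d" "\<psi> k \<noteq> d"
    proof -
      have "complex_of_real (c (\<phi> k) * choice_sum \<phi>) = of_real (c (\<psi> k) * choice_sum \<psi>)"
        using arg_cong[OF eq, of "\<lambda>v. v $ k"] that by (simp add: choice_point_def)
      then have "c (\<phi> k) = c (\<psi> k)"
        unfolding of_real_eq_iff using s choice_sum_bounds(1)[of \<phi>, OF i(1)] by simp
      then show ?thesis using c_inj by (simp add: inj_eq)
    qed
    ultimately show "\<phi> k = \<psi> k" by metis
  qed
qed

lemma product_pair_card: "card (pair_solutions F G) = Suc d ^ CARD('m) - d ^ CARD('m)"
proof -
  have "{\<phi>. (\<forall>i. \<phi> i \<le> d) \<and> (\<exists>i. \<phi> i = d)} = PiE (UNIV :: 'm set) (\<lambda>_. {..d}) - PiE UNIV (\<lambda>_. {..<d})"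
    by (auto simp: PiE_def Pi_def extensional_def) (metis le_neq_implies_less)
  moreover have "card (PiE (UNIV :: 'm set) (\<lambda>_. {..d}) - PiE UNIV (\<lambda>_. {..<d})) = Suc d ^ CARD('m) - d ^ CARD('m)"
  proof -
    have "PiE (UNIV :: 'm set) (\<lambda>_. {..<d}) \<subseteq> PiE UNIV (\<lambda>_. {..d})" by (intro PiE_mono) auto
    moreover have "finite (PiE (UNIV :: 'm set) (\<lambda>_. {..<d}))" by (intro finite_PiE) auto
    ultimately show ?thesis by (simp add: card_Diff_subset card_PiE)
  qed
  moreover have "card (pair_solutions F G) = card {\<phi> :: 'm => nat. (\<forall>i. \<phi> i \<le> d) \<and> (\<exists>i. \<phi> i = d)}"
    unfolding product_pair_solutions by (rule card_image[OF inj_on_choice_point])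
  ultimately show ?thesis by simp
qed

lemma product_pair_nondegenerate:
  assumes "x \<in> pair_solutions F G"
  shows "nondegenerate (\<lambda>x. vfun F x - vfun G x) x"
proof -
  obtain \<phi> i0 where \<phi>: "x = choice_point \<phi>" "\<And>i. \<phi> i \<le> d" "\<phi> i0 = d"
    using assms unfolding product_pair_solutions by blast
  define s where "s = choice_sum \<phi>"
  have s: "s > 0" "\<And>j. c j * s < 1" unfolding s_def using choice_sum_bounds[of \<phi> i0, OF \<phi>(3)] by auto
  have sumx: "(\<Sum>i\<in>UNIV. x $ i) = of_real s"
    unfolding \<phi>(1) s_def by (rule choice_point_sum[of \<phi> i0, OF \<phi>(3)])
  have xk: "x $ k = (if \<phi> k = d then 1 else of_real (c (\<phi> k) * s))" for k
    by (simp add: \<phi>(1) choice_point_def s_def)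
  \<comment> \<open>\<open>a k\<close> is the linear factor that vanishes at the solution and
    \<open>b k\<close> its cofactor, which does not; hence the derivative at \<open>x\<close>
    involves \<open>b k\<close> only through its value.\<close>
  define a where "a k z = (if \<phi> k = d then 1 - z k else z k - of_real (c (\<phi> k)) * (\<Sum>i\<in>UNIV. z i))" for k and z :: "'m => complex"
  define a' where "a' k h = (if \<phi> k = d then - (h $ k) else h $ k - of_real (c (\<phi> k)) * (\<Sum>i\<in>UNIV. h $ i))"
    for k and h :: "complex^'m"
  define b where "b k z = (if \<phi> k = d then F k z
      else (1 - z k) * (\<Prod>j\<in>{..<d} - {\<phi> k}. z k - of_real (c j) * (\<Sum>i\<in>UNIV. z i)))" for k z
  have ab: "F k z - G k z = a k z * b k z" for k z
  proof (cases "\<phi> k = d")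
    case False
    then have "\<phi> k \<in> {..<d}" using \<phi>(2)[of k] by simp
    then have "F k z = (z k - of_real (c (\<phi> k)) * (\<Sum>i\<in>UNIV. z i)) *
        (\<Prod>j\<in>{..<d} - {\<phi> k}. z k - of_real (c j) * (\<Sum>i\<in>UNIV. z i))"
      unfolding F_def by (intro prod.remove) auto
    moreover have "F k z - G k z = (1 - z k) * F k z" by (simp add: G_def algebra_simps)
    ultimately show ?thesis using False by (simp add: a_def b_def mult.left_commute)
  qed (simp add: G_def a_def b_def algebra_simps)
  have pb: "poly_fun (b k)" for k
  proof (cases "\<phi> k = d")
    case True
    then have "b k = F k" by (simp add: b_def fun_eq_iff)
    then show ?thesis using product_pair_poly by (simp add: poly_pair_def)
  next
    case False
    then have "b k = (\<lambda>z. (1 - z k) * (\<Prod>j\<in>{..<d} - {\<phi> k}. z k - of_real (c j) * (\<Sum>i\<in>UNIV. z i)))"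
      by (simp add: b_def fun_eq_iff)
    then show ?thesis by (simp add: poly_fun_intros)
  qed
  have bx: "b k (vec_nth x) \<noteq> 0" for k
  proof (cases "\<phi> k = d")
    case True
    have "1 - complex_of_real (c j) * of_real s \<noteq> 0" for j
      using s(2)[of j] by (metis less_irrefl of_real_1 of_real_eq_iff of_real_mult right_minus_eq)
    moreover have "x $ k = 1" using True by (simp add: xk)
    ultimately show ?thesis using True by (simp add: b_def F_def sumx)
  next
    case False
    have "1 - complex_of_real (c (\<phi> k) * s) \<noteq> 0"
      using s(2)[of "\<phi> k"] by (metis less_irrefl of_real_1 of_real_eq_iff right_minus_eq)
    moreover have "complex_of_real (c (\<phi> k) * s) - of_real (c j) * of_real s \<noteq> 0" if "j \<noteq> \<phi> k" for j
      using that s(1) c_inj by (simp add: inj_eq)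
    moreover have "x $ k = of_real (c (\<phi> k) * s)" using False by (simp add: xk)
    moreover have "s \<noteq> 0" using s(1) by simp
    ultimately show ?thesis using False by (simp add: b_def sumx)
  qed
  have ax: "a k (vec_nth x) = 0" for k unfolding a_def sumx by (simp add: xk)
  have da: "((\<lambda>y::complex^'m. a k (vec_nth y)) has_derivative a' k) (at x)" for k
    unfolding a_def a'_def
    by (cases "\<phi> k = d") (auto intro!: derivative_eq_intros bounded_linear_imp_has_derivative[OF bounded_linear_vec_nth])
  define b' where "b' k = (SOME B. ((\<lambda>y::complex^'m. b k (vec_nth y)) has_derivative B) (at x))" for k
  have db: "((\<lambda>y::complex^'m. b k (vec_nth y)) has_derivative b' k) (at x)" for k
    unfolding b'_def by (rule someI_ex[OF poly_fun_differentiable[OF pb]])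
  have "((\<lambda>y. \<chi> k. a k (vec_nth y) * b k (vec_nth y)) has_derivative
      (\<lambda>h. \<chi> k. a k (vec_nth x) * b' k h + a' k h * b k (vec_nth x))) (at x)"
    by (intro has_derivative_vec_lambda has_derivative_mult da db)
  moreover have "(\<lambda>y. \<chi> k. a k (vec_nth y) * b k (vec_nth y)) = (\<lambda>x. vfun F x - vfun G x)"
    by (simp add: fun_eq_iff vec_eq_iff vfun_def ab)
  ultimately have D: "((\<lambda>x. vfun F x - vfun G x) has_derivative (\<lambda>h. \<chi> k. a' k h * b k (vec_nth x))) (at x)"
    by (simp add: ax)
  show ?thesis
    unfolding nondegenerate_def
  proof (intro exI conjI allI impI, rule D)
    fix h :: "complex^'m" assume "(\<chi> k. a' k h * b k (vec_nth x)) = 0"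
    then have a': "a' k h = 0" for k using bx by (simp add: vec_eq_iff)
    define t where "t = (\<Sum>i\<in>UNIV. h $ i)"
    have hk: "h $ k = of_real (if \<phi> k = d then 0 else c (\<phi> k)) * t" for k
      using a'[of k] by (auto simp: a'_def t_def split: if_splits)
    define q where "q = (\<Sum>i\<in>{i. \<phi> i \<noteq> d}. c (\<phi> i))"
    have q: "q \<le> 1 / 2" unfolding q_def by (rule sum_c_le)
    have "t = of_real (\<Sum>k\<in>UNIV. if \<phi> k = d then 0 else c (\<phi> k)) * t"
      by (subst t_def) (simp add: hk sum_distrib_right)
    also have "(\<Sum>k\<in>UNIV. if \<phi> k = d then 0 else c (\<phi> k)) = q"
      by (simp add: q_def sum.If_cases Collect_neg_eq)
    finally have "t * of_real (1 - q) = 0" by (simp add: algebra_simps)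
    then have "t = 0" using q by auto
    then show "h = 0" by (simp add: vec_eq_iff hk)
  qed
qed

end

lemma poly_fun_prod_nonzero:
  assumes "finite I" "\<And>i. i \<in> I ==> poly_fun (f i) \<and> (\<exists>z. f i z \<noteq> 0)"
  shows "\<exists>z. \<forall>i\<in>I. f i z \<noteq> 0"
proof -
  have "\<exists>z. (\<Prod>i\<in>I. f i z) \<noteq> 0"
    using assms
  proof (induction I rule: finite_induct)
    case (insert i I)
    obtain y where "f i y \<noteq> 0" using insert.prems by blast
    moreover obtain z where "(\<Prod>i\<in>I. f i z) \<noteq> 0" using insert.IH insert.prems by blast
    moreover have "poly_fun (f i)" "poly_fun (\<lambda>z. \<Prod>i\<in>I. f i z)"
      using insert.prems by (auto intro: poly_fun_prod)
    ultimately show ?case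
      using poly_fun_mult_nonzero[of "f i" "\<lambda>z. \<Prod>i\<in>I. f i z" y z] insert.hyps by simp
  qed simp
  then obtain z where z: "(\<Prod>i\<in>I. f i z) \<noteq> 0" ..
  then have "\<forall>i\<in>I. f i z \<noteq> 0" using assms(1) by simp
  then show ?thesis by blast
qed

text \<open>The equations of the product pair are mixed by an invertible matrix, which affects
  neither the solutions nor their nondegeneracy. A generic matrix makes \<open>G\<close> pair
  nontrivially with each vector of \<open>V\<close>. These vectors will be the nodes, and the
  pairing decides how the escaping solutions emerge there.\<close>

theorem exists_good_pair:
  fixes V :: "(complex^'m::finite) set"
  assumes V: "finite V" "0 \<notin> V"
  obtains F G :: "'m => 'm cfun" where "good_pair d F G"
    "card (pair_solutions F G) = Suc d ^ CARD('m) - d ^ CARD('m)"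
    "\<And>v. v \<in> V ==> (\<Sum>k\<in>UNIV. v $ k * G k (vec_nth v)) \<noteq> 0"
proof -
  define c where "c j = 1 / (2 * CARD('m) * (real j + 2))" for j
  define F0 where "F0 k x = (\<Prod>j<d. x k - complex_of_real (c j) * (\<Sum>i\<in>UNIV. x i))" for k :: 'm and x
  define G0 where "G0 k x = x k * F0 k x" for k :: 'm and x
  have c: "inj c" "\<And>j. c j > 0" "\<And>j. c j < 1 / (2 * CARD('m))"
  proof -
    show "inj c" by (auto simp: inj_def c_def)
    show "c j > 0" for j by (simp add: c_def)
    have "real CARD('m) * (real j + 2) > real CARD('m) * 1" for j by (rule mult_strict_left_mono) auto
    then show "c j < 1 / (2 * CARD('m))" for j unfolding c_def by (intro divide_strict_left_mono) (auto simp: mult.assoc)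
  qed
  note ctx = c F0_def G0_def
  have nv: "\<exists>k. G0 k (vec_nth v) \<noteq> 0" if "v \<noteq> 0" for v
    by (rule product_pair_nonvanishing(2)[OF ctx that])
  define f where "f v z = (\<Sum>k\<in>UNIV. \<Sum>l\<in>UNIV. v $ k * (z (k, l) * G0 l (vec_nth v)))" for v :: "complex^'m" and z
  \<comment> \<open>\<open>None\<close> encodes the invertibility of the mixing matrix
    \<open>z\<close>, \<open>Some v\<close> the pairing with \<open>v\<close>.\<close>
  define q where "q i = (case i of None => (\<lambda>z. det (\<chi> k l. z (k, l) :: complex^'m^'m)) | Some v => f v)" for i
  have "\<exists>z. \<forall>i\<in>insert None (Some ` V). q i z \<noteq> 0"
  proof (rule poly_fun_prod_nonzero)
    fix i assume i: "i \<in> insert None (Some ` V)"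
    show "poly_fun (q i) \<and> (\<exists>z. q i z \<noteq> 0)"
    proof (cases i)
      case None
      have "poly_fun (\<lambda>z. det (\<chi> k l. z (k, l) :: complex^'m^'m))"
        by (intro poly_fun_det) (simp add: poly_fun.var)
      moreover have "det (\<chi> k l. (\<lambda>(k, l). if k = l then 1 else 0) (k, l) :: complex^'m^'m) \<noteq> 0"
        using det_I[where 'a=complex and 'n='m] by (simp add: mat_def)
      ultimately show ?thesis using None by (auto simp: q_def intro!: exI[of _ "\<lambda>(k, l). if k = l then 1 else 0"])
    next
      case (Some v)
      then have "v \<noteq> 0" using i V by auto
      then obtain k where "v $ k \<noteq> 0" by (auto simp: vec_eq_iff)
      moreover obtain l where "G0 l (vec_nth v) \<noteq> 0" using nv[OF \<open>v \<noteq> 0\<close>] by blast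
      ultimately have kl: "v $ k \<noteq> 0" "G0 l (vec_nth v) \<noteq> 0" by simp_all
      have "f v (\<lambda>p. if p = (k, l) then 1 else 0) = v $ k * G0 l (vec_nth v)"
      proof -
        have "f v (\<lambda>p. if p = (k, l) then 1 else 0) =
            (\<Sum>k'\<in>UNIV. \<Sum>l'\<in>UNIV. if k' = k then if l' = l then v $ k * G0 l (vec_nth v) else 0 else 0)"
          unfolding f_def by (intro sum.cong refl) auto
        also have "\<dots> = (\<Sum>k'\<in>UNIV. if k' = k then \<Sum>l'\<in>UNIV. if l' = l then v $ k * G0 l (vec_nth v) else 0 else 0)"
          by (intro sum.cong refl) simp
        finally show ?thesis by simp
      qed
      then have "f v (\<lambda>p. if p = (k, l) then 1 else 0) \<noteq> 0" using kl by simp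
      moreover have "poly_fun (f v)" unfolding f_def by (intro poly_fun_intros)
      ultimately show ?thesis using Some by (auto simp: q_def)
    qed
  qed (use V in auto)
  then obtain z where z: "\<And>i. i \<in> insert None (Some ` V) ==> q i z \<noteq> 0" by blast
  define M :: "complex^'m^'m" where "M = (\<chi> k l. z (k, l))"
  have "det M \<noteq> 0" using z[of None] by (simp add: q_def M_def)
  then have ker: "M *v x = 0 \<longleftrightarrow> x = 0" for x
    using matrix_left_invertible_ker[of M] by (auto simp: invertible_det_nz[symmetric] invertible_left_inverse)
  have fv: "f v z \<noteq> 0" if "v \<in> V" for v using z[of "Some v"] that by (simp add: q_def)
  define F where "F k x = (\<Sum>l\<in>UNIV. M $ k $ l * F0 l x)" for k x
  define G where "G k x = (\<Sum>l\<in>UNIV. M $ k $ l * G0 l x)" for k x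
  have vfun: "vfun F x = M *v vfun F0 x" "vfun G x = M *v vfun G0 x" for x
    by (simp_all add: vfun_def F_def G_def matrix_vector_mult_def vec_eq_iff)
  have diff: "vfun F x - vfun G x = M *v (vfun F0 x - vfun G0 x)" for x
    by (simp add: vfun matrix_vector_mult_diff_distrib)
  have sols: "pair_solutions F G = pair_solutions F0 G0"
  proof -
    have "vfun F x = vfun G x \<longleftrightarrow> vfun F0 x = vfun G0 x" for x
      using diff[of x] ker[of "vfun F0 x - vfun G0 x"] by (metis right_minus_eq)
    then show ?thesis by (simp add: pair_solutions_def)
  qed
  have "good_pair d F G"
    unfolding good_pair_def
  proof (intro conjI allI impI ballI)
    have "poly_pair d F0 G0" by (rule product_pair_poly[OF ctx])
    then have p: "\<And>k. poly_fun (F0 k)" "\<And>k. poly_fun (G0 k)" "\<And>k. homog d (F0 k)" "\<And>k. homog (Suc d) (G0 k)"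
      by (simp_all add: poly_pair_def)
    have "poly_fun (F k)" "poly_fun (G k)" for k
      unfolding F_def G_def by (intro poly_fun_intros p)+
    then show "poly_pair d F G"
      using p(3,4) by (simp add: poly_pair_def homog_def F_def G_def sum_distrib_left mult.left_commute)
    fix x :: "complex^'m" assume "x \<noteq> 0"
    then have "vfun F0 x \<noteq> 0" "vfun G0 x \<noteq> 0"
      using product_pair_nonvanishing[OF ctx, of x] by (auto simp: vfun_def vec_eq_iff)
    then show "vfun F x \<noteq> 0" "vfun G x \<noteq> 0" by (simp_all add: vfun ker)
  next
    fix x assume "x \<in> pair_solutions F G"
    then have "nondegenerate (\<lambda>x. vfun F0 x - vfun G0 x) x"
      unfolding sols by (rule product_pair_nondegenerate[OF ctx])
    then obtain f' where f': "((\<lambda>x. vfun F0 x - vfun G0 x) has_derivative f') (at x)" "\<And>h. f' h = 0 ==> h = 0"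
      unfolding nondegenerate_def by blast
    have "bounded_linear ((*v) M)"
      by (rule linear_conv_bounded_linear[THEN iffD1]) (rule linearI; simp add: matrix_vector_mult_def
        vec_eq_iff scaleR_right.sum algebra_simps sum.distrib)
    from bounded_linear.has_derivative[OF this f'(1)]
    show "nondegenerate (\<lambda>x. vfun F x - vfun G x) x"
      unfolding nondegenerate_def diff using f'(2) ker by blast
  qed
  moreover have "card (pair_solutions F G) = Suc d ^ CARD('m) - d ^ CARD('m)"
    unfolding sols by (rule product_pair_card[OF ctx])
  moreover have "(\<Sum>k\<in>UNIV. v $ k * G k (vec_nth v)) \<noteq> 0" if "v \<in> V" for v
    using fv[OF that] by (simp add: f_def G_def M_def sum_distrib_left)
  ultimately show ?thesis using that by blast
qed

section \<open>Derivatives of the determinant\<close>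

abbreviation repl :: "'n => complex^'n^'n => complex^'n^'n => complex^'n^'n" where
  "repl i X M \<equiv> \<chi> r. if r = i then X $ r else M $ r"

abbreviation repl2 :: "'n => complex^'n^'n => 'n => complex^'n^'n => complex^'n^'n => complex^'n^'n" where
  "repl2 i X j Y M \<equiv> \<chi> r. if r = i then X $ r else if r = j then Y $ r else M $ r"

text \<open>The derivative of \<open>det\<close> at \<open>M\<close> in direction \<open>X\<close>,
  written by rows because linearity and homogeneity then follow from multilinearity;
  \<open>d2det\<close> is the mixed second derivative.\<close>

definition ddet :: "complex^'n^'n => complex^'n^'n => complex" where
  "ddet M X = (\<Sum>i\<in>UNIV. det (repl i X M))"

definition d2det :: "complex^'n^'n => complex^'n^'n => complex^'n^'n => complex" where
  "d2det M X Y = (\<Sum>i\<in>UNIV. \<Sum>j\<in>UNIV - {i}. det (repl2 i X j Y M))"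

lemma sum_Diff_singleton_if:
  "(\<Sum>j\<in>UNIV - {i}. f j) = (\<Sum>j\<in>(UNIV :: 'n::finite set). if i = j then 0 else f j :: complex)"
  by (intro sum.mono_neutral_cong_left) auto

lemma d2det_commute: "d2det M X Y = d2det M Y (X :: complex^'n^'n)"
proof -
  have "d2det M X Y = (\<Sum>i\<in>UNIV. \<Sum>j\<in>UNIV. if i = j then 0 else det (repl2 i X j Y M))"
    unfolding d2det_def sum_Diff_singleton_if ..
  also have "\<dots> = (\<Sum>j\<in>UNIV. \<Sum>i\<in>UNIV. if i = j then 0 else det (repl2 i X j Y M))"
    by (rule sum.swap)
  also have "\<dots> = (\<Sum>j\<in>UNIV. \<Sum>i\<in>UNIV. if j = i then 0 else det (repl2 j Y i X M))"
    by (intro sum.cong refl if_cong arg_cong[of _ _ det]) (auto simp: vec_eq_iff)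
  also have "\<dots> = d2det M Y X"
    unfolding d2det_def sum_Diff_singleton_if ..
  finally show ?thesis .
qed

lemma ddet_self: "ddet M M = of_nat CARD('n) * det (M :: complex^'n^'n)"
  by (simp add: ddet_def)

lemma d2det_self: "d2det M M Y = of_nat (CARD('n) - 1) * ddet (M :: complex^'n^'n) Y"
proof -
  have "d2det M M Y = d2det M Y M" by (rule d2det_commute)
  also have "\<dots> = (\<Sum>i\<in>UNIV. \<Sum>j\<in>UNIV - {i}. det (repl i Y M))"
    unfolding d2det_def by (intro sum.cong refl arg_cong[of _ _ det]) (auto simp: vec_eq_iff)
  also have "\<dots> = (\<Sum>i\<in>UNIV. of_nat (CARD('n) - 1) * det (repl i Y M))"
    by simp
  finally show ?thesis by (simp add: ddet_def sum_distrib_left)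
qed

lemma cscale_row: "cscale c A $ r = c *s A $ r"
  by (simp add: cscale_def vec_eq_iff)

lemma sum_cscale_row: "(\<Sum>k\<in>K. cscale (x k) (B k)) $ r = (\<Sum>k\<in>K. x k *s B k $ r)"
  by (simp add: cscale_row)

lemma ddet_linear: "ddet M (\<Sum>k\<in>K. cscale (x k) (B k)) = (\<Sum>k\<in>K. x k * ddet M (B k))"
proof (cases "finite K")
  case True
  have "det (repl i (\<Sum>k\<in>K. cscale (x k) (B k)) M) = (\<Sum>k\<in>K. x k * det (repl i (B k) M))" for i
    unfolding sum_cscale_row det_linear_row_sum[OF True] det_row_mul ..
  then have "ddet M (\<Sum>k\<in>K. cscale (x k) (B k)) = (\<Sum>i\<in>UNIV. \<Sum>k\<in>K. x k * det (repl i (B k) M))"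
    by (simp add: ddet_def)
  also have "\<dots> = (\<Sum>k\<in>K. \<Sum>i\<in>UNIV. x k * det (repl i (B k) M))"
    by (rule sum.swap)
  finally show ?thesis by (simp add: ddet_def sum_distrib_left)
next
  case False
  have "det (\<chi> r. if r = i then 0 $ r else M $ r) = 0" for i
    by (rule det_zero_row(1)[of i]) (simp add: row_def vec_eq_iff)
  with False show ?thesis by (simp add: ddet_def del: zero_index)
qed

lemma d2det_linear: "finite K ==> d2det M (\<Sum>k\<in>K. cscale (x k) (B k)) Y = (\<Sum>k\<in>K. x k * d2det M (B k) Y)"
proof -
  assume K: "finite K"
  have "det (repl2 i (\<Sum>k\<in>K. cscale (x k) (B k)) j Y M) =
      (\<Sum>k\<in>K. x k * det (repl2 i (B k) j Y M))" for i j
    unfolding sum_cscale_row det_linear_row_sum[OF K] det_row_mul ..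
  then have "d2det M (\<Sum>k\<in>K. cscale (x k) (B k)) Y =
      (\<Sum>i\<in>UNIV. \<Sum>j\<in>UNIV - {i}. \<Sum>k\<in>K. x k * det (repl2 i (B k) j Y M))"
    unfolding d2det_def by simp
  also have "\<dots> = (\<Sum>i\<in>UNIV. \<Sum>k\<in>K. \<Sum>j\<in>UNIV - {i}. x k * det (repl2 i (B k) j Y M))"
    by (intro sum.cong refl) (rule sum.swap)
  also have "\<dots> = (\<Sum>k\<in>K. \<Sum>i\<in>UNIV. \<Sum>j\<in>UNIV - {i}. x k * det (repl2 i (B k) j Y M))"
    by (rule sum.swap)
  finally show ?thesis by (simp add: d2det_def sum_distrib_left)
qed

lemma ddet_homogeneous: "ddet (cscale c M) X = c ^ (CARD('n) - 1) * ddet (M :: complex^'n^'n) X"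
proof -
  have "det (repl i X (cscale c M)) = c ^ (CARD('n) - 1) * det (repl i X M)" for i
  proof -
    have "repl i X (cscale c M) = (\<chi> r. (if r = i then 1 else c) *s (if r = i then X $ r else M $ r))"
      by (simp add: vec_eq_iff cscale_row)
    then have "det (repl i X (cscale c M)) = (\<Prod>r\<in>UNIV. if r = i then 1 else c) * det (repl i X M)"
      by (simp only: det_rows_mul)
    also have "(\<Prod>r\<in>UNIV. if r = i then 1 else c) = c ^ (CARD('n) - 1)"
      by (simp add: prod.If_cases Compl_eq_Diff_UNIV)
    finally show ?thesis .
  qed
  then show ?thesis by (simp add: ddet_def sum_distrib_left)
qed

lemma d2det_homogeneous: "d2det (cscale c M) X Y = c ^ (CARD('n) - 2) * d2det (M :: complex^'n^'n) X Y"
proof -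
  have "det (repl2 i X j Y (cscale c M)) = c ^ (CARD('n) - 2) * det (repl2 i X j Y M)" if "j \<noteq> i" for i j
  proof -
    have "repl2 i X j Y (cscale c M) =
        (\<chi> r. (if r \<in> {i, j} then 1 else c) *s (if r = i then X $ r else if r = j then Y $ r else M $ r))"
      by (simp add: vec_eq_iff cscale_row)
    then have "det (repl2 i X j Y (cscale c M)) =
        (\<Prod>r\<in>UNIV. if r \<in> {i, j} then 1 else c) * det (repl2 i X j Y M)"
      by (simp only: det_rows_mul)
    also have "(\<Prod>r\<in>UNIV. if r \<in> {i, j} then 1 else c) = c ^ card (- {i, j})"
      by (subst prod.If_cases) (auto simp: Compl_eq)
    also have "card (- {i, j}) = CARD('n) - 2"
      using that by (simp add: Compl_eq_Diff_UNIV card_Diff_subset)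
    finally show ?thesis .
  qed
  then show ?thesis by (simp add: d2det_def sum_distrib_left)
qed

lemma det_line_derivative:
  "((\<lambda>t. det (M + cscale t X)) has_field_derivative ddet M X) (at 0)"
proof -
  have "((\<lambda>t. \<Sum>p | p permutes UNIV. of_int (sign p) * (\<Prod>i\<in>UNIV. M $ i $ p i + t * X $ i $ p i)) has_field_derivative
      (\<Sum>p | p permutes UNIV. of_int (sign p) * (\<Sum>i\<in>UNIV. X $ i $ p i * (\<Prod>j\<in>UNIV - {i}. M $ j $ p j + 0 * X $ j $ p j)))) (at 0)"
    by (auto intro!: derivative_eq_intros has_field_derivative_prod simp: mult.commute)
  moreover have "(\<Sum>p | p permutes UNIV. of_int (sign p) * (\<Sum>i\<in>UNIV. X $ i $ p i * (\<Prod>j\<in>UNIV - {i}. M $ j $ p j + 0 * X $ j $ p j))) = ddet M X"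
  proof -
    have "(\<Prod>j\<in>UNIV. (repl i X M) $ j $ p j) = X $ i $ p i * (\<Prod>j\<in>UNIV - {i}. M $ j $ p j)" for i p
      by (subst prod.remove[of _ i]) auto
    then have "ddet M X = (\<Sum>i\<in>UNIV. \<Sum>p | p permutes UNIV. of_int (sign p) * (X $ i $ p i * (\<Prod>j\<in>UNIV - {i}. M $ j $ p j)))"
      by (simp add: ddet_def det_def)
    also have "\<dots> = (\<Sum>p | p permutes UNIV. \<Sum>i\<in>UNIV. of_int (sign p) * (X $ i $ p i * (\<Prod>j\<in>UNIV - {i}. M $ j $ p j)))"
      by (rule sum.swap)
    finally show ?thesis by (simp add: sum_distrib_left)
  qed
  ultimately show ?thesis by (simp add: det_def cscale_def)
qed

lemma ddet_line_derivative:
  "((\<lambda>t. ddet (M + cscale t Y) X) has_field_derivative d2det M X Y) (at 0)"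
proof -
  have "((\<lambda>t. det (repl i X (M + cscale t Y))) has_field_derivative
      (\<Sum>j\<in>UNIV - {i}. det (repl2 i X j Y M))) (at 0)" for i
  proof -
    define M' where "M' = repl i X M"
    define Y' where "Y' = (\<chi> r. if r = i then 0 else Y $ r)"
    have "repl i X (M + cscale t Y) = M' + cscale t Y'" for t
      by (simp add: M'_def Y'_def vec_eq_iff cscale_def)
    moreover have "ddet M' Y' = (\<Sum>j\<in>UNIV - {i}. det (repl2 i X j Y M))"
    proof -
      have "det (repl i Y' M') = 0"
        by (rule det_zero_row(1)[of i]) (simp add: row_def vec_eq_iff Y'_def)
      then have "ddet M' Y' = (\<Sum>j\<in>UNIV - {i}. det (repl j Y' M'))"
        unfolding ddet_def by (subst sum.remove[of _ i]) auto
      also have "\<dots> = (\<Sum>j\<in>UNIV - {i}. det (repl2 i X j Y M))"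
        by (intro sum.cong refl arg_cong[of _ _ det]) (auto simp: vec_eq_iff Y'_def M'_def)
      finally show ?thesis .
    qed
    ultimately show ?thesis using det_line_derivative[of M' Y'] by simp
  qed
  then show ?thesis
    unfolding ddet_def d2det_def by (intro derivative_intros)
qed

lemma mult_cscale: "M ** cscale t X = cscale t (M ** X)"
  by (simp add: matrix_matrix_mult_def cscale_def vec_eq_iff sum_distrib_left mult.left_commute)

text \<open>The multiplicativity of \<open>det\<close>, differentiated along a line;
  \<open>d2det_mult\<close> arises by differentiating once more.\<close>

lemma ddet_mult: "ddet (M ** N) (M ** X) = det M * ddet N X"
proof (rule DERIV_unique)
  show "((\<lambda>t. det (M ** N + cscale t (M ** X))) has_field_derivative ddet (M ** N) (M ** X)) (at 0)"
    by (rule det_line_derivative)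
  have "det (M ** N + cscale t (M ** X)) = det M * det (N + cscale t X)" for t
    unfolding mult_cscale[symmetric] matrix_add_ldistrib[symmetric] by (rule det_mul)
  then show "((\<lambda>t. det (M ** N + cscale t (M ** X))) has_field_derivative det M * ddet N X) (at 0)"
    using DERIV_cmult[OF det_line_derivative] by simp
qed

lemma d2det_mult: "d2det (M ** N) (M ** X) (M ** Y) = det M * d2det N X Y"
proof (rule DERIV_unique)
  show "((\<lambda>t. ddet (M ** N + cscale t (M ** Y)) (M ** X)) has_field_derivative d2det (M ** N) (M ** X) (M ** Y)) (at 0)"
    by (rule ddet_line_derivative)
  have "ddet (M ** N + cscale t (M ** Y)) (M ** X) = det M * ddet (N + cscale t Y) X" for t
    unfolding mult_cscale[symmetric] matrix_add_ldistrib[symmetric] by (rule ddet_mult)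
  then show "((\<lambda>t. ddet (M ** N + cscale t (M ** Y)) (M ** X)) has_field_derivative det M * d2det N X Y) (at 0)"
    using DERIV_cmult[OF ddet_line_derivative] by simp
qed

lemma vec_as_axis_sum: "(u :: complex^'n) = (\<Sum>l\<in>UNIV. u $ l *s axis l 1)"
  by (simp add: vec_eq_iff axis_def if_distrib[of "\<lambda>c. _ * c"] cong: if_cong)

lemma det_row_expand:
  "det (\<chi> r. if r = i then u else c r) = (\<Sum>l\<in>UNIV. u $ l * det (\<chi> r. if r = i then axis l 1 else c r :: complex^'n^'n))"
proof -
  have "det (\<chi> r. if r = i then u else c r) = det (\<chi> r. if r = i then (\<Sum>l\<in>UNIV. u $ l *s axis l 1) else c r)"
    by (subst vec_as_axis_sum[of u]) rule
  then show ?thesis by (simp only: det_linear_row_sum[OF finite] det_row_mul)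
qed

lemma det_replace_row_id:
  fixes u :: "complex^'n"
  shows "det (\<chi> r. if r = i then u else axis r 1) = u $ i"
proof -
  have "det (\<chi> r. if r = i then axis l 1 else axis r 1 :: complex^'n^'n) = (if l = i then 1 else 0)" for l
  proof (cases "l = i")
    case True
    have "(\<chi> r. if r = i then axis i 1 else axis r 1 :: complex^'n^'n) = mat 1"
      by (auto simp: vec_eq_iff mat_def axis_def)
    then show ?thesis unfolding True by simp
  next
    case False
    then have "det (\<chi> r. if r = i then axis l 1 else axis r 1 :: complex^'n^'n) = 0"
      by (intro det_identical_rows[of i l]) (auto simp: row_def vec_eq_iff)
    then show ?thesis using False by simp
  qed
  then show ?thesis
    unfolding det_row_expand[of i u] by (simp add: if_distrib[of "\<lambda>c. _ * c"] cong: if_cong)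
qed

lemma det_replace_two_rows_id:
  fixes u v :: "complex^'n"
  assumes "i \<noteq> j"
  shows "det (\<chi> r. if r = i then u else if r = j then v else axis r 1) = u $ i * v $ j - u $ j * v $ i"
proof -
  have "det (\<chi> r. if r = i then axis l 1 else if r = j then v else axis r 1 :: complex^'n^'n) =
      (if l = i then v $ j else if l = j then - (v $ i) else 0)" for l
  proof -
    consider "l = i" | "l = j" | "l \<noteq> i" "l \<noteq> j" by blast
    then show ?thesis
    proof cases
      case 1
      have "(\<chi> r. if r = i then axis l 1 else if r = j then v else axis r 1 :: complex^'n^'n) = (\<chi> r. if r = j then v else axis r 1)"
        using 1 assms by (auto simp: vec_eq_iff)
      then show ?thesis using 1 by (simp add: det_replace_row_id)
    next
      case 2
      let ?A = "\<chi> r. if r = i then v else axis r 1 :: complex^'n^'n"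
      have "(\<chi> r. if r = i then axis l 1 else if r = j then v else axis r 1 :: complex^'n^'n) = (\<chi> r. ?A $ Transposition.transpose i j r)"
        using 2 assms by (auto simp: vec_eq_iff Transposition.transpose_def)
      moreover have "det (\<chi> r. ?A $ Transposition.transpose i j r) = of_int (sign (Transposition.transpose i j)) * det ?A"
        by (rule det_permute_rows) (rule permutes_swap_id; simp)
      ultimately show ?thesis using 2 assms by (simp add: det_replace_row_id sign_swap_id)
    next
      case 3
      then have "det (\<chi> r. if r = i then axis l 1 else if r = j then v else axis r 1 :: complex^'n^'n) = 0"
        by (intro det_identical_rows[of i l]) (auto simp: row_def vec_eq_iff)
      then show ?thesis using 3 by simp
    qed
  qed
  then have "det (\<chi> r. if r = i then u else if r = j then v else axis r 1) =
      (\<Sum>l\<in>UNIV. u $ l * (if l = i then v $ j else if l = j then - (v $ i) else 0))"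
    unfolding det_row_expand[of i u] by simp
  also have "\<dots> = (\<Sum>l\<in>{i, j}. u $ l * (if l = i then v $ j else if l = j then - (v $ i) else 0))"
    by (intro sum.mono_neutral_right) auto
  finally show ?thesis using assms by simp
qed

section \<open>Jacobi's formula and its analogue of second order\<close>

lemma ddet_id: "ddet (mat 1) X = trace (X :: complex^'n^'n)"
proof -
  have "repl i X (mat 1) = (\<chi> r. if r = i then X $ i else axis r 1)" for i
    by (auto simp: vec_eq_iff mat_def axis_def)
  then show ?thesis by (simp add: ddet_def trace_def det_replace_row_id)
qed

lemma d2det_id: "d2det (mat 1) X Y = trace X * trace Y - trace (X ** (Y :: complex^'n^'n))"
proof -
  have "repl2 i X j Y (mat 1) = (\<chi> r. if r = i then X $ i else if r = j then Y $ j else axis r 1)" for i j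
    by (auto simp: vec_eq_iff mat_def axis_def)
  then have "d2det (mat 1) X Y = (\<Sum>i\<in>UNIV. \<Sum>j\<in>UNIV - {i}. X $ i $ i * Y $ j $ j - X $ i $ j * Y $ j $ i)"
    by (simp add: d2det_def det_replace_two_rows_id)
  also have "\<dots> = (\<Sum>i\<in>UNIV. \<Sum>j\<in>UNIV. X $ i $ i * Y $ j $ j - X $ i $ j * Y $ j $ i)"
    by (intro sum.cong refl sum.mono_neutral_left) auto
  finally show ?thesis
    by (simp add: trace_def matrix_matrix_mult_def sum_subtractf sum_product)
qed

lemma ddet_inverse:
  assumes "M ** K = mat 1"
  shows "ddet M X = det M * trace (K ** X)"
  using ddet_mult[of M "mat 1" "K ** X"] assms by (simp add: matrix_mul_assoc ddet_id)

lemma d2det_inverse: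
  assumes "M ** K = mat 1"
  shows "d2det M X Y = det M * (trace (K ** X) * trace (K ** Y) - trace (K ** X ** K ** Y))"
  using d2det_mult[of M "mat 1" "K ** X" "K ** Y"] assms by (simp add: matrix_mul_assoc d2det_id)

lemma transpose_inverse:
  fixes K S :: "complex^'n::finite^'n"
  assumes "K ** S = mat 1" "transpose S = S" shows "transpose K = K"
proof -
  have S: "S ** K = mat 1" using assms(1) matrix_left_right_inverse by blast
  have "transpose K ** S = mat 1"
    using arg_cong[OF S, of transpose] by (simp add: matrix_transpose_mul assms(2) transpose_mat)
  then have "transpose K ** S ** K = K" by simp
  then show ?thesis by (simp add: matrix_mul_assoc[symmetric] S)
qed

section \<open>The likelihood equations as a pair of homogeneous systems\<close>

definition lin_comb :: "('m::finite => complex^'n^'n) => ('m => complex) => complex^'n^'n" where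
  "lin_comb B x = (\<Sum>k\<in>UNIV. cscale (x k) (B k))"

text \<open>The partial derivatives of \<open>ddet (lin_comb B x) A\<close> and of \<open>(n - 1) * det (lin_comb B x)\<close>.\<close>

definition lik_F :: "('m::finite => complex^'n^'n) => complex^'n^'n => 'm => 'm cfun" where
  "lik_F B A k x = d2det (lin_comb B x) (B k) A"

definition lik_G :: "('m::finite => complex^'n^'n) => 'm => 'm cfun" where
  "lik_G B k x = of_nat (CARD('n) - 1) * ddet (lin_comb B x) (B k)"

lemma lin_comb_nth: "lin_comb B x $ r $ s = (\<Sum>k\<in>UNIV. x k * B k $ r $ s)"
  by (simp add: lin_comb_def cscale_def)

lemma lin_comb_scale: "lin_comb B (\<lambda>k. c * x k) = cscale c (lin_comb B x)"
  by (simp add: vec_eq_iff lin_comb_nth cscale_def sum_distrib_left mult.assoc)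

lemma sum_lik_F: "(\<Sum>k\<in>UNIV. y k * lik_F B A k x) = d2det (lin_comb B x) (lin_comb B y) A"
  by (simp add: lik_F_def lin_comb_def[of B y] d2det_linear)

lemma sum_lik_G:
  "(\<Sum>k\<in>UNIV. y k * lik_G B k x) = of_nat (CARD('n) - 1) * ddet (lin_comb B x) (lin_comb (B :: _ => complex^'n^'n) y)"
  by (simp add: lik_G_def lin_comb_def[of B y] ddet_linear sum_distrib_left mult.left_commute)

lemma trace_mult_lin_comb: "trace (M ** lin_comb B x) = (\<Sum>k\<in>UNIV. x k * trace (M ** B k))"
proof -
  have "trace (M ** (\<Sum>k\<in>K. cscale (x k) (B k))) = (\<Sum>k\<in>K. x k * trace (M ** B k))" if "finite K" for K
    using that
  proof (induction K rule: finite_induct)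
    case empty
    show ?case by (simp add: trace_def)
  next
    case (insert k K)
    have "trace (cscale (x k) (M ** B k)) = x k * trace (M ** B k)"
      by (simp add: trace_def cscale_def sum_distrib_left)
    with insert show ?case by (simp add: matrix_add_ldistrib trace_add mult_cscale)
  qed
  then show ?thesis by (simp add: lin_comb_def)
qed

lemma lik_pair:
  fixes B :: "'m::finite => complex^'n^'n"
  assumes "CARD('n) \<ge> 2"
  shows "poly_pair (CARD('n) - 2) (lik_F B A) (lik_G B)"
proof -
  have lc: "poly_fun (\<lambda>x. lin_comb B x $ r $ s)" for r s
    unfolding lin_comb_nth by (intro poly_fun_intros)
  have "poly_fun (lik_F B A k)" for k
  proof -
    have "poly_fun (\<lambda>x. (if r = i then B k $ r else if r = j then A $ r else lin_comb B x $ r) $ s)" for r i j s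
      using lc by (cases "r = i"; cases "r = j") (simp_all add: poly_fun.const)
    then show ?thesis unfolding lik_F_def d2det_def by (intro poly_fun_sum poly_fun_det) simp
  qed
  moreover have "poly_fun (lik_G B k)" for k
  proof -
    have "poly_fun (\<lambda>x. (if r = i then B k $ r else lin_comb B x $ r) $ s)" for r i s
      using lc by (cases "r = i") (simp_all add: poly_fun.const)
    then show ?thesis unfolding lik_G_def ddet_def by (intro poly_fun_intros poly_fun_det) simp
  qed
  moreover have "Suc (CARD('n) - 2) = CARD('n) - 1" using assms by simp
  ultimately show ?thesis
    by (simp add: poly_pair_def homog_def lik_F_def lik_G_def lin_comb_scale d2det_homogeneous ddet_homogeneous mult.left_commute
        del: power_Suc)
qed

text \<open>Contraction with \<open>x\<close> and Euler's relation show that either form of the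
  equations forces \<open>trace (K ** A)\<close> to be n. With this value, the term
  \<open>trace (K ** B k) * trace (K ** A)\<close> of \<open>lik_F\<close> and the factor n - 1 of
  \<open>lik_G\<close> leave exactly one copy of \<open>trace (K ** B k)\<close>, which is the
  reason for that factor.\<close>

lemma lik_equations:
  fixes B :: "'m::finite => complex^'n^'n"
  assumes n: "CARD('n) \<ge> 2" and inv: "lin_comb B x ** K = mat 1"
  shows "(\<forall>k. lik_F B A k x = lik_G B k x) \<longleftrightarrow> (\<forall>k. trace (K ** A ** K ** B k) = trace (K ** B k))"
    "(\<forall>k. lik_F B A k x = lik_G B k x) ==> trace (K ** A) = of_nat CARD('n)"
proof -
  let ?n = "of_nat CARD('n) :: complex"
  have n1: "of_nat (CARD('n) - 1) = ?n - 1" "?n - 1 \<noteq> 0"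
    using n by (simp_all add: of_nat_diff)
  have d: "det (lin_comb B x) \<noteq> 0" using inv invertible_det_nz invertible_right_inverse by blast
  have "trace (K ** B k ** K ** A) = trace (K ** A ** K ** B k)" for k
    using trace_mul_sym[of "K ** B k" "K ** A"] by (simp add: matrix_mul_assoc)
  then have F: "lik_F B A k x = det (lin_comb B x) * (trace (K ** B k) * trace (K ** A) - trace (K ** A ** K ** B k))" for k
    unfolding lik_F_def d2det_inverse[OF inv] by simp
  have G: "lik_G B k x = (?n - 1) * (det (lin_comb B x) * trace (K ** B k))" for k
    unfolding lik_G_def ddet_inverse[OF inv] n1(1) ..
  have KS: "K ** lin_comb B x = mat 1" using inv matrix_left_right_inverse by blast
  show tr: "trace (K ** A) = ?n" if "\<forall>k. lik_F B A k x = lik_G B k x"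
  proof -
    have "(\<Sum>k\<in>UNIV. x k * lik_F B A k x) = (\<Sum>k\<in>UNIV. x k * lik_G B k x)" using that by simp
    then have "(?n - 1) * ddet (lin_comb B x) A = (?n - 1) * (?n * det (lin_comb B x))"
      unfolding sum_lik_F sum_lik_G d2det_self ddet_self n1(1) .
    then show ?thesis using n1(2) d by (simp add: ddet_inverse[OF inv])
  qed
  have "lik_F B A k x = lik_G B k x \<longleftrightarrow> trace (K ** A ** K ** B k) = trace (K ** B k)"
    if "trace (K ** A) = ?n" for k
    using d unfolding F G that by (auto simp: algebra_simps)
  moreover have "trace (K ** A) = ?n" if "\<forall>k. trace (K ** A ** K ** B k) = trace (K ** B k)"
  proof -
    have "trace (K ** A ** K ** lin_comb B x) = trace (K ** lin_comb B x)"
      unfolding trace_mult_lin_comb using that by simp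
    then show ?thesis
      by (simp add: matrix_mul_assoc[symmetric] KS trace_I)
  qed
  ultimately show "(\<forall>k. lik_F B A k x = lik_G B k x) \<longleftrightarrow> (\<forall>k. trace (K ** A ** K ** B k) = trace (K ** B k))"
    using tr by blast
qed

section \<open>Pencils spanned by rank one matrices\<close>

text \<open>\<open>arr y\<close> is the sum of \<open>y i\<close> times the square of the \<open>i\<close>-th linear form, over the coordinates and
  (for \<open>None\<close>) their sum.\<close>

definition arr :: "('n option => complex) => complex^'n^'n" where
  "arr y = (\<chi> r s. (if r = s then y (Some r) else 0) + y None)"

definition co_prod :: "('o::finite => complex) => 'o set => complex" where
  "co_prod y X = (\<Prod>k\<in>- X. y k)"

definition elem_sym :: "('o::finite) cfun" where
  "elem_sym y = (\<Sum>i\<in>UNIV. co_prod y {i})"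

text \<open>\<open>A\<close> padded by a zero row and column at \<open>None\<close>: the indices are
  regarded as vertices, namely the unit vectors and, for \<open>None\<close>, the origin.\<close>

definition qent :: "complex^'n^'n => 'n option => 'n option => complex" where
  "qent A i j = (case i of None => 0 | Some r => case j of None => 0 | Some s => A $ r $ s)"

text \<open>The quadratic form of \<open>A\<close> at the difference of the vertices
  \<open>i\<close> and \<open>j\<close>. This difference spans the common kernel of all linear forms
  other than those with index \<open>i\<close> and \<open>j\<close>.\<close>

definition edge :: "complex^'n^'n => 'n option => 'n option => complex" where
  "edge A i j = qent A i i + qent A j j - qent A i j - qent A j i"

definition edge_sum :: "complex^'n^'n => ('n::finite option) cfun" where
  "edge_sum A y = (\<Sum>i\<in>UNIV. \<Sum>j\<in>UNIV. edge A i j * co_prod y {i, j}) / 2"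

lemma edge_commute: "edge A i j = edge A j i"
  by (simp add: edge_def algebra_simps)

lemma edge_same [simp]: "edge A i i = 0"
  by (simp add: edge_def)

lemma arr_linear: "arr (\<lambda>i. y i + t * h i) = arr y + cscale t (arr h)"
  by (simp add: arr_def cscale_def vec_eq_iff algebra_simps)

lemma transpose_arr: "transpose (arr y) = arr y"
  by (simp add: arr_def transpose_def vec_eq_iff)

lemma lin_comb_arr: "lin_comb (\<lambda>k. arr (a k)) x = arr (\<lambda>i. \<Sum>k\<in>UNIV. x k * a k i)"
  by (simp add: vec_eq_iff lin_comb_nth arr_def algebra_simps sum.distrib if_distrib[of "\<lambda>c. _ * c"] cong: if_cong)

lemma poly_fun_co_prod: "poly_fun (\<lambda>y. co_prod y X)"
  unfolding co_prod_def by (intro poly_fun_intros)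

lemma sum_option: "(\<Sum>i\<in>UNIV. f i) = f None + (\<Sum>r\<in>UNIV. f (Some r))" for f :: "'n::finite option => complex"
  by (simp add: UNIV_option_conv sum.reindex)

text \<open>A diagonal matrix plus a constant one. In the multilinear expansion at most one row can
  be the constant row, since a second copy is removed by a row operation. Nothing is divided, so
  vanishing weights are covered.\<close>

lemma det_arr: "det (arr y) = elem_sym y"
proof -
  define L where "L r = y (Some r) *s axis r (1::complex)" for r :: 'a
  define one :: "complex^'a" where "one = (\<chi> s. 1)"
  define c where "c = y None"
  define p where "p i = (\<Prod>r\<in>UNIV - {i}. y (Some r))" for i
  have claim1: "det (\<chi> r. if r = i then one else if r \<in> T then L r + c *s one else L r) = p i"
    if "finite T" "i \<notin> T" for i T
    using that
  proof (induction T rule: finite_induct)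
    case empty
    have "(\<chi> r. if r = i then one else if r \<in> {} then L r + c *s one else L r) =
        (\<chi> r. (if r = i then 1 else y (Some r)) *s (if r = i then one else axis r 1))"
      by (simp add: vec_eq_iff L_def)
    then have "det (\<chi> r. if r = i then one else if r \<in> {} then L r + c *s one else L r) =
        (\<Prod>r\<in>UNIV. if r = i then 1 else y (Some r)) * det (\<chi> r. if r = i then one else axis r 1)"
      by (simp only: det_rows_mul)
    also have "(\<Prod>r\<in>UNIV. if r = i then 1 else y (Some r)) = p i"
      unfolding p_def by (intro prod.mono_neutral_cong_right) auto
    finally show ?case by (simp add: det_replace_row_id one_def)
  next
    case (insert j T)
    then have ij: "i \<noteq> j" by auto
    define M where "M = (\<chi> r. if r = i then one else if r \<in> T then L r + c *s one else L r)"
    have "(\<chi> r. if r = i then one else if r \<in> insert j T then L r + c *s one else L r) =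
        (\<chi> k. if k = j then row j M + c *s row i M else row k M)"
      using ij insert.hyps by (auto simp: M_def row_def vec_eq_iff)
    then show ?case using det_row_operation[of j i M c] ij insert by (simp add: M_def)
  qed
  have claim2: "det (\<chi> r. if r \<in> T then L r + c *s one else L r) = (\<Prod>r\<in>UNIV. y (Some r)) + c * (\<Sum>i\<in>T. p i)"
    if "finite T" for T
    using that
  proof (induction T rule: finite_induct)
    case empty
    have "(\<chi> r. if r \<in> {} then L r + c *s one else L r) = (\<chi> r. y (Some r) *s axis r 1)"
      by (simp add: vec_eq_iff L_def)
    moreover have "(\<chi> r. axis r 1 :: complex^'a^'a) = mat 1"
      by (auto simp: vec_eq_iff mat_def axis_def)
    ultimately show ?case by (simp add: det_rows_mul)
  next
    case (insert j T)
    have "det (\<chi> r. if r \<in> insert j T then L r + c *s one else L r) =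
        det (\<chi> r. if r = j then L j + c *s one else if r \<in> T then L r + c *s one else L r)"
      by (intro arg_cong[of _ _ det]) (auto simp: vec_eq_iff)
    also have "\<dots> = det (\<chi> r. if r = j then L j else if r \<in> T then L r + c *s one else L r) +
        det (\<chi> r. if r = j then c *s one else if r \<in> T then L r + c *s one else L r)"
      by (rule det_row_add[of j "\<lambda>r. L j" "\<lambda>r. c *s one"])
    also have "det (\<chi> r. if r = j then L j else if r \<in> T then L r + c *s one else L r) =
        det (\<chi> r. if r \<in> T then L r + c *s one else L r)"
      using insert.hyps by (intro arg_cong[of _ _ det]) (auto simp: vec_eq_iff)
    also have "det (\<chi> r. if r = j then c *s one else if r \<in> T then L r + c *s one else L r) = c * p j"
      unfolding det_row_mul using claim1[OF insert.hyps] by simp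
    finally show ?case using insert by (simp add: algebra_simps)
  qed
  have "arr y = (\<chi> r. if r \<in> UNIV then L r + c *s one else L r)"
    by (auto simp: vec_eq_iff arr_def L_def c_def one_def axis_def)
  then have "det (arr y) = (\<Prod>r\<in>UNIV. y (Some r)) + c * (\<Sum>i\<in>UNIV. p i)"
    using claim2[of UNIV] by simp
  moreover have "co_prod y {None} = (\<Prod>r\<in>UNIV. y (Some r))"
  proof -
    have "- {None} = range (Some :: 'a => _)" by (auto simp: image_iff)
    then show ?thesis by (simp add: co_prod_def prod.reindex)
  qed
  moreover have "co_prod y {Some r} = c * p r" for r
  proof -
    have "- {Some r} = insert None (Some ` (UNIV - {r}))" by (auto simp: image_iff)
    then show ?thesis by (simp add: co_prod_def prod.reindex c_def p_def)
  qed
  ultimately show ?thesis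
    by (simp add: elem_sym_def sum_option sum_distrib_left)
qed

lemma co_prod_inverse:
  assumes "\<And>i. y i \<noteq> 0" shows "co_prod y X = (\<Prod>i\<in>UNIV. y i) * (\<Prod>i\<in>X. inverse (y i))"
proof -
  have "(\<Prod>i\<in>UNIV. y i) = (\<Prod>i\<in>X. y i) * co_prod y X"
    unfolding co_prod_def by (subst prod.union_disjoint[symmetric]) auto
  moreover have "(\<Prod>i\<in>X. y i) * (\<Prod>i\<in>X. inverse (y i)) = 1"
    using assms by (simp add: prod.distrib[symmetric])
  ultimately show ?thesis by (metis (no_types, lifting) mult.commute mult.left_commute mult_1)
qed

text \<open>The Sherman-Morrison formula for a rank one change of a diagonal matrix.\<close>

lemma arr_inverse:
  assumes y: "\<And>i. y i \<noteq> 0" and e: "(\<Sum>i\<in>UNIV. inverse (y i)) \<noteq> 0"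
  shows "arr y ** (\<chi> r s. (if r = s then inverse (y (Some r)) else 0) -
    inverse (y (Some r)) * inverse (y (Some s)) / (\<Sum>i\<in>UNIV. inverse (y i))) = mat 1"
proof -
  define \<eta> where "\<eta> r = inverse (y (Some r))" for r
  define E where "E = (\<Sum>i\<in>UNIV. inverse (y i))"
  have E: "E = inverse (y None) + (\<Sum>r\<in>UNIV. \<eta> r)" by (simp add: E_def sum_option \<eta>_def)
  have "(\<Sum>k\<in>UNIV. ((if r = k then y (Some r) else 0) + y None) * ((if k = s then \<eta> k else 0) - \<eta> k * \<eta> s / E)) =
      (if r = s then 1 else 0)" for r s
  proof -
    have "(\<Sum>k\<in>UNIV. ((if r = k then y (Some r) else 0) + y None) * ((if k = s then \<eta> k else 0) - \<eta> k * \<eta> s / E)) =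
        (\<Sum>k\<in>UNIV. if r = k then y (Some r) * ((if r = s then \<eta> r else 0) - \<eta> r * \<eta> s / E) else 0) +
        (\<Sum>k\<in>UNIV. if k = s then y None * \<eta> s else 0) - (\<Sum>k\<in>UNIV. \<eta> k) * (y None * \<eta> s / E)"
      unfolding sum_distrib_right sum.distrib[symmetric] sum_subtractf[symmetric]
      by (intro sum.cong refl) (auto simp: algebra_simps)
    also have "\<dots> = y (Some r) * ((if r = s then \<eta> r else 0) - \<eta> r * \<eta> s / E) + y None * \<eta> s
        - (E - inverse (y None)) * (y None * \<eta> s / E)"
      by (simp add: E)
    also have "\<dots> = (if r = s then 1 else 0)"
      using y[of "Some r"] y[of None] e unfolding E_def[symmetric] by (auto simp: \<eta>_def field_simps)
    finally show ?thesis .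
  qed
  then show ?thesis
    unfolding E_def[symmetric] \<eta>_def[symmetric] by (simp add: matrix_matrix_mult_def arr_def vec_eq_iff mat_def)
qed

lemma poly_fun_eqI:
  assumes "poly_fun f" "poly_fun g" "poly_fun h" "h w \<noteq> 0" "\<And>z. h z \<noteq> 0 ==> f z = g z"
  shows "f z = g z"
proof (rule ccontr)
  assume "f z \<noteq> g z"
  then have "\<exists>z. (f z - g z) * h z \<noteq> 0"
    using assms(4) by (intro poly_fun_mult_nonzero poly_fun_diff assms) auto
  then show False using assms(5) by auto
qed

lemma poly_fun_arr_entry: "poly_fun (\<lambda>y. arr y $ r $ s)"
  by (cases "r = s") (simp_all add: arr_def poly_fun.intros)

text \<open>A symmetric matrix \<open>M\<close>, seen as a weighted graph Laplacian on \<open>'n option\<close>.\<close>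

definition ext :: "complex^'n::finite^'n => 'n option => 'n option => complex" where
  "ext M l l' = (case l of
     Some r => (case l' of Some s => M $ r $ s | None => - (\<Sum>s\<in>UNIV. M $ r $ s))
   | None => (case l' of Some s => - (\<Sum>r\<in>UNIV. M $ r $ s) | None => (\<Sum>r\<in>UNIV. \<Sum>s\<in>UNIV. M $ r $ s)))"

lemma ext_sum: "(\<Sum>l\<in>UNIV. ext M l l') = 0" "(\<Sum>l'\<in>UNIV. ext M l l') = 0"
proof -
  show "(\<Sum>l\<in>UNIV. ext M l l') = 0"
    unfolding sum_option ext_def
    by (cases l') (simp_all add: sum_negf)
  show "(\<Sum>l'\<in>UNIV. ext M l l') = 0"
    unfolding sum_option ext_def
    by (cases l) (simp_all add: sum_negf, subst sum.swap, simp)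
qed

lemma ext_commute:
  assumes "transpose M = M" shows "ext M l l' = ext M l' l"
proof -
  have "M $ r $ s = M $ s $ r" for r s using arg_cong[OF assms, of "\<lambda>M. M $ s $ r"] by (simp add: transpose_def)
  then show ?thesis unfolding ext_def by (cases l; cases l') simp_all
qed

text \<open>The terms of \<open>edge\<close> that depend on one index only are killed by the
  vanishing row and column sums.\<close>

lemma sum_edge_ext:
  assumes "\<And>q. (\<Sum>p\<in>UNIV. f p q) = 0" "\<And>p. (\<Sum>q\<in>UNIV. f p q) = 0"
  shows "(\<Sum>p\<in>UNIV. \<Sum>q\<in>UNIV. f p q * edge A p q) = - (\<Sum>p\<in>UNIV. \<Sum>q\<in>UNIV. f p q * (qent A p q + qent A q p))"
proof -
  have "(\<Sum>p\<in>UNIV. \<Sum>q\<in>UNIV. f p q * qent A p p) = 0"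
    by (simp add: sum_distrib_right[symmetric] assms)
  moreover have "(\<Sum>p\<in>UNIV. \<Sum>q\<in>UNIV. f p q * qent A q q) = 0"
    by (subst sum.swap) (simp add: sum_distrib_right[symmetric] assms)
  ultimately show ?thesis
    unfolding edge_def by (simp add: algebra_simps sum.distrib sum_subtractf)
qed

lemma trace_ext:
  assumes M: "transpose M = M"
  shows "trace (M ** A) = - (\<Sum>p\<in>UNIV. \<Sum>q\<in>UNIV. ext M p q * edge A p q) / 2"
proof -
  have "trace (M ** A) = (\<Sum>p\<in>UNIV. \<Sum>q\<in>UNIV. ext M p q * qent A q p)"
    by (simp add: sum_option trace_def matrix_matrix_mult_def qent_def) (simp add: ext_def)
  moreover have "(\<Sum>p\<in>UNIV. \<Sum>q\<in>UNIV. ext M p q * qent A p q) = (\<Sum>p\<in>UNIV. \<Sum>q\<in>UNIV. ext M p q * qent A q p)"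
    by (subst sum.swap) (simp add: ext_commute[OF M])
  ultimately show ?thesis
    using sum_edge_ext[of "ext M" A] by (simp add: ext_sum distrib_left sum.distrib)
qed

text \<open>For nonzero weights and determinant, the inverse satisfies
  \<open>ext K p q = - \<eta> p * \<eta> q / E\<close> off the diagonal, so that
  \<open>trace_ext\<close> turns Jacobi's formula into a sum over edges. Both sides are polynomials
  in \<open>y\<close>, and the identity extends to singular matrices.\<close>

lemma ddet_arr: "ddet (arr y) A = edge_sum A y"
proof (rule poly_fun_eqI[of "\<lambda>y. ddet (arr y) A" "edge_sum A" "\<lambda>y. (\<Prod>i\<in>UNIV. y i) * elem_sym y" "\<lambda>_. 1"])
  have "poly_fun (\<lambda>y. (if r = i then A $ r else arr y $ r) $ s)" for r i s
    by (cases "r = i") (simp_all add: poly_fun.const poly_fun_arr_entry)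
  then show "poly_fun (\<lambda>y. ddet (arr y) A)"
    unfolding ddet_def by (intro poly_fun_intros poly_fun_det) simp
  have "edge_sum A = (\<lambda>y. (1 / 2) * (\<Sum>i\<in>UNIV. \<Sum>j\<in>UNIV. edge A i j * co_prod y {i, j}))"
    by (simp add: edge_sum_def fun_eq_iff)
  then show "poly_fun (edge_sum A)"
    by (simp only:) (intro poly_fun_intros poly_fun_co_prod)
  show "poly_fun (\<lambda>y. (\<Prod>i\<in>UNIV. y i) * elem_sym y)"
    unfolding elem_sym_def by (intro poly_fun_intros poly_fun_co_prod)
  show "(\<Prod>i\<in>UNIV. 1) * elem_sym (\<lambda>_ :: 'a option. 1) \<noteq> 0"
    by (simp add: elem_sym_def co_prod_def) (metis of_nat_Suc of_nat_neq_0)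
  fix y :: "'a option => complex"
  assume nz: "(\<Prod>i\<in>UNIV. y i) * elem_sym y \<noteq> 0"
  then have y: "y i \<noteq> 0" for i by auto
  define \<eta> where "\<eta> i = inverse (y i)" for i
  define E where "E = (\<Sum>i\<in>UNIV. \<eta> i)"
  have es: "elem_sym y = (\<Prod>i\<in>UNIV. y i) * E"
    by (simp add: elem_sym_def co_prod_inverse[OF y] E_def \<eta>_def sum_distrib_left)
  then have E: "E \<noteq> 0" using nz by auto
  define K :: "complex^'a^'a" where "K = (\<chi> r s. (if r = s then \<eta> (Some r) else 0) - \<eta> (Some r) * \<eta> (Some s) / E)"
  have "arr y ** K = mat 1"
    using arr_inverse[of y, OF y] E unfolding K_def E_def \<eta>_def by blast
  then have dd: "ddet (arr y) A = elem_sym y * trace (K ** A)"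
    by (simp add: ddet_inverse det_arr)
  have K: "transpose K = K" by (simp add: K_def transpose_def vec_eq_iff mult.commute)
  have row: "(\<Sum>s\<in>UNIV. K $ r $ s) = \<eta> (Some r) * \<eta> None / E" "(\<Sum>s\<in>UNIV. K $ s $ r) = \<eta> (Some r) * \<eta> None / E" for r
  proof -
    have "(\<Sum>s\<in>UNIV. K $ r $ s) = \<eta> (Some r) - \<eta> (Some r) * (E - \<eta> None) / E"
      by (simp add: K_def E_def sum_option sum_subtractf sum_distrib_left sum_divide_distrib)
    also have "\<dots> = \<eta> (Some r) * \<eta> None / E" using E by (simp add: field_simps)
    finally show "(\<Sum>s\<in>UNIV. K $ r $ s) = \<eta> (Some r) * \<eta> None / E" .
    then show "(\<Sum>s\<in>UNIV. K $ s $ r) = \<eta> (Some r) * \<eta> None / E"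
      using K by (metis (no_types, lifting) sum.cong transpose_def vec_lambda_beta)
  qed
  have "(\<Sum>r\<in>UNIV. \<eta> (Some r) * \<eta> None / E) = (E - \<eta> None) * \<eta> None / E"
    by (simp add: E_def sum_option sum_distrib_right sum_divide_distrib)
  also have "\<dots> = \<eta> None - \<eta> None * \<eta> None / E" using E by (simp add: field_simps)
  finally have "ext K p q = (if p = q then \<eta> p else 0) - \<eta> p * \<eta> q / E" for p q
    by (cases p; cases q) (simp_all add: ext_def row, simp_all add: K_def)
  then have "ext K p q * edge A p q = - (edge A p q * (\<eta> p * \<eta> q)) / E" for p q
    by (cases "p = q") simp_all
  then have tr: "trace (K ** A) = (\<Sum>p\<in>UNIV. \<Sum>q\<in>UNIV. edge A p q * (\<eta> p * \<eta> q)) / (E * 2)"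
    unfolding trace_ext[OF K] by (simp add: sum_negf sum_divide_distrib)
  have co: "edge A i j * co_prod y {i, j} = (\<Prod>i\<in>UNIV. y i) * (edge A i j * (\<eta> i * \<eta> j))" for i j
    by (cases "i = j") (simp_all add: co_prod_inverse[OF y] \<eta>_def)
  show "ddet (arr y) A = edge_sum A y"
    unfolding dd tr es edge_sum_def co sum_distrib_left[symmetric] using E by simp
qed

lemma co_prod_line_derivative:
  "((\<lambda>t. co_prod (\<lambda>i. y i + t * h i) X) has_field_derivative (\<Sum>l\<in>- X. h l * co_prod y (insert l X))) (at 0)"
proof -
  have "((\<lambda>t. \<Prod>i\<in>- X. y i + t * h i) has_field_derivative (\<Sum>l\<in>- X. h l * (\<Prod>k\<in>- X - {l}. y k + 0 * h k))) (at 0)"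
    by (intro has_field_derivative_prod) (auto intro!: derivative_eq_intros)
  moreover have "- X - {l} = - insert l X" for l by auto
  ultimately show ?thesis by (simp add: co_prod_def)
qed

lemma ddet_arr_arr: "ddet (arr y) (arr h) = (\<Sum>i\<in>UNIV. \<Sum>l\<in>- {i}. h l * co_prod y {l, i})"
proof (rule DERIV_unique)
  show "((\<lambda>t. det (arr y + cscale t (arr h))) has_field_derivative ddet (arr y) (arr h)) (at 0)"
    by (rule det_line_derivative)
  show "((\<lambda>t. det (arr y + cscale t (arr h))) has_field_derivative (\<Sum>i\<in>UNIV. \<Sum>l\<in>- {i}. h l * co_prod y {l, i})) (at 0)"
    unfolding arr_linear[symmetric] det_arr elem_sym_def
    by (intro derivative_intros co_prod_line_derivative)
qed

lemma d2det_arr_arr: "d2det (arr y) (arr h) A =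
  (\<Sum>i\<in>UNIV. \<Sum>j\<in>UNIV. edge A i j * (\<Sum>l\<in>- {i, j}. h l * co_prod y {l, i, j})) / 2"
proof (rule DERIV_unique)
  show "((\<lambda>t. ddet (arr y + cscale t (arr h)) A) has_field_derivative d2det (arr y) (arr h) A) (at 0)"
    unfolding d2det_commute[of _ "arr h"] by (rule ddet_line_derivative)
  show "((\<lambda>t. ddet (arr y + cscale t (arr h)) A) has_field_derivative
      (\<Sum>i\<in>UNIV. \<Sum>j\<in>UNIV. edge A i j * (\<Sum>l\<in>- {i, j}. h l * co_prod y {l, i, j})) / 2) (at 0)"
    unfolding arr_linear[symmetric] ddet_arr edge_sum_def
    by (intro DERIV_cdivide DERIV_sum DERIV_cmult co_prod_line_derivative)
qed

section \<open>Arrangements in general position\<close>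

definition form :: "('m::finite => 'o => complex) => complex^'m => 'o => complex" where
  "form a x i = (\<Sum>k\<in>UNIV. x $ k * a k i)"

definition pencil :: "('m::finite => 'n::finite option => complex) => 'm => complex^'n^'n" where
  "pencil a k = arr (a k)"

text \<open>As soon as there are \<open>CARD('m)\<close> forms, this says that any
  \<open>CARD('m)\<close> of them are linearly independent.\<close>

definition general_position :: "('m::finite => 'o::finite => complex) => bool" where
  "general_position a \<longleftrightarrow> (\<forall>x. x \<noteq> 0 \<longrightarrow> card {i. form a x i = 0} < CARD('m))"

lemma form_linear: "form a (x + t *s h) i = form a x i + t * form a h i"
  by (simp add: form_def algebra_simps sum.distrib sum_distrib_left)

lemma form_smult: "form a (t *s x) i = t * form a x i"
  by (simp add: form_def sum_distrib_left mult.assoc)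

lemma form_axis: "form a (axis k 1) i = a k i"
  by (simp add: form_def axis_def if_distrib[of "\<lambda>c. c * _"] cong: if_cong)

abbreviation vcomb :: "('m::finite => complex^'n^'n) => complex^'m => complex^'n^'n" where
  "vcomb B \<equiv> \<lambda>x. lin_comb B (vec_nth x)"

lemma lin_comb_pencil: "vcomb (pencil a) x = arr (form a x)"
  unfolding pencil_def by (simp add: lin_comb_arr form_def[abs_def])

text \<open>\<open>T\<close> is enlarged to \<open>CARD('m)\<close> forms, whose coefficient matrix
  is square with trivial kernel, hence invertible.\<close>

lemma general_position_interpolate:
  fixes a :: "'m::finite => 'o::finite => complex"
  assumes gp: "general_position a" and T: "card T \<le> CARD('m)" and m: "CARD('m) \<le> CARD('o)"
  shows "\<exists>x. \<forall>i\<in>T. form a x i = c i"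
proof -
  obtain T' where T': "T \<subseteq> T'" "card T' = CARD('m)"
    using exists_subset_between[of T "CARD('m)" UNIV] T m by auto
  obtain \<beta> where \<beta>: "bij_betw \<beta> (UNIV :: 'm set) T'"
    using finite_same_card_bij[of "UNIV :: 'm set" T'] T'(2) by (metis finite)
  define M :: "complex^'m^'m" where "M = (\<chi> k' k. a k (\<beta> k'))"
  have Mx: "(M *v x) $ k = form a x (\<beta> k)" for x k
    by (simp add: M_def matrix_vector_mult_def form_def mult.commute)
  have "x = 0" if "M *v x = 0" for x
  proof (rule ccontr)
    assume "x \<noteq> 0"
    have "T' \<subseteq> {i. form a x i = 0}"
      using that Mx[of x] \<beta> by (fastforce simp: bij_betw_def)
    then have "CARD('m) \<le> card {i. form a x i = 0}"
      using T'(2) by (metis card_mono finite)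
    with gp \<open>x \<noteq> 0\<close> show False unfolding general_position_def by (metis linorder_not_le)
  qed
  then have "\<exists>B. M ** B = mat 1"
    using matrix_left_invertible_ker[of M] by (metis matrix_left_right_inverse)
  then obtain B where B: "M ** B = mat 1" ..
  define x where "x = B *v (\<chi> k. c (\<beta> k))"
  have "M *v x = (\<chi> k. c (\<beta> k))"
    unfolding x_def by (simp add: matrix_vector_mul_assoc B)
  then have eq: "form a x (\<beta> k) = c (\<beta> k)" for k by (metis Mx vec_lambda_beta)
  have "form a x i = c i" if "i \<in> T" for i
  proof -
    have "i \<in> range \<beta>" using that T'(1) \<beta> by (auto simp: bij_betw_def)
    then show ?thesis using eq by auto
  qed
  then show ?thesis by blast
qed

lemma general_position_form_inj:
  assumes "general_position (a :: 'm::finite => 'o::finite => complex)" "CARD('m) \<le> CARD('o)" "form a x = (\<lambda>_. 0)"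
  shows "x = 0"
proof (rule ccontr)
  assume "x \<noteq> 0"
  then have "card {i. form a x i = 0} < CARD('m)" using assms(1) by (simp add: general_position_def)
  moreover have "{i. form a x i = 0} = UNIV" using assms(3) by simp
  ultimately show False using assms(2) by simp
qed

text \<open>Points of the moment curve: \<open>form a x i\<close> is the value at \<open>c i\<close>
  of a polynomial of degree below \<open>CARD('m)\<close>, which has too few roots.\<close>

lemma exists_general_position:
  "\<exists>a :: 'm::finite => 'o::finite => complex. general_position a"
proof -
  obtain \<kappa> where \<kappa>: "bij_betw \<kappa> (UNIV :: 'm set) {0..<CARD('m)}"
    using ex_bij_betw_finite_nat[of "UNIV :: 'm set"] by auto
  obtain c0 where "bij_betw c0 (UNIV :: 'o set) {0..<CARD('o)}"
    using ex_bij_betw_finite_nat[of "UNIV :: 'o set"] by auto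
  then have c0: "inj c0" by (simp add: bij_betw_def)
  define c where "c i = complex_of_nat (c0 i)" for i
  have c: "inj c" using c0 by (auto simp: inj_def c_def)
  define a where "a k i = c i ^ \<kappa> k" for k i
  have "card {i. form a x i = 0} < CARD('m)" if "x \<noteq> 0" for x :: "complex^'m"
  proof -
    define p where "p = (\<Sum>k\<in>UNIV. monom (x $ k) (\<kappa> k))"
    have p: "poly p (c i) = form a x i" for i
      by (simp add: p_def poly_sum poly_monom form_def a_def)
    obtain k where k: "x $ k \<noteq> 0" using \<open>x \<noteq> 0\<close> by (auto simp: vec_eq_iff)
    have "coeff p (\<kappa> k) = (\<Sum>l\<in>UNIV. if l = k then x $ k else 0)"
      unfolding p_def coeff_sum coeff_monom
      using \<kappa> by (intro sum.cong refl) (auto simp: bij_betw_def inj_on_def)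
    then have "p \<noteq> 0" using k by auto
    have \<kappa>_less: "\<kappa> k < CARD('m)" for k using \<kappa> by (auto simp: bij_betw_def)
    have "degree p \<le> CARD('m) - 1"
      unfolding p_def
    proof (rule degree_sum_le)
      show "degree (monom (x $ k) (\<kappa> k)) \<le> CARD('m) - 1" for k
        using degree_monom_le[of "x $ k" "\<kappa> k"] \<kappa>_less[of k] by linarith
    qed simp
    moreover have "card {i. form a x i = 0} \<le> card {z. poly p z = 0}"
      using c poly_roots_finite[OF \<open>p \<noteq> 0\<close>]
      by (intro card_inj_on_le[of c]) (auto simp: p[symmetric] intro: inj_on_subset)
    moreover have "card {z. poly p z = 0} \<le> degree p" by (rule card_poly_roots_bound[OF \<open>p \<noteq> 0\<close>])
    moreover have "CARD('m) > 0" by simp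
    ultimately show ?thesis by linarith
  qed
  then show ?thesis unfolding general_position_def by blast
qed

text \<open>The line through the origin and \<open>x\<close> consists of zeros, so the derivative
  kills \<open>x\<close>. Together with a Sard argument this excludes nonzero zeros of a generic
  homogeneous system.\<close>

lemma homogeneous_degenerate:
  fixes f :: "complex^'m::finite => complex^'m"
  assumes hom: "\<And>c. f (c *s x) = c ^ d *s f x" and "f x = 0" "x \<noteq> 0"
  shows "\<not> nondegenerate f x"
proof
  assume "nondegenerate f x"
  then obtain f' where f': "(f has_derivative f') (at x)" "\<And>h. f' h = 0 ==> h = 0"
    unfolding nondegenerate_def by blast
  have "((\<lambda>t::real. x + t *\<^sub>R x) has_derivative (\<lambda>t. t *\<^sub>R x)) (at 0)"
    by (auto intro!: derivative_eq_intros)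
  moreover have "(f has_derivative f') (at (x + 0 *\<^sub>R x))" using f'(1) by simp
  ultimately have "((\<lambda>t. f (x + t *\<^sub>R x)) has_derivative (\<lambda>t. f' (t *\<^sub>R x))) (at 0)"
    by (rule has_derivative_compose)
  moreover have "f (x + t *\<^sub>R x) = 0" for t
  proof -
    have "x + t *\<^sub>R x = (1 + complex_of_real t) *s x" by (simp add: scaleR_eq_smult vec_eq_iff algebra_simps)
    then have "f (x + t *\<^sub>R x) = f ((1 + complex_of_real t) *s x)" by (simp only:)
    then show ?thesis unfolding hom assms(2) by simp
  qed
  ultimately have "((\<lambda>t::real. 0) has_derivative (\<lambda>t. f' (t *\<^sub>R x))) (at 0)" by simp
  from fun_cong[OF has_derivative_unique[OF this has_derivative_const], of 1] have "f' x = 0" by simp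
  with f'(2) \<open>x \<noteq> 0\<close> show False by blast
qed

lemma open_not_in_negligible:
  assumes "open U" "U \<noteq> {}" "negligible N" obtains z where "z \<in> U" "z \<notin> N"
  using assms open_not_negligible negligible_subset by blast

section \<open>Values where two or three of the forms vanish\<close>

lemma co_prod_remove: "l \<notin> X ==> co_prod y X = y l * co_prod y (insert l X)"
proof -
  assume "l \<notin> X"
  moreover have "- X - {l} = - insert l X" by auto
  ultimately show ?thesis unfolding co_prod_def by (subst prod.remove[of _ l]) auto
qed

lemma co_prod_nz: "(\<And>i. i \<notin> X ==> y i \<noteq> 0) ==> co_prod y X \<noteq> 0"
  by (simp add: co_prod_def)

lemma co_prod_zero: "i \<notin> X ==> y i = 0 ==> co_prod y X = 0"
  by (auto simp: co_prod_def intro!: prod_zero bexI[of _ i])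

lemma sum_doubleton:
  fixes f :: "'o::finite => 'o => complex"
  assumes "i \<noteq> j" and f: "\<And>p q. {p, q} \<noteq> {i, j} ==> f p q = 0"
  shows "(\<Sum>p\<in>UNIV. \<Sum>q\<in>UNIV. f p q) = f i j + f j i"
proof -
  have "(\<Sum>p\<in>UNIV. \<Sum>q\<in>UNIV. f p q) = (\<Sum>p\<in>{i, j}. \<Sum>q\<in>UNIV. f p q)"
    using f by (intro sum.mono_neutral_right ballI sum.neutral) (auto simp: doubleton_eq_iff)
  also have "\<dots> = (\<Sum>p\<in>{i, j}. \<Sum>q\<in>{i, j}. f p q)"
    using f by (intro sum.cong refl sum.mono_neutral_right) (auto simp: doubleton_eq_iff)
  finally show ?thesis using f[of i i] f[of j j] \<open>i \<noteq> j\<close> by (simp add: doubleton_eq_iff)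
qed

lemma elem_sym_two_zeros:
  assumes "y i = 0" "y j = 0" "i \<noteq> j" shows "elem_sym y = 0"
proof -
  have "co_prod y {l} = 0" for l
    using assms by (cases "l = i") (auto intro: co_prod_zero[of j] co_prod_zero[of i])
  then show ?thesis by (simp add: elem_sym_def)
qed

text \<open>Only the pair {i, j} omits both vanishing factors from the product.\<close>

lemma edge_sum_two_zeros:
  assumes y: "y i = 0" "y j = 0" and ij: "i \<noteq> j"
  shows "edge_sum A y = edge A i j * co_prod y {i, j}"
proof -
  have "(\<Sum>p\<in>UNIV. \<Sum>q\<in>UNIV. edge A p q * co_prod y {p, q}) =
      edge A i j * co_prod y {i, j} + edge A j i * co_prod y {j, i}"
  proof (rule sum_doubleton[OF ij])
    fix p q assume pq: "{p, q} \<noteq> {i, j}"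
    show "edge A p q * co_prod y {p, q} = 0"
    proof (cases "p = q")
      case False
      then have "\<exists>l\<in>{i, j}. l \<notin> {p, q}" using pq ij by auto
      then show ?thesis using y by (auto intro: co_prod_zero)
    qed simp
  qed
  then show ?thesis by (simp add: edge_sum_def edge_commute[of _ j i] insert_commute[of j i])
qed

lemma ddet_two_zeros:
  assumes y: "{l. y l = 0} = {i, j}" and h: "h i = 1" "h j = 0"
  shows "ddet (arr y) (arr h) = co_prod y {i, j}"
proof -
  have "(\<Sum>l\<in>- {p}. h l * co_prod y {l, p}) = (if p = j then co_prod y {i, j} else 0)" for p
  proof (cases "p = j")
    case True
    have "i \<noteq> j" using h by auto
    then have "(\<Sum>l\<in>- {p}. h l * co_prod y {l, p}) = (\<Sum>l\<in>{i}. h l * co_prod y {l, p})"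
      using y True by (intro sum.mono_neutral_right) (auto intro: co_prod_zero[of i])
    then show ?thesis using h True by simp
  next
    case False
    have "h l * co_prod y {l, p} = 0" if "l \<noteq> p" for l
      using y h False co_prod_zero[of j "{l, p}" y] by (cases "l = j") auto
    then show ?thesis using False by (simp add: sum.neutral)
  qed
  then show ?thesis unfolding ddet_arr_arr by simp
qed

lemma ddet_three_zeros:
  assumes y: "y i = 0" "y j = 0" "y k = 0" and ijk: "i \<noteq> j" "i \<noteq> k" "j \<noteq> k"
  shows "ddet (arr y) (arr h) = 0"
proof -
  have "co_prod y {l, p} = 0" for l p
  proof -
    have "\<not> {i, j, k} \<subseteq> {l, p}"
      using card_mono[of "{l, p}" "{i, j, k}"] ijk by (auto simp: card_insert_if split: if_splits)
    then show ?thesis using y by (auto intro: co_prod_zero)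
  qed
  then show ?thesis unfolding ddet_arr_arr by simp
qed

text \<open>A product survives only if the omitted indices are \<open>i\<close>, \<open>j\<close>
  and \<open>k\<close>; the three terms differ in which of them carries \<open>h\<close>.\<close>

lemma d2det_at_node:
  fixes y h :: "'n::finite option => complex" and A :: "complex^'n^'n"
  assumes y: "y i = 0" "y j = 0" "y k = 0" and ijk: "i \<noteq> j" "i \<noteq> k" "j \<noteq> k"
  shows "d2det (arr y) (arr h) A = (h i * edge A j k + h j * edge A i k + h k * edge A i j) * co_prod y {i, j, k}"
proof -
  define w where "w a b c p q = (if {p, q} = {b, c} then h a * edge A p q * co_prod y {i, j, k} else 0)" for a b c p q
  have w: "(\<Sum>p\<in>UNIV. \<Sum>q\<in>UNIV. w a b c p q) = 2 * (h a * edge A b c * co_prod y {i, j, k})" if "b \<noteq> c" for a b c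
    by (subst sum_doubleton[OF that]) (simp_all add: w_def insert_commute edge_commute[of _ c b])
  have S: "(\<Sum>l\<in>- {p, q}. h l * co_prod y {l, p, q}) = h a * co_prod y {i, j, k}"
    if "{a, p, q} = {i, j, k}" "a \<notin> {p, q}" for a p q
  proof -
    have "a \<in> {i, j, k}" unfolding that(1)[symmetric] by simp
    then have "y a = 0" using y by auto
    then have "(\<Sum>l\<in>- {p, q}. h l * co_prod y {l, p, q}) = (\<Sum>l\<in>{a}. h l * co_prod y {l, p, q})"
      using that(2) by (intro sum.mono_neutral_right) (auto intro: co_prod_zero[of a])
    then show ?thesis by (simp add: that(1))
  qed
  have "edge A p q * (\<Sum>l\<in>- {p, q}. h l * co_prod y {l, p, q}) = w i j k p q + w j i k p q + w k i j p q" for p q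
  proof -
    consider "{p, q} = {j, k}" | "{p, q} = {i, k}" | "{p, q} = {i, j}"
      | "{p, q} \<noteq> {j, k}" "{p, q} \<noteq> {i, k}" "{p, q} \<noteq> {i, j}" by blast
    then show ?thesis
    proof cases
      case 1
      then show ?thesis using S[of i p q] ijk by (auto simp: w_def doubleton_eq_iff)
    next
      case 2
      then show ?thesis using S[of j p q] ijk by (auto simp: w_def doubleton_eq_iff insert_commute)
    next
      case 3
      then show ?thesis using S[of k p q] ijk by (auto simp: w_def doubleton_eq_iff insert_commute)
    next
      case 4
      have "h l * co_prod y {l, p, q} = 0" if "l \<in> - {p, q}" for l
      proof -
        have "i \<notin> {l, p, q} \<or> j \<notin> {l, p, q} \<or> k \<notin> {l, p, q}" using 4 ijk that by auto
        then show ?thesis using y by (metis co_prod_zero mult_zero_right)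
      qed
      then have "(\<Sum>l\<in>- {p, q}. h l * co_prod y {l, p, q}) = 0" by (intro sum.neutral) blast
      then show ?thesis using 4 by (simp add: w_def)
    qed
  qed
  then show ?thesis unfolding d2det_arr_arr by (simp add: sum.distrib w ijk algebra_simps)
qed

text \<open>On a line in direction \<open>u\<close> the coefficient of top degree is
  \<open>elem_sym (form a u)\<close>, whatever the base point, so the bound is uniform in
  \<open>z\<close>.\<close>

lemma card_roots_line:
  fixes u z :: "complex^'m::finite" and a :: "'m => 'o::finite => complex"
  assumes u: "elem_sym (form a u) \<noteq> 0"
  shows "finite {t::real. elem_sym (form a (z + t *\<^sub>R u)) = 0} \<and> card {t::real. elem_sym (form a (z + t *\<^sub>R u)) = 0} \<le> CARD('o) - 1"
proof -
  define p where "p = (\<Sum>i\<in>UNIV. \<Prod>j\<in>- {i}. [:form a z j, form a u j:])"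
  have p: "poly p (of_real t) = elem_sym (form a (z + t *\<^sub>R u))" for t :: real
    by (simp add: p_def poly_sum poly_prod elem_sym_def co_prod_def scaleR_eq_smult form_linear)
  have cp: "degree (\<Prod>j\<in>J. [:b j, c j:]) \<le> card J \<and> coeff (\<Prod>j\<in>J. [:b j, c j:]) (card J) = (\<Prod>j\<in>J. c j)"
    for J :: "'o set" and b c :: "'o => complex"
    using finite[of J]
  proof (induction J rule: finite_induct)
    case (insert j J)
    have d: "degree (\<Prod>j\<in>J. [:b j, c j:]) \<le> card J" using insert by blast
    then have "coeff (\<Prod>j\<in>J. [:b j, c j:]) (Suc (card J)) = 0" by (intro coeff_eq_0) simp
    moreover have "degree ([:b j, c j:] * (\<Prod>j\<in>J. [:b j, c j:])) \<le> 1 + card J"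
      by (rule order_trans[OF degree_mult_le add_mono[OF _ d]]) simp
    ultimately show ?case using insert by (simp add: coeff_pCons)
  qed simp
  have card: "card (- {i}) = CARD('o) - 1" for i :: 'o
    by (simp add: Compl_eq_Diff_UNIV)
  have "degree p \<le> CARD('o) - 1"
    unfolding p_def by (rule degree_sum_le) (use cp card in \<open>metis finite\<close>)+
  moreover have "coeff p (CARD('o) - 1) = elem_sym (form a u)"
    unfolding p_def coeff_sum elem_sym_def co_prod_def by (intro sum.cong refl) (metis cp card)
  then have "p \<noteq> 0" using u by auto
  moreover have inj: "inj_on complex_of_real {t. elem_sym (form a (z + t *\<^sub>R u)) = 0}" by (auto simp: inj_on_def)
  moreover have img: "complex_of_real ` {t. elem_sym (form a (z + t *\<^sub>R u)) = 0} \<subseteq> {s. poly p s = 0}"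
    by (auto simp: p)
  moreover have fin: "finite {s. poly p s = 0}" using \<open>p \<noteq> 0\<close> by (rule poly_roots_finite)
  moreover have "card {s. poly p s = 0} \<le> degree p" by (rule card_poly_roots_bound[OF \<open>p \<noteq> 0\<close>])
  ultimately show ?thesis
    using card_inj_on_le[OF inj img fin] inj_on_finite[OF inj img fin] by linarith
qed

text \<open>Rescaling the forms by generic weights, the determinant has no singular point off the arrangement.\<close>

lemma exists_smooth_arrangement:
  assumes n: "CARD('n) \<ge> 2" and m: "CARD('m) \<le> CARD('n) + 1"
  obtains a :: "'m::finite => 'n::finite option => complex" where "general_position a"
    "\<And>x. (\<And>i. form a x i \<noteq> 0) ==> \<exists>h. ddet (arr (form a x)) (arr (form a h)) \<noteq> 0"
proof -
  have m': "CARD('m) \<le> CARD('n option)" using m by simp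
  obtain b :: "'m => 'n option => complex" where b: "general_position b"
    using exists_general_position by blast
  \<comment> \<open>\<open>c i k\<close> is a partial derivative of the product of all forms of
    \<open>b\<close> except the one with index \<open>i\<close>. Weighted sums of these products
    form a linear family, and the argument is that of Bertini's theorem.\<close>
  define c where "c i k z = (\<Sum>l\<in>- {i}. b k l * co_prod (\<lambda>j. \<Sum>k'\<in>UNIV. z k' * b k' j) {l, i})" for i k and z :: "'m => complex"
  have c_vec: "c i k (vec_nth x) = (\<Sum>l\<in>- {i}. b k l * co_prod (form b x) {l, i})" for i k x
    by (simp add: c_def form_def[abs_def])
  have poly: "poly_fun (c i k)" for i k
    unfolding c_def co_prod_def by (intro poly_fun_intros)
  define Bad where "Bad = {w. \<exists>x. spanning c x \<and> linear_family c (\<lambda>_ _. 0) w x = 0 \<and>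
      (\<not> nondegenerate (linear_family c (\<lambda>_ _. 0) w) x \<or> x \<in> {})}"
  have neg: "negligible Bad"
    unfolding Bad_def by (rule negligible_degenerate[where u=0 and N=0]) (auto intro: poly poly_fun.const)
  have op: "open {w :: complex^'n option. \<forall>i. w $ i \<noteq> 0}"
  proof -
    have "{w :: complex^'n option. \<forall>i. w $ i \<noteq> 0} = (\<Inter>i. {w. w $ i \<noteq> 0})" by auto
    also have "open \<dots>" by (intro open_INT ballI open_Collect_neq continuous_intros) simp
    finally show ?thesis .
  qed
  have ne: "{w :: complex^'n option. \<forall>i. w $ i \<noteq> 0} \<noteq> {}" by (auto intro!: exI[of _ "\<chi> i. 1"])
  obtain w :: "complex^'n option" where w_in: "w \<in> {w. \<forall>i. w $ i \<noteq> 0}" and w_good: "w \<notin> Bad"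
    by (rule open_not_in_negligible[OF op ne neg])
  have w: "w $ i \<noteq> 0" for i using w_in by simp
  have nd: "nondegenerate (linear_family c (\<lambda>_ _. 0) w) x"
    if "spanning c x" "linear_family c (\<lambda>_ _. 0) w x = 0" for x
    using w_good that unfolding Bad_def by blast
  \<comment> \<open>Dividing each form by its weight turns \<open>elem_sym\<close> into the weighted
    sum of products, up to the product of all weights.\<close>
  define a where "a k i = b k i / w $ i" for k i
  have fa: "form a x i = form b x i / w $ i" for x i
    by (simp add: form_def a_def sum_divide_distrib)
  have "general_position a"
    using b w by (simp add: general_position_def fa)
  moreover have "\<exists>h. ddet (arr (form a x)) (arr (form a h)) \<noteq> 0" if x: "\<And>i. form a x i \<noteq> 0" for x
  proof (rule ccontr)
    assume no: "\<nexists>h. ddet (arr (form a x)) (arr (form a h)) \<noteq> 0"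
    define P where "P = (\<Prod>i\<in>UNIV. w $ i)"
    have P: "P \<noteq> 0" using w by (simp add: P_def)
    have fb: "form b x i \<noteq> 0" for i using x[of i] by (auto simp: fa)
    have "x \<noteq> 0" using x by (auto simp: form_def)
    have co: "co_prod (form a x) {l, i} = co_prod (form b x) {l, i} * (w $ l * w $ i) / P" if "l \<noteq> i" for l i
    proof -
      have "P = w $ l * (w $ i * (\<Prod>j\<in>- {l, i}. w $ j))"
      proof -
        have "UNIV - {l} - {i} = - {l, i}" by auto
        then show ?thesis
          using that unfolding P_def by (simp add: prod.remove[of UNIV l] prod.remove[of "UNIV - {l}" i])
      qed
      moreover have "co_prod (form a x) {l, i} = co_prod (form b x) {l, i} / (\<Prod>j\<in>- {l, i}. w $ j)"
        by (simp add: co_prod_def fa prod_dividef)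
      ultimately show ?thesis using w P by (simp add: field_simps)
    qed
    have sum0: "(\<Sum>i\<in>UNIV. w $ i * (\<Sum>l\<in>- {i}. form b h l * co_prod (form b x) {l, i})) = 0" for h
    proof -
      have "0 = ddet (arr (form a x)) (arr (form a h))" using no by simp
      also have "\<dots> = (\<Sum>i\<in>UNIV. \<Sum>l\<in>- {i}. w $ i * (form b h l * co_prod (form b x) {l, i}) / P)"
        unfolding ddet_arr_arr
      proof (intro sum.cong refl)
        fix i l :: "'n option" assume "l \<in> - {i}"
        then show "form a h l * co_prod (form a x) {l, i} = w $ i * (form b h l * co_prod (form b x) {l, i}) / P"
          using w[of l] by (simp add: co fa)
      qed
      also have "\<dots> = (\<Sum>i\<in>UNIV. w $ i * (\<Sum>l\<in>- {i}. form b h l * co_prod (form b x) {l, i})) / P"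
        by (simp add: sum_divide_distrib sum_distrib_left)
      finally show ?thesis using P by simp
    qed
    have "linear_family c (\<lambda>_ _. 0) w x = 0"
    proof -
      have "(\<Sum>i\<in>UNIV. w $ i * c i k (vec_nth x)) = 0" for k
        using sum0[of "axis k 1"] by (simp add: c_vec form_axis)
      then show ?thesis by (simp add: linear_family_def vec_eq_iff)
    qed
    moreover have "spanning c x"
      unfolding spanning_def
    proof (intro allI impI)
      fix h :: "complex^'m" assume h: "\<forall>i. (\<Sum>k\<in>UNIV. h $ k * c i k (vec_nth x)) = 0"
      \<comment> \<open>In terms of logarithmic derivatives, the sum over all indices but one
        vanishes, so each \<theta> equals the total \<Theta>; adding up gives
        \<open>CARD('n) * \<Theta> = 0\<close>.\<close>
      define \<theta> where "\<theta> l = form b h l / form b x l" for l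
      have s: "(\<Sum>l\<in>- {i}. \<theta> l) = 0" for i
      proof -
        have "0 = (\<Sum>k\<in>UNIV. h $ k * c i k (vec_nth x))" using h by simp
        also have "\<dots> = (\<Sum>k\<in>UNIV. \<Sum>l\<in>- {i}. h $ k * b k l * co_prod (form b x) {l, i})"
          by (simp add: c_vec sum_distrib_left mult.assoc)
        also have "\<dots> = (\<Sum>l\<in>- {i}. \<Sum>k\<in>UNIV. h $ k * b k l * co_prod (form b x) {l, i})"
          by (rule sum.swap)
        also have "\<dots> = (\<Sum>l\<in>- {i}. form b h l * co_prod (form b x) {l, i})"
          by (simp add: form_def sum_distrib_right)
        also have "\<dots> = (\<Sum>l\<in>- {i}. \<theta> l * co_prod (form b x) {i})"
          by (intro sum.cong refl) (use fb in \<open>simp add: \<theta>_def co_prod_remove[of _ "{_}"]\<close>)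
        also have "\<dots> = (\<Sum>l\<in>- {i}. \<theta> l) * co_prod (form b x) {i}" by (simp add: sum_distrib_right)
        finally show ?thesis using co_prod_nz[of "{i}" "form b x"] fb by auto
      qed
      define \<Theta> where "\<Theta> = (\<Sum>l\<in>UNIV. \<theta> l)"
      have "\<Theta> = \<theta> i" for i
        using s[of i] unfolding \<Theta>_def by (simp add: sum.remove[of UNIV i] Compl_eq_Diff_UNIV)
      then have "(\<Sum>l\<in>UNIV. \<theta> l) = (\<Sum>l\<in>(UNIV :: 'n option set). \<Theta>)" by (simp only:)
      then have "\<Theta> = of_nat (CARD('n) + 1) * \<Theta>" by (simp add: \<Theta>_def[symmetric])
      then have "of_nat CARD('n) * \<Theta> = 0" by (simp add: algebra_simps)
      then have "\<Theta> = 0" by simp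
      then have "form b h l = 0" for l using \<open>\<And>i. \<Theta> = \<theta> i\<close>[of l] fb[of l] by (simp add: \<theta>_def)
      then show "h = 0" using general_position_form_inj[OF b m'] by (simp add: fun_eq_iff)
    qed
    ultimately have nondeg: "nondegenerate (linear_family c (\<lambda>_ _. 0) w) x" using nd by blast
    have "linear_family c (\<lambda>_ _. 0) w (t *s x) = t ^ (CARD('n) - 1) *s linear_family c (\<lambda>_ _. 0) w x" for t
    proof -
      have "co_prod (form b (t *s x)) {l, i} = t ^ (CARD('n) - 1) * co_prod (form b x) {l, i}" if "l \<noteq> i" for l i
        using that by (simp add: co_prod_def form_smult prod.distrib Compl_eq_Diff_UNIV card_Diff_subset)
      then have "c i k (vec_nth (t *s x)) = t ^ (CARD('n) - 1) * c i k (vec_nth x)" for i k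
        unfolding c_vec sum_distrib_left by (intro sum.cong refl) simp
      then show ?thesis
        by (simp add: linear_family_def vec_eq_iff sum_distrib_left mult.left_commute)
    qed
    from homogeneous_degenerate[of "linear_family c (\<lambda>_ _. 0) w", OF this \<open>linear_family c (\<lambda>_ _. 0) w x = 0\<close> \<open>x \<noteq> 0\<close>] nondeg
    show False by blast
  qed
  ultimately show ?thesis using that by blast
qed

lemma arr_eq_0: "CARD('n) \<ge> 2 ==> arr y = (0 :: complex^'n^'n) ==> y = (\<lambda>_. 0)"
proof
  fix i assume n: "CARD('n) \<ge> 2" and y: "arr y = (0 :: complex^'n^'n)"
  have "\<not> (UNIV :: 'n set) \<subseteq> {undefined}" using n card_mono[of "{undefined}" "UNIV :: 'n set"] by auto
  then obtain r s :: 'n where "r \<noteq> s" by blast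
  then have N: "y None = 0" using arg_cong[OF y, of "\<lambda>M. M $ r $ s"] by (simp add: arr_def)
  show "y i = 0"
  proof (cases i)
    case (Some r)
    then show ?thesis using N arg_cong[OF y, of "\<lambda>M. M $ r $ r"] by (simp add: arr_def)
  qed (use N in simp)
qed

text \<open>Polarisation with the vertex \<open>None\<close> as origin: squared lengths of the edges
  determine the inner products.\<close>

lemma exists_edges:
  fixes e :: "'n::finite option => 'n option => complex"
  assumes "\<And>i j. e i j = e j i" "\<And>i. e i i = 0"
  shows "\<exists>A :: complex^'n^'n. transpose A = A \<and> (\<forall>i j. edge A i j = e i j)"
proof -
  define A :: "complex^'n^'n" where
    "A = (\<chi> r s. (e None (Some r) + e None (Some s) - e (Some r) (Some s)) / 2)"
  have "transpose A = A"
    using assms by (simp add: A_def transpose_def vec_eq_iff add.commute)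
  moreover have "edge A i j = e i j" for i j
    using assms by (cases i; cases j) (auto simp: edge_def qent_def A_def field_simps)
  ultimately show ?thesis by blast
qed

definition sym_unit :: "'n \<times> 'n => complex^'n^'n" where
  "sym_unit e = (\<chi> r s. (if (r, s) = e then 1 else 0) + (if (s, r) = e then 1 else 0))"

lemma sum_sym_unit: "(\<Sum>e\<in>UNIV. cscale (z e) (sym_unit e)) = (\<chi> r s. z (r, s) + z (s, r))"
proof -
  have "(\<Sum>e\<in>UNIV. z e * ((if (r, s) = e then 1 else 0) + (if (s, r) = e then 1 else 0))) = z (r, s) + z (s, r)" for r s
    by (simp add: distrib_left sum.distrib if_distrib[of "\<lambda>c. _ * c"] cong: if_cong)
  then show ?thesis by (simp add: vec_eq_iff cscale_def sym_unit_def)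
qed

lemma symmetric_eq_sum:
  assumes "transpose A = A" shows "A = (\<Sum>e\<in>UNIV. cscale (A $ fst e $ snd e / 2) (sym_unit e))"
proof -
  have "A $ r $ s = A $ s $ r" for r s
    using arg_cong[OF assms, of "\<lambda>M. M $ s $ r"] by (simp add: transpose_def)
  then show ?thesis unfolding sum_sym_unit by (simp add: vec_eq_iff)
qed

lemma d2det_linear2: "finite K ==> d2det M X (\<Sum>k\<in>K. cscale (y k) (A k)) = (\<Sum>k\<in>K. y k * d2det M X (A k))"
  using d2det_linear[of K M y A X] by (simp add: d2det_commute[of M X])

text \<open>Where the pencil is invertible or off the arrangement, the gradient of \<open>ddet \<Sigma> A\<close> can be prescribed by the
  choice of the symmetric matrix \<open>A\<close>.\<close>

lemma d2det_arr_nondegenerate: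
  fixes y h :: "'n::finite option => complex"
  assumes n: "CARD('n) \<ge> 2" and y: "det (arr y :: complex^'n^'n) \<noteq> 0 \<or> (\<forall>i. y i \<noteq> 0)"
    and zero: "\<And>A :: complex^'n^'n. transpose A = A ==> d2det (arr y) (arr h) A = 0"
  shows "h = (\<lambda>_. 0)"
  using y
proof
  assume "det (arr y :: complex^'n^'n) \<noteq> 0"
  then obtain K :: "complex^'n^'n" where K: "arr y ** K = mat 1"
    by (metis invertible_det_nz invertible_right_inverse)
  then have K': "K ** arr y = mat 1" using matrix_left_right_inverse by blast
  define S H where "S = (arr y :: complex^'n^'n)" and "H = (arr h :: complex^'n^'n)"
  have tr: "trace (K ** H ** K ** X) = trace (K ** H) * trace (K ** X)" if "transpose X = X" for X
    using zero[OF that] d2det_inverse[OF K, of H X] \<open>det (arr y) \<noteq> 0\<close> by (simp add: H_def)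
  \<comment> \<open>The choice \<open>A = S\<close> gives this relation, which forces the trace to
    be 0 because n \<noteq> 1.\<close>
  have "trace (K ** H) = trace (K ** H) * of_nat CARD('n)"
    using tr[of S] K' by (simp add: S_def transpose_arr matrix_mul_assoc[symmetric] trace_I)
  then have "trace (K ** H) * (of_nat CARD('n) - 1) = 0" by (simp add: algebra_simps)
  moreover have "of_nat CARD('n) - 1 \<noteq> (0 :: complex)" using n by (auto simp: of_nat_eq_1_iff)
  ultimately have tr0: "trace (K ** H) = 0" by simp
  have "H $ r $ s = 0" for r s
  proof -
    define X where "X = sym_unit (r, s)"
    have "transpose X = X" by (auto simp: X_def sym_unit_def transpose_def vec_eq_iff)
    \<comment> \<open>Testing with \<open>S ** X ** S\<close> cancels both inverses and leaves
      \<open>trace (H ** X)\<close>, which is twice an entry of the symmetric matrix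
      \<open>H\<close>.\<close>
    then have "transpose (S ** X ** S) = S ** X ** S"
      by (simp add: matrix_transpose_mul S_def transpose_arr matrix_mul_assoc)
    then have "trace (K ** H ** K ** (S ** X ** S)) = 0" using tr tr0 by simp
    moreover have "K ** H ** K ** (S ** X ** S) = K ** (H ** X ** S)"
      using K' by (simp add: S_def matrix_mul_assoc[symmetric]) (simp add: matrix_mul_assoc)
    moreover have "trace (K ** (H ** X ** S)) = trace (H ** X)"
      using K K' trace_mul_sym[of K "H ** X ** S"] by (simp add: S_def matrix_mul_assoc[symmetric])
    moreover have "trace (H ** X) = H $ r $ s + H $ s $ r"
    proof -
      have "trace (H ** X) = (\<Sum>i\<in>UNIV. \<Sum>k\<in>UNIV. (if k = r then if i = s then H $ i $ k else 0 else 0) +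
          (if k = s then if i = r then H $ i $ k else 0 else 0))"
        unfolding trace_def matrix_matrix_mult_def
        by (simp, intro sum.cong refl) (auto simp: X_def sym_unit_def)
      then show ?thesis by (simp add: sum.distrib add.commute)
    qed
    moreover have "H $ r $ s = H $ s $ r" by (simp add: H_def arr_def)
    ultimately show ?thesis by simp
  qed
  then show ?thesis using arr_eq_0[OF n] by (simp add: H_def vec_eq_iff)
next
  assume y: "\<forall>i. y i \<noteq> 0"
  \<comment> \<open>Matrices with a single nonzero edge show that the \<theta> sum to 0 over the
    complement of any two indices. With at least three indices this makes all \<theta> equal, and
    comparing totals makes them 0.\<close>
  define \<theta> where "\<theta> l = h l / y l" for l
  have s: "(\<Sum>l\<in>- {i0, j0}. \<theta> l) = 0" if ij: "i0 \<noteq> j0" for i0 j0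
  proof -
    define e where "e i j = (if (i = i0 \<and> j = j0) \<or> (i = j0 \<and> j = i0) then 1 else 0 :: complex)" for i j
    have "e i j = e j i" "e i i = 0" for i j using ij by (auto simp: e_def)
    then obtain A :: "complex^'n^'n" where A: "transpose A = A" "\<And>i j. edge A i j = e i j"
      using exists_edges[of e] by blast
    define q where "q i j = (\<Sum>l\<in>- {i, j}. h l * co_prod y {l, i, j})" for i j
    have q: "q i j = q j i" for i j by (simp add: q_def insert_commute)
    have "0 = (\<Sum>i\<in>UNIV. \<Sum>j\<in>UNIV. e i j * q i j) / 2"
      using zero[OF A(1)] by (simp add: d2det_arr_arr A(2) q_def)
    also have "\<dots> = (e i0 j0 * q i0 j0 + e j0 i0 * q j0 i0) / 2"
      by (subst sum_doubleton[OF ij]) (auto simp: e_def doubleton_eq_iff)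
    finally have "q i0 j0 = 0" using q[of j0 i0] by (simp add: e_def)
    moreover have "q i0 j0 = (\<Sum>l\<in>- {i0, j0}. \<theta> l) * co_prod y {i0, j0}"
      unfolding q_def sum_distrib_right
      by (intro sum.cong refl) (use y in \<open>simp add: \<theta>_def co_prod_remove[of _ "{i0, j0}"]\<close>)
    ultimately show ?thesis using co_prod_nz[of "{i0, j0}" y] y by simp
  qed
  define \<Theta> where "\<Theta> = (\<Sum>l\<in>UNIV. \<theta> l)"
  have s2: "\<Theta> = \<theta> i + \<theta> j" if "i \<noteq> j" for i j
  proof -
    have "\<Theta> = (\<Sum>l\<in>{i, j}. \<theta> l) + (\<Sum>l\<in>- {i, j}. \<theta> l)"
      unfolding \<Theta>_def by (subst sum.union_disjoint[symmetric]) auto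
    then show ?thesis using s[OF that] that by simp
  qed
  have eq: "\<theta> i = \<theta> j" for i j
  proof -
    have "card {i, j} < CARD('n option)" using n card_insert_le_m1[of 2 "{j}" i] by (simp add: card_insert_if)
    then have "{i, j} \<noteq> UNIV" by (metis less_irrefl)
    then obtain k where "k \<noteq> i" "k \<noteq> j" by blast
    then show ?thesis using s2[of i k] s2[of j k] by simp
  qed
  have "\<theta> i = 0" for i
  proof -
    have "\<Theta> = of_nat (CARD('n) + 1) * \<theta> i"
    proof -
      have "\<Theta> = (\<Sum>l\<in>(UNIV :: 'n option set). \<theta> i)"
        unfolding \<Theta>_def by (intro sum.cong refl eq)
      then show ?thesis by simp
    qed
    moreover obtain r :: 'n where True by simp
    have "\<Theta> = \<theta> i + \<theta> i" using s2[of None "Some r"] eq[of None i] eq[of "Some r" i] by simp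
    ultimately have "(of_nat CARD('n) - 1) * \<theta> i = 0" by (simp add: algebra_simps)
    moreover have "of_nat CARD('n) - 1 \<noteq> (0 :: complex)" using n by (auto simp: of_nat_eq_1_iff)
    ultimately show ?thesis by simp
  qed
  then have "h i = 0" for i using y by (simp add: \<theta>_def)
  then show ?thesis by blast
qed

text \<open>Heron's expression. For \<open>e = edge A\<close> with symmetric \<open>A\<close> it is
  four times the Gram determinant of \<open>A\<close> on the plane spanned by the differences of the
  vertices \<open>i\<close>, \<open>j\<close>, \<open>k\<close>; this plane is the kernel of
  \<open>arr y\<close> when exactly these three weights vanish.\<close>

definition triple_disc :: "('o => 'o => complex) => 'o => 'o => 'o => complex" where
  "triple_disc e i j k = (e i j + e i k + e j k)^2 - 2 * ((e i j)^2 + (e i k)^2 + (e j k)^2)"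

abbreviation pencil_solutions :: "('m::finite => 'n::finite option => complex) => complex^'n^'n => (complex^'m) set" where
  "pencil_solutions a A \<equiv> pair_solutions (lik_F (pencil a) A) (lik_G (pencil a))"

text \<open>For at most three unknowns, general position excludes three vanishing forms, so the
  condition on the zeros of \<open>lik_G\<close> then says that there are none. The conditions on
  \<open>triple_disc\<close> and \<open>edge\<close> keep the local equations at the nodes
  nondegenerate.\<close>

definition generic_pencil :: "('m::finite => 'n::finite option => complex) => complex^'n^'n => bool" where
  "generic_pencil a A \<longleftrightarrow> general_position a \<and> transpose A = A \<and>
    (\<forall>x. x \<noteq> 0 \<longrightarrow> vfun (lik_F (pencil a) A) x \<noteq> 0) \<and>
    (\<forall>x. x \<noteq> 0 \<longrightarrow> vfun (lik_G (pencil a)) x = 0 \<longrightarrow> card {i. form a x i = 0} = 3) \<and>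
    (\<forall>x\<in>pencil_solutions a A. det (arr (form a x)) \<noteq> 0 \<and>
      nondegenerate (\<lambda>x. vfun (lik_F (pencil a) A) x - vfun (lik_G (pencil a)) x) x) \<and>
    (\<forall>i j k. i \<noteq> j \<longrightarrow> i \<noteq> k \<longrightarrow> j \<noteq> k \<longrightarrow> triple_disc (edge A) i j k \<noteq> 0) \<and>
    (\<forall>i j. i \<noteq> j \<longrightarrow> edge A i j \<noteq> 0)"

lemma generic_pencilD:
  assumes "generic_pencil a A"
  shows "general_position a" "transpose A = A"
    "x \<noteq> 0 ==> vfun (lik_F (pencil a) A) x \<noteq> 0"
    "x \<noteq> 0 ==> vfun (lik_G (pencil a)) x = 0 ==> card {i. form a x i = 0} = 3"
    "x \<in> pencil_solutions a A ==> det (vcomb (pencil a) x) \<noteq> 0"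
    "x \<in> pencil_solutions a A ==> nondegenerate (\<lambda>x. vfun (lik_F (pencil a) A) x - vfun (lik_G (pencil a)) x) x"
    "i \<noteq> j ==> i \<noteq> k ==> j \<noteq> k ==> triple_disc (edge A) i j k \<noteq> 0"
    "i \<noteq> j ==> edge A i j \<noteq> 0"
  using assms by (simp_all add: generic_pencil_def lin_comb_pencil)

text \<open>Points are sorted by the number of vanishing forms. With at most one, the coefficient
  vectors span and Sard's theorem applies; with two, the determinant vanishes but
  \<open>edge_sum\<close> does not; with three, \<open>F\<close> survives while \<open>G\<close>
  vanishes; four are excluded by general position.\<close>

theorem exists_generic_pencil:
  assumes n: "CARD('n) \<ge> 2" and m: "2 \<le> CARD('m)" "CARD('m) \<le> 4" "CARD('m) \<le> CARD('n) + 1"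
  shows "\<exists>(a :: 'm::finite => 'n::finite option => complex) A. generic_pencil a A"
proof -
  have m': "CARD('m) \<le> CARD('n option)" using m by simp
  obtain a :: "'m => 'n option => complex" where a: "general_position a"
    and smooth: "\<And>x. (\<And>i. form a x i \<noteq> 0) ==> \<exists>h. ddet (arr (form a x)) (arr (form a h)) \<noteq> 0"
    by (rule exists_smooth_arrangement[OF n m(3)]) (rule that, assumption, blast)
  define mat :: "complex^('n \<times> 'n) => complex^'n^'n" where "mat z = (\<chi> r s. z $ (r, s) + z $ (s, r))" for z
  have mat_sum: "mat z = (\<Sum>e\<in>UNIV. cscale (z $ e) (sym_unit e))" for z
    unfolding sum_sym_unit mat_def ..
  have mat_sym: "transpose (mat z) = mat z" for z
    by (simp add: mat_def transpose_def vec_eq_iff add.commute)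
  define F where "F z = lik_F (pencil a) (mat z)" for z
  define G where "G = lik_G (pencil a)"
  have contract_F: "(\<Sum>k\<in>UNIV. h $ k * F z k (vec_nth x)) = d2det (arr (form a x)) (arr (form a h)) (mat z)" for h z x
    unfolding F_def sum_lik_F lin_comb_pencil ..
  have contract_G: "(\<Sum>k\<in>UNIV. h $ k * G k (vec_nth x)) = of_nat (CARD('n) - 1) * ddet (arr (form a x)) (arr (form a h))" for h x
    unfolding G_def sum_lik_G lin_comb_pencil ..
  define c where "c e k x = lik_F (pencil a) (sym_unit e) k x" for e :: "'n \<times> 'n" and k x
  have pairs: "poly_pair (CARD('n) - 2) (lik_F (pencil a) A) G" for A :: "complex^'n^'n"
    unfolding G_def by (rule lik_pair[OF n])
  have pc: "poly_fun (c e k)" and pG: "poly_fun (G k)" for e k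
    using pairs[of "sym_unit e"] by (simp_all add: poly_pair_def c_def[abs_def])
  have F_sum: "F z k x = (\<Sum>e\<in>UNIV. z $ e * c e k x)" for z k x
    unfolding F_def lik_F_def c_def mat_sum by (rule d2det_linear2) simp
  have span: "spanning c x" if "x \<noteq> 0" "det (arr (form a x) :: complex^'n^'n) \<noteq> 0 \<or> (\<forall>i. form a x i \<noteq> 0)" for x
    unfolding spanning_def
  proof (intro allI impI)
    fix h :: "complex^'m" assume h: "\<forall>e. (\<Sum>k\<in>UNIV. h $ k * c e k (vec_nth x)) = 0"
    have "form a h = (\<lambda>_. 0)"
    proof (rule d2det_arr_nondegenerate[OF n that(2)])
      fix A :: "complex^'n^'n" assume "transpose A = A"
      then have "d2det (arr (form a x)) (arr (form a h)) A =
          (\<Sum>e\<in>UNIV. A $ fst e $ snd e / 2 * d2det (arr (form a x)) (arr (form a h)) (sym_unit e))"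
        by (subst symmetric_eq_sum, assumption, subst d2det_linear2) simp_all
      also have "\<dots> = (\<Sum>e\<in>UNIV. A $ fst e $ snd e / 2 * (\<Sum>k\<in>UNIV. h $ k * c e k (vec_nth x)))"
        unfolding c_def sum_lik_F lin_comb_pencil ..
      finally show "d2det (arr (form a x)) (arr (form a h)) A = 0" using h by simp
    qed
    then show "h = 0" by (rule general_position_form_inj[OF a m'])
  qed
  have det_es: "det (arr (form a x) :: complex^'n^'n) = elem_sym (form a x)" for x by (rule det_arr)
  obtain u where u: "elem_sym (form a u) \<noteq> 0"
  proof -
    have "\<exists>z. \<forall>i\<in>UNIV. (\<Sum>k\<in>UNIV. z k * a k i) \<noteq> 0"
    proof (rule poly_fun_prod_nonzero)
      fix i :: "'n option"
      obtain x where "\<forall>j\<in>{i}. form a x j = 1"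
        using general_position_interpolate[OF a _ m', of "{i}" "\<lambda>_. 1"] by auto
      then have "(\<Sum>k\<in>UNIV. x $ k * a k i) \<noteq> 0" by (simp add: form_def)
      then show "poly_fun (\<lambda>z. \<Sum>k\<in>UNIV. z k * a k i) \<and> (\<exists>z. (\<Sum>k\<in>UNIV. z k * a k i) \<noteq> 0)"
        by (intro conjI poly_fun_intros) (rule exI[of _ "vec_nth x"])
    qed simp
    then obtain z where "\<And>i. (\<Sum>k\<in>UNIV. z k * a k i) \<noteq> 0" by blast
    then have "\<And>i. form a (vec_lambda z) i \<noteq> 0" by (simp add: form_def)
    from smooth[OF this] obtain h where h: "ddet (arr (form a (vec_lambda z))) (arr (form a h)) \<noteq> 0" by blast
    have D: "((\<lambda>t. elem_sym (form a (vec_lambda z + t *s h))) has_field_derivative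
        ddet (arr (form a (vec_lambda z))) (arr (form a h))) (at 0)"
      using det_line_derivative[of "arr (form a (vec_lambda z))" "arr (form a h)"]
      unfolding arr_linear[symmetric] det_arr by (simp add: form_linear[abs_def])
    have "\<exists>t. elem_sym (form a (vec_lambda z + t *s h)) \<noteq> 0"
    proof (rule ccontr)
      assume "\<not> ?thesis"
      then have "((\<lambda>t::complex. 0) has_field_derivative ddet (arr (form a (vec_lambda z))) (arr (form a h))) (at 0)"
        using D by simp
      then show False using h DERIV_unique[OF _ DERIV_const] by blast
    qed
    then show ?thesis using that by blast
  qed
  define Z where "Z = {x. elem_sym (form a x) = 0}"
  have "closed Z"
  proof -
    have "continuous_on UNIV (\<lambda>x. elem_sym (form a x))"
      unfolding elem_sym_def co_prod_def form_def by (intro continuous_intros)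
    then have "closed ((\<lambda>x. elem_sym (form a x)) -` {0})" by (intro closed_vimage) auto
    then show ?thesis by (simp add: Z_def vimage_def)
  qed
  \<comment> \<open>\<open>Bad1\<close> collects the data with a solution that is degenerate or
    singular as a matrix, \<open>Bad2\<close> those with a degenerate zero of \<open>F\<close>; by
    homogeneity every nonzero zero of \<open>F\<close> is degenerate.\<close>
  define Bad1 where "Bad1 = {z. \<exists>x. spanning c x \<and> linear_family c G z x = 0 \<and>
    (\<not> nondegenerate (linear_family c G z) x \<or> x \<in> Z)}"
  define Bad2 where "Bad2 = {z. \<exists>x. spanning c x \<and> linear_family c (\<lambda>_ _. 0) z x = 0 \<and>
    (\<not> nondegenerate (linear_family c (\<lambda>_ _. 0) z) x \<or> x \<in> {})}"
  have "negligible Bad1"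
    unfolding Bad1_def by (rule negligible_degenerate[where u=u and N="CARD('n option) - 1"])
      (use pc pG \<open>closed Z\<close> card_roots_line[of a u, OF u] in \<open>auto simp: Z_def\<close>)
  moreover have "negligible Bad2"
    unfolding Bad2_def by (rule negligible_degenerate[where u=0 and N=0]) (auto intro: pc poly_fun.const)
  ultimately have neg: "negligible (Bad1 \<union> Bad2)" by simp
  define U where "U = (\<Inter>i. \<Inter>j\<in>- {i}. {z. edge (mat z) i j \<noteq> 0}) \<inter>
    (\<Inter>i. \<Inter>j\<in>- {i}. \<Inter>k\<in>- {i, j}. {z. triple_disc (edge (mat z)) i j k \<noteq> 0})"
  have cont: "continuous_on UNIV (\<lambda>z. edge (mat z) i j)" for i j
  proof -
    have "continuous_on UNIV (\<lambda>z. qent (mat z) i j)" for i j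
      unfolding qent_def mat_def by (cases i; cases j) (auto intro!: continuous_intros)
    then show ?thesis unfolding edge_def by (intro continuous_intros)
  qed
  have "open U"
    unfolding U_def triple_disc_def
    by (intro open_Int open_INT ballI open_Collect_neq continuous_intros cont) simp_all
  moreover have "U \<noteq> {}"
  proof -
    \<comment> \<open>All edges equal to 1 give the value 9 - 6 = 3 for
      \<open>triple_disc\<close>.\<close>
    obtain A :: "complex^'n^'n" where A: "transpose A = A" "\<And>i j. edge A i j = (if i = j then 0 else 1)"
    proof -
      have "(if i = j then 0 else 1 :: complex) = (if j = i then 0 else 1)" for i j :: "'n option" by auto
      then show ?thesis using that exists_edges[of "\<lambda>i j. if i = j then 0 else 1"] by (simp only: simp_thms if_True) blast
    qed
    have "mat (\<chi> e. A $ fst e $ snd e / 2) = A"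
      by (subst (2) symmetric_eq_sum[OF A(1)]) (simp add: mat_sum)
    then have "(\<chi> e. A $ fst e $ snd e / 2) \<in> U"
      by (auto simp: U_def A(2) triple_disc_def)
    then show ?thesis by blast
  qed
  ultimately obtain z where zU: "z \<in> U" and z: "z \<notin> Bad1 \<union> Bad2"
    by (rule open_not_in_negligible[OF _ _ neg])
  have edge: "edge (mat z) i j \<noteq> 0" if "i \<noteq> j" for i j using zU that by (simp add: U_def)
  have lf: "linear_family c G z x = vfun (F z) x - vfun G x" "linear_family c (\<lambda>_ _. 0) z x = vfun (F z) x" for x
    by (simp_all add: linear_family_def vfun_def F_sum vec_eq_iff)
  have disc: "triple_disc (edge (mat z)) i j k \<noteq> 0" if "i \<noteq> j" "i \<noteq> k" "j \<noteq> k" for i j k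
    using zU that by (simp add: U_def)
  have few: "card {i. form a x i = 0} \<le> 3" if "x \<noteq> 0" for x
    using a m(2) that unfolding general_position_def by fastforce
  have contract0: "vfun H x = 0 ==> (\<Sum>k\<in>UNIV. h $ k * H k (vec_nth x)) = 0" for H x and h :: "complex^'m"
    by (simp add: vfun_def vec_eq_iff)
  have strata: "card {i. form a x i = 0} = 2 \<or> card {i. form a x i = 0} = 3"
    if "x \<noteq> 0" "\<not> (det (arr (form a x) :: complex^'n^'n) \<noteq> 0 \<or> (\<forall>i. form a x i \<noteq> 0))" for x
  proof -
    have "card {i. form a x i = 0} \<noteq> 0" using that by auto
    moreover have "card {i. form a x i = 0} \<noteq> 1"
    proof
      assume "card {i. form a x i = 0} = 1"
      then obtain i where i: "{i. form a x i = 0} = {i}" by (auto simp: card_1_singleton_iff)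
      have "elem_sym (form a x) = (\<Sum>j\<in>{i}. co_prod (form a x) {j})"
      proof -
        have "form a x i = 0" using i by blast
        then show ?thesis
          unfolding elem_sym_def by (intro sum.mono_neutral_right) (auto intro!: co_prod_zero[of i])
      qed
      also have "\<dots> \<noteq> 0" using i by (auto intro!: co_prod_nz)
      finally show False using that det_es by simp
    qed
    ultimately show ?thesis using few[OF that(1)] by linarith
  qed
  have two: "edge_sum (mat z) (form a x) \<noteq> 0" "elem_sym (form a x) = 0" if c2: "card {i. form a x i = 0} = 2" for x
  proof -
    obtain i j where ij: "{i. form a x i = 0} = {i, j}" "i \<noteq> j" using c2 by (auto simp: card_2_iff)
    then have y: "form a x i = 0" "form a x j = 0" by auto
    have "co_prod (form a x) {i, j} \<noteq> 0" using ij by (intro co_prod_nz) auto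
    then show "edge_sum (mat z) (form a x) \<noteq> 0" using edge_sum_two_zeros[of "form a x", OF y ij(2)] edge[OF ij(2)] by simp
    show "elem_sym (form a x) = 0" by (rule elem_sym_two_zeros[of "form a x", OF y ij(2)])
  qed
  have n1: "of_nat (CARD('n) - 1) \<noteq> (0 :: complex)" using n by simp
  have G_zero: "card {i. form a x i = 0} = 3" if x: "x \<noteq> 0" "vfun G x = 0" for x
  proof (rule ccontr)
    assume not3: "card {i. form a x i = 0} \<noteq> 3"
    have dd: "ddet (arr (form a x)) (arr (form a h)) = 0" for h
      using contract0[OF x(2), of h] n1 unfolding contract_G by simp
    then have "\<not> (\<forall>i. form a x i \<noteq> 0)" using smooth by blast
    moreover have "det (arr (form a x) :: complex^'n^'n) = 0"
      using dd[of x] unfolding ddet_self by simp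
    ultimately have "card {i. form a x i = 0} = 2" using strata[OF x(1)] not3 by blast
    then obtain i j where ij: "{i. form a x i = 0} = {i, j}" "i \<noteq> j" by (auto simp: card_2_iff)
    have "card {i, j} \<le> CARD('m)" using ij(2) m(1) by simp
    then obtain h where h: "form a h i = 1" "form a h j = 0"
      using general_position_interpolate[OF a _ m', of "{i, j}" "\<lambda>l. if l = i then 1 else 0"] ij(2) by auto
    have "ddet (arr (form a x)) (arr (form a h)) = co_prod (form a x) {i, j}"
      by (rule ddet_two_zeros[of "form a x", OF ij(1) h])
    moreover have "co_prod (form a x) {i, j} \<noteq> 0" using ij by (intro co_prod_nz) auto
    ultimately show False using dd by simp
  qed
  have three: "vfun (F z) x \<noteq> 0" "vfun G x = 0" if three: "card {i. form a x i = 0} = 3" and x: "x \<noteq> 0" for x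
  proof -
    obtain i j k where ijk: "{i. form a x i = 0} = {i, j, k}" "i \<noteq> j" "i \<noteq> k" "j \<noteq> k"
      using three by (auto simp: card_3_iff)
    have "card {i, j, k} \<le> CARD('m)"
      using ijk a x unfolding general_position_def by (metis less_imp_le)
    then obtain h where h: "form a h i = 1" "form a h j = 0" "form a h k = 0"
      using general_position_interpolate[OF a _ m', of "{i, j, k}" "\<lambda>l. if l = i then 1 else 0"] ijk by auto
    have y: "form a x i = 0" "form a x j = 0" "form a x k = 0" using ijk(1) by auto
    have "d2det (arr (form a x)) (arr (form a h)) (mat z) = edge (mat z) j k * co_prod (form a x) {i, j, k}"
      using d2det_at_node[of "form a x", OF y ijk(2,3,4), of "form a h"] by (simp add: h)
    moreover have "co_prod (form a x) {i, j, k} \<noteq> 0" using ijk by (intro co_prod_nz) auto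
    ultimately have "d2det (arr (form a x)) (arr (form a h)) (mat z) \<noteq> 0" using edge[OF ijk(4)] by simp
    then show "vfun (F z) x \<noteq> 0" using contract0[of "F z" x h] unfolding contract_F by blast
    have "ddet (arr (form a x)) (arr (form a h)) = 0" for h
      by (rule ddet_three_zeros[of "form a x", OF y ijk(2,3,4)])
    then have "(\<Sum>k\<in>UNIV. axis l 1 $ k * G k (vec_nth x)) = 0" for l
      using contract_G[of "axis l 1" x] by simp
    then have "G l (vec_nth x) = 0" for l
      by (simp add: axis_def if_distrib[of "\<lambda>c. c * _"] cong: if_cong)
    then show "vfun G x = 0" by (simp add: vfun_def vec_eq_iff)
  qed
  have homF: "vfun (F z) (t *s x) = t ^ (CARD('n) - 2) *s vfun (F z) x" for t x
    by (rule vfun_scale) (use pairs[of "mat z"] in \<open>simp add: poly_pair_def F_def\<close>)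
  have euler: "(\<Sum>k\<in>UNIV. x $ k * F z k (vec_nth x)) = of_nat (CARD('n) - 1) * edge_sum (mat z) (form a x)" for x
    unfolding contract_F d2det_self ddet_arr ..
  have F_nz: "vfun (F z) x \<noteq> 0" if x: "x \<noteq> 0" for x
  proof
    assume zero: "vfun (F z) x = 0"
    show False
    proof (cases "det (arr (form a x) :: complex^'n^'n) \<noteq> 0 \<or> (\<forall>i. form a x i \<noteq> 0)")
      case True
      have "nondegenerate (linear_family c (\<lambda>_ _. 0) z) x"
        using z span[OF x True] zero unfolding Bad2_def lf[symmetric] by blast
      then have "nondegenerate (vfun (F z)) x" by (simp add: lf(2)[abs_def])
      then show False using homogeneous_degenerate[of "vfun (F z)", OF homF zero x] by blast
    next
      case False
      from strata[OF x this] show False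
      proof
        assume "card {i. form a x i = 0} = 2"
        then show False using two(1)[of x] contract0[OF zero, of x] n1 unfolding euler by simp
      next
        assume "card {i. form a x i = 0} = 3"
        then show False using three(1)[OF _ x] zero by blast
      qed
    qed
  qed
  have FG: "det (arr (form a x) :: complex^'n^'n) \<noteq> 0 \<and> nondegenerate (\<lambda>x. vfun (F z) x - vfun G x) x"
    if x: "x \<noteq> 0" and eq: "vfun (F z) x = vfun G x" for x
  proof (cases "det (arr (form a x) :: complex^'n^'n) \<noteq> 0 \<or> (\<forall>i. form a x i \<noteq> 0)")
    case True
    have "linear_family c G z x = 0" using eq by (simp add: lf)
    then have "nondegenerate (linear_family c G z) x" "x \<notin> Z"
      using z span[OF x True] unfolding Bad1_def by blast+
    then show ?thesis by (simp add: lf(1)[abs_def] Z_def det_es)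
  next
    case False
    from strata[OF x this] show ?thesis
    proof
      assume c2: "card {i. form a x i = 0} = 2"
      have "(\<Sum>k\<in>UNIV. x $ k * F z k (vec_nth x)) = (\<Sum>k\<in>UNIV. x $ k * G k (vec_nth x))"
        using eq by (simp add: vfun_def vec_eq_iff)
      then have "of_nat (CARD('n) - 1) * edge_sum (mat z) (form a x) =
          of_nat (CARD('n) - 1) * (of_nat CARD('n) * elem_sym (form a x))"
        unfolding euler contract_G ddet_self det_es .
      then show ?thesis using two[OF c2] n1 by simp
    next
      assume "card {i. form a x i = 0} = 3"
      then show ?thesis using three[OF _ x] eq by simp
    qed
  qed
  have "generic_pencil a (mat z)"
    using a mat_sym F_nz G_zero FG disc edge by (simp add: generic_pencil_def F_def G_def pair_solutions_def)
  then show ?thesis by blast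
qed

section \<open>Solutions absorbed by the nodes\<close>

definition cdot :: "complex^'m::finite => complex^'m => complex" where
  "cdot h v = (\<Sum>k\<in>UNIV. h $ k * v $ k)"

lemma cdot_linear:
  "cdot h (v + w) = cdot h v + cdot h w" "cdot h (v - w) = cdot h v - cdot h w" "cdot h (c *s v) = c * cdot h v"
  "cdot (h + h') v = cdot h v + cdot h' v" "cdot (c *s h) v = c * cdot h v" "cdot h 0 = 0"
  by (simp_all add: cdot_def algebra_simps sum.distrib sum_subtractf sum_distrib_left)

lemma cdot_sum: "cdot (\<Sum>k\<in>K. f k) v = (\<Sum>k\<in>K. cdot (f k) v)"
  by (simp add: cdot_def sum_distrib_right) (rule sum.swap)

lemma cdot_axis: "cdot (axis k 1) v = v $ k"
  by (simp add: cdot_def axis_def if_distrib[of "\<lambda>c. c * _"] cong: if_cong)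

lemma cdot_lik_F: "cdot h (vfun (lik_F (pencil a) A) x) = d2det (arr (form a x)) (arr (form a h)) A"
  unfolding cdot_def vfun_def vec_lambda_beta sum_lik_F lin_comb_pencil ..

lemma cdot_lik_G: "cdot h (vfun (lik_G (pencil a)) x) =
  of_nat (CARD('n) - 1) * ddet (arr (form a x) :: complex^'n^'n) (arr (form a h))"
  unfolding cdot_def vfun_def vec_lambda_beta sum_lik_G lin_comb_pencil ..

lemma UNIV_4:
  assumes card4: "CARD('m::finite) = 4"
  obtains k0 ki kj kk :: "'m::finite" where "UNIV = {k0, ki, kj, kk}" "distinct [k0, ki, kj, kk]"
proof -
  obtain f where f: "bij_betw f {0..<4::nat} (UNIV :: 'm set)"
    using ex_bij_betw_nat_finite[of "UNIV :: 'm set"] card4 by auto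
  have "UNIV = f ` {0..<4}" using f by (simp add: bij_betw_def)
  also have "{0..<4::nat} = {0, 1, 2, 3}" by auto
  finally have U: "UNIV = {f 0, f 1, f 2, f 3}" by simp
  have "inj_on f {0..<4}" using f by (simp add: bij_betw_def)
  then have "f i \<noteq> f j" if "i < 4" "j < 4" "i \<noteq> j" for i j
    using that by (auto dest: inj_onD)
  then have "distinct [f 0, f 1, f 2, f 3]" by simp
  with U show ?thesis by (rule that)
qed

text \<open>The limit of the rescaled equations at a node, in local coordinates: \<open>p\<close>, \<open>q\<close>, \<open>r\<close> are the three vanishing
  forms and \<open>\<alpha>\<close> is the scale.\<close>

lemma limit_equations_linear:
  fixes \<alpha> p q r g N e1 e2 e3 :: complex
  assumes "g \<noteq> 0" "N \<noteq> 0"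
  shows "(g * (\<alpha> * e1 - N * (q + r)) = 0 \<and> g * (\<alpha> * e2 - N * (p + r)) = 0 \<and> g * (\<alpha> * e3 - N * (p + q)) = 0) \<longleftrightarrow>
    (p = \<alpha> * ((e1 + e2 + e3) / 2 - e1) / N \<and> q = \<alpha> * ((e1 + e2 + e3) / 2 - e2) / N \<and>
     r = \<alpha> * ((e1 + e2 + e3) / 2 - e3) / N)" (is "?L \<longleftrightarrow> ?R")
proof
  assume ?L
  then have 1: "\<alpha> * e1 = N * (q + r)" "\<alpha> * e2 = N * (p + r)" "\<alpha> * e3 = N * (p + q)" using assms(1) by auto
  have "\<alpha> * ((e1 + e2 + e3) / 2 - e) = (\<alpha> * e1 + \<alpha> * e2 + \<alpha> * e3) / 2 - \<alpha> * e" for e by (simp add: field_simps)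
  then show ?R using assms(2) by (simp add: 1) (simp add: field_simps)
next
  assume ?R
  then have p: "p = \<alpha> * ((e1 + e2 + e3) / 2 - e1) / N" and q: "q = \<alpha> * ((e1 + e2 + e3) / 2 - e2) / N"
    and r: "r = \<alpha> * ((e1 + e2 + e3) / 2 - e3) / N" by blast+
  show ?L unfolding p q r using assms(2) by (simp add: field_simps)
qed

text \<open>The linear equations make \<open>p\<close>, \<open>q\<close>, \<open>r\<close> multiples
  of \<alpha>, and the last equation becomes \<alpha>^2 = \<sigma>^2 Q; its two roots are the two
  solutions absorbed by a node. The factor n - 2 in \<open>Q\<close> arises as 2 N - n.\<close>

lemma limit_equations:
  fixes \<alpha> p q r \<sigma> g h N n e1 e2 e3 :: complex
  assumes g: "g \<noteq> 0" and N: "N \<noteq> 0" "N = n - 1" "n \<noteq> 2"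
    and disc: "(e3 + e2 + e1)^2 - 2 * (e3^2 + e2^2 + e1^2) \<noteq> 0"
    and Q: "Q = 4 * N * h / ((n - 2) * g * ((e3 + e2 + e1)^2 - 2 * (e3^2 + e2^2 + e1^2)))"
  shows "(g * (\<alpha> * e1 - N * (q + r)) = 0 \<and> g * (\<alpha> * e2 - N * (p + r)) = 0 \<and> g * (\<alpha> * e3 - N * (p + q)) = 0 \<and>
     N * g * (\<alpha> * (e1 * p + e2 * q + e3 * r) - n * (p * q + p * r + q * r)) - \<sigma>^2 * h = 0) \<longleftrightarrow>
    (p = \<alpha> * ((e1 + e2 + e3) / 2 - e1) / N \<and> q = \<alpha> * ((e1 + e2 + e3) / 2 - e2) / N \<and>
     r = \<alpha> * ((e1 + e2 + e3) / 2 - e3) / N \<and> \<alpha>^2 = \<sigma>^2 * Q)" (is "_ \<and> _ \<and> _ \<and> ?quad \<longleftrightarrow> ?p \<and> ?q \<and> ?r \<and> _")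
proof -
  define K where "K = (e3 + e2 + e1)^2 - 2 * (e3^2 + e2^2 + e1^2)"
  have "?quad \<longleftrightarrow> \<alpha>^2 = \<sigma>^2 * Q" if pqr: ?p ?q ?r
  proof -
    have "e1 * p + e2 * q + e3 * r = \<alpha> * K / (2 * N)" "p * q + p * r + q * r = \<alpha>^2 * K / (4 * N^2)"
      using N(1) unfolding pqr K_def by (simp_all add: field_simps power2_eq_square)
    then have "N * g * (\<alpha> * (e1 * p + e2 * q + e3 * r) - n * (p * q + p * r + q * r)) =
        N * g * (\<alpha> * (\<alpha> * K / (2 * N)) - n * (\<alpha>^2 * K / (4 * N^2)))" by simp
    also have "\<dots> = g * \<alpha>^2 * K * (2 * N - n) / (4 * N)"
      using N(1) by (simp add: field_simps power2_eq_square)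
    also have "2 * N - n = n - 2" using N(2) by simp
    finally have "N * g * (\<alpha> * (e1 * p + e2 * q + e3 * r) - n * (p * q + p * r + q * r)) = g * \<alpha>^2 * K * (n - 2) / (4 * N)" .
    moreover have "g * \<alpha>^2 * K * (n - 2) / (4 * N) - \<sigma>^2 * h = 0 \<longleftrightarrow> \<alpha>^2 = \<sigma>^2 * Q"
      using g N disc unfolding Q K_def[symmetric] by (auto simp: field_simps)
    ultimately show ?thesis by simp
  qed
  then show ?thesis using limit_equations_linear[OF g N(1), of \<alpha> e1 q r e2 p e3] by blast
qed

text \<open>The same elimination for the linearised equations: what remains is a nonzero multiple of
  \<open>\<alpha>'\<close>, so both roots are simple.\<close>

lemma limit_equations_derivative:
  fixes \<alpha> p q r g N n e1 e2 e3 \<alpha>' p' q' r' :: complex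
  assumes g: "g \<noteq> 0" and N: "N \<noteq> 0" "N = n - 1" "n \<noteq> 2" and \<alpha>: "\<alpha> \<noteq> 0"
    and disc: "(e3 + e2 + e1)^2 - 2 * (e3^2 + e2^2 + e1^2) \<noteq> 0"
    and pqr: "p = \<alpha> * ((e1 + e2 + e3) / 2 - e1) / N" "q = \<alpha> * ((e1 + e2 + e3) / 2 - e2) / N"
      "r = \<alpha> * ((e1 + e2 + e3) / 2 - e3) / N"
    and lin: "g * (\<alpha>' * e1 - N * (q' + r')) = 0" "g * (\<alpha>' * e2 - N * (p' + r')) = 0" "g * (\<alpha>' * e3 - N * (p' + q')) = 0"
    and quad: "N * g * (\<alpha>' * (e1 * p + e2 * q + e3 * r) + \<alpha> * (e1 * p' + e2 * q' + e3 * r') -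
      n * (p' * q + p * q' + p' * r + p * r' + q' * r + q * r')) = 0"
  shows "\<alpha>' = 0 \<and> p' = 0 \<and> q' = 0 \<and> r' = 0"
proof -
  define K where "K = (e3 + e2 + e1)^2 - 2 * (e3^2 + e2^2 + e1^2)"
  have pqr': "p' = \<alpha>' * ((e1 + e2 + e3) / 2 - e1) / N" "q' = \<alpha>' * ((e1 + e2 + e3) / 2 - e2) / N"
    "r' = \<alpha>' * ((e1 + e2 + e3) / 2 - e3) / N"
    using limit_equations_linear[OF g N(1), of \<alpha>' e1 q' r' e2 p' e3] lin by blast+
  have "e1 * p + e2 * q + e3 * r = \<alpha> * K / (2 * N)" "e1 * p' + e2 * q' + e3 * r' = \<alpha>' * K / (2 * N)"
    "p' * q + p * q' + p' * r + p * r' + q' * r + q * r' = \<alpha> * \<alpha>' * K / (2 * N^2)"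
    using N(1) unfolding pqr pqr' K_def by (simp_all add: field_simps power2_eq_square)
  with quad have "N * g * (\<alpha>' * (\<alpha> * K / (2 * N)) + \<alpha> * (\<alpha>' * K / (2 * N)) - n * (\<alpha> * \<alpha>' * K / (2 * N^2))) = 0" by simp
  moreover have "N * g * (\<alpha>' * (\<alpha> * K / (2 * N)) + \<alpha> * (\<alpha>' * K / (2 * N)) - n * (\<alpha> * \<alpha>' * K / (2 * N^2))) =
      g * \<alpha> * \<alpha>' * K * (2 * N - n) / (2 * N)"
    using N(1) by (simp add: field_simps power2_eq_square)
  moreover have "2 * N - n \<noteq> 0" using N by simp
  ultimately have "\<alpha>' = 0" using g \<alpha> N(1) disc unfolding K_def[symmetric] by simp
  then show ?thesis unfolding pqr' by simp
qed

text \<open>Local coordinates at a node: \<open>dl\<close> is the basis dual to the four forms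
  selected by \<open>\<beta>\<close>, \<open>dl k0\<close> is the node, and \<open>ki\<close>,
  \<open>kj\<close>, \<open>kk\<close> belong to the forms that vanish there. The last assumption
  gives the deformation a nonzero effect in the direction of the node.\<close>

locale node =
  fixes a :: "'m::finite => 'n::finite option => complex" and A :: "complex^'n^'n"
    and F' G' :: "'m => 'm cfun"
    and d :: nat and N n :: complex and F G
    and k0 ki kj kk :: 'm and \<beta> :: "'m => 'n option" and dl :: "'m => complex^'m"
  defines d: "d \<equiv> CARD('n) - 2" and N: "N \<equiv> of_nat (CARD('n) - 1)" and n: "n \<equiv> of_nat CARD('n)"
    and F: "F \<equiv> lik_F (pencil a) A" and G: "G \<equiv> lik_G (pencil a)"
  assumes n3: "CARD('n) \<ge> 3"
    and pair': "poly_pair d F' G'"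
    and UNIV_m: "UNIV = {k0, ki, kj, kk}" and dist_k: "distinct [k0, ki, kj, kk]"
    and \<beta>_inj: "inj \<beta>"
    and dl: "\<And>k k'. form a (dl k) (\<beta> k') = (if k = k' then 1 else 0)"
    and \<beta>_zero: "\<And>x. (\<And>k. form a x (\<beta> k) = 0) ==> x = 0"
    and vanish: "{l. form a (dl k0) l = 0} = {\<beta> ki, \<beta> kj, \<beta> kk}"
    and disc: "triple_disc (edge A) (\<beta> ki) (\<beta> kj) (\<beta> kk) \<noteq> 0"
    and h0: "cdot (dl k0) (vfun G' (dl k0)) \<noteq> 0"
begin

definition "K = {ki, kj, kk}"
definition "T = \<beta> ` K"

text \<open>Blow-up of the node: coordinates in \<open>K\<close> are measured in units of
  \<open>\<rho>\<close>, while \<open>\<xi> $ k0\<close> is reserved for the size of the solution,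
  see \<open>bpt\<close>.\<close>

definition pt :: "complex => complex^'m => complex^'m" where
  "pt \<rho> \<xi> = dl k0 + \<rho> *s (\<Sum>k\<in>K. \<xi> $ k *s dl k)"

text \<open>For \<open>s\<close> at most \<open>card (T - X)\<close>, this is \<open>co_prod\<close>
  at \<open>pt \<rho> \<xi>\<close> divided by \<open>\<rho> ^ s\<close>, written without division
  so that it is a polynomial and makes sense at \<open>\<rho> = 0\<close>.\<close>

definition rp :: "complex => complex^'m => 'n option set => nat => complex" where
  "rp \<rho> \<xi> X s = \<rho> ^ (card (T - X) - s) * (\<Prod>k\<in>{k \<in> K. \<beta> k \<notin> X}. \<xi> $ k) * co_prod (form a (pt \<rho> \<xi>)) (T \<union> X)"

lemma K_facts: "k0 \<notin> K" "UNIV = insert k0 K" "finite K" "card K = 3" "card T = 3" "T = {\<beta> ki, \<beta> kj, \<beta> kk}"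
proof -
  show "k0 \<notin> K" "UNIV = insert k0 K" "finite K" "card K = 3"
    using UNIV_m dist_k by (auto simp: K_def)
  then show "card T = 3" unfolding T_def using \<beta>_inj by (simp add: card_image inj_on_subset)
  show "T = {\<beta> ki, \<beta> kj, \<beta> kk}" by (simp add: T_def K_def)
qed

lemma form_pt: "form a (pt \<rho> \<xi>) l = form a (dl k0) l + \<rho> * (\<Sum>k\<in>K. \<xi> $ k * form a (dl k) l)"
proof -
  have "form a (\<Sum>k\<in>J. \<xi> $ k *s dl k) l = (\<Sum>k\<in>J. \<xi> $ k * form a (dl k) l)" if "finite J" for J
    using that
  proof (induction J rule: finite_induct)
    case (insert k J)
    then show ?case using form_linear[of a "\<Sum>k\<in>J. \<xi> $ k *s dl k" "\<xi> $ k" "dl k" l] by (simp add: add.commute)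
  qed (simp add: form_def)
  then show ?thesis unfolding pt_def form_linear using K_facts(3) by simp
qed

lemma form_pt_\<beta>: "form a (pt \<rho> \<xi>) (\<beta> k) = (if k = k0 then 1 else \<rho> * \<xi> $ k)"
proof -
  have "(\<Sum>k'\<in>K. \<xi> $ k' * form a (dl k') (\<beta> k)) = (if k \<in> K then \<xi> $ k else 0)"
    using K_facts(3) by (simp add: dl if_distrib[of "\<lambda>c. _ * c"] cong: if_cong)
  then show ?thesis using K_facts(1,2) by (auto simp: form_pt dl)
qed

lemma co_prod_rp:
  assumes "s \<le> card (T - X)" shows "co_prod (form a (pt \<rho> \<xi>)) X = \<rho> ^ s * rp \<rho> \<xi> X s"
proof -
  have TX: "T - X = \<beta> ` {k \<in> K. \<beta> k \<notin> X}" by (auto simp: T_def)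
  have inj: "inj_on \<beta> {k \<in> K. \<beta> k \<notin> X}" using \<beta>_inj by (rule inj_on_subset) simp
  have "- X = (T - X) \<union> - (T \<union> X)" by auto
  then have "co_prod (form a (pt \<rho> \<xi>)) X = (\<Prod>i\<in>T - X. form a (pt \<rho> \<xi>) i) * co_prod (form a (pt \<rho> \<xi>)) (T \<union> X)"
    unfolding co_prod_def by (subst prod.union_disjoint[symmetric]) auto
  also have "(\<Prod>i\<in>T - X. form a (pt \<rho> \<xi>) i) = (\<Prod>k\<in>{k \<in> K. \<beta> k \<notin> X}. \<rho> * \<xi> $ k)"
    unfolding TX prod.reindex[OF inj] o_def using K_facts(1) by (intro prod.cong refl) (auto simp: form_pt_\<beta>)
  also have "\<dots> = \<rho> ^ card (T - X) * (\<Prod>k\<in>{k \<in> K. \<beta> k \<notin> X}. \<xi> $ k)"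
    by (simp add: prod.distrib TX card_image[OF inj])
  finally show ?thesis
    using assms by (simp add: rp_def power_add[symmetric] mult.assoc[symmetric])
qed

lemma T_minus_card: "card (T - X) \<ge> 3 - card X"
  using K_facts(5) diff_card_le_card_Diff[of X T] by simp

definition "D2 \<rho> \<xi> = (\<Sum>i\<in>UNIV. rp \<rho> \<xi> {i} 2)"
definition "P1 \<rho> \<xi> = (\<Sum>i\<in>UNIV. \<Sum>j\<in>UNIV. edge A i j * rp \<rho> \<xi> {i, j} 1) / 2"
definition "G1 \<rho> \<xi> k = (\<Sum>i\<in>UNIV. \<Sum>l\<in>- {i}. form a (dl k) l * rp \<rho> \<xi> {l, i} 1)"

lemma elem_sym_D2: "elem_sym (form a (pt \<rho> \<xi>)) = \<rho>^2 * D2 \<rho> \<xi>"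
  unfolding elem_sym_def D2_def sum_distrib_left
  by (intro sum.cong refl co_prod_rp order_trans[OF _ T_minus_card]) simp

lemma card_pair_le: "1 \<le> card (T - {i, j})"
  by (rule order_trans[OF _ T_minus_card]) (simp add: card_insert_if)

lemma edge_sum_P1: "edge_sum A (form a (pt \<rho> \<xi>)) = \<rho> * P1 \<rho> \<xi>"
  unfolding edge_sum_def P1_def by (simp add: co_prod_rp[OF card_pair_le] sum_distrib_left mult.left_commute)

lemma ddet_G1: "ddet (arr (form a (pt \<rho> \<xi>)) :: complex^'n^'n) (arr (form a (dl k))) = \<rho> * G1 \<rho> \<xi> k"
  unfolding ddet_arr_arr G1_def by (simp add: co_prod_rp[OF card_pair_le] sum_distrib_left mult.left_commute)

text \<open>The equations at \<open>bpt \<rho> \<xi>\<close> and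
  \<open>t = \<rho>^2 * \<sigma>^2\<close>, paired with \<open>dl k\<close> and divided by
  \<open>\<rho>\<close>. For \<open>k0\<close> the pairing is with the point
  \<open>pt \<rho> \<xi>\<close> itself: by Euler's relation the result is divisible even by
  \<open>\<rho>^2\<close>, which preserves the quadratic information in the limit.\<close>

definition psi :: "'m => complex => complex => complex^'m => complex" where
  "psi k \<rho> \<sigma> \<xi> = (if k = k0 then
      (1 - \<rho>^2 * \<sigma>^2) * (N * (\<xi> $ k0 * P1 \<rho> \<xi> - n * D2 \<rho> \<xi>)) +
      \<sigma>^2 * (\<rho> * \<xi> $ k0 * cdot (pt \<rho> \<xi>) (vfun F' (pt \<rho> \<xi>)) - cdot (pt \<rho> \<xi>) (vfun G' (pt \<rho> \<xi>)))
    else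
      (1 - \<rho>^2 * \<sigma>^2) * (\<xi> $ k0 * cdot (dl k) (vfun F (pt \<rho> \<xi>)) - N * G1 \<rho> \<xi> k) +
      \<rho> * \<sigma>^2 * (\<rho> * \<xi> $ k0 * cdot (dl k) (vfun F' (pt \<rho> \<xi>)) - cdot (dl k) (vfun G' (pt \<rho> \<xi>))))"

definition path_eq :: "complex => complex^'m => bool" where
  "path_eq t x \<longleftrightarrow> vseg F F' t x = vseg G G' t x"

abbreviation "bpt \<rho> \<xi> \<equiv> inverse (\<rho> * \<xi> $ k0) *s pt \<rho> \<xi>"

lemma cdot_dl_zero: "(\<And>k. cdot (dl k) v = 0) ==> v = 0"
proof -
  assume z: "\<And>k. cdot (dl k) v = 0"
  have "cdot x v = 0" for x
  proof -
    have f: "form a (\<Sum>k\<in>J. c k *s dl k) l = (\<Sum>k\<in>J. c k * form a (dl k) l)" for c l and J :: "'m set"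
      unfolding form_def by (simp add: sum_distrib_right sum_distrib_left mult.assoc) (rule sum.swap)
    have "x - (\<Sum>k\<in>UNIV. form a x (\<beta> k) *s dl k) = 0"
    proof (rule \<beta>_zero)
      fix k
      have "form a (x - (\<Sum>k\<in>UNIV. form a x (\<beta> k) *s dl k)) (\<beta> k) =
          form a x (\<beta> k) - form a (\<Sum>k\<in>UNIV. form a x (\<beta> k) *s dl k) (\<beta> k)"
        by (simp add: form_def algebra_simps sum_subtractf)
      then show "form a (x - (\<Sum>k\<in>UNIV. form a x (\<beta> k) *s dl k)) (\<beta> k) = 0"
        unfolding f by (simp add: dl if_distrib[of "\<lambda>c. _ * c"] cong: if_cong)
    qed
    then have "x = (\<Sum>k\<in>UNIV. form a x (\<beta> k) *s dl k)" by simp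
    then have "cdot x v = (\<Sum>k\<in>UNIV. cdot (form a x (\<beta> k) *s dl k) v)" by (metis cdot_sum)
    then show ?thesis by (simp add: cdot_linear z)
  qed
  then have "v $ k = 0" for k using cdot_axis[of k v] by simp
  then show "v = 0" by (simp add: vec_eq_iff)
qed

lemma pair: "poly_pair d F G" using lik_pair[of "pencil a" A] n3 by (simp add: d F G)

text \<open>A common power of the scaling factor drops out. Pairing with
  \<open>pt \<rho> \<xi>\<close> instead of \<open>dl k0\<close> is an equivalent condition, since
  the two differ by a combination of the vectors \<open>dl k\<close> with \<open>k\<close> in
  \<open>K\<close>.\<close>

lemma path_eq_psi:
  assumes \<rho>: "\<rho> \<noteq> 0" and \<alpha>: "\<xi> $ k0 \<noteq> 0"
  shows "path_eq (\<rho>^2 * \<sigma>^2) (bpt \<rho> \<xi>) \<longleftrightarrow> (\<forall>k. psi k \<rho> \<sigma> \<xi> = 0)"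
proof -
  define c where "c = inverse (\<rho> * \<xi> $ k0)"
  define u where "u = pt \<rho> \<xi>"
  define t where "t = \<rho>^2 * \<sigma>^2"
  have c: "c \<noteq> 0" "inverse c = \<rho> * \<xi> $ k0" using assms by (simp_all add: c_def)
  define W where "W = (1 - t) *s (inverse c *s vfun F u - vfun G u) + t *s (inverse c *s vfun F' u - vfun G' u)"
  have scale: "vfun F (c *s u) = c ^ d *s vfun F u" "vfun F' (c *s u) = c ^ d *s vfun F' u"
    "vfun G (c *s u) = c ^ Suc d *s vfun G u" "vfun G' (c *s u) = c ^ Suc d *s vfun G' u"
    using pair pair' by (auto simp: poly_pair_def simp del: power_Suc intro!: vfun_scale)
  have "path_eq t (c *s u) \<longleftrightarrow> c ^ Suc d *s W = 0"
  proof -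
    have "c ^ Suc d *s W = vseg F F' t (c *s u) - vseg G G' t (c *s u)"
      unfolding vseg_def scale W_def using c(1) by (auto simp: vec_eq_iff field_simps)
    then show ?thesis by (simp add: path_eq_def)
  qed
  also have "\<dots> \<longleftrightarrow> W = 0" using c(1) by simp
  also have "\<dots> \<longleftrightarrow> (\<forall>k. cdot (dl k) W = 0)" using cdot_dl_zero[of W] by (auto simp: cdot_linear)
  also have "\<dots> \<longleftrightarrow> (\<forall>k\<in>K. cdot (dl k) W = 0) \<and> cdot u W = 0"
  proof -
    have "cdot u W = cdot (dl k0) W + \<rho> * (\<Sum>k\<in>K. \<xi> $ k * cdot (dl k) W)"
      unfolding u_def pt_def by (simp add: cdot_linear cdot_sum)
    then have "cdot u W = cdot (dl k0) W" if "\<forall>k\<in>K. cdot (dl k) W = 0" using that by simp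
    moreover have "(\<forall>k. cdot (dl k) W = 0) \<longleftrightarrow> cdot (dl k0) W = 0 \<and> (\<forall>k\<in>K. cdot (dl k) W = 0)"
      using K_facts(2) by (metis UNIV_I insertE)
    ultimately show ?thesis by auto
  qed
  also have "\<dots> \<longleftrightarrow> (\<forall>k. psi k \<rho> \<sigma> \<xi> = 0)"
  proof -
    have "cdot (dl k) W = \<rho> * psi k \<rho> \<sigma> \<xi>" if "k \<in> K" for k
    proof -
      have "k \<noteq> k0" using that K_facts(1) by auto
      moreover have "cdot (dl k) (vfun G u) = N * (\<rho> * G1 \<rho> \<xi> k)"
        unfolding G N cdot_lik_G u_def ddet_G1 ..
      ultimately show ?thesis
        unfolding W_def psi_def c(2) t_def cdot_linear by (simp add: u_def power2_eq_square algebra_simps)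
    qed
    moreover have "cdot u W = \<rho>^2 * psi k0 \<rho> \<sigma> \<xi>"
    proof -
      have "cdot u (vfun F u) = N * (\<rho> * P1 \<rho> \<xi>)"
        unfolding F N cdot_lik_F d2det_self ddet_arr u_def edge_sum_P1 ..
      moreover have "cdot u (vfun G u) = N * (n * (\<rho>^2 * D2 \<rho> \<xi>))"
        unfolding G N n cdot_lik_G ddet_self det_arr u_def elem_sym_D2 ..
      ultimately show ?thesis
        unfolding W_def psi_def c(2) t_def cdot_linear by (simp add: u_def power2_eq_square algebra_simps)
    qed
    ultimately have "(\<forall>k\<in>K. cdot (dl k) W = 0) \<and> cdot u W = 0 \<longleftrightarrow> (\<forall>k\<in>K. psi k \<rho> \<sigma> \<xi> = 0) \<and> psi k0 \<rho> \<sigma> \<xi> = 0"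
      using \<rho> by simp
    also have "\<dots> \<longleftrightarrow> (\<forall>k. psi k \<rho> \<sigma> \<xi> = 0)" using K_facts(2) by (metis UNIV_I insertE)
    finally show ?thesis .
  qed
  finally show ?thesis unfolding c_def u_def t_def .
qed

definition "g0 = co_prod (form a (dl k0)) T"
definition "h\<^sub>0 = cdot (dl k0) (vfun G' (dl k0))"
definition "e1 = edge A (\<beta> kj) (\<beta> kk)"
definition "e2 = edge A (\<beta> ki) (\<beta> kk)"
definition "e3 = edge A (\<beta> ki) (\<beta> kj)"

lemma g0_nz: "g0 \<noteq> 0"
  unfolding g0_def using vanish K_facts(6) by (intro co_prod_nz) auto

lemma pt_0: "pt 0 \<xi> = dl k0" by (simp add: pt_def)

lemma rp_0: "rp 0 \<xi> X s = (if card (T - X) \<le> s then (\<Prod>k\<in>{k \<in> K. \<beta> k \<notin> X}. \<xi> $ k) * co_prod (form a (dl k0)) (T \<union> X) else 0)"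
  by (simp add: rp_def pt_0)

lemma k_neq: "k0 \<noteq> ki" "k0 \<noteq> kj" "k0 \<noteq> kk" "ki \<noteq> k0" "kj \<noteq> k0" "kk \<noteq> k0"
  "ki \<noteq> kj" "ki \<noteq> kk" "kj \<noteq> kk" "kj \<noteq> ki" "kk \<noteq> ki" "kk \<noteq> kj"
  using dist_k by auto

lemma \<beta>_neq: "\<beta> ki \<noteq> \<beta> kj" "\<beta> ki \<noteq> \<beta> kk" "\<beta> kj \<noteq> \<beta> kk" "\<beta> kj \<noteq> \<beta> ki" "\<beta> kk \<noteq> \<beta> ki" "\<beta> kk \<noteq> \<beta> kj"
  using \<beta>_inj dist_k by (auto simp: inj_eq)

text \<open>A product omitting \<open>p\<close> and \<open>q\<close> is of first order in
  \<open>\<rho>\<close> exactly if these are distinct elements of \<open>T\<close>; the coordinate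
  of the third element remains.\<close>

lemma rp_pair_0: "rp 0 \<xi> {p, q} 1 = (if {p, q} = {\<beta> ki, \<beta> kj} then g0 * \<xi> $ kk else
  if {p, q} = {\<beta> ki, \<beta> kk} then g0 * \<xi> $ kj else if {p, q} = {\<beta> kj, \<beta> kk} then g0 * \<xi> $ ki else 0)"
proof -
  have g: "co_prod (form a (dl k0)) (T \<union> X) = g0" if "X \<subseteq> T" for X
    using that by (simp add: g0_def Un_absorb2)
  have sub: "{p, q} \<subseteq> T \<and> p \<noteq> q" if "card (T - {p, q}) \<le> 1"
  proof -
    have "card (T - {p, q}) = 3 - card (T \<inter> {p, q})"
      using K_facts(5) by (simp add: card_Diff_subset_Int)
    then have "2 \<le> card (T \<inter> {p, q})" using that by linarith
    moreover have "card (T \<inter> {p, q}) \<le> card {p, q}" by (intro card_mono) auto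
    moreover have "card {p, q} \<le> 2" by (simp add: card_insert_if)
    ultimately have "card (T \<inter> {p, q}) = card {p, q}" "card {p, q} = 2" by linarith+
    then have "T \<inter> {p, q} = {p, q}" by (intro card_subset_eq) auto
    moreover have "p \<noteq> q" using \<open>card {p, q} = 2\<close> by auto
    ultimately show ?thesis by blast
  qed
  have val: "rp 0 \<xi> {p, q} 1 = g0 * \<xi> $ c"
    if "{p, q} = {\<beta> a', \<beta> b'}" "K = {a', b', c}" "distinct [a', b', c]" for a' b' c
  proof -
    have "{k \<in> K. \<beta> k \<notin> {p, q}} = {c}"
      unfolding that(1,2) using that(3) \<beta>_inj by (auto simp: inj_eq)
    moreover have "T - {p, q} = {\<beta> c}"
      unfolding that(1) T_def that(2) using that(3) \<beta>_inj by (auto simp: inj_eq)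
    moreover have "{p, q} \<subseteq> T" unfolding that(1) T_def that(2) by auto
    ultimately show ?thesis using g[of "{p, q}"] by (simp add: rp_0)
  qed
  consider "{p, q} = {\<beta> ki, \<beta> kj}" | "{p, q} = {\<beta> ki, \<beta> kk}" | "{p, q} = {\<beta> kj, \<beta> kk}" | "\<not> card (T - {p, q}) \<le> 1"
  proof (cases "card (T - {p, q}) \<le> 1")
    case True
    then have "p \<in> T" "q \<in> T" "p \<noteq> q" using sub by auto
    then show ?thesis using that unfolding K_facts(6) by (auto simp: insert_commute)
  qed (use that in blast)
  then show ?thesis
  proof cases
    case 1
    then show ?thesis using val[of ki kj kk] dist_k by (auto simp: K_def)
  next
    case 2
    moreover have "{p, q} \<noteq> {\<beta> ki, \<beta> kj}" unfolding 2 using \<beta>_neq by (auto simp: doubleton_eq_iff)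
    ultimately show ?thesis using val[of ki kk kj] dist_k by (auto simp: K_def)
  next
    case 3
    moreover have "{p, q} \<noteq> {\<beta> ki, \<beta> kj}" "{p, q} \<noteq> {\<beta> ki, \<beta> kk}" unfolding 3 using \<beta>_neq by (auto simp: doubleton_eq_iff)
    ultimately show ?thesis using val[of kj kk ki] dist_k by (auto simp: K_def)
  next
    case 4
    have "card (T - {\<beta> ki, \<beta> kj}) \<le> 1" "card (T - {\<beta> ki, \<beta> kk}) \<le> 1" "card (T - {\<beta> kj, \<beta> kk}) \<le> 1"
      unfolding K_facts(6) by (simp_all add: insert_Diff_if card_insert_if)
    then have "{p, q} \<noteq> {\<beta> ki, \<beta> kj}" "{p, q} \<noteq> {\<beta> ki, \<beta> kk}" "{p, q} \<noteq> {\<beta> kj, \<beta> kk}" using 4 by metis+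
    then show ?thesis using 4 by (simp add: rp_0)
  qed
qed

lemma pair_sum_0:
  "(\<Sum>i\<in>UNIV. \<Sum>l\<in>- {i}. w l i * rp 0 \<xi> {l, i} 1) =
    g0 * ((w (\<beta> ki) (\<beta> kj) + w (\<beta> kj) (\<beta> ki)) * \<xi> $ kk + (w (\<beta> ki) (\<beta> kk) + w (\<beta> kk) (\<beta> ki)) * \<xi> $ kj +
      (w (\<beta> kj) (\<beta> kk) + w (\<beta> kk) (\<beta> kj)) * \<xi> $ ki)"
proof -
  have zero: "rp 0 \<xi> {l, i} 1 = 0" if "l \<notin> T \<or> i \<notin> T" for l i
    using that unfolding rp_pair_0 K_facts(6) by (auto simp: doubleton_eq_iff)
  have "(\<Sum>i\<in>UNIV. \<Sum>l\<in>- {i}. w l i * rp 0 \<xi> {l, i} 1) = (\<Sum>i\<in>T. \<Sum>l\<in>T - {i}. w l i * rp 0 \<xi> {l, i} 1)"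
    by (intro sum.mono_neutral_cong_right ballI sum.neutral sum.mono_neutral_right)
      (auto simp: zero simp del: One_nat_def)
  also have "\<dots> = g0 * ((w (\<beta> ki) (\<beta> kj) + w (\<beta> kj) (\<beta> ki)) * \<xi> $ kk + (w (\<beta> ki) (\<beta> kk) + w (\<beta> kk) (\<beta> ki)) * \<xi> $ kj +
      (w (\<beta> kj) (\<beta> kk) + w (\<beta> kk) (\<beta> kj)) * \<xi> $ ki)"
  proof -
    have "T - {\<beta> ki} = {\<beta> kj, \<beta> kk}" "T - {\<beta> kj} = {\<beta> ki, \<beta> kk}" "T - {\<beta> kk} = {\<beta> ki, \<beta> kj}"
      unfolding K_facts(6) using \<beta>_neq by auto
    moreover have "rp 0 \<xi> {\<beta> ki, \<beta> kj} 1 = g0 * \<xi> $ kk" "rp 0 \<xi> {\<beta> kj, \<beta> ki} 1 = g0 * \<xi> $ kk"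
      "rp 0 \<xi> {\<beta> ki, \<beta> kk} 1 = g0 * \<xi> $ kj" "rp 0 \<xi> {\<beta> kk, \<beta> ki} 1 = g0 * \<xi> $ kj"
      "rp 0 \<xi> {\<beta> kj, \<beta> kk} 1 = g0 * \<xi> $ ki" "rp 0 \<xi> {\<beta> kk, \<beta> kj} 1 = g0 * \<xi> $ ki"
      using \<beta>_neq unfolding rp_pair_0 by (auto simp: doubleton_eq_iff)
    ultimately show ?thesis
      using \<beta>_neq by (subst K_facts(6)) (simp add: algebra_simps del: One_nat_def)
  qed
  finally show ?thesis .
qed

lemma P1_0: "P1 0 \<xi> = g0 * (e1 * \<xi> $ ki + e2 * \<xi> $ kj + e3 * \<xi> $ kk)"
proof -
  have "(\<Sum>j\<in>UNIV. edge A i j * rp 0 \<xi> {i, j} 1) = (\<Sum>l\<in>- {i}. edge A l i * rp 0 \<xi> {l, i} 1)" for i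
    by (subst sum.remove[of _ i]) (auto simp: edge_same edge_commute[of A i] insert_commute[of i] Compl_eq_Diff_UNIV)
  then have "P1 0 \<xi> = (\<Sum>i\<in>UNIV. \<Sum>l\<in>- {i}. edge A l i * rp 0 \<xi> {l, i} 1) / 2"
    unfolding P1_def by simp
  also have "\<dots> = g0 * (e1 * \<xi> $ ki + e2 * \<xi> $ kj + e3 * \<xi> $ kk)"
    unfolding pair_sum_0 e1_def e2_def e3_def
    by (simp add: edge_commute[of A "\<beta> kj" "\<beta> ki"] edge_commute[of A "\<beta> kk" "\<beta> ki"] edge_commute[of A "\<beta> kk" "\<beta> kj"] algebra_simps)
  finally show ?thesis .
qed

lemma D2_0: "D2 0 \<xi> = g0 * (\<xi> $ ki * \<xi> $ kj + \<xi> $ ki * \<xi> $ kk + \<xi> $ kj * \<xi> $ kk)"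
proof -
  have "rp 0 \<xi> {i} 2 = 0" if "i \<notin> T" for i
    using that K_facts(5) by (simp add: rp_0)
  then have "D2 0 \<xi> = (\<Sum>i\<in>T. rp 0 \<xi> {i} 2)"
    unfolding D2_def by (intro sum.mono_neutral_right) auto
  also have "\<dots> = (\<Sum>k\<in>K. rp 0 \<xi> {\<beta> k} 2)"
    unfolding T_def using inj_on_subset[OF \<beta>_inj, of K] by (simp add: sum.reindex)
  also have "\<dots> = (\<Sum>k\<in>K. (\<Prod>k'\<in>K - {k}. \<xi> $ k') * g0)"
  proof (intro sum.cong refl)
    fix k assume k: "k \<in> K"
    have "{k' \<in> K. \<beta> k' \<notin> {\<beta> k}} = K - {k}" using \<beta>_inj by (auto simp: inj_eq)
    moreover have "\<beta> k \<in> T" using k by (simp add: T_def)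
    ultimately show "rp 0 \<xi> {\<beta> k} 2 = (\<Prod>k'\<in>K - {k}. \<xi> $ k') * g0"
      using K_facts(5) by (simp add: rp_0 g0_def insert_absorb)
  qed
  also have "\<dots> = g0 * (\<xi> $ ki * \<xi> $ kj + \<xi> $ ki * \<xi> $ kk + \<xi> $ kj * \<xi> $ kk)"
  proof -
    have "K - {ki} = {kj, kk}" "K - {kj} = {ki, kk}" "K - {kk} = {ki, kj}" "(\<Sum>k\<in>K. f k) = f ki + f kj + f kk"
      for f :: "'m => complex"
      unfolding K_def using dist_k by auto
    then show ?thesis using dist_k by (simp add: algebra_simps)
  qed
  finally show ?thesis .
qed

lemma cdot_F_0:
  assumes "K = {k, k1, k2}" "distinct [k, k1, k2]"
  shows "cdot (dl k) (vfun F (dl k0)) = edge A (\<beta> k1) (\<beta> k2) * g0"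
proof -
  have "T = {\<beta> k, \<beta> k1, \<beta> k2}" unfolding T_def assms(1) by simp
  moreover have "k0 \<notin> {k, k1, k2}" using K_facts(1) assms(1) by simp
  ultimately show ?thesis
    using d2det_at_node[of "form a (dl k0)" "\<beta> k" "\<beta> k1" "\<beta> k2" "form a (dl k)" A] \<beta>_inj assms(2)
    by (simp add: F cdot_lik_F dl g0_def inj_eq)
qed

lemma psi_0:
  "psi ki 0 \<sigma> \<xi> = g0 * (\<xi> $ k0 * e1 - N * (\<xi> $ kj + \<xi> $ kk))"
  "psi kj 0 \<sigma> \<xi> = g0 * (\<xi> $ k0 * e2 - N * (\<xi> $ ki + \<xi> $ kk))"
  "psi kk 0 \<sigma> \<xi> = g0 * (\<xi> $ k0 * e3 - N * (\<xi> $ ki + \<xi> $ kj))"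
  "psi k0 0 \<sigma> \<xi> = N * g0 * (\<xi> $ k0 * (e1 * \<xi> $ ki + e2 * \<xi> $ kj + e3 * \<xi> $ kk) -
    n * (\<xi> $ ki * \<xi> $ kj + \<xi> $ ki * \<xi> $ kk + \<xi> $ kj * \<xi> $ kk)) - \<sigma>^2 * h\<^sub>0"
proof -
  have K: "K = {ki, kj, kk}" "K = {kj, ki, kk}" "K = {kk, ki, kj}" by (auto simp: K_def)
  show "psi ki 0 \<sigma> \<xi> = g0 * (\<xi> $ k0 * e1 - N * (\<xi> $ kj + \<xi> $ kk))"
    using cdot_F_0[OF K(1)] k_neq unfolding psi_def G1_def pair_sum_0[of "\<lambda>l i. form a (dl _) l"]
    by (simp add: pt_0 dl e1_def algebra_simps)
  show "psi kj 0 \<sigma> \<xi> = g0 * (\<xi> $ k0 * e2 - N * (\<xi> $ ki + \<xi> $ kk))"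
    using cdot_F_0[OF K(2)] k_neq unfolding psi_def G1_def pair_sum_0[of "\<lambda>l i. form a (dl _) l"]
    by (simp add: pt_0 dl e2_def algebra_simps)
  show "psi kk 0 \<sigma> \<xi> = g0 * (\<xi> $ k0 * e3 - N * (\<xi> $ ki + \<xi> $ kj))"
    using cdot_F_0[OF K(3)] k_neq unfolding psi_def G1_def pair_sum_0[of "\<lambda>l i. form a (dl _) l"]
    by (simp add: pt_0 dl e3_def algebra_simps)
  show "psi k0 0 \<sigma> \<xi> = N * g0 * (\<xi> $ k0 * (e1 * \<xi> $ ki + e2 * \<xi> $ kj + e3 * \<xi> $ kk) -
    n * (\<xi> $ ki * \<xi> $ kj + \<xi> $ ki * \<xi> $ kk + \<xi> $ kj * \<xi> $ kk)) - \<sigma>^2 * h\<^sub>0"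
    unfolding psi_def P1_0 D2_0 h\<^sub>0_def by (simp add: pt_0 algebra_simps)
qed

definition "discr = (e3 + e2 + e1)^2 - 2 * (e3^2 + e2^2 + e1^2)"
definition "Q = 4 * N * h\<^sub>0 / ((n - 2) * g0 * discr)"

text \<open>The solution of the three linear limit equations with
  \<open>\<xi> $ k0 = s\<close>.\<close>

definition lim_pt :: "complex => complex^'m" where
  "lim_pt s = (\<chi> k. if k = k0 then s else s * ((e1 + e2 + e3) / 2 - (if k = ki then e1 else if k = kj then e2 else e3)) / N)"

lemma constants: "discr \<noteq> 0" "N \<noteq> 0" "N = n - 1" "n \<noteq> 2" "Q \<noteq> 0"
proof -
  show d: "discr \<noteq> 0" using disc by (simp add: discr_def e1_def e2_def e3_def triple_disc_def)
  show N0: "N \<noteq> 0" and "N = n - 1" using n3 by (simp_all add: N n of_nat_diff)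
  have "n \<noteq> of_nat 2" unfolding n using n3 by (subst of_nat_eq_iff) simp
  then show n2: "n \<noteq> 2" by simp
  show "Q \<noteq> 0" using d N0 n2 g0_nz h0 by (simp add: Q_def h\<^sub>0_def)
qed

lemma all_k: "(\<forall>k. P k) \<longleftrightarrow> P ki \<and> P kj \<and> P kk \<and> P k0"
  using UNIV_m by (metis UNIV_I empty_iff insertE)

lemma psi_limit: "(\<forall>k. psi k 0 \<sigma> \<xi> = 0) \<longleftrightarrow> \<xi> = lim_pt (\<xi> $ k0) \<and> (\<xi> $ k0)^2 = \<sigma>^2 * Q"
proof -
  have "\<xi> = lim_pt (\<xi> $ k0) \<longleftrightarrow> \<xi> $ ki = \<xi> $ k0 * ((e1 + e2 + e3) / 2 - e1) / N \<and>
      \<xi> $ kj = \<xi> $ k0 * ((e1 + e2 + e3) / 2 - e2) / N \<and> \<xi> $ kk = \<xi> $ k0 * ((e1 + e2 + e3) / 2 - e3) / N"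
    unfolding vec_eq_iff all_k using dist_k by (auto simp: lim_pt_def)
  then show ?thesis
    unfolding all_k psi_0
    using limit_equations[OF g0_nz constants(2,3,4) constants(1)[unfolded discr_def] Q_def[unfolded discr_def], of "\<xi> $ k0" "\<xi> $ kj" "\<xi> $ kk" "\<xi> $ ki" \<sigma>]
    by simp
qed

text \<open>Of the two parameters, \<open>False\<close> indexes \<open>\<rho>\<close> and
  \<open>True\<close> indexes \<open>\<sigma>\<close>.\<close>

definition psi_fun :: "'m => (bool + 'm) cfun" where
  "psi_fun k z = psi k (z (Inl False)) (z (Inl True)) (\<chi> i. z (Inr i))"

lemma sys_psi: "sys psi_fun p \<xi> = (\<chi> k. psi k (p $ False) (p $ True) \<xi>)"
  by (simp add: sys_def psi_fun_def vec_nth_inverse)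

lemma psi_fun_poly: "poly_fun (psi_fun k)"
proof -
  have pt: "poly_fun (\<lambda>z :: bool + 'm => complex. pt (z (Inl False)) (\<chi> i. z (Inr i)) $ k)" for k
    unfolding pt_def by (simp add: sum_component) (intro poly_fun_intros)
  have rp: "poly_fun (\<lambda>z :: bool + 'm => complex. rp (z (Inl False)) (\<chi> i. z (Inr i)) X s)" for X s
    unfolding rp_def form_pt
    by (intro poly_fun_intros poly_fun_subst[OF poly_fun_co_prod]) (simp_all add: poly_fun.var)
  have H: "poly_fun (\<lambda>z :: bool + 'm => complex. H k (vec_nth (pt (z (Inl False)) (\<chi> i. z (Inr i)))))" if "\<And>k. poly_fun (H k)"
    for H :: "'m => 'm cfun" and k
    by (rule poly_fun_subst[OF that]) (rule pt)
  have polys: "\<And>k. poly_fun (F k)" "\<And>k. poly_fun (F' k)" "\<And>k. poly_fun (G' k)"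
    using pair pair' by (simp_all add: poly_pair_def)
  show ?thesis
  proof (cases "k = k0")
    case True
    then show ?thesis
      unfolding psi_fun_def[abs_def] psi_def P1_def D2_def cdot_def vfun_def
      by (simp only: if_True vec_lambda_beta divide_inverse simp_thms) (intro poly_fun_intros rp pt H polys)
  next
    case False
    then show ?thesis
      unfolding psi_fun_def[abs_def] psi_def G1_def cdot_def vfun_def
      by (simp only: if_False vec_lambda_beta) (intro poly_fun_intros rp pt H polys)
  qed
qed

lemma psi_nondegenerate:
  assumes \<sigma>: "p $ False = 0" and s: "s \<noteq> 0"
  shows "nondegenerate (sys psi_fun p) (lim_pt s)"
proof -
  define \<xi> where "\<xi> = lim_pt s"
  define psi' where "psi' k h = (if k = ki then g0 * (h $ k0 * e1 - N * (h $ kj + h $ kk))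
    else if k = kj then g0 * (h $ k0 * e2 - N * (h $ ki + h $ kk))
    else if k = kk then g0 * (h $ k0 * e3 - N * (h $ ki + h $ kj))
    else N * g0 * (h $ k0 * (e1 * \<xi> $ ki + e2 * \<xi> $ kj + e3 * \<xi> $ kk) + \<xi> $ k0 * (e1 * h $ ki + e2 * h $ kj + e3 * h $ kk) -
      n * (h $ ki * \<xi> $ kj + \<xi> $ ki * h $ kj + h $ ki * \<xi> $ kk + \<xi> $ ki * h $ kk + h $ kj * \<xi> $ kk + \<xi> $ kj * h $ kk)))"
    for k and h :: "complex^'m"
  have nth: "((\<lambda>\<xi> :: complex^'m. \<xi> $ k) has_derivative (\<lambda>h. h $ k)) (at \<xi>)" for k
    by (rule bounded_linear_imp_has_derivative[OF bounded_linear_vec_nth])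
  have "((\<lambda>\<xi>. psi k 0 (p $ True) \<xi>) has_derivative psi' k) (at \<xi>)" for k
  proof -
    have "k \<in> {k0, ki, kj, kk}" using UNIV_m by auto
    then consider "k = ki" | "k = kj" | "k = kk" | "k = k0" by auto
    then show ?thesis
    proof cases
      case 1
      show ?thesis unfolding 1 psi_0 psi'_def using dist_k by (auto intro!: derivative_eq_intros nth)
    next
      case 2
      show ?thesis unfolding 2 psi_0 psi'_def using dist_k by (auto intro!: derivative_eq_intros nth)
    next
      case 3
      show ?thesis unfolding 3 psi_0 psi'_def using dist_k by (auto intro!: derivative_eq_intros nth)
    next
      case 4
      show ?thesis unfolding 4 psi_0 psi'_def using dist_k by (auto intro!: derivative_eq_intros nth simp: algebra_simps)
    qed
  qed
  then have "((\<lambda>\<xi>. \<chi> k. psi k 0 (p $ True) \<xi>) has_derivative (\<lambda>h. \<chi> k. psi' k h)) (at \<xi>)"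
    by (rule has_derivative_vec_lambda)
  then have D: "(sys psi_fun p has_derivative (\<lambda>h. \<chi> k. psi' k h)) (at \<xi>)"
    unfolding sys_psi[abs_def] using \<sigma> by simp
  have "h = 0" if "(\<chi> k. psi' k h) = 0" for h
  proof -
    have z: "psi' k h = 0" for k using arg_cong[OF that, of "\<lambda>v. v $ k"] by simp
    have \<xi>: "\<xi> $ k0 = s" "\<xi> $ ki = s * ((e1 + e2 + e3) / 2 - e1) / N" "\<xi> $ kj = s * ((e1 + e2 + e3) / 2 - e2) / N"
      "\<xi> $ kk = s * ((e1 + e2 + e3) / 2 - e3) / N"
      using dist_k by (auto simp: \<xi>_def lim_pt_def)
    have "h $ k0 = 0 \<and> h $ ki = 0 \<and> h $ kj = 0 \<and> h $ kk = 0"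
      using z[of ki] z[of kj] z[of kk] z[of k0] k_neq
      by (intro limit_equations_derivative[OF g0_nz constants(2,3,4) s constants(1)[unfolded discr_def] \<xi>(2,3,4)])
        (simp_all add: psi'_def \<xi>(1) algebra_simps)
    then show ?thesis unfolding vec_eq_iff all_k by simp
  qed
  then show ?thesis using D unfolding nondegenerate_def \<xi>_def by blast
qed

section \<open>The two branches at a node\<close>

definition ctr :: "bool => complex^'m" where
  "ctr b = lim_pt (if b then csqrt Q else - csqrt Q)"

text \<open>The factor \<open>\<delta> = csqrt t\<close> turns the two solutions \<open>\<plusminus>csqrt Q\<close> of the limit equations into two branches
  \<open>x \<sim> d\<^sub>k\<^sub>0 / (\<delta> \<alpha>)\<close> of the original system.\<close>

definition branch :: "real => bool => complex => (complex^'m) set" where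
  "branch r b t = bpt (csqrt t) ` ball (ctr b) r"

text \<open>Within this distance from a centre \<open>\<xi> $ k0\<close> stays away from 0, and the
  balls around the two centres remain disjoint.\<close>

definition "rad = norm (csqrt Q) / 2"

lemma ctr_k0: "ctr b $ k0 = (if b then csqrt Q else - csqrt Q)" "ctr b $ k0 \<noteq> 0"
  using constants(5) by (simp_all add: ctr_def lim_pt_def)

lemma ball_ctr:
  assumes "\<xi> \<in> ball (ctr b) r" "r \<le> rad"
  shows "norm (\<xi> $ k0 - (if b then csqrt Q else - csqrt Q)) < rad" "norm (\<xi> $ k0) > rad" "\<xi> $ k0 \<noteq> 0"
    "norm (\<xi> $ k) \<le> norm (ctr b) + rad"
proof -
  have "norm ((\<xi> - ctr b) $ k0) \<le> norm (\<xi> - ctr b)" by (rule Finite_Cartesian_Product.norm_nth_le)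
  also have "\<dots> < r" using assms(1) by (simp add: dist_norm norm_minus_commute)
  finally show 1: "norm (\<xi> $ k0 - (if b then csqrt Q else - csqrt Q)) < rad"
    using assms(2) by (simp add: ctr_k0)
  have "norm (ctr b $ k0) \<le> norm (\<xi> $ k0) + norm (\<xi> $ k0 - ctr b $ k0)"
    by norm
  moreover have "norm (ctr b $ k0) = 2 * rad" by (simp add: ctr_k0 rad_def)
  ultimately show 2: "norm (\<xi> $ k0) > rad" using 1 by (simp add: ctr_k0)
  have "rad \<ge> 0" by (simp add: rad_def)
  with 2 show "\<xi> $ k0 \<noteq> 0" by auto
  have "norm (\<xi> $ k) \<le> norm \<xi>" by (rule Finite_Cartesian_Product.norm_nth_le)
  also have "\<dots> \<le> norm (ctr b) + norm (\<xi> - ctr b)" by norm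
  also have "norm (\<xi> - ctr b) < r" using assms(1) by (simp add: dist_norm norm_minus_commute)
  finally show "norm (\<xi> $ k) \<le> norm (ctr b) + rad" using assms(2) by simp
qed

lemma form_branch_pt:
  assumes "\<delta> \<noteq> 0" "\<xi> $ k0 \<noteq> 0"
  shows "form a (bpt \<delta> \<xi>) (\<beta> k) = (if k = k0 then inverse (\<delta> * \<xi> $ k0) else \<xi> $ k / \<xi> $ k0)"
  using assms by (simp add: form_smult form_pt_\<beta> field_simps)

lemma branch_pt_inj:
  assumes "\<delta> \<noteq> 0" "\<xi> $ k0 \<noteq> 0" "\<zeta> $ k0 \<noteq> 0"
    and eq: "bpt \<delta> \<xi> = bpt \<delta> \<zeta>"
  shows "\<xi> = \<zeta>"
proof -
  have f: "(if k = k0 then inverse (\<delta> * \<xi> $ k0) else \<xi> $ k / \<xi> $ k0) = (if k = k0 then inverse (\<delta> * \<zeta> $ k0) else \<zeta> $ k / \<zeta> $ k0)" for k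
    using form_branch_pt[OF assms(1,2)] form_branch_pt[OF assms(1,3)] eq by metis
  from f[of k0] have 0: "\<xi> $ k0 = \<zeta> $ k0" using assms(1) by simp
  have "\<xi> $ k = \<zeta> $ k" for k using f[of k] 0 assms(2) by (cases "k = k0") auto
  then show ?thesis by (simp add: vec_eq_iff)
qed

text \<open>\<open>csqrt\<close> jumps along its cut, but the branches only rely on its limit at
  0.\<close>

lemma tendsto_csqrt_0: "(csqrt \<longlongrightarrow> 0) (at 0)"
proof (rule tendsto_norm_zero_cancel)
  have "((\<lambda>t::complex. sqrt (norm t)) \<longlongrightarrow> sqrt (norm (0::complex))) (at 0)" by (intro tendsto_intros)
  then show "((\<lambda>t. norm (csqrt t)) \<longlongrightarrow> 0) (at 0)" by simp
qed

lemma branch_ex1: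
  assumes r: "r \<le> rad" and ex1: "eventually (\<lambda>p. \<exists>!\<xi>. \<xi> \<in> ball (ctr b) r \<and> sys psi_fun p \<xi> = 0) (nhds (\<chi> c. if c then 1 else 0))"
  shows "eventually (\<lambda>t. \<exists>!x. x \<in> branch r b t \<and> x \<noteq> 0 \<and> path_eq t x) (at 0)"
proof -
  \<comment> \<open>The branches correspond to \<sigma> = 1 and \<rho> =
    \<open>csqrt t\<close>.\<close>
  have "((\<lambda>t. \<chi> c. if c then 1 else csqrt t) \<longlongrightarrow> (\<chi> c. if c then 1 else 0)) (at (0::complex))"
    using tendsto_csqrt_0 by (intro vec_tendstoI) simp
  with ex1 have "eventually (\<lambda>t. \<exists>!\<xi>. \<xi> \<in> ball (ctr b) r \<and> sys psi_fun (\<chi> c. if c then 1 else csqrt t) \<xi> = 0) (at 0)"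
    by (rule eventually_compose_filterlim)
  moreover have "eventually (\<lambda>t :: complex. t \<noteq> 0) (at 0)" by (simp add: eventually_at_filter)
  ultimately show ?thesis
  proof eventually_elim
    case (elim t)
    define \<delta> where "\<delta> = csqrt t"
    have \<delta>: "\<delta> \<noteq> 0" "\<delta>^2 * 1^2 = t" using elim(2) by (simp_all add: \<delta>_def)
    have eq: "path_eq t (bpt \<delta> \<xi>) \<longleftrightarrow> sys psi_fun (\<chi> c. if c then 1 else csqrt t) \<xi> = 0"
      and nz: "bpt \<delta> \<xi> \<noteq> 0" if "\<xi> \<in> ball (ctr b) r" for \<xi>
    proof -
      have k0: "\<xi> $ k0 \<noteq> 0" using ball_ctr(3)[OF that r] .
      show "path_eq t (bpt \<delta> \<xi>) \<longleftrightarrow> sys psi_fun (\<chi> c. if c then 1 else csqrt t) \<xi> = 0"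
        using path_eq_psi[OF \<delta>(1) k0, of 1] unfolding \<delta>(2) sys_psi by (simp add: vec_eq_iff \<delta>_def)
      have "form a (pt \<delta> \<xi>) (\<beta> k0) = 1" by (simp add: form_pt_\<beta>)
      then have "pt \<delta> \<xi> \<noteq> 0" by (auto simp: form_def)
      then show "bpt \<delta> \<xi> \<noteq> 0" using k0 \<delta> by simp
    qed
    obtain \<xi> where \<xi>: "\<xi> \<in> ball (ctr b) r" "sys psi_fun (\<chi> c. if c then 1 else csqrt t) \<xi> = 0"
      and uniq: "\<And>\<zeta>. \<zeta> \<in> ball (ctr b) r \<and> sys psi_fun (\<chi> c. if c then 1 else csqrt t) \<zeta> = 0 ==> \<zeta> = \<xi>"
      using elim(1) by blast
    show ?case
    proof (rule ex1I[of _ "bpt \<delta> \<xi>"], intro conjI)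
      show "bpt \<delta> \<xi> \<in> branch r b t" using \<xi>(1) by (auto simp: branch_def \<delta>_def)
      show "bpt \<delta> \<xi> \<noteq> 0" "path_eq t (bpt \<delta> \<xi>)"
        using \<xi> nz eq by auto
      fix x assume x: "x \<in> branch r b t \<and> x \<noteq> 0 \<and> path_eq t x"
      then obtain \<zeta> where \<zeta>: "\<zeta> \<in> ball (ctr b) r" "x = bpt \<delta> \<zeta>"
        by (auto simp: branch_def \<delta>_def)
      then have "\<zeta> = \<xi>" using uniq eq x by blast
      then show "x = bpt \<delta> \<xi>" using \<zeta> by simp
    qed
  qed
qed

lemma branch_disjoint:
  assumes r: "r \<le> rad" and "t \<noteq> 0"
  shows "branch r True t \<inter> branch r False t = {}"
proof (rule ccontr)
  assume "\<not> ?thesis"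
  then obtain \<xi> \<zeta> where \<xi>: "\<xi> \<in> ball (ctr True) r" "\<zeta> \<in> ball (ctr False) r"
    and eq: "bpt (csqrt t) \<xi> = bpt (csqrt t) \<zeta>"
    unfolding branch_def by auto
  have "\<xi> = \<zeta>"
    by (rule branch_pt_inj[OF _ ball_ctr(3)[OF \<xi>(1) r] ball_ctr(3)[OF \<xi>(2) r] eq]) (use assms(2) in simp)
  then have "norm (\<xi> $ k0 - csqrt Q) < rad" "norm (\<xi> $ k0 + csqrt Q) < rad"
    using ball_ctr(1)[OF \<xi>(1) r] ball_ctr(1)[OF \<xi>(2) r] by simp_all
  moreover have "norm (2 * csqrt Q) \<le> norm (\<xi> $ k0 - csqrt Q) + norm (\<xi> $ k0 + csqrt Q)"
    using norm_triangle_ineq4[of "\<xi> $ k0 + csqrt Q" "\<xi> $ k0 - csqrt Q"] by simp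
  moreover have "norm (2 * csqrt Q) = 2 * norm (csqrt Q)" by (simp only: norm_mult norm_numeral)
  ultimately show False using norm_ge_zero[of "csqrt Q"] unfolding rad_def by linarith
qed

text \<open>In local coordinates such a form is \<open>\<xi> $ k / \<xi> $ k0\<close>. The contrast
  with \<open>branch_unbounded\<close> tells branches at different nodes apart.\<close>

lemma branch_bounded:
  assumes r: "r \<le> rad" and l: "l \<in> T"
  shows "\<exists>C. \<forall>t x b. t \<noteq> 0 \<longrightarrow> x \<in> branch r b t \<longrightarrow> norm (form a x l) \<le> C"
proof -
  obtain k where k: "k \<in> K" "l = \<beta> k" using l by (auto simp: T_def)
  define C where "C = norm (ctr True) + norm (ctr False) + rad"
  have rad: "rad > 0" using constants(5) by (simp add: rad_def)
  have "norm (form a x l) \<le> C / rad" if "t \<noteq> 0" "x \<in> branch r b t" for t x b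
  proof -
    obtain \<xi> where \<xi>: "\<xi> \<in> ball (ctr b) r" "x = bpt (csqrt t) \<xi>"
      using \<open>x \<in> branch r b t\<close> by (auto simp: branch_def)
    have "k \<noteq> k0" using k K_facts(1) by auto
    then have "form a x l = \<xi> $ k / \<xi> $ k0"
      unfolding \<xi>(2) k(2) using form_branch_pt[of "csqrt t" \<xi> k] ball_ctr(3)[OF \<xi>(1) r] \<open>t \<noteq> 0\<close> by simp
    moreover have "norm (\<xi> $ k) \<le> C"
      using ball_ctr(4)[OF \<xi>(1) r, of k] by (cases b) (auto simp: C_def intro: order_trans)
    ultimately show ?thesis
      using ball_ctr(2)[OF \<xi>(1) r] rad by (auto simp: norm_divide C_def intro!: frac_le)
  qed
  then show ?thesis by blast
qed

text \<open>At \<open>pt (csqrt t) \<xi>\<close> the form is close to its nonzero value at the node,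
  while the scaling factor of \<open>bpt\<close> tends to infinity uniformly on the ball.\<close>

lemma branch_unbounded:
  assumes r: "r \<le> rad" and l: "l \<notin> T"
  shows "eventually (\<lambda>t. \<forall>x\<in>branch r b t. R < norm (form a x l)) (at 0)"
proof -
  define f where "f = norm (form a (dl k0) l)"
  define C where "C = norm (ctr b) + rad"
  define D where "D = (\<Sum>k\<in>K. C * norm (form a (dl k) l))"
  have rad: "rad > 0" using constants(5) by (simp add: rad_def)
  have C: "C > 0" unfolding C_def using rad by (simp add: add_nonneg_pos)
  have "form a (dl k0) l \<noteq> 0" using l vanish K_facts(6) by auto
  then have f: "f > 0" by (simp add: f_def)
  have "((\<lambda>t. f - norm (csqrt t) * D) \<longlongrightarrow> f - norm (0::complex) * D) (at 0)"
    by (intro tendsto_intros tendsto_csqrt_0)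
  then have "eventually (\<lambda>t. f / 2 < f - norm (csqrt t) * D) (at 0)"
    by (rule order_tendstoD) (use f in simp)
  moreover have "((\<lambda>t. R * (norm (csqrt t) * C)) \<longlongrightarrow> R * (norm (0::complex) * C)) (at 0)"
    by (intro tendsto_intros tendsto_csqrt_0)
  then have "eventually (\<lambda>t. R * (norm (csqrt t) * C) < f / 2) (at 0)"
    by (rule order_tendstoD) (use f in simp)
  moreover have "eventually (\<lambda>t :: complex. t \<noteq> 0) (at 0)" by (simp add: eventually_at_filter)
  ultimately show ?thesis
  proof eventually_elim
    case (elim t)
    show ?case
    proof
      fix x assume "x \<in> branch r b t"
      then obtain \<xi> where \<xi>: "\<xi> \<in> ball (ctr b) r" "x = bpt (csqrt t) \<xi>"
        by (auto simp: branch_def)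
      have le: "norm (\<xi> $ k) \<le> C" for k using ball_ctr(4)[OF \<xi>(1) r] by (simp add: C_def)
      have "norm (\<Sum>k\<in>K. \<xi> $ k * form a (dl k) l) \<le> D"
        unfolding D_def by (intro order_trans[OF norm_sum] sum_mono) (simp add: norm_mult mult_right_mono le)
      then have "norm (csqrt t * (\<Sum>k\<in>K. \<xi> $ k * form a (dl k) l)) \<le> norm (csqrt t) * D"
        by (simp add: norm_mult mult_left_mono)
      then have "f - norm (csqrt t) * D \<le> norm (form a (pt (csqrt t) \<xi>) l)"
        unfolding form_pt f_def
        by (smt (verit) norm_diff_ineq)
      then have "R * (norm (csqrt t) * C) < norm (form a (pt (csqrt t) \<xi>) l)" using elim by simp
      moreover have pos: "norm (csqrt t * \<xi> $ k0) > 0" using elim(3) ball_ctr(3)[OF \<xi>(1) r] by simp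
      moreover have "R * norm (csqrt t * \<xi> $ k0) \<le> max 0 (R * (norm (csqrt t) * C))"
      proof (cases "R \<ge> 0")
        case True
        then have "R * norm (csqrt t * \<xi> $ k0) \<le> R * (norm (csqrt t) * C)"
          unfolding norm_mult by (intro mult_left_mono le) auto
        then show ?thesis by simp
      next
        case False
        then have "R * norm (csqrt t * \<xi> $ k0) \<le> 0" by (intro mult_nonpos_nonneg) auto
        then show ?thesis by simp
      qed
      moreover have "0 < norm (form a (pt (csqrt t) \<xi>) l)"
        using \<open>f - norm (csqrt t) * D \<le> norm (form a (pt (csqrt t) \<xi>) l)\<close> elim(1) f by linarith
      ultimately have "R * norm (csqrt t * \<xi> $ k0) < norm (form a (pt (csqrt t) \<xi>) l)" by linarith
      then show "R < norm (form a x l)"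
        unfolding \<xi>(2) form_smult norm_mult norm_inverse
        using pos unfolding norm_mult by (simp add: field_simps)
    qed
  qed
qed

lemma lim_pt_smult: "lim_pt (c * s) = c *s lim_pt s"
  by (simp add: lim_pt_def vec_eq_iff)

lemma x_eq_pt:
  assumes y: "form a x (\<beta> k0) = y" "y \<noteq> 0" and \<rho>: "\<rho> \<noteq> 0"
    and \<xi>: "\<xi> $ k0 = inverse (\<rho> * y)" "\<And>k. k \<in> K ==> \<xi> $ k = form a x (\<beta> k) / (\<rho> * y)"
  shows "x = bpt \<rho> \<xi>"
proof -
  have "x - bpt \<rho> \<xi> = 0"
  proof (rule \<beta>_zero)
    fix k
    have "form a (x - bpt \<rho> \<xi>) (\<beta> k) =
        form a x (\<beta> k) - form a (bpt \<rho> \<xi>) (\<beta> k)"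
      by (simp add: form_def algebra_simps sum_subtractf)
    also have "form a (bpt \<rho> \<xi>) (\<beta> k) = form a x (\<beta> k)"
    proof (cases "k = k0")
      case True
      then show ?thesis using form_branch_pt[of \<rho> \<xi> k] \<rho> y by (simp add: \<xi>(1))
    next
      case False
      then have "k \<in> K" using K_facts(2) by blast
      then show ?thesis using form_branch_pt[of \<rho> \<xi> k] \<rho> y False by (simp add: \<xi> field_simps)
    qed
    finally show "form a (x - bpt \<rho> \<xi>) (\<beta> k) = 0" by simp
  qed
  then show ?thesis by simp
qed

text \<open>Nothing is known beforehand about the relative size of \<open>csqrt t\<close> and the
  local coordinates, so both are divided by the norm \<rho> of the joint vector. The limit
  (\<sigma>0, \<xi>0) is a unit vector satisfying the limit equations, and \<sigma>0 = 0 would force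
  \<xi>0 = 0. Hence \<xi> / \<sigma> tends to one of the two centres, which puts the solution on
  that branch.\<close>

lemma branch_cover_aux:
  assumes r: "0 < r" and t: "t \<longlonglongrightarrow> 0" and eq: "\<And>k. path_eq (t k) (x k)"
    and y: "\<And>k. form a (x k) (\<beta> k0) \<noteq> 0" "(\<lambda>k. inverse (form a (x k) (\<beta> k0))) \<longlonglongrightarrow> 0"
    and w: "\<And>j. j \<in> K ==> (\<lambda>k. form a (x k) (\<beta> j) / form a (x k) (\<beta> k0)) \<longlonglongrightarrow> 0"
  shows "\<exists>k. t k \<noteq> 0 \<and> (\<exists>b. x k \<in> branch r b (t k))"
proof -
  define v :: "nat => complex^'m" where
    "v k = (\<chi> j. if j = k0 then inverse (form a (x k) (\<beta> k0)) else form a (x k) (\<beta> j) / form a (x k) (\<beta> k0))" for k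
  define z where "z k = join (\<chi> _ :: unit. csqrt (t k)) (v k)" for k
  have "z k $ Inr k0 \<noteq> 0" for k using y(1) by (simp add: z_def v_def)
  then have nz: "z k \<noteq> 0" for k by (metis zero_index)
  have "(\<lambda>k. v k $ j) \<longlonglongrightarrow> 0" for j
    using y(2) w[of j] K_facts(2) by (cases "j = k0") (auto simp: v_def)
  moreover have "(\<lambda>k. csqrt (t k)) \<longlonglongrightarrow> 0"
    using tendsto_compose[OF _ t, of csqrt] tendsto_csqrt_0 by simp
  ultimately have z0: "z \<longlonglongrightarrow> 0"
  proof (intro vec_tendstoI)
    fix i :: "unit + 'm"
    assume "\<And>j. (\<lambda>k. v k $ j) \<longlonglongrightarrow> 0" "(\<lambda>k. csqrt (t k)) \<longlonglongrightarrow> 0"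
    then show "(\<lambda>k. z k $ i) \<longlonglongrightarrow> 0 $ i" by (cases i) (simp_all add: z_def)
  qed
  obtain f u where f: "strict_mono (f :: nat => nat)" "norm u = 1" "(\<lambda>k. z (f k) /\<^sub>R norm (z (f k))) \<longlonglongrightarrow> u"
    by (rule sphere_subsequence[of z, OF nz]) (rule that)
  define \<rho> where "\<rho> k = complex_of_real (norm (z (f k)))" for k
  define \<sigma> where "\<sigma> k = csqrt (t (f k)) / \<rho> k" for k
  define \<xi> :: "nat => complex^'m" where "\<xi> k = (\<chi> j. v (f k) $ j / \<rho> k)" for k
  define \<sigma>0 where "\<sigma>0 = u $ Inl ()"
  define \<xi>0 :: "complex^'m" where "\<xi>0 = (\<chi> j. u $ Inr j)"
  have \<rho>: "\<rho> k \<noteq> 0" for k using nz by (simp add: \<rho>_def)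
  have \<rho>\<sigma>: "\<rho> k * \<sigma> k = csqrt (t (f k))" for k using \<rho> by (simp add: \<sigma>_def)
  have zf: "(\<lambda>k. (z (f k) /\<^sub>R norm (z (f k))) $ i) \<longlonglongrightarrow> u $ i" for i by (rule tendsto_vec_nth[OF f(3)])
  have \<sigma>lim: "\<sigma> \<longlonglongrightarrow> \<sigma>0"
    using zf[of "Inl ()"] by (simp add: \<sigma>_def[abs_def] \<rho>_def \<sigma>0_def z_def scaleR_conv_of_real[where 'a=complex] divide_inverse mult.commute)
  have \<xi>lim: "\<xi> \<longlonglongrightarrow> \<xi>0"
  proof (rule vec_tendstoI)
    fix j show "(\<lambda>k. \<xi> k $ j) \<longlonglongrightarrow> \<xi>0 $ j"
      using zf[of "Inr j"] by (simp add: \<xi>_def \<rho>_def \<xi>0_def z_def scaleR_conv_of_real[where 'a=complex] divide_inverse mult.commute)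
  qed
  have "(\<lambda>k. norm (z (f k))) \<longlonglongrightarrow> 0"
    using tendsto_norm[OF LIMSEQ_subseq_LIMSEQ[OF z0 f(1)]] by (simp add: o_def)
  then have \<rho>lim: "\<rho> \<longlonglongrightarrow> 0" unfolding \<rho>_def[abs_def] by (metis of_real_0 tendsto_of_real)
  define p :: "nat => complex^bool" where "p k = (\<chi> c. if c then \<sigma> k else \<rho> k)" for k
  have plim: "p \<longlonglongrightarrow> (\<chi> c. if c then \<sigma>0 else 0)"
  proof (rule vec_tendstoI)
    fix c show "(\<lambda>k. p k $ c) \<longlonglongrightarrow> (\<chi> c. if c then \<sigma>0 else 0) $ c"
      by (cases c) (simp_all add: p_def \<sigma>lim \<rho>lim)
  qed
  have k0: "\<xi> k $ k0 \<noteq> 0" for k using y(1) \<rho> by (simp add: \<xi>_def v_def)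
  have "sys psi_fun (p k) (\<xi> k) = 0" for k
  proof -
    have x: "x (f k) = inverse (\<rho> k * \<xi> k $ k0) *s pt (\<rho> k) (\<xi> k)"
    proof (rule x_eq_pt[OF refl y(1) \<rho>])
      show "\<xi> k $ k0 = inverse (\<rho> k * form a (x (f k)) (\<beta> k0))" by (simp add: \<xi>_def v_def field_simps)
      fix j assume "j \<in> K"
      then have "j \<noteq> k0" using K_facts(1) by auto
      then show "\<xi> k $ j = form a (x (f k)) (\<beta> j) / (\<rho> k * form a (x (f k)) (\<beta> k0))" by (simp add: \<xi>_def v_def field_simps)
    qed
    have "\<rho> k ^ 2 * \<sigma> k ^ 2 = t (f k)" unfolding power_mult_distrib[symmetric] \<rho>\<sigma> by simp
    then have "\<forall>j. psi j (\<rho> k) (\<sigma> k) (\<xi> k) = 0"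
      using path_eq_psi[of "\<rho> k" "\<xi> k" "\<sigma> k", OF \<rho> k0] eq[of "f k"] unfolding x by simp
    then show ?thesis unfolding sys_psi by (simp add: vec_eq_iff p_def)
  qed
  then have "sys psi_fun (\<chi> c. if c then \<sigma>0 else 0) \<xi>0 = 0"
    by (rule sys_limit[of psi_fun, OF psi_fun_poly plim \<xi>lim])
  then have "\<forall>k. psi k 0 \<sigma>0 \<xi>0 = 0" unfolding sys_psi by (simp add: vec_eq_iff)
  then have L: "\<xi>0 = lim_pt (\<xi>0 $ k0)" "(\<xi>0 $ k0)^2 = \<sigma>0^2 * Q" unfolding psi_limit by blast+
  have \<sigma>0: "\<sigma>0 \<noteq> 0"
  proof
    assume "\<sigma>0 = 0"
    then have "\<xi>0 $ k0 = 0" using L(2) by simp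
    then have "\<xi>0 = lim_pt 0" using L(1) by simp
    also have "\<dots> = 0" by (simp add: lim_pt_def vec_eq_iff)
    finally have "u $ i = 0" for i
      using \<open>\<sigma>0 = 0\<close> by (cases i) (simp_all add: \<sigma>0_def \<xi>0_def vec_eq_iff)
    then have "u = 0" by (simp add: vec_eq_iff)
    then show False using f(2) by simp
  qed
  have "(\<xi>0 $ k0)^2 = (\<sigma>0 * csqrt Q)^2" unfolding L(2) by (simp add: power_mult_distrib)
  then have "\<xi>0 $ k0 = \<sigma>0 * csqrt Q \<or> \<xi>0 $ k0 = \<sigma>0 * (- csqrt Q)" unfolding power2_eq_iff by simp
  then obtain b where "\<xi>0 = \<sigma>0 *s ctr b"
    unfolding ctr_def lim_pt_smult[symmetric] using L(1) by (metis (full_types))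
  have "(\<lambda>k. inverse (\<sigma> k) *s \<xi> k) \<longlonglongrightarrow> ctr b"
  proof (rule vec_tendstoI)
    fix j
    have "(\<lambda>k. inverse (\<sigma> k) * \<xi> k $ j) \<longlonglongrightarrow> inverse \<sigma>0 * \<xi>0 $ j"
      by (intro tendsto_intros \<sigma>lim \<xi>lim \<sigma>0)
    then show "(\<lambda>k. (inverse (\<sigma> k) *s \<xi> k) $ j) \<longlonglongrightarrow> ctr b $ j"
      using \<sigma>0 \<open>\<xi>0 = \<sigma>0 *s ctr b\<close> by (simp add: mult.assoc[symmetric])
  qed
  then have "eventually (\<lambda>k. dist (inverse (\<sigma> k) *s \<xi> k) (ctr b) < r) sequentially" using r by (rule tendstoD)
  moreover have "eventually (\<lambda>k. \<sigma> k \<noteq> 0) sequentially" using \<sigma>lim \<sigma>0 by (rule tendsto_imp_eventually_ne)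
  ultimately have "eventually (\<lambda>k. dist (inverse (\<sigma> k) *s \<xi> k) (ctr b) < r \<and> \<sigma> k \<noteq> 0) sequentially" by (rule eventually_conj)
  then obtain k where k: "dist (inverse (\<sigma> k) *s \<xi> k) (ctr b) < r" "\<sigma> k \<noteq> 0"
    using eventually_happens' by force
  have \<delta>: "csqrt (t (f k)) \<noteq> 0" unfolding \<rho>\<sigma>[symmetric] using \<rho> k(2) by simp
  have "x (f k) = inverse (csqrt (t (f k)) * (inverse (\<sigma> k) *s \<xi> k) $ k0) *s pt (csqrt (t (f k))) (inverse (\<sigma> k) *s \<xi> k)"
  proof (rule x_eq_pt[OF refl y(1) \<delta>])
    show "(inverse (\<sigma> k) *s \<xi> k) $ k0 = inverse (csqrt (t (f k)) * form a (x (f k)) (\<beta> k0))"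
      unfolding \<rho>\<sigma>[symmetric] by (simp add: \<xi>_def v_def field_simps)
    fix j assume "j \<in> K"
    then have "j \<noteq> k0" using K_facts(1) by auto
    then show "(inverse (\<sigma> k) *s \<xi> k) $ j = form a (x (f k)) (\<beta> j) / (csqrt (t (f k)) * form a (x (f k)) (\<beta> k0))"
      unfolding \<rho>\<sigma>[symmetric] by (simp add: \<xi>_def v_def field_simps)
  qed
  then have "x (f k) \<in> branch r b (t (f k))"
    unfolding branch_def using k(1) by (intro image_eqI[of _ _ "inverse (\<sigma> k) *s \<xi> k"]) (simp_all add: dist_commute)
  then show ?thesis using \<delta> by auto
qed

text \<open>Escape in the direction of the node makes the form at \<open>k0\<close> dominate those
  in \<open>T\<close>, after finitely many terms are dropped; these are the hypotheses of
  \<open>branch_cover_aux\<close>.\<close>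

lemma branch_cover:
  assumes r: "0 < r" and t: "t \<longlonglongrightarrow> 0" and eq: "\<And>k. path_eq (t k) (x k)" and nz: "\<And>k. x k \<noteq> 0"
    and inv: "(\<lambda>k. inverse (norm (x k))) \<longlonglongrightarrow> 0" and u: "(\<lambda>k. x k /\<^sub>R norm (x k)) \<longlonglongrightarrow> u"
    and T: "{l. form a u l = 0} = T"
  shows "\<exists>k. t k \<noteq> 0 \<and> (\<exists>b. x k \<in> branch r b (t k))"
proof -
  define y where "y k l = form a (x k) l / complex_of_real (norm (x k))" for k l
  have ylim: "(\<lambda>k. y k l) \<longlonglongrightarrow> form a u l" for l
  proof -
    have "(\<lambda>k. form a (x k /\<^sub>R norm (x k)) l) \<longlonglongrightarrow> form a u l"
      unfolding form_def by (intro tendsto_intros u)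
    moreover have "form a (x k /\<^sub>R norm (x k)) l = y k l" for k
      unfolding scaleR_eq_smult form_smult y_def by (simp add: divide_inverse mult.commute)
    ultimately show ?thesis by simp
  qed
  have "\<beta> k0 \<notin> T" using K_facts(1) \<beta>_inj by (auto simp: T_def inj_eq)
  then have k0: "form a u (\<beta> k0) \<noteq> 0" using T by blast
  then have "eventually (\<lambda>k. y k (\<beta> k0) \<noteq> 0) sequentially" using ylim by (rule tendsto_imp_eventually_ne[rotated])
  then obtain k1 where k1: "\<And>k. k \<ge> k1 ==> y k (\<beta> k0) \<noteq> 0" unfolding eventually_sequentially by blast
  have "\<exists>k. t (k + k1) \<noteq> 0 \<and> (\<exists>b. x (k + k1) \<in> branch r b (t (k + k1)))"
  proof (rule branch_cover_aux[OF r, of "\<lambda>k. t (k + k1)" "\<lambda>k. x (k + k1)"])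
    show "(\<lambda>k. t (k + k1)) \<longlonglongrightarrow> 0" by (rule LIMSEQ_ignore_initial_segment[OF t])
    show "path_eq (t (k + k1)) (x (k + k1))" for k by (rule eq)
    show "form a (x (k + k1)) (\<beta> k0) \<noteq> 0" for k using k1[of "k + k1"] by (auto simp: y_def)
    have "(\<lambda>k. inverse (y k (\<beta> k0)) * complex_of_real (inverse (norm (x k)))) \<longlonglongrightarrow> inverse (form a u (\<beta> k0)) * complex_of_real 0"
      by (intro tendsto_intros ylim k0 inv)
    moreover have "inverse (y k (\<beta> k0)) * complex_of_real (inverse (norm (x k))) = inverse (form a (x k) (\<beta> k0))" for k
      using nz[of k] by (simp add: y_def field_simps)
    ultimately have "(\<lambda>k. inverse (form a (x k) (\<beta> k0))) \<longlonglongrightarrow> 0" by simp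
    then show "(\<lambda>k. inverse (form a (x (k + k1)) (\<beta> k0))) \<longlonglongrightarrow> 0" by (rule LIMSEQ_ignore_initial_segment)
    fix j assume "j \<in> K"
    then have "form a u (\<beta> j) = 0" using T by (auto simp: T_def)
    have "(\<lambda>k. y k (\<beta> j) / y k (\<beta> k0)) \<longlonglongrightarrow> form a u (\<beta> j) / form a u (\<beta> k0)"
      by (intro tendsto_intros ylim k0)
    moreover have "y k (\<beta> j) / y k (\<beta> k0) = form a (x k) (\<beta> j) / form a (x k) (\<beta> k0)" for k
      using nz[of k] by (simp add: y_def)
    ultimately have "(\<lambda>k. form a (x k) (\<beta> j) / form a (x k) (\<beta> k0)) \<longlonglongrightarrow> 0"
      using \<open>form a u (\<beta> j) = 0\<close> by simp
    then show "(\<lambda>k. form a (x (k + k1)) (\<beta> j) / form a (x (k + k1)) (\<beta> k0)) \<longlonglongrightarrow> 0"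
      by (rule LIMSEQ_ignore_initial_segment)
  qed
  then show ?thesis by blast
qed

lemma branch_radius:
  obtains r where "0 < r" "r \<le> rad" "\<And>b. eventually (\<lambda>t. \<exists>!x. x \<in> branch r b t \<and> x \<noteq> 0 \<and> path_eq t x) (at 0)"
proof -
  define p0 :: "complex^bool" where "p0 = (\<chi> c. if c then 1 else 0)"
  have "\<exists>r0>0. \<forall>r. 0 < r \<and> r \<le> r0 \<longrightarrow> eventually (\<lambda>p. \<exists>!\<xi>. \<xi> \<in> ball (ctr b) r \<and> sys psi_fun p \<xi> = 0) (nhds p0)" for b
  proof -
    have k0: "ctr b $ k0 \<noteq> 0" by (rule ctr_k0)
    have ctr: "ctr b = lim_pt (ctr b $ k0)" by (simp add: ctr_def lim_pt_def)
    have "(ctr b $ k0)^2 = 1^2 * Q" by (simp add: ctr_k0)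
    then have "\<forall>k. psi k 0 1 (ctr b) = 0" using psi_limit[of 1 "ctr b"] ctr by simp
    then have sol: "sys psi_fun p0 (ctr b) = 0" unfolding sys_psi by (simp add: p0_def vec_eq_iff)
    have nd: "nondegenerate (sys psi_fun p0) (ctr b)"
      by (subst ctr) (rule psi_nondegenerate[OF _ k0], simp add: p0_def)
    obtain r0 where "r0 > 0"
      "\<And>r. 0 < r ==> r \<le> r0 ==> eventually (\<lambda>p. \<exists>!\<xi>. \<xi> \<in> ball (ctr b) r \<and> sys psi_fun p \<xi> = 0) (nhds p0)"
      by (rule persistence[where e=psi_fun, OF psi_fun_poly sol nd]) (rule that)
    then show ?thesis by (intro exI[of _ r0]) simp
  qed
  then have "\<exists>r0. \<forall>b. r0 b > 0 \<and> (\<forall>r. 0 < r \<and> r \<le> r0 b \<longrightarrow>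
      eventually (\<lambda>p. \<exists>!\<xi>. \<xi> \<in> ball (ctr b) r \<and> sys psi_fun p \<xi> = 0) (nhds p0))"
    by (intro choice allI)
  then obtain r0 where r0: "\<And>b. r0 b > 0" "\<And>b r. 0 < r ==> r \<le> r0 b ==>
      eventually (\<lambda>p. \<exists>!\<xi>. \<xi> \<in> ball (ctr b) r \<and> sys psi_fun p \<xi> = 0) (nhds p0)"
    by blast
  define r where "r = min rad (min (r0 True) (r0 False))"
  have r: "0 < r" "r \<le> rad" "r \<le> r0 True" "r \<le> r0 False"
    using r0(1) constants(5) by (simp_all add: r_def rad_def)
  have rb: "r \<le> r0 b" for b using r by (cases b) auto
  have "eventually (\<lambda>t. \<exists>!x. x \<in> branch r b t \<and> x \<noteq> 0 \<and> path_eq t x) (at 0)" for b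
    by (rule branch_ex1[OF r(2) r0(2)[OF r(1) rb, unfolded p0_def]])
  then show ?thesis using that[of r] r by blast
qed

end

text \<open>The properties of the branches that are used outside the local coordinates; the node
  enters only through its set \<open>T\<close> of vanishing forms.\<close>

definition node_branches :: "('m::finite => 'o => complex) => (complex => (complex^'m) set) => 'o set =>
    (bool => complex => (complex^'m) set) => bool" where
  "node_branches a S T B \<longleftrightarrow> (\<forall>b. eventually (\<lambda>t. \<exists>!x. x \<in> B b t \<inter> S t) (at 0)) \<and>
    (\<forall>t. t \<noteq> 0 \<longrightarrow> B True t \<inter> B False t = {}) \<and>
    (\<forall>l\<in>T. \<exists>C. \<forall>t x b. t \<noteq> 0 \<longrightarrow> x \<in> B b t \<longrightarrow> norm (form a x l) \<le> C) \<and>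
    (\<forall>b l R. l \<notin> T \<longrightarrow> eventually (\<lambda>t. \<forall>x\<in>B b t. R < norm (form a x l)) (at 0)) \<and>
    (\<forall>t x u. t \<longlonglongrightarrow> 0 \<longrightarrow> (\<forall>k. x k \<in> S (t k)) \<longrightarrow> (\<lambda>k. inverse (norm (x k))) \<longlonglongrightarrow> 0 \<longrightarrow>
      (\<lambda>k. x k /\<^sub>R norm (x k)) \<longlonglongrightarrow> u \<longrightarrow> {l. form a u l = 0} = T \<longrightarrow> (\<exists>k. t k \<noteq> 0 \<and> (\<exists>b. x k \<in> B b (t k))))"

context node
begin

lemma exists_branches: "\<exists>B. node_branches a (path_solutions F G F' G') T B"
proof -
  have S: "x \<in> path_solutions F G F' G' t \<longleftrightarrow> x \<noteq> 0 \<and> path_eq t x" for x t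
    by (simp add: path_solutions_def path_eq_def)
  obtain r where r: "0 < r" "r \<le> rad" "\<And>b. eventually (\<lambda>t. \<exists>!x. x \<in> branch r b t \<and> x \<noteq> 0 \<and> path_eq t x) (at 0)"
    by (rule branch_radius) (rule that)
  show ?thesis
    unfolding node_branches_def Int_iff S
  proof (intro exI[of _ "branch r"] conjI allI ballI impI)
    fix t :: "nat => complex" and x u
    assume "t \<longlonglongrightarrow> 0" "\<forall>k. x k \<noteq> 0 \<and> path_eq (t k) (x k)" "(\<lambda>k. inverse (norm (x k))) \<longlonglongrightarrow> 0"
      "(\<lambda>k. x k /\<^sub>R norm (x k)) \<longlonglongrightarrow> u" "{l. form a u l = 0} = T"
    then show "\<exists>k. t k \<noteq> 0 \<and> (\<exists>b. x k \<in> branch r b (t k))"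
      by (intro branch_cover[OF r(1)]) auto
  qed (use r branch_disjoint branch_bounded branch_unbounded in blast)+
qed

end

section \<open>Counting all nodal branches\<close>

lemma exists_node:
  fixes a :: "'m::finite => 'n::finite option => complex"
  assumes gp: "general_position a" and n: "CARD('n) \<ge> 3"
    and U: "UNIV = {k0, ki, kj, kk :: 'm}" "distinct [k0, ki, kj, kk]" and T: "card T = 3"
  shows "\<exists>\<beta> dl. inj \<beta> \<and> (\<forall>k k'. form a (dl k) (\<beta> k') = (if k = k' then 1 else 0)) \<and>
    (\<forall>x. (\<forall>k. form a x (\<beta> k) = 0) \<longrightarrow> x = 0) \<and>
    {l. form a (dl k0) l = 0} = {\<beta> ki, \<beta> kj, \<beta> kk} \<and> T = {\<beta> ki, \<beta> kj, \<beta> kk}"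
proof -
  have m: "CARD('m) = 4" unfolding U(1) using U(2) by simp
  obtain i j k where ijk: "T = {i, j, k}" "i \<noteq> j" "i \<noteq> k" "j \<noteq> k"
    using T by (auto simp: card_3_iff)
  \<comment> \<open>A fourth form, not vanishing at the node, completes the coordinates; it exists
    since there are at least four forms.\<close>
  have "T \<noteq> UNIV" using T n by auto
  then obtain l where l: "l \<notin> T" by blast
  define \<beta> where "\<beta> k' = (if k' = k0 then l else if k' = ki then i else if k' = kj then j else k)" for k'
  have all_k: "(\<forall>k. P k) \<longleftrightarrow> P k0 \<and> P ki \<and> P kj \<and> P kk" for P
    using U(1) by (metis UNIV_I empty_iff insertE)
  have inj: "inj \<beta>"
    unfolding inj_def all_k using U(2) ijk l by (auto simp: \<beta>_def)
  have range: "card (range \<beta>) = 4" using inj m by (simp add: card_image)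
  have "\<exists>x. \<forall>l\<in>range \<beta>. form a x l = (if l = \<beta> k' then 1 else 0)" for k'
    by (rule general_position_interpolate[OF gp]) (use range m n in auto)
  then have "\<exists>dl. \<forall>k'. \<forall>l\<in>range \<beta>. form a (dl k') l = (if l = \<beta> k' then 1 else 0)" by (intro choice allI)
  then obtain dl where "\<And>k' l. l \<in> range \<beta> ==> form a (dl k') l = (if l = \<beta> k' then 1 else 0)" by blast
  then have dl: "form a (dl k) (\<beta> k') = (if k = k' then 1 else 0)" for k k' using inj by (auto simp: inj_eq)
  have zero: "x = 0" if "\<forall>k. form a x (\<beta> k) = 0" for x
  proof (rule ccontr)
    assume "x \<noteq> 0"
    then have "card {l. form a x l = 0} < 4" using gp m by (simp add: general_position_def)
    moreover have "card (range \<beta>) \<le> card {l. form a x l = 0}" using that by (intro card_mono) auto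
    ultimately show False using range by simp
  qed
  have T': "T = {\<beta> ki, \<beta> kj, \<beta> kk}" using ijk U(2) by (auto simp: \<beta>_def)
  have "{l. form a (dl k0) l = 0} = T"
  proof (rule sym, rule card_seteq)
    show "T \<subseteq> {l. form a (dl k0) l = 0}" unfolding T' using U(2) by (auto simp: dl)
    have "dl k0 \<noteq> 0" using dl[of k0 k0] by (auto simp: form_def)
    then have "card {l. form a (dl k0) l = 0} < 4" using gp m by (simp add: general_position_def)
    then show "card {l. form a (dl k0) l = 0} \<le> card T" using T by simp
  qed simp
  then show ?thesis using inj dl zero T' by blast
qed

lemma form_bound: "norm (form a x l) \<le> norm x * (\<Sum>k\<in>UNIV. norm (a k l))"
  unfolding form_def sum_distrib_left
  by (intro order_trans[OF norm_sum] sum_mono) (simp add: norm_mult mult_right_mono Finite_Cartesian_Product.norm_nth_le)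

text \<open>Every triple of forms vanishes at one node, and two branches come in from infinity there
  as the deformation starts. So for small \<open>t \<noteq> 0\<close> the count is that of the
  pencil plus two per triple, and \<open>good_pair_card\<close> identifies it with that of the
  product pair.\<close>

lemma card_pencil_solutions_nodal:
  fixes a :: "'m::finite => 'n::finite option => complex" and A :: "complex^'n^'n"
  assumes n: "CARD('n) \<ge> 3" and m: "CARD('m) = 4" and gen: "generic_pencil a A"
  shows "card (pencil_solutions a A) + 2 * (CARD('n) + 1 choose 3) = Suc (CARD('n) - 2) ^ 4 - (CARD('n) - 2) ^ 4"
proof -
  note gp = generic_pencilD(1)[OF gen]
  define d where "d = CARD('n) - 2"
  define F where "F = lik_F (pencil a) A"
  define G where "G = lik_G (pencil a)"
  have pair: "poly_pair d F G" unfolding d_def F_def G_def using n by (intro lik_pair) simp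
  obtain k0 ki kj kk :: 'm where U: "UNIV = {k0, ki, kj, kk}" "distinct [k0, ki, kj, kk]"
    by (rule UNIV_4[OF m]) (rule that)
  define TT where "TT = {T :: 'n option set. card T = 3}"
  define pred where "pred T \<beta> dl \<longleftrightarrow> inj \<beta> \<and> (\<forall>k k'. form a (dl k) (\<beta> k') = (if k = k' then 1 else 0)) \<and>
    (\<forall>x. (\<forall>k. form a x (\<beta> k) = 0) \<longrightarrow> x = 0) \<and>
    {l. form a (dl k0) l = 0} = {\<beta> ki, \<beta> kj, \<beta> kk} \<and> T = {\<beta> ki, \<beta> kj, \<beta> kk}" for T \<beta> dl
  have "\<exists>bd. \<forall>T\<in>TT. pred T (fst (bd T)) (snd (bd T))"
    using exists_node[OF gp n U] unfolding pred_def TT_def by (intro bchoice ballI) simp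
  then obtain bd where bd: "\<And>T. T \<in> TT ==> pred T (fst (bd T)) (snd (bd T))" by blast
  \<comment> \<open>The nodes are handed to \<open>exists_good_pair\<close>, which yields the last
    assumption of the locale.\<close>
  define V where "V = (\<lambda>T. snd (bd T) k0) ` TT"
  have "0 \<notin> V"
  proof
    assume "0 \<in> V"
    then obtain T where T: "T \<in> TT" "snd (bd T) k0 = 0" by (auto simp: V_def)
    have "form a (snd (bd T) k0) (fst (bd T) k0) = 1" using bd[OF T(1)] unfolding pred_def by simp
    then show False unfolding T(2) by (simp add: form_def)
  qed
  have "finite V" by (simp add: V_def)
  obtain F' G' :: "'m => 'm cfun" where good: "good_pair d F' G'" and card': "card (pair_solutions F' G') = Suc d ^ CARD('m) - d ^ CARD('m)"
    and V: "\<And>v. v \<in> V ==> (\<Sum>k\<in>UNIV. v $ k * G' k (vec_nth v)) \<noteq> 0"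
    by (rule exists_good_pair[OF \<open>finite V\<close> \<open>0 \<notin> V\<close>]) (rule that)
  have pair': "poly_pair d F' G'" using good by (simp add: good_pair_def)
  define S where "S = path_solutions F G F' G'"
  have "\<exists>B. node_branches a S T B" if T: "T \<in> TT" for T
  proof -
    have p: "pred T (fst (bd T)) (snd (bd T))" by (rule bd[OF T])
    have inj: "inj (fst (bd T))" using p by (simp add: pred_def)
    have h: "cdot (snd (bd T) k0) (vfun G' (snd (bd T) k0)) \<noteq> 0"
      using V[of "snd (bd T) k0"] T by (simp add: V_def cdot_def vfun_def)
    interpret node a A F' G' "CARD('n) - 2" "of_nat (CARD('n) - 1)" "of_nat CARD('n)" "lik_F (pencil a) A" "lik_G (pencil a)"
      k0 ki kj kk "fst (bd T)" "snd (bd T)"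
    proof unfold_locales
      show "3 \<le> CARD('n)" "poly_pair (CARD('n) - 2) F' G'" "UNIV = {k0, ki, kj, kk}" "distinct [k0, ki, kj, kk]" "inj (fst (bd T))"
        using n pair' U inj by (simp_all add: d_def)
      show "triple_disc (edge A) (fst (bd T) ki) (fst (bd T) kj) (fst (bd T) kk) \<noteq> 0"
        using generic_pencilD(7)[OF gen] inj U(2) by (simp add: inj_eq)
    qed (use p h in \<open>auto simp: pred_def\<close>)
    have T: "T = node.T ki kj kk (fst (bd T))" using p unfolding K_facts(6) by (simp add: pred_def)
    show ?thesis unfolding S_def F_def G_def by (rule exists_branches[folded T])
  qed
  then have "\<exists>B. \<forall>T\<in>TT. node_branches a S T (B T)" by (intro bchoice ballI)
  then obtain B where B: "\<And>T. T \<in> TT ==> node_branches a S T (B T)" by blast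
  define J where "J = TT \<times> (UNIV :: bool set)"
  define N where "N = (\<lambda>(T, b). B T b)"
  have cTT: "card TT = CARD('n) + 1 choose 3" using n_subsets[of "UNIV :: 'n option set" 3] by (simp add: TT_def)
  have nv: "eventually (\<lambda>t :: complex. t \<noteq> 0) (at 0)" by (simp add: eventually_at_filter)
  have "eventually (\<lambda>t. finite (S t) \<and> card (S t) = card (S 0) + card J) (at 0)"
    unfolding S_def
  proof (rule path_card_near[OF pair pair', where N=N])
    show "vseg F F' 0 x \<noteq> 0" if "x \<noteq> 0" for x using generic_pencilD(3)[OF gen that] by (simp add: F_def)
    show "nondegenerate (\<lambda>x. vseg F F' 0 x - vseg G G' 0 x) x" if "x \<in> path_solutions F G F' G' 0" for x
      using generic_pencilD(6)[OF gen, of x] that by (simp add: F_def G_def)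
    show "finite J" by (simp add: J_def)
    show "eventually (\<lambda>t. \<exists>!x. x \<in> N j t \<inter> path_solutions F G F' G' t) (at 0)" if "j \<in> J" for j
      using B that unfolding node_branches_def S_def by (auto simp: J_def N_def)
    show "eventually (\<lambda>t. N i t \<inter> N j t = {}) (at 0)" if ij: "i \<in> J" "j \<in> J" "i \<noteq> j" for i j
    proof -
      obtain T b T' b' where i: "i = (T, b)" "T \<in> TT" and j: "j = (T', b')" "T' \<in> TT" using ij by (auto simp: J_def)
      show ?thesis
      proof (cases "T = T'")
        case True
        then have "b \<noteq> b'" using ij i j by simp
        have "B T True t \<inter> B T False t = {}" if "t \<noteq> 0" for t using B[OF i(2)] that unfolding node_branches_def by blast
        then have dj: "B T b t \<inter> B T b' t = {}" if "t \<noteq> 0" for t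
          using that \<open>b \<noteq> b'\<close> by (cases b; cases b') auto
        from nv have "eventually (\<lambda>t. B T b t \<inter> B T b' t = {}) (at 0)"
          by eventually_elim (rule dj)
        then show ?thesis by (simp add: N_def i j True)
      next
        case False
        \<comment> \<open>A form vanishing at the first node but not at the second is bounded on the
          branches of the first and unbounded on those of the second.\<close>
        have "\<not> T \<subseteq> T'" using False i(2) j(2) card_subset_eq[of T' T] by (auto simp: TT_def)
        then obtain l where l: "l \<in> T" "l \<notin> T'" by blast
        have "\<exists>C. \<forall>t x b. t \<noteq> 0 \<longrightarrow> x \<in> B T b t \<longrightarrow> norm (form a x l) \<le> C"
          using B[OF i(2)] l(1) unfolding node_branches_def by blast
        then obtain C where C: "\<And>t x b. t \<noteq> 0 ==> x \<in> B T b t ==> norm (form a x l) \<le> C" by blast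
        have "eventually (\<lambda>t. \<forall>x\<in>B T' b' t. C < norm (form a x l)) (at 0)"
          using B[OF j(2)] l(2) unfolding node_branches_def by blast
        with nv show ?thesis
          by eventually_elim (use C in \<open>force simp: N_def i j\<close>)
      qed
    qed
    show "\<exists>r>0. eventually (\<lambda>t. N j t \<inter> ball x r = {}) (at 0)" if jJ: "j \<in> J" for j x
    proof -
      obtain T b where j: "j = (T, b)" "T \<in> TT" using jJ by (auto simp: J_def)
      have "T \<noteq> UNIV" using j(2) n by (auto simp: TT_def)
      then obtain l where l: "l \<notin> T" by blast
      define R where "R = (norm x + 1) * (\<Sum>k\<in>UNIV. norm (a k l))"
      have R: "norm (form a y l) \<le> R" if "y \<in> ball x 1" for y
      proof -
        have "norm y \<le> norm x + norm (y - x)" by norm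
        then have "norm y \<le> norm x + 1" using that by (simp add: dist_norm norm_minus_commute)
        then show ?thesis unfolding R_def
          by (intro order_trans[OF form_bound] mult_right_mono) (auto intro: sum_nonneg)
      qed
      have "eventually (\<lambda>t. \<forall>x\<in>B T b t. R < norm (form a x l)) (at 0)"
        using B[OF j(2)] l unfolding node_branches_def by blast
      then have "eventually (\<lambda>t. N j t \<inter> ball x 1 = {}) (at 0)"
        by eventually_elim (use R in \<open>force simp: N_def j\<close>)
      then show ?thesis by (intro exI[of _ 1]) simp
    qed
    fix t x u
    assume tx: "t \<longlonglongrightarrow> 0" "\<And>k. x k \<in> path_solutions F G F' G' (t k)" "(\<lambda>k. inverse (norm (x k))) \<longlonglongrightarrow> 0"
      "(\<lambda>k. x k /\<^sub>R norm (x k)) \<longlonglongrightarrow> u" and u: "u \<noteq> 0" "vseg G G' 0 u = 0"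
    define T where "T = {l. form a u l = 0}"
    have T: "T \<in> TT" using generic_pencilD(4)[OF gen u(1)] u(2) by (simp add: G_def T_def TT_def)
    have "\<exists>k. t k \<noteq> 0 \<and> (\<exists>b. x k \<in> B T b (t k))"
      using B[OF T] tx T_def unfolding node_branches_def S_def by blast
    then show "\<exists>k. t k \<noteq> 0 \<and> (\<exists>j\<in>J. x k \<in> N j (t k))" using T by (force simp: J_def N_def)
  qed
  then have "card (S 0) + card J = card (pair_solutions F' G')"
    unfolding S_def by (rule good_pair_card[OF _ pair good])
  then show ?thesis
    unfolding card' m by (simp add: S_def J_def cTT card_cartesian_product F_def G_def d_def mult.commute)
qed

text \<open>The subtractions are those of natural numbers; \<open>generic_degree_values\<close>
  confirms that they do not truncate in the cases at issue.\<close>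

definition generic_degree :: "nat => nat => nat" where
  "generic_degree m n = (n - 1) ^ m - (n - 2) ^ m - (if m = 4 then 2 * (n + 1 choose 3) else 0)"

theorem card_pencil_solutions:
  fixes a :: "'m::finite => 'n::finite option => complex" and A :: "complex^'n^'n"
  assumes n: "CARD('n) \<ge> 2" and m: "CARD('m) \<le> 4" "CARD('m) \<le> CARD('n) + 1" and gen: "generic_pencil a A"
  shows "card (pencil_solutions a A) = generic_degree CARD('m) CARD('n)"
proof (cases "CARD('m) = 4")
  case True
  then have "CARD('n) \<ge> 3" "Suc (CARD('n) - 2) = CARD('n) - 1" using m(2) by simp_all
  then show ?thesis using card_pencil_solutions_nodal[OF _ True gen] True by (simp add: generic_degree_def)
next
  case False
  define d where "d = CARD('n) - 2"
  have d: "Suc d = CARD('n) - 1" using n by (simp add: d_def)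
  have pair: "poly_pair d (lik_F (pencil a) A) (lik_G (pencil a))" unfolding d_def using n by (rule lik_pair)
  have G: "vfun (lik_G (pencil a)) x \<noteq> 0" if "x \<noteq> 0" for x
  proof
    assume "vfun (lik_G (pencil a)) x = 0"
    then have "card {i. form a x i = 0} = 3" by (rule generic_pencilD(4)[OF gen that])
    moreover have "card {i. form a x i = 0} < CARD('m)"
      using generic_pencilD(1)[OF gen] that by (simp add: general_position_def)
    ultimately show False using False m(1) by simp
  qed
  obtain F' G' :: "'m => 'm cfun" where good: "good_pair d F' G'"
    and card': "card (pair_solutions F' G') = Suc d ^ CARD('m) - d ^ CARD('m)"
    using exists_good_pair[of "{}" d] by auto
  have "poly_pair d F' G'" using good by (simp add: good_pair_def)
  from good_pair_near[OF pair this, of 0]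
  have "card (pencil_solutions a A) = card (pair_solutions F' G')"
    using G generic_pencilD(3,6)[OF gen] by (intro good_pair_card[OF _ pair good]) simp
  then show ?thesis using card' False d by (simp add: generic_degree_def d_def)
qed

section \<open>Properness at the nodes\<close>

text \<open>By \<open>arr y ** M = 0\<close>, the products \<open>y l * ext M l (Some s)\<close> do
  not depend on \<open>l\<close>, and at \<open>i\<close> they are 0.\<close>

lemma ext_zero:
  assumes M: "arr y ** M = 0" "transpose M = M" and i: "y i = 0" and l: "y l \<noteq> 0"
  shows "ext M l l' = 0"
proof -
  have eq: "y (Some r) * M $ r $ s + y None * (\<Sum>r\<in>UNIV. M $ r $ s) = 0" for r s
  proof -
    have "(arr y ** M) $ r $ s = (\<Sum>k\<in>UNIV. (if r = k then y (Some r) else 0) * M $ k $ s) + y None * (\<Sum>r\<in>UNIV. M $ r $ s)"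
      by (simp add: matrix_matrix_mult_def arr_def algebra_simps sum.distrib sum_distrib_left)
    also have "(\<Sum>k\<in>UNIV. (if r = k then y (Some r) else 0) * M $ k $ s) = y (Some r) * M $ r $ s"
      by (simp add: if_distrib[of "\<lambda>c. c * _"] cong: if_cong)
    finally show ?thesis using M(1) by simp
  qed
  have col: "y l * ext M l (Some s) = y None * ext M None (Some s)" for l s
    using eq[of _ s] by (cases l) (auto simp: ext_def add_eq_0_iff2)
  have some: "ext M l (Some s) = 0" for s
    using col[of l s] col[of i s] i l by auto
  show ?thesis
  proof (cases l')
    case None
    have "ext M l None + (\<Sum>s\<in>UNIV. ext M l (Some s)) = 0"
      using ext_sum(2)[of M l] unfolding sum_option by simp
    then show ?thesis using some None by simp
  qed (use some in simp)
qed

lemma trace_arr_ext: "trace (M ** arr h) = (\<Sum>l\<in>UNIV. h l * ext M l l)"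
proof -
  have "trace (M ** arr h) = (\<Sum>r\<in>UNIV. \<Sum>s\<in>UNIV. M $ r $ s * (if s = r then h (Some s) else 0) + M $ r $ s * h None)"
    by (simp add: trace_def matrix_matrix_mult_def arr_def distrib_left)
  also have "\<dots> = (\<Sum>r\<in>UNIV. M $ r $ r * h (Some r)) + (\<Sum>r\<in>UNIV. \<Sum>s\<in>UNIV. M $ r $ s) * h None"
    by (simp add: sum.distrib sum_distrib_right if_distrib[of "\<lambda>c. _ * c"] cong: if_cong)
  finally show ?thesis by (simp add: sum_option ext_def mult.commute)
qed

text \<open>As in \<open>trace_ext\<close>, the vanishing row and column sums of
  \<open>ext M\<close> allow the entries of \<open>A\<close> to be exchanged for edges.\<close>

lemma ext_triple:
  assumes M: "transpose M = M" and A: "transpose A = A"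
  shows "ext (M ** A ** M) l l' = - (\<Sum>p\<in>UNIV. \<Sum>q\<in>UNIV. ext M l p * edge A p q * ext M q l') / 2"
proof -
  have Ms: "M $ r $ s = M $ s $ r" for r s using arg_cong[OF M, of "\<lambda>M. M $ s $ r"] by (simp add: transpose_def)
  have As: "A $ r $ s = A $ s $ r" for r s using arg_cong[OF A, of "\<lambda>M. M $ s $ r"] by (simp add: transpose_def)
  have q: "qent A p q = qent A q p" for p q unfolding qent_def using As by (auto split: option.split)
  have "(M ** A ** M) $ r $ s = (\<Sum>p\<in>UNIV. \<Sum>q\<in>UNIV. M $ r $ p * A $ p $ q * M $ q $ s)" for r s
    by (simp add: matrix_matrix_mult_def sum_distrib_right) (rule sum.swap)
  then have MAM: "(M ** A ** M) $ r $ s = (\<Sum>p\<in>UNIV. \<Sum>q\<in>UNIV. M $ r $ p * (A $ p $ q * M $ q $ s))" for r s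
    by (simp add: mult.assoc)
  have swap: "(\<Sum>t\<in>UNIV. \<Sum>p\<in>UNIV. \<Sum>q\<in>UNIV. g t p q) = (\<Sum>p\<in>UNIV. \<Sum>q\<in>UNIV. \<Sum>t\<in>UNIV. g t p q)"
    for g :: "'n => 'n => 'n => complex"
    by (subst sum.swap) (intro sum.cong refl sum.swap)
  have some: "ext (M ** A ** M) (Some r) l' = (\<Sum>p\<in>UNIV. \<Sum>q\<in>UNIV. M $ r $ p * (A $ p $ q * ext M (Some q) l'))" for r
  proof (cases l')
    case None
    have "ext (M ** A ** M) (Some r) None = - (\<Sum>s\<in>UNIV. \<Sum>p\<in>UNIV. \<Sum>q\<in>UNIV. M $ r $ p * (A $ p $ q * M $ q $ s))"
      by (simp only: ext_def option.case MAM)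
    also have "\<dots> = - (\<Sum>p\<in>UNIV. \<Sum>q\<in>UNIV. \<Sum>s\<in>UNIV. M $ r $ p * (A $ p $ q * M $ q $ s))" by (subst swap) rule
    finally show ?thesis unfolding None by (simp add: ext_def sum_negf sum_distrib_left)
  next
    case (Some s)
    then show ?thesis unfolding Some by (simp only: ext_def option.case MAM)
  qed
  have "ext (M ** A ** M) l l' = (\<Sum>p\<in>UNIV. \<Sum>q\<in>UNIV. ext M l (Some p) * (A $ p $ q * ext M (Some q) l'))"
  proof (cases l)
    case None
    have "ext (M ** A ** M) None l' = - (\<Sum>r\<in>UNIV. ext (M ** A ** M) (Some r) l')"
      using ext_sum(1)[of "M ** A ** M" l'] unfolding sum_option by (simp add: add_eq_0_iff2)
    also have "\<dots> = - (\<Sum>p\<in>UNIV. \<Sum>q\<in>UNIV. \<Sum>r\<in>UNIV. M $ r $ p * (A $ p $ q * ext M (Some q) l'))"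
      unfolding some by (subst swap) rule
    also have "\<dots> = - (\<Sum>p\<in>UNIV. \<Sum>q\<in>UNIV. (\<Sum>r\<in>UNIV. M $ r $ p) * (A $ p $ q * ext M (Some q) l'))"
      unfolding sum_distrib_right ..
    also have "\<dots> = (\<Sum>p\<in>UNIV. \<Sum>q\<in>UNIV. ext M None (Some p) * (A $ p $ q * ext M (Some q) l'))"
      by (simp add: ext_def[of M None] sum_negf)
    finally show ?thesis unfolding None .
  next
    case (Some r)
    then show ?thesis unfolding Some some by (simp add: ext_def[of M "Some r"])
  qed
  also have "\<dots> = (\<Sum>p\<in>UNIV. \<Sum>q\<in>UNIV. ext M l p * (qent A p q * ext M q l'))"
    by (simp add: sum_option qent_def)
  also have "\<dots> = (\<Sum>p\<in>UNIV. \<Sum>q\<in>UNIV. (ext M l p * ext M q l') * (qent A p q + qent A q p)) / 2"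
    by (simp add: q sum_divide_distrib mult_ac)
  also have "\<dots> = - (\<Sum>p\<in>UNIV. \<Sum>q\<in>UNIV. (ext M l p * ext M q l') * edge A p q) / 2"
    by (subst sum_edge_ext) (simp_all add: sum_distrib_left[symmetric] sum_distrib_right[symmetric] ext_sum)
  finally show ?thesis by (simp add: mult.assoc mult.commute[of "edge _ _ _"])
qed

text \<open>\<open>M\<close> lives on the two-dimensional kernel of \<open>arr y\<close> and is the
  Laplacian of a triangle with weights \<open>c1\<close>, \<open>c2\<close>, \<open>c3\<close>. By
  \<open>eq1\<close> its diagonal is proportional to the opposite edges of \<open>A\<close>, which
  determines \<open>M\<close> up to a factor \<tau>: it is a multiple of the adjugate of
  \<open>A\<close> on the kernel. Then \<open>M ** A ** M\<close> equals \<open>M\<close> times half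
  of \<open>trace (M ** A)\<close>, whereas \<open>eq2\<close> demands the fraction 1/n; one
  diagonal entry suffices for the contradiction.\<close>

lemma no_node_limit:
  fixes A M :: "complex^'n::finite^'n"
  assumes n: "CARD('n) \<ge> 3" and M: "transpose M = M" "M \<noteq> 0" "arr y ** M = 0" and A: "transpose A = A"
    and y: "{l. y l = 0} = {i, j, k}" and ijk: "i \<noteq> j" "i \<noteq> k" "j \<noteq> k"
    and edge: "\<And>p q. p \<noteq> q ==> edge A p q \<noteq> 0" and disc: "triple_disc (edge A) i j k \<noteq> 0"
    and eq1: "\<And>h h'. h \<in> H ==> h' \<in> H ==> d2det (arr y) (arr h) A * trace (M ** arr h') = d2det (arr y) (arr h') A * trace (M ** arr h)"
    and eq2: "\<And>h. h \<in> H ==> of_nat CARD('n) * trace (M ** A ** M ** arr h) = trace (M ** arr h) * trace (M ** A)"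
    and H: "\<And>c. \<exists>h\<in>H. \<forall>l\<in>{i, j, k}. h l = c l"
  shows False
proof -
  define T where "T = {i, j, k}"
  define e1 e2 e3 where "e1 = edge A j k" and "e2 = edge A i k" and "e3 = edge A i j"
  have e: "e1 \<noteq> 0" "e2 \<noteq> 0" "e3 \<noteq> 0" using edge ijk by (auto simp: e1_def e2_def e3_def)
  have ec: "edge A k j = e1" "edge A k i = e2" "edge A j i = e3"
    unfolding e1_def e2_def e3_def by (rule edge_commute)+
  have y0: "y i = 0" "y j = 0" "y k = 0" using y by auto
  have supp: "ext X l l' = 0" if "arr y ** X = 0" "transpose X = X" "l \<notin> T \<or> l' \<notin> T" for X l l'
    using that(3)
  proof
    assume "l \<notin> T"
    then show ?thesis using ext_zero[OF that(1,2) y0(1), of l l'] y by (auto simp: T_def)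
  next
    assume "l' \<notin> T"
    then show ?thesis using ext_zero[OF that(1,2) y0(1), of l' l] y ext_commute[OF that(2)] by (auto simp: T_def)
  qed
  have sumT: "(\<Sum>l\<in>UNIV. f l) = f i + f j + f k" if "\<And>l. l \<notin> T ==> f l = 0" for f :: "'n option => complex"
  proof -
    have "(\<Sum>l\<in>UNIV. f l) = (\<Sum>l\<in>T. f l)" by (intro sum.mono_neutral_right) (use that in auto)
    then show ?thesis using ijk by (simp add: T_def)
  qed
  define c1 c2 c3 where "c1 = - ext M j k" and "c2 = - ext M i k" and "c3 = - ext M i j"
  have off: "ext M j k = - c1" "ext M k j = - c1" "ext M i k = - c2" "ext M k i = - c2" "ext M i j = - c3" "ext M j i = - c3"
    by (simp_all add: c1_def c2_def c3_def ext_commute[OF M(1), of k] ext_commute[OF M(1), of j i])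
  have suppM: "ext M l l' = 0" if "l \<notin> T \<or> l' \<notin> T" for l l' using supp[OF M(3,1) that] .
  have row: "ext M l i + ext M l j + ext M l k = 0" for l
    using sumT[of "ext M l"] suppM ext_sum(2)[of M l] by simp
  have diag: "ext M i i = c2 + c3" "ext M j j = c1 + c3" "ext M k k = c1 + c2"
    using row[of i] row[of j] row[of k] unfolding off by (simp_all add: add_eq_0_iff2 algebra_simps)
  have tr: "trace (X ** arr h) = h i * ext X i i + h j * ext X j j + h k * ext X k k"
    if "arr y ** X = 0" "transpose X = X" for X h
    unfolding trace_arr_ext by (rule sumT) (simp add: supp[OF that])
  have d2: "d2det (arr y) (arr h) A = (h i * e1 + h j * e2 + h k * e3) * co_prod y T" for h
    unfolding T_def e1_def e2_def e3_def by (rule d2det_at_node[OF y0 ijk])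
  have g: "co_prod y T \<noteq> 0" using y by (intro co_prod_nz) (auto simp: T_def)
  have unit: "\<exists>h\<in>H. h i = a \<and> h j = b \<and> h k = c" for a b c
    using H[of "\<lambda>l. if l = i then a else if l = j then b else c"] ijk by auto
  obtain hi where hi: "hi \<in> H" "hi i = 1" "hi j = 0" "hi k = 0" using unit[of 1 0 0] by auto
  obtain hj where hj: "hj \<in> H" "hj i = 0" "hj j = 1" "hj k = 0" using unit[of 0 1 0] by auto
  obtain hk where hk: "hk \<in> H" "hk i = 0" "hk j = 0" "hk k = 1" using unit[of 0 0 1] by auto
  have p: "e1 * (c1 + c3) = e2 * (c2 + c3)" "e1 * (c1 + c2) = e3 * (c2 + c3)"
    using eq1[OF hi(1) hj(1)] eq1[OF hi(1) hk(1)] g unfolding d2 tr[OF M(3,1)] diag by (simp_all add: hi hj hk)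
  define \<tau> where "\<tau> = (c2 + c3) / e1"
  have x: "c2 + c3 = \<tau> * e1" "c1 + c3 = \<tau> * e2" "c1 + c2 = \<tau> * e3"
    using p e by (simp_all add: \<tau>_def field_simps)
  have c: "c1 = \<tau> * (e2 + e3 - e1) / 2" "c2 = \<tau> * (e1 + e3 - e2) / 2" "c3 = \<tau> * (e1 + e2 - e3) / 2"
    using x by (auto simp: algebra_simps) algebra+
  have \<tau>: "\<tau> \<noteq> 0"
  proof
    assume "\<tau> = 0"
    then have z: "c1 = 0" "c2 = 0" "c3 = 0" using c by auto
    have "ext M l l' = 0" for l l'
    proof (cases "l \<in> T \<and> l' \<in> T")
      case True
      then show ?thesis using off diag z by (auto simp: T_def)
    qed (use suppM in blast)
    moreover have "M $ r $ s = ext M (Some r) (Some s)" for r s by (simp add: ext_def)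
    ultimately have "M $ r $ s = 0" for r s by simp
    then show False using M(2) by (simp add: vec_eq_iff)
  qed
  define D where "D = triple_disc (edge A) i j k"
  have Dd: "D = (e3 + e2 + e1)^2 - 2 * (e3^2 + e2^2 + e1^2)" by (simp add: D_def triple_disc_def e1_def e2_def e3_def)
  have sum2: "(\<Sum>p\<in>UNIV. \<Sum>q\<in>UNIV. w p q * edge A p q) =
      (w j k + w k j) * e1 + (w i k + w k i) * e2 + (w i j + w j i) * e3"
    if "\<And>p q. p \<notin> T \<or> q \<notin> T ==> w p q = 0" for w
  proof -
    have "(\<Sum>p\<in>UNIV. \<Sum>q\<in>UNIV. w p q * edge A p q) = (\<Sum>q\<in>UNIV. w i q * edge A i q) + (\<Sum>q\<in>UNIV. w j q * edge A j q) + (\<Sum>q\<in>UNIV. w k q * edge A k q)"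
      by (rule sumT) (simp add: that)
    also have "\<dots> = (w j k + w k j) * e1 + (w i k + w k i) * e2 + (w i j + w j i) * e3"
      by (subst (1 2 3) sumT) (simp_all add: that ec e1_def[symmetric] e2_def[symmetric] e3_def[symmetric] algebra_simps)
    finally show ?thesis .
  qed
  have trA: "trace (M ** A) = \<tau> * D / 2"
  proof -
    have "(\<Sum>p\<in>UNIV. \<Sum>q\<in>UNIV. ext M p q * edge A p q) = (ext M j k + ext M k j) * e1 + (ext M i k + ext M k i) * e2 +
        (ext M i j + ext M j i) * e3"
      by (rule sum2) (rule suppM)
    then have "trace (M ** A) = - ((- c1 + - c1) * e1 + (- c2 + - c2) * e2 + (- c3 + - c3) * e3) / 2"
      unfolding trace_ext[OF M(1)] off by simp
    also have "\<dots> = \<tau> * D / 2" unfolding c Dd by (simp add: field_simps power2_eq_square)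
    finally show ?thesis .
  qed
  have MAM: "arr y ** (M ** A ** M) = 0" "transpose (M ** A ** M) = M ** A ** M"
    using M(1,3) A by (simp_all add: matrix_mul_assoc matrix_transpose_mul)
  have "ext (M ** A ** M) i i = - (\<Sum>p\<in>UNIV. \<Sum>q\<in>UNIV. (ext M i p * ext M q i) * edge A p q) / 2"
    unfolding ext_triple[OF M(1) A] by (simp add: mult.assoc mult.commute mult.left_commute)
  also have "\<dots> = - (2 * (ext M i j * ext M k i) * e1 + (ext M i i * ext M k i + ext M i k * ext M i i) * e2 +
      (ext M i i * ext M j i + ext M i j * ext M i i) * e3) / 2"
    by (subst sum2) (auto simp: suppM off)
  also have "\<dots> = (\<tau> * D / 4) * (\<tau> * e1)"
    unfolding off diag x c Dd by (simp add: field_simps power2_eq_square)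
  finally have e': "ext (M ** A ** M) i i = (\<tau> * D / 4) * (\<tau> * e1)" .
  have "of_nat CARD('n) * ext (M ** A ** M) i i = ext M i i * trace (M ** A)"
    using eq2[OF hi(1)] unfolding tr[OF MAM] tr[OF M(3,1)] by (simp add: hi)
  then have "of_nat CARD('n) * ((\<tau> * D / 4) * (\<tau> * e1)) = 2 * ((\<tau> * D / 4) * (\<tau> * e1))"
    unfolding e' diag x trA by (simp add: field_simps)
  moreover have "(\<tau> * D / 4) * (\<tau> * e1) \<noteq> 0" using \<tau> e disc by (simp add: D_def)
  ultimately have "(of_nat CARD('n) :: complex) = of_nat 2" by simp
  then have "CARD('n) = 2" by (simp only: of_nat_eq_iff)
  then show False using n by simp
qed

section \<open>Limits of normalised inverses\<close>

lemma tendsto_matrix_mult: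
  fixes X Y :: "nat => complex^'n::finite^'n"
  assumes "X \<longlonglongrightarrow> X0" "Y \<longlonglongrightarrow> Y0" shows "(\<lambda>k. X k ** Y k) \<longlonglongrightarrow> X0 ** Y0"
  unfolding matrix_matrix_mult_def by (intro vec_tendstoI) (simp, intro tendsto_intros assms)

lemma tendsto_trace: "X \<longlonglongrightarrow> X0 ==> (\<lambda>k. trace (X k)) \<longlonglongrightarrow> trace (X0 :: complex^'n::finite^'n)"
  unfolding trace_def by (intro tendsto_intros)

lemma tendsto_det:
  fixes X :: "nat => complex^'n::finite^'n"
  assumes "\<And>r s. (\<lambda>k. X k $ r $ s) \<longlonglongrightarrow> X0 $ r $ s" shows "(\<lambda>k. det (X k)) \<longlonglongrightarrow> det X0"
  unfolding det_def by (intro tendsto_intros assms)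

lemma tendsto_d2det:
  fixes X Y Z :: "nat => complex^'n::finite^'n"
  assumes "X \<longlonglongrightarrow> X0" "Y \<longlonglongrightarrow> Y0" "Z \<longlonglongrightarrow> Z0" shows "(\<lambda>k. d2det (X k) (Y k) (Z k)) \<longlonglongrightarrow> d2det X0 Y0 Z0"
proof -
  have "(\<lambda>k. (repl2 i (Y k) j (Z k) (X k)) $ r $ s) \<longlonglongrightarrow>
      (repl2 i Y0 j Z0 X0) $ r $ s" for i j r s
    by (cases "r = i"; cases "r = j") (auto intro!: tendsto_intros assms)
  then show ?thesis unfolding d2det_def by (intro tendsto_sum tendsto_det)
qed

lemma tendsto_lin_comb:
  fixes B :: "nat => 'm::finite => complex^'n::finite^'n" and x :: "nat => complex^'m"
  assumes "\<And>j. (\<lambda>k. B k j) \<longlonglongrightarrow> B0 j" "x \<longlonglongrightarrow> x0"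
  shows "(\<lambda>k. vcomb (B k) (x k)) \<longlonglongrightarrow> vcomb B0 x0"
proof (intro vec_tendstoI)
  fix r s
  have "(\<lambda>k. \<Sum>j\<in>UNIV. x k $ j * B k j $ r $ s) \<longlonglongrightarrow> (\<Sum>j\<in>UNIV. x0 $ j * B0 j $ r $ s)"
    by (intro tendsto_intros assms)
  then show "(\<lambda>k. vcomb (B k) (x k) $ r $ s) \<longlonglongrightarrow> vcomb B0 x0 $ r $ s"
    by (simp add: lin_comb_nth)
qed

lemma transpose_lin_comb: "(\<And>j. transpose (B j) = B j) ==> transpose (lin_comb B x) = lin_comb B x"
  by (simp add: vec_eq_iff transpose_def lin_comb_nth)

lemma cscale_mult: "cscale t X ** M = cscale t (X ** M)"
  by (simp add: matrix_matrix_mult_def cscale_def vec_eq_iff sum_distrib_left mult.assoc)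

lemma trace_cscale: "trace (cscale t X) = t * trace X"
  by (simp add: trace_def cscale_def sum_distrib_left)

text \<open>Both identities are homogeneous in \<open>K\<close> and in the solution, so they survive
  rescaling and passage to the limit. The first eliminates the unknown ratio of the two gradients;
  in the second, \<open>trace (K ** A) = n\<close> balances the degrees.\<close>

lemma solution_identities:
  fixes B :: "'m::finite => complex^'n::finite^'n"
  assumes n: "CARD('n) \<ge> 2" and inv: "lin_comb B x ** K = mat 1" and eq: "\<forall>k. lik_F B A k x = lik_G B k x"
  shows "d2det (lin_comb B x) (lin_comb B t) A * trace (K ** lin_comb B t') =
      d2det (lin_comb B x) (lin_comb B t') A * trace (K ** lin_comb B t)"
    "of_nat CARD('n) * trace (K ** A ** K ** lin_comb B t) = trace (K ** lin_comb B t) * trace (K ** A)"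
proof -
  have "d2det (lin_comb B x) (lin_comb B t) A = of_nat (CARD('n) - 1) * (det (lin_comb B x) * trace (K ** lin_comb B t))" for t
  proof -
    have "(\<Sum>k\<in>UNIV. t k * lik_F B A k x) = (\<Sum>k\<in>UNIV. t k * lik_G B k x)" using eq by simp
    then show ?thesis unfolding sum_lik_F sum_lik_G ddet_inverse[OF inv] .
  qed
  then show "d2det (lin_comb B x) (lin_comb B t) A * trace (K ** lin_comb B t') =
      d2det (lin_comb B x) (lin_comb B t') A * trace (K ** lin_comb B t)" by simp
  have "trace (K ** A) = of_nat CARD('n)" "\<forall>k. trace (K ** A ** K ** B k) = trace (K ** B k)"
    using lik_equations[OF n inv, of A] eq by blast+
  then show "of_nat CARD('n) * trace (K ** A ** K ** lin_comb B t) = trace (K ** lin_comb B t) * trace (K ** A)"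
    unfolding trace_mult_lin_comb by (simp add: mult.commute)
qed

text \<open>Solutions for perturbed data do not run into a node: the normalised inverses \<open>M\<close> of \<open>\<Sigma>\<close> would have a limit
  as in \<open>no_node_limit\<close>.\<close>

lemma no_escape_to_node:
  fixes B :: "nat => 'm::finite => complex^'n::finite^'n" and A :: "nat => complex^'n^'n" and x :: "nat => complex^'m"
  assumes n: "CARD('n) \<ge> 3" and m: "CARD('m) \<ge> 3" "CARD('m) \<le> CARD('n) + 1" and gen: "generic_pencil a A0"
    and sym: "\<And>k j. transpose (B k j) = B k j" and B: "\<And>j. (\<lambda>k. B k j) \<longlonglongrightarrow> pencil a j" and A: "A \<longlonglongrightarrow> A0"
    and x: "(\<lambda>k. x k /\<^sub>R norm (x k)) \<longlonglongrightarrow> u" "\<And>k. det (vcomb (B k) (x k)) \<noteq> 0"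
    and eq: "\<And>k. \<forall>j. lik_F (B k) (A k) j (vec_nth (x k)) = lik_G (B k) j (vec_nth (x k))"
    and node: "card {l. form a u l = 0} = 3"
  shows False
proof -
  define Z where "Z k t = vcomb (B k) t" for k t
  define S where "S k = Z k (x k /\<^sub>R norm (x k))" for k
  obtain i j k where ijk: "{l. form a u l = 0} = {i, j, k}" "i \<noteq> j" "i \<noteq> k" "j \<noteq> k"
    using node by (auto simp: card_3_iff)
  have "\<exists>K. \<forall>k. Z k (x k) ** K k = mat 1"
    unfolding Z_def using x(2) by (intro choice allI) (meson invertible_det_nz invertible_right_inverse)
  then obtain K where K: "\<And>k. Z k (x k) ** K k = mat 1" by blast
  have symZ: "transpose (Z k t) = Z k t" for k t unfolding Z_def by (rule transpose_lin_comb[OF sym])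
  have Kl: "K k ** Z k (x k) = mat 1" for k using K matrix_left_right_inverse by blast
  have symK: "transpose (K k) = K k" for k by (rule transpose_inverse[OF Kl symZ])
  have K0: "K k \<noteq> 0" for k
    using arg_cong[OF K[of k], of "\<lambda>X. X $ undefined $ undefined"] by (auto simp: matrix_matrix_mult_def mat_def)
  \<comment> \<open>The size of the inverses is not controlled, so they are brought to norm one
    before compactness is used.\<close>
  define M where "M k = cscale (of_real (inverse (norm (K k)))) (K k)" for k
  have "norm (M k) = 1" for k
  proof -
    have "M k = K k /\<^sub>R norm (K k)" by (simp add: M_def cscale_def vec_eq_iff scaleR_conv_of_real[where 'a=complex])
    then show ?thesis using K0[of k] by simp
  qed
  then have "\<forall>k. M k \<in> sphere 0 1" by simp
  then obtain M0 f where M0: "M0 \<in> sphere 0 1" "strict_mono (f :: nat => nat)" "(M \<circ> f) \<longlonglongrightarrow> M0"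
    using compact_sphere[of "0 :: complex^'n^'n" 1] unfolding compact_def by metis
  have Mlim: "(\<lambda>k. M (f k)) \<longlonglongrightarrow> M0" using M0(3) by (simp add: o_def)
  have xnz: "x k \<noteq> 0" for k
    using arg_cong[OF K[of k], of "\<lambda>X. X $ undefined $ undefined"]
    by (auto simp: Z_def matrix_matrix_mult_def lin_comb_nth mat_def)
  have Slim: "(\<lambda>k. S (f k)) \<longlonglongrightarrow> arr (form a u)"
    unfolding S_def Z_def lin_comb_pencil[symmetric]
    using LIMSEQ_subseq_LIMSEQ[OF B M0(2)] LIMSEQ_subseq_LIMSEQ[OF x(1) M0(2)] by (intro tendsto_lin_comb) (simp_all add: o_def)
  have Zlim: "(\<lambda>k. Z (f k) t) \<longlonglongrightarrow> arr (form a t)" for t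
    unfolding Z_def lin_comb_pencil[symmetric]
    using LIMSEQ_subseq_LIMSEQ[OF B M0(2)] by (intro tendsto_lin_comb) (simp_all add: o_def)
  have Alim: "(\<lambda>k. A (f k)) \<longlonglongrightarrow> A0" using LIMSEQ_subseq_LIMSEQ[OF A M0(2)] by (simp add: o_def)
  have Sx: "S k = cscale (of_real (inverse (norm (x k)))) (Z k (x k))" for k
    unfolding S_def Z_def scaleR_eq_smult lin_comb_scale[symmetric] by (rule arg_cong[of _ _ "lin_comb (B k)"]) (simp add: fun_eq_iff)
  have symM: "transpose (M k) = M k" for k
    using symK[of k] by (simp add: M_def vec_eq_iff transpose_def cscale_def)
  show False
  proof (rule no_node_limit[of M0 "form a u" A0 i j k "range (form a)"])
    show "3 \<le> CARD('n)" "transpose A0 = A0" "{l. form a u l = 0} = {i, j, k}" "i \<noteq> j" "i \<noteq> k" "j \<noteq> k"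
      "triple_disc (edge A0) i j k \<noteq> 0" using n ijk generic_pencilD(2,7)[OF gen] by auto
    show "\<And>p q. p \<noteq> q ==> edge A0 p q \<noteq> 0" by (rule generic_pencilD(8)[OF gen])
    show "M0 \<noteq> 0" using M0(1) by auto
    show "transpose M0 = M0"
    proof -
      have "M0 $ r $ s = M0 $ s $ r" for r s
      proof (rule LIMSEQ_unique)
        have "M (f k) $ r $ s = M (f k) $ s $ r" for k
          using arg_cong[OF symM[of "f k"], of "\<lambda>X. X $ s $ r"] by (simp add: transpose_def)
        moreover have l: "(\<lambda>k. M (f k) $ r $ s) \<longlonglongrightarrow> M0 $ r $ s" for r s by (intro tendsto_intros Mlim)
        ultimately show "(\<lambda>k. M (f k) $ r $ s) \<longlonglongrightarrow> M0 $ s $ r" using l[of s r] by simp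
        show "(\<lambda>k. M (f k) $ r $ s) \<longlonglongrightarrow> M0 $ r $ s" by (rule l)
      qed
      then show ?thesis by (simp add: vec_eq_iff transpose_def)
    qed
    show "arr (form a u) ** M0 = 0"
    proof -
      \<comment> \<open>\<open>S k ** M k\<close> is a scalar matrix. In the limit the scalar must
        vanish, since otherwise \<open>arr (form a u)\<close> would be invertible at a node.\<close>
      define \<theta> where "\<theta> k = complex_of_real (inverse (norm (x k))) * of_real (inverse (norm (K k)))" for k
      have SM: "S k ** M k = cscale (\<theta> k) (mat 1)" for k
        unfolding Sx M_def mult_cscale cscale_mult K \<theta>_def by (simp add: cscale_def vec_eq_iff)
      have lim: "(\<lambda>k. S (f k) ** M (f k)) \<longlonglongrightarrow> arr (form a u) ** M0" by (rule tendsto_matrix_mult[OF Slim Mlim])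
      define \<theta>0 where "\<theta>0 = (arr (form a u) ** M0) $ undefined $ undefined"
      have \<theta>lim: "(\<lambda>k. \<theta> (f k)) \<longlonglongrightarrow> \<theta>0"
        using tendsto_vec_nth[OF tendsto_vec_nth[OF lim], of undefined undefined] by (simp add: SM \<theta>0_def cscale_def mat_def)
      have "arr (form a u) ** M0 = cscale \<theta>0 (mat 1)"
      proof (rule LIMSEQ_unique[OF lim], unfold SM, intro vec_tendstoI)
        fix r s show "(\<lambda>k. cscale (\<theta> (f k)) (mat 1) $ r $ s) \<longlonglongrightarrow> cscale \<theta>0 (mat 1 :: complex^'n^'n) $ r $ s"
          using \<theta>lim by (simp add: cscale_def mat_def)
      qed
      moreover have "\<theta>0 = 0"
      proof (rule ccontr)
        assume "\<theta>0 \<noteq> 0"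
        then have "arr (form a u) ** cscale (inverse \<theta>0) M0 = mat 1"
          unfolding mult_cscale calculation by (simp add: cscale_def vec_eq_iff)
        then have "det (arr (form a u) :: complex^'n^'n) \<noteq> 0" using invertible_det_nz invertible_right_inverse by blast
        moreover have "form a u i = 0" "form a u j = 0" using ijk by auto
        ultimately show False using elem_sym_two_zeros[of "form a u" i j] ijk by (simp add: det_arr)
      qed
      ultimately show ?thesis by (simp add: cscale_def vec_eq_iff)
    qed
    show "d2det (arr (form a u)) (arr h) A0 * trace (M0 ** arr h') = d2det (arr (form a u)) (arr h') A0 * trace (M0 ** arr h)"
      if hh: "h \<in> range (form a)" "h' \<in> range (form a)" for h h'
    proof -
      obtain t t' where h: "h = form a t" "h' = form a t'" using hh by blast
      have "d2det (S k) (Z k t) (A k) * trace (M k ** Z k t') = d2det (S k) (Z k t') (A k) * trace (M k ** Z k t)" for k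
        unfolding Sx M_def d2det_homogeneous cscale_mult trace_cscale
        using solution_identities(1)[of "B k" "vec_nth (x k)" "K k" "A k" "vec_nth t" "vec_nth t'"] n K[of k] eq[of k]
        by (simp add: Z_def)
      then have s: "(\<lambda>k. d2det (S (f k)) (Z (f k) t) (A (f k)) * trace (M (f k) ** Z (f k) t')) =
          (\<lambda>k. d2det (S (f k)) (Z (f k) t') (A (f k)) * trace (M (f k) ** Z (f k) t))" by simp
      show ?thesis unfolding h
        by (rule LIMSEQ_unique[of "\<lambda>k. d2det (S (f k)) (Z (f k) t) (A (f k)) * trace (M (f k) ** Z (f k) t')"], rule tendsto_mult,
            rule tendsto_d2det[OF Slim Zlim Alim], rule tendsto_trace[OF tendsto_matrix_mult[OF Mlim Zlim]], unfold s, rule tendsto_mult,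
            rule tendsto_d2det[OF Slim Zlim Alim], rule tendsto_trace[OF tendsto_matrix_mult[OF Mlim Zlim]])
    qed
    show "of_nat CARD('n) * trace (M0 ** A0 ** M0 ** arr h) = trace (M0 ** arr h) * trace (M0 ** A0)"
      if hh: "h \<in> range (form a)" for h
    proof -
      obtain t where h: "h = form a t" using hh by blast
      have "of_nat CARD('n) * trace (M k ** A k ** M k ** Z k t) = trace (M k ** Z k t) * trace (M k ** A k)" for k
        unfolding M_def mult_cscale cscale_mult trace_cscale
        using solution_identities(2)[of "B k" "vec_nth (x k)" "K k" "A k" "vec_nth t"] n K[of k] eq[of k]
        by (simp add: Z_def)
      then have s: "(\<lambda>k. of_nat CARD('n) * trace (M (f k) ** A (f k) ** M (f k) ** Z (f k) t)) =
          (\<lambda>k. trace (M (f k) ** Z (f k) t) * trace (M (f k) ** A (f k)))" by simp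
      show ?thesis unfolding h
        by (rule LIMSEQ_unique[of "\<lambda>k. of_nat CARD('n) * trace (M (f k) ** A (f k) ** M (f k) ** Z (f k) t)"], rule tendsto_mult[OF tendsto_const],
            intro tendsto_trace tendsto_matrix_mult Mlim Alim Zlim, unfold s, intro tendsto_mult tendsto_trace tendsto_matrix_mult Mlim Alim Zlim)
    qed
    show "\<exists>h\<in>range (form a). \<forall>l\<in>{i, j, k}. h l = c l" for c
      using general_position_interpolate[OF generic_pencilD(1)[OF gen], of "{i, j, k}" c] m ijk by auto
  qed
qed

section \<open>Counting for generic pencils\<close>

definition lik_solutions :: "('m::finite => complex^'n::finite^'n) => complex^'n^'n => (complex^'m) set" where
  "lik_solutions B A = {x. det (vcomb B x) \<noteq> 0 \<and> (\<forall>k. lik_F B A k (vec_nth x) = lik_G B k (vec_nth x))}"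

text \<open>All matrix entries are treated as free variables, and symmetrising afterwards makes
  every point of the parameter space a legitimate datum. For index type \<open>'m option\<close>,
  \<open>None\<close> belongs to the data matrix and \<open>Some k\<close> to the basis.\<close>

definition sym_part :: "('o \<times> 'n \<times> 'n => complex) => 'o => complex^'n::finite^'n" where
  "sym_part z i = (\<chi> r s. (z (i, r, s) + z (i, s, r)) / 2)"

definition entries :: "('o => complex^'n::finite^'n) => 'o \<times> 'n \<times> 'n => complex" where
  "entries B = (\<lambda>(i, r, s). B i $ r $ s)"

abbreviation sym_mats :: "('m option \<times> 'n \<times> 'n => complex) => 'm => complex^'n::finite^'n" where
  "sym_mats z \<equiv> \<lambda>k. sym_part z (Some k)"

lemma transpose_sym_part: "transpose (sym_part z i) = sym_part z i"
  by (simp add: sym_part_def transpose_def vec_eq_iff add.commute)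

lemma transpose_nth: "transpose A = A ==> A $ r $ s = A $ s $ r"
  by (drule arg_cong[of _ _ "\<lambda>M. M $ s $ r"]) (simp add: transpose_def)

lemma sym_part_entries: "transpose (B i) = B i ==> sym_part (entries B) i = B i"
  using transpose_nth[of "B i"] by (simp add: sym_part_def entries_def vec_eq_iff)

lemma lik_poly:
  fixes k :: "'m::finite"
  defines "B \<equiv> \<lambda>z :: ('m option \<times> 'n::finite \<times> 'n) + 'm => complex. \<lambda>k. sym_part (\<lambda>i. z (Inl i)) (Some k)"
  shows "poly_fun (\<lambda>z. det (lin_comb (B z) (\<lambda>k. z (Inr k))))"
    "poly_fun (\<lambda>z. lik_F (B z) (sym_part (\<lambda>i. z (Inl i)) None) k (\<lambda>k. z (Inr k)))"
    "poly_fun (\<lambda>z. lik_G (B z) k (\<lambda>k. z (Inr k)))"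
proof -
  have sp: "poly_fun (\<lambda>z :: ('m option \<times> 'n \<times> 'n) + 'm => complex. sym_part (\<lambda>i. z (Inl i)) o' $ r $ s)" for o' r s
    unfolding sym_part_def divide_inverse vec_lambda_beta by (intro poly_fun_intros)
  have lc: "poly_fun (\<lambda>z. lin_comb (B z) (\<lambda>k. z (Inr k)) $ r $ s)" for r s
    unfolding lin_comb_nth B_def by (intro poly_fun_intros sp)
  show "poly_fun (\<lambda>z. det (lin_comb (B z) (\<lambda>k. z (Inr k))))" by (intro poly_fun_det lc)
  have "poly_fun (\<lambda>z. (if r = i then B z k $ r else if r = j then sym_part (\<lambda>i. z (Inl i)) None $ r
      else lin_comb (B z) (\<lambda>k. z (Inr k)) $ r) $ s)" for r i j s
    using lc sp by (cases "r = i"; cases "r = j") (simp_all add: B_def)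
  then show "poly_fun (\<lambda>z. lik_F (B z) (sym_part (\<lambda>i. z (Inl i)) None) k (\<lambda>k. z (Inr k)))"
    unfolding lik_F_def d2det_def by (intro poly_fun_sum poly_fun_det) simp
  have "poly_fun (\<lambda>z. (if r = i then B z k $ r else lin_comb (B z) (\<lambda>k. z (Inr k)) $ r) $ s)" for r i s
    using lc sp by (cases "r = i") (simp_all add: B_def)
  then show "poly_fun (\<lambda>z. lik_G (B z) k (\<lambda>k. z (Inr k)))"
    unfolding lik_G_def ddet_def by (intro poly_fun_intros poly_fun_det) simp
qed

text \<open>\<open>card_near\<close> with invertibility as the open condition and no extra branches.
  Since \<open>lik_F\<close> has no zeros at the special pencil, solutions could only escape towards
  a node, and \<open>no_escape_to_node\<close> rules this out because the nearby systems still come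
  from pencils of symmetric matrices.\<close>

lemma eventually_card_lik_solutions:
  fixes a :: "'m::finite => 'n::finite option => complex" and A :: "complex^'n^'n" and p0 :: "complex^('m option \<times> 'n \<times> 'n)"
  assumes n: "CARD('n) \<ge> 2" and m: "CARD('m) \<le> 4" "CARD('m) \<le> CARD('n) + 1" and gen: "generic_pencil a A"
    and p0: "vec_nth p0 = entries (case_option A (pencil a))"
  shows "eventually (\<lambda>p. finite (lik_solutions (sym_mats (vec_nth p)) (sym_part (vec_nth p) None)) \<and>
      card (lik_solutions (sym_mats (vec_nth p)) (sym_part (vec_nth p) None)) =
      card (pencil_solutions a A)) (nhds p0)"
proof -
  define PB where "PB p = sym_mats (vec_nth p)" for p :: "complex^('m option \<times> 'n \<times> 'n)"
  define PA where "PA p = sym_part (vec_nth p) None" for p :: "complex^('m option \<times> 'n \<times> 'n)"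
  define P where "P k z = lik_F (sym_mats (\<lambda>i. z (Inl i))) (sym_part (\<lambda>i. z (Inl i)) None) k (\<lambda>k. z (Inr k))"
    for k :: 'm and z :: "('m option \<times> 'n \<times> 'n) + 'm => complex"
  define Q where "Q k z = lik_G (sym_mats (\<lambda>i. z (Inl i))) k (\<lambda>k. z (Inr k))"
    for k :: 'm and z :: "('m option \<times> 'n \<times> 'n) + 'm => complex"
  define D where "D z = det (lin_comb (sym_mats (\<lambda>i. z (Inl i))) (\<lambda>k. z (Inr k)))"
    for z :: "('m option \<times> 'n \<times> 'n) + 'm => complex"
  have D: "poly_fun D" and Ppoly: "poly_fun (P k)" and Qpoly: "poly_fun (Q k)" for k
    unfolding D_def P_def Q_def by (rule lik_poly)+
  define d where "d = CARD('n) - 2"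
  have hom: "homog_param d (P k)" "homog_param (Suc d) (Q k)" for k
  proof -
    have "poly_pair d (lik_F B A) (lik_G B)" for B :: "'m => complex^'n^'n" and A
      unfolding d_def by (rule lik_pair[OF n])
    then show "homog_param d (P k)" "homog_param (Suc d) (Q k)"
      unfolding homog_param_def P_def Q_def poly_pair_def homog_def by simp_all
  qed
  have sysP: "sys P p x = vfun (lik_F (PB p) (PA p)) x" and sysQ: "sys Q p x = vfun (lik_G (PB p)) x" for p x
    by (simp_all add: sys_def vfun_def P_def Q_def PA_def PB_def)
  have PB0: "PB p0 = pencil a"
    unfolding PB_def p0 by (rule ext) (subst sym_part_entries; simp add: pencil_def transpose_arr)
  have PA0: "PA p0 = A" unfolding PA_def p0 by (subst sym_part_entries) (simp_all add: generic_pencilD(2)[OF gen])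
  define e where "e = diff_fun P Q"
  have e: "poly_fun (e k)" for k unfolding e_def diff_fun_def by (intro poly_fun_intros Ppoly Qpoly)
  have sys_e: "sys e p x = vfun (lik_F (PB p) (PA p)) x - vfun (lik_G (PB p)) x" for p x
    unfolding e_def sys_diff_fun sysP sysQ ..
  define \<Omega> where "\<Omega> p = {x. det (vcomb (PB p) x) \<noteq> 0}" for p
  have sol: "{x \<in> \<Omega> p. sys e p x = 0} = lik_solutions (PB p) (PA p)" for p
    by (auto simp: \<Omega>_def sys_e lik_solutions_def vfun_def vec_eq_iff)
  have nz: "x \<noteq> 0" if "x \<in> \<Omega> p" for x p
  proof
    assume "x = 0"
    then have "vcomb (PB p) x = 0" by (simp add: vec_eq_iff lin_comb_nth)
    moreover have "det (0 :: complex^'n^'n) = 0" by (rule det_zero_row(1)) (simp add: row_def vec_eq_iff)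
    ultimately show False using that by (simp add: \<Omega>_def)
  qed
  have sol0: "{x \<in> \<Omega> p0. sys e p0 x = 0} = pencil_solutions a A"
    using generic_pencilD(5)[OF gen] nz[of _ p0] by (auto simp: \<Omega>_def sys_e PB0 PA0 pair_solutions_def)
  have op: "open (Sigma UNIV \<Omega>)"
  proof -
    have "continuous_on UNIV (\<lambda>z :: (complex^('m option \<times> 'n \<times> 'n)) \<times> (complex^'m). D (vec_nth (join (fst z) (snd z))))"
      by (rule continuous_on_compose2[OF poly_fun_continuous[OF D, of UNIV] continuous_join]) (auto intro!: continuous_intros)
    then have "open {z :: (complex^('m option \<times> 'n \<times> 'n)) \<times> (complex^'m). D (vec_nth (join (fst z) (snd z))) \<noteq> 0}"
      by (intro open_Collect_neq continuous_on_const)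
    moreover have "Sigma UNIV \<Omega> = {z. D (vec_nth (join (fst z) (snd z))) \<noteq> 0}"
      by (auto simp: \<Omega>_def D_def PB_def)
    ultimately show ?thesis by simp
  qed
  have ndg: "nondegenerate (sys e p0) x" if "x \<in> \<Omega> p0" "sys e p0 x = 0" for x
  proof -
    have "x \<in> {x \<in> \<Omega> p0. sys e p0 x = 0}" using that by simp
    moreover have "sys e p0 = (\<lambda>x. vfun (lik_F (pencil a) A) x - vfun (lik_G (pencil a)) x)"
      by (simp add: fun_eq_iff sys_e PB0 PA0)
    ultimately show ?thesis using generic_pencilD(6)[OF gen] unfolding sol0 by simp
  qed
  have cov: "\<exists>r l. strict_mono (r :: nat => nat) \<and> l \<in> \<Omega> p0 \<and> (x \<circ> r) \<longlonglongrightarrow> l"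
    if p: "p \<longlonglongrightarrow> p0" and x: "\<And>k. x k \<in> \<Omega> (p k) \<and> sys e (p k) (x k) = 0" for p and x :: "nat => complex^'m"
  proof -
    have xnz: "x k \<noteq> 0" for k using nz x by blast
    have eq: "sys P (p k) (x k) = sys Q (p k) (x k)" for k using x[of k] by (simp add: sys_e sysP sysQ)
    obtain r u where ru: "strict_mono (r :: nat => nat)" "norm u = 1" "(\<lambda>k. x (r k) /\<^sub>R norm (x (r k))) \<longlonglongrightarrow> u"
      "(\<exists>l. l \<noteq> 0 \<and> (x \<circ> r) \<longlonglongrightarrow> l) \<or> sys P p0 u = 0 \<or>
        (sys Q p0 u = 0 \<and> (\<lambda>k. inverse (norm (x (r k)))) \<longlonglongrightarrow> 0)"
      by (rule escape[of P Q, OF Ppoly Qpoly hom p xnz eq]) (rule that)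
    have u: "u \<noteq> 0" using ru(2) by auto
    have "sys P p0 u \<noteq> 0" using generic_pencilD(3)[OF gen u] by (simp add: sysP PB0 PA0)
    have pr: "(\<lambda>k. p (r k)) \<longlonglongrightarrow> p0" using LIMSEQ_subseq_LIMSEQ[OF p ru(1)] by (simp add: o_def)
    have "sys Q p0 u \<noteq> 0"
    proof
      assume "sys Q p0 u = 0"
      then have node: "card {l. form a u l = 0} = 3" using generic_pencilD(4)[OF gen u] by (simp add: sysQ PB0)
      then have m4: "CARD('m) = 4" using generic_pencilD(1)[OF gen] u m(1) by (force simp: general_position_def)
      have lim: "(\<lambda>k. sym_part (vec_nth (p (r k))) o') \<longlonglongrightarrow> sym_part (vec_nth p0) o'" for o'
        unfolding sym_part_def by (intro vec_tendstoI) (simp, intro tendsto_intros pr, simp)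
      show False
      proof (rule no_escape_to_node[where B="\<lambda>k. PB (p (r k))" and A="\<lambda>k. PA (p (r k))" and x="\<lambda>k. x (r k)" and a=a and u=u])
        show "3 \<le> CARD('n)" "3 \<le> CARD('m)" "CARD('m) \<le> CARD('n) + 1" using m m4 by simp_all
        show "generic_pencil a A" "card {l. form a u l = 0} = 3" by fact+
        show "transpose (PB (p (r k)) j) = PB (p (r k)) j" for k j by (simp add: PB_def transpose_sym_part)
        show "(\<lambda>k. PB (p (r k)) j) \<longlonglongrightarrow> pencil a j" for j
          using lim[of "Some j"] PB0 by (simp add: PB_def fun_eq_iff)
        show "(\<lambda>k. PA (p (r k))) \<longlonglongrightarrow> A" using lim[of None] PA0 by (simp add: PA_def)
        show "(\<lambda>k. x (r k) /\<^sub>R norm (x (r k))) \<longlonglongrightarrow> u" by fact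
        show "det (vcomb (PB (p (r k))) (x (r k))) \<noteq> 0" for k using x[of "r k"] by (simp add: \<Omega>_def)
        show "\<forall>j. lik_F (PB (p (r k))) (PA (p (r k))) j (vec_nth (x (r k))) = lik_G (PB (p (r k))) j (vec_nth (x (r k)))" for k
          using eq[of "r k"] by (simp add: sysP sysQ vfun_def vec_eq_iff)
      qed
    qed
    then obtain l where l: "l \<noteq> 0" "(x \<circ> r) \<longlonglongrightarrow> l" using ru(4) \<open>sys P p0 u \<noteq> 0\<close> by blast
    have "sys e p0 l = 0"
      by (rule sys_limit[OF e pr l(2)]) (use x in \<open>simp add: o_def\<close>)
    \<comment> \<open>The limit is invertible because at \<open>p0\<close> every nonzero solution
      is.\<close>
    then have "l \<in> {x \<in> \<Omega> p0. sys e p0 x = 0}" unfolding sol0 using l(1) by (simp add: pair_solutions_def sys_e PB0 PA0)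
    then show ?thesis using ru(1) l(2) by blast
  qed
  have cov': "(\<exists>r l. strict_mono (r :: nat => nat) \<and> l \<in> \<Omega> p0 \<and> (x \<circ> r) \<longlonglongrightarrow> l) \<or> (\<exists>k. p k \<noteq> p0 \<and> (\<exists>j\<in>{} :: unit set. x k \<in> {}))"
    if "p \<longlonglongrightarrow> p0" "\<And>k. x k \<in> \<Omega> (p k) \<and> sys e (p k) (x k) = 0" for p and x :: "nat => complex^'m"
    using cov[OF that] by blast
  note near = card_near[where N="\<lambda>_ _. {}" and e=e and \<Omega>=\<Omega>, OF e op ndg _ _ _ _ cov']
  have fin: "finite {x \<in> \<Omega> p0. sys e p0 x = 0}" by (rule near(1)) simp_all
  have at: "eventually (\<lambda>p. finite {x \<in> \<Omega> p. sys e p x = 0} \<and> card {x \<in> \<Omega> p. sys e p x = 0} =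
      card {x \<in> \<Omega> p0. sys e p0 x = 0} + card ({} :: unit set)) (at p0)"
    by (rule near(2)) simp_all
  have "eventually (\<lambda>p. finite {x \<in> \<Omega> p. sys e p x = 0} \<and> card {x \<in> \<Omega> p. sys e p x = 0} =
      card {x \<in> \<Omega> p0. sys e p0 x = 0}) (nhds p0)"
    unfolding eventually_nhds_conv_at using at fin by simp
  then show ?thesis unfolding sol0 unfolding sol by (simp add: PA_def PB_def)
qed

text \<open>The count is a constructible property of the entries and holds in a classical
  neighbourhood of the special pencil, hence off a hypersurface.\<close>

theorem exists_generic_count:
  assumes n: "CARD('n) \<ge> 2" and m: "2 \<le> CARD('m)" "CARD('m) \<le> 4" "CARD('m) \<le> CARD('n) + 1"
  shows "\<exists>(h :: ('m::finite option \<times> 'n::finite \<times> 'n) cfun) (B0 :: 'm => complex^'n^'n) (A0 :: complex^'n^'n).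
    poly_fun h \<and> (\<forall>k. transpose (B0 k) = B0 k) \<and> transpose A0 = A0 \<and> h (entries (case_option A0 B0)) \<noteq> 0 \<and>
    (\<forall>B A. (\<forall>k. transpose (B k) = B k) \<longrightarrow> transpose A = A \<longrightarrow> h (entries (case_option A B)) \<noteq> 0 \<longrightarrow>
      finite (lik_solutions B A) \<and> card (lik_solutions B A) = generic_degree CARD('m) CARD('n))"
proof -
  obtain a :: "'m => 'n option => complex" and A :: "complex^'n^'n" where gen: "generic_pencil a A"
    using exists_generic_pencil[OF n m] by blast
  define p0 :: "complex^('m option \<times> 'n \<times> 'n)" where "p0 = vec_lambda (entries (case_option A (pencil a)))"
  have p0: "vec_nth p0 = entries (case_option A (pencil a))" by (simp add: p0_def vec_lambda_inverse)
  define R where "R z \<longleftrightarrow> \<not> (det (lin_comb (sym_mats (\<lambda>i. z (Inl i))) (\<lambda>k. z (Inr k))) = 0) \<and>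
      (\<forall>k\<in>UNIV. lik_F (sym_mats (\<lambda>i. z (Inl i))) (sym_part (\<lambda>i. z (Inl i)) None) k (\<lambda>k. z (Inr k)) -
        lik_G (sym_mats (\<lambda>i. z (Inl i))) k (\<lambda>k. z (Inr k)) = 0)"
    for z :: "('m option \<times> 'n \<times> 'n) + 'm => complex"
  define C where "C z \<longleftrightarrow> finite (lik_solutions (sym_mats z) (sym_part z None)) \<and>
      card (lik_solutions (sym_mats z) (sym_part z None)) = generic_degree CARD('m) CARD('n)"
    for z :: "'m option \<times> 'n \<times> 'n => complex"
  have "constructible R"
    unfolding R_def
    by (intro constructible.conj constructible.neg constructible.zero constructible_Ball poly_fun_diff lik_poly) auto
  then have "constructible C"
  proof (rule constructible_cong[OF constructible_card[where N="generic_degree CARD('m) CARD('n)"]])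
    fix z
    have "lik_solutions (sym_mats z) (sym_part z None) = {x. R (case_sum z (vec_nth x))}"
      by (simp add: lik_solutions_def R_def)
    then show "(finite {x. R (case_sum z x)} \<and> card {x. R (case_sum z x)} = generic_degree CARD('m) CARD('n)) = C z"
      unfolding C_def using card_vec_sol[of "\<lambda>x. R (case_sum z x)"] by simp
  qed
  moreover have "eventually (\<lambda>p. C (vec_nth p)) (nhds p0)"
    using eventually_card_lik_solutions[OF n m(2,3) gen p0] card_pencil_solutions[OF n m(2,3) gen] unfolding C_def by simp
  ultimately obtain h where h: "poly_fun h" "\<exists>z. h z \<noteq> 0" "\<And>z. h z \<noteq> 0 ==> C z"
    by (rule constructible_near_generic) (rule that)
  from h(2) obtain z0 where z0: "h z0 \<noteq> 0" ..
  text \<open>\<open>h\<close> might vanish on all symmetric tuples, so the antisymmetric part of \<open>z0\<close> is added first.\<close>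
  define g where "g z = h (\<lambda>(i, r, s). (z (i, r, s) + z (i, s, r)) / 2 + (z0 (i, r, s) - z0 (i, s, r)) / 2)" for z
  have g_poly: "poly_fun g"
    unfolding g_def divide_inverse case_prod_beta' by (intro poly_fun_intros poly_fun_subst[OF h(1)])
  have "g (entries (case_option (sym_part z0 None) (sym_mats z0))) = h z0"
    unfolding g_def by (intro arg_cong[of _ _ h] ext)
      (auto simp: entries_def sym_part_def field_simps split: option.split)
  moreover have "finite (lik_solutions B A) \<and> card (lik_solutions B A) = generic_degree CARD('m) CARD('n)"
    if BA: "\<And>k. transpose (B k) = B k" "transpose A = A" and nz: "g (entries (case_option A B)) \<noteq> 0" for B A
  proof -
    define z where "z = (\<lambda>(i, r, s). (entries (case_option A B) (i, r, s) + entries (case_option A B) (i, s, r)) / 2 + (z0 (i, r, s) - z0 (i, s, r)) / 2)"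
    have "C z" using nz unfolding g_def z_def by (rule h(3))
    moreover have "sym_part z i = case_option A B i" for i
      using transpose_nth[OF BA(1)] transpose_nth[OF BA(2)]
      by (cases i) (auto simp: z_def sym_part_def entries_def vec_eq_iff field_simps)
    ultimately show ?thesis by (simp add: C_def)
  qed
  ultimately show ?thesis
    by (intro exI[of _ g] exI[of _ "\<lambda>k. sym_part z0 (Some k)"] exI[of _ "sym_part z0 None"])
      (simp add: g_poly z0 transpose_sym_part)
qed

section \<open>From the likelihood equations to the ML-degree\<close>

lemma matrix_inv_left: "det A \<noteq> 0 ==> matrix_inv A ** A = mat 1"
  and matrix_inv_right: "det A \<noteq> 0 ==> A ** matrix_inv A = (mat 1 :: complex^'n::finite^'n)"
  using matrix_left_right_inverse[of _ A]
    someI_ex[of "\<lambda>A'. A ** A' = mat 1 \<and> A' ** A = mat 1"]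
  unfolding matrix_inv_def by (simp_all add: invertible_det_nz[symmetric] invertible_def)

text \<open>A solution is determined by the coordinates \<open>x\<close> of \<Sigma> in the basis
  \<open>B\<close>, as \<open>K\<close> is the inverse of \<Sigma>; orthogonality to
  \<open>L\<close> is tested on the basis, where it becomes \<open>lik_equations\<close>.\<close>

lemma ml_solutions_card:
  fixes B :: "'m::finite => complex^'n::finite^'n"
  assumes n: "CARD('n) \<ge> 2" and B: "\<And>k. transpose (B k) = B k" and A: "transpose A = A"
    and inj: "inj (vcomb B)"
  defines "L \<equiv> range (vcomb B)"
  shows "finite (ml_solutions L A) = finite (lik_solutions B A)" "card (ml_solutions L A) = card (lik_solutions B A)"
proof -
  have sym: "transpose (lin_comb B x) = lin_comb B x" for x by (rule transpose_lin_comb[OF B])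
  have iff: "K ** A ** K - K \<in> orth_compl L \<longleftrightarrow> (\<forall>k. lik_F B A k (vec_nth x) = lik_G B k (vec_nth x))"
    if K: "K ** vcomb B x = mat 1" for K and x :: "complex^'m"
  proof -
    have K': "vcomb B x ** K = mat 1" using K matrix_left_right_inverse by blast
    have "transpose K = K" by (rule transpose_inverse[OF K sym])
    then have "transpose (K ** A ** K) = K ** A ** K" by (simp add: matrix_transpose_mul A matrix_mul_assoc)
    moreover have "transpose (K ** A ** K - K) = transpose (K ** A ** K) - transpose K"
      by (simp add: transpose_def vec_eq_iff)
    ultimately have "transpose (K ** A ** K - K) = K ** A ** K - K" using \<open>transpose K = K\<close> by simp
    then have "K ** A ** K - K \<in> orth_compl L \<longleftrightarrow> (\<forall>t :: complex^'m. trace ((K ** A ** K - K) ** vcomb B t) = 0)"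
      by (auto simp: orth_compl_def sym_matrices_def L_def)
    also have "\<dots> \<longleftrightarrow> (\<forall>k. trace ((K ** A ** K - K) ** B k) = 0)"
    proof
      assume *: "\<forall>t :: complex^'m. trace ((K ** A ** K - K) ** vcomb B t) = 0"
      have "trace ((K ** A ** K - K) ** B k) = trace ((K ** A ** K - K) ** vcomb B (axis k 1))" for k
        unfolding trace_mult_lin_comb by (simp add: axis_def if_distrib[of "\<lambda>c. c * _"] cong: if_cong)
      with * show "\<forall>k. trace ((K ** A ** K - K) ** B k) = 0" by simp
    qed (simp add: trace_mult_lin_comb)
    also have "\<dots> \<longleftrightarrow> (\<forall>k. trace (K ** A ** K ** B k) = trace (K ** B k))"
      by (simp add: matrix_matrix_mult_def trace_def left_diff_distrib sum_subtractf)
    finally show ?thesis unfolding lik_equations(1)[OF n K'] .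
  qed
  let ?g = "\<lambda>x. (matrix_inv (vcomb B x), vcomb B x)"
  have "bij_betw ?g (lik_solutions B A) (ml_solutions L A)"
    unfolding bij_betw_def
  proof
    show "inj_on ?g (lik_solutions B A)"
      using inj by (auto simp: inj_on_def)
    show "?g ` lik_solutions B A = ml_solutions L A"
    proof (intro subset_antisym subsetI)
      fix z assume "z \<in> ?g ` lik_solutions B A"
      then obtain x where x: "x \<in> lik_solutions B A" "z = ?g x" by blast
      have inv: "matrix_inv (vcomb B x) ** vcomb B x = mat 1"
        using x(1) by (intro matrix_inv_left) (simp add: lik_solutions_def)
      then show "z \<in> ml_solutions L A"
        using x iff[OF inv] sym transpose_inverse[OF inv sym]
        by (simp add: ml_solutions_def sym_matrices_def lik_solutions_def L_def)
    next
      fix z assume z: "z \<in> ml_solutions L A"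
      then obtain K x where x: "z = (K, vcomb B x)" "K ** vcomb B x = mat 1" "K ** A ** K - K \<in> orth_compl L"
        by (auto simp: ml_solutions_def L_def)
      have det: "det (vcomb B x) \<noteq> 0" using x(2) invertible_det_nz invertible_left_inverse by blast
      have "K = K ** (vcomb B x ** matrix_inv (vcomb B x))" using matrix_inv_right[OF det] by simp
      also have "\<dots> = matrix_inv (vcomb B x)" unfolding matrix_mul_assoc x(2) by simp
      finally show "z \<in> ?g ` lik_solutions B A"
        using x iff[OF x(2)] det by (auto simp: lik_solutions_def)
    qed
  qed
  then show "finite (ml_solutions L A) = finite (lik_solutions B A)" "card (ml_solutions L A) = card (lik_solutions B A)"
    using bij_betw_finite bij_betw_same_card by fastforce+
qed

text \<open>For fixed \<open>B\<close>, \<open>h\<close> becomes a polynomial in the data alone,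
  which \<open>A0\<close> shows to be nonzero somewhere on the symmetric matrices.\<close>

lemma has_ml_degreeI:
  fixes B :: "'m::finite => complex^'n::finite^'n" and h :: "('m option \<times> 'n \<times> 'n) cfun"
  assumes n: "CARD('n) \<ge> 2" and B: "\<And>k. transpose (B k) = B k"
    and inj: "inj (vcomb B)"
    and h: "poly_fun h" and A0: "transpose A0 = A0" "h (entries (case_option A0 B)) \<noteq> 0"
    and count: "\<And>A. transpose A = A ==> h (entries (case_option A B)) \<noteq> 0 ==>
      finite (lik_solutions B A) \<and> card (lik_solutions B A) = N"
  shows "has_ml_degree (range (vcomb B)) N"
proof -
  define f where "f y = h (\<lambda>(i, r, s). case i of None => y (r, s) | Some k => B k $ r $ s)" for y :: "'n \<times> 'n => complex"
  have "poly_fun f"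
    unfolding f_def
  proof (rule poly_fun_subst[OF h])
    fix i :: "'m option \<times> 'n \<times> 'n"
    obtain k r s where i: "i = (k, r, s)" by (cases i)
    show "poly_fun (\<lambda>y. case i of (i, r, s) => case i of None => y (r, s) | Some k => B k $ r $ s)"
      unfolding i by (cases k) (auto intro: poly_fun.intros)
  qed
  have f: "f (\<lambda>(i, j). A $ i $ j) = h (entries (case_option A B))" for A
    unfolding f_def entries_def by (intro arg_cong[of _ _ h]) (auto simp: fun_eq_iff split: option.split)
  define U where "U = {A \<in> sym_matrices. f (\<lambda>(i, j). A $ i $ j) \<noteq> 0}"
  have "zariski_closed_sym (sym_matrices - U)"
    unfolding zariski_closed_sym_def by (intro exI[of _ "{f}"]) (use \<open>poly_fun f\<close> in \<open>auto simp: U_def\<close>)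
  then have "zariski_open_sym U" by (auto simp: zariski_open_sym_def U_def)
  moreover have "A0 \<in> U" using A0 by (simp add: U_def sym_matrices_def f)
  moreover have "finite (ml_solutions (range (vcomb B)) A) \<and>
      card (ml_solutions (range (vcomb B)) A) = N" if "A \<in> U" for A
    using ml_solutions_card[OF n B _ inj, of A] count[of A] that by (simp add: U_def sym_matrices_def f)
  ultimately show ?thesis unfolding has_ml_degree_def by blast
qed

section \<open>Pluecker coordinates\<close>

lemma hom_poly_fun_power: "hom_poly_fun d (\<lambda>y. y c ^ d)"
proof (induction d)
  case 0
  show ?case using hom_poly_fun.const[of 1] by simp
next
  case (Suc d)
  show ?case using hom_poly_fun.mult[OF hom_poly_fun.var[of c] Suc] by simp
qed

text \<open>Denominators are cleared in the chart where the coordinate \<open>c\<close> is nonzero;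
  summands are brought to equal degree by powers of \<open>y c\<close>.\<close>

lemma homogenize:
  assumes "poly_fun g"
  shows "\<exists>d f. hom_poly_fun d f \<and> (\<forall>y. y c \<noteq> 0 \<longrightarrow> f y = y c ^ d * g (\<lambda>i. y (\<sigma> i) / y c))"
  using assms
proof induction
  case (const a)
  show ?case by (intro exI[of _ 0] exI[of _ "\<lambda>_. a"]) (simp add: hom_poly_fun.const)
next
  case (var i)
  show ?case by (intro exI[of _ 1] exI[of _ "\<lambda>y. y (\<sigma> i)"]) (use hom_poly_fun.var[of "\<sigma> i"] in simp)
next
  case (add g1 g2)
  obtain d1 f1 d2 f2 where f: "hom_poly_fun d1 f1" "\<And>y. y c \<noteq> 0 ==> f1 y = y c ^ d1 * g1 (\<lambda>i. y (\<sigma> i) / y c)"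
    "hom_poly_fun d2 f2" "\<And>y. y c \<noteq> 0 ==> f2 y = y c ^ d2 * g2 (\<lambda>i. y (\<sigma> i) / y c)"
    using add.IH by blast
  have "hom_poly_fun (d1 + d2) (\<lambda>y. f1 y * y c ^ d2)" "hom_poly_fun (d2 + d1) (\<lambda>y. f2 y * y c ^ d1)"
    by (intro hom_poly_fun.mult f hom_poly_fun_power)+
  then have "hom_poly_fun (d1 + d2) (\<lambda>y. f1 y * y c ^ d2 + f2 y * y c ^ d1)"
    by (intro hom_poly_fun.add) (simp_all add: add.commute)
  then show ?case
    by (intro exI[of _ "d1 + d2"] exI[of _ "\<lambda>y. f1 y * y c ^ d2 + f2 y * y c ^ d1"]) (simp add: f power_add algebra_simps)
next
  case (mult g1 g2)
  obtain d1 f1 d2 f2 where f: "hom_poly_fun d1 f1" "\<And>y. y c \<noteq> 0 ==> f1 y = y c ^ d1 * g1 (\<lambda>i. y (\<sigma> i) / y c)"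
    "hom_poly_fun d2 f2" "\<And>y. y c \<noteq> 0 ==> f2 y = y c ^ d2 * g2 (\<lambda>i. y (\<sigma> i) / y c)"
    using mult.IH by blast
  then show ?case
    by (intro exI[of _ "d1 + d2"] exI[of _ "\<lambda>y. f1 y * f2 y"]) (simp add: hom_poly_fun.mult power_add)
qed

text \<open>Laplace expansion along the column with number \<open>k\<close>; the cofactors
  \<open>C j\<close> do not involve the position placed there.\<close>

lemma pluecker_expand:
  assumes "k < m"
  shows "\<exists>C. \<forall>q. pluecker m B (c(k := q)) = (\<Sum>j<m. C j * B j $ fst q $ snd q)"
proof -
  define C where "C j = (\<Sum>p | p permutes {..<m} \<and> p j = k. of_int (sign p) * (\<Prod>l\<in>{..<m} - {j}. B l $ fst (c (p l)) $ snd (c (p l))))" for j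
  define t where "t q p = of_int (sign p) * (\<Prod>l<m. B l $ fst ((c(k := q)) (p l)) $ snd ((c(k := q)) (p l)))" for q and p :: "nat => nat"
  have "pluecker m B (c(k := q)) = (\<Sum>j<m. C j * B j $ fst q $ snd q)" for q
  proof -
    have U: "{p. p permutes {..<m}} = (\<Union>j<m. {p. p permutes {..<m} \<and> p j = k})"
    proof (intro subset_antisym subsetI)
      fix p assume "p \<in> {p. p permutes {..<m}}"
      then have p: "p permutes {..<m}" by simp
      obtain j where "j \<in> {..<m}" "p j = k" using permutes_image[OF p] assms by (metis imageE lessThan_iff)
      then show "p \<in> (\<Union>j<m. {p. p permutes {..<m} \<and> p j = k})" using p by blast
    qed blast
    have "pluecker m B (c(k := q)) = (\<Sum>p\<in>{p. p permutes {..<m}}. t q p)" by (simp add: pluecker_def t_def)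
    also have "\<dots> = (\<Sum>j<m. \<Sum>p | p permutes {..<m} \<and> p j = k. t q p)"
      unfolding U
    proof (rule sum.UNION_disjoint)
      show "\<forall>i\<in>{..<m}. finite {p. p permutes {..<m} \<and> p i = k}"
        using finite_permutations[of "{..<m}"] by (auto intro: finite_subset[rotated])
      show "\<forall>i\<in>{..<m}. \<forall>j\<in>{..<m}. i \<noteq> j \<longrightarrow> {p. p permutes {..<m} \<and> p i = k} \<inter> {p. p permutes {..<m} \<and> p j = k} = {}"
        using permutes_inj by (fastforce dest: injD)
    qed simp
    also have "\<dots> = (\<Sum>j<m. C j * B j $ fst q $ snd q)"
    proof (intro sum.cong refl)
      fix j assume j: "j \<in> {..<m}"
      have "t q p = of_int (sign p) * (\<Prod>l\<in>{..<m} - {j}. B l $ fst (c (p l)) $ snd (c (p l))) * B j $ fst q $ snd q"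
        if p: "p permutes {..<m}" "p j = k" for p
      proof -
        have "p l \<noteq> k" if "l \<noteq> j" for l using p that permutes_inj[OF p(1)] by (auto dest: injD)
        then have "(\<Prod>l\<in>{..<m} - {j}. B l $ fst ((c(k := q)) (p l)) $ snd ((c(k := q)) (p l))) =
            (\<Prod>l\<in>{..<m} - {j}. B l $ fst (c (p l)) $ snd (c (p l)))"
          by (intro prod.cong refl) auto
        then show ?thesis unfolding t_def using j p(2) by (subst prod.remove[of _ j]) auto
      qed
      then show "(\<Sum>p | p permutes {..<m} \<and> p j = k. t q p) = C j * B j $ fst q $ snd q"
        unfolding C_def sum_distrib_right by (intro sum.cong refl) auto
    qed
    finally show ?thesis .
  qed
  then show ?thesis by blast
qed

text \<open>Composition with the transposition of \<open>k\<close> and \<open>l\<close> pairs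
  permutations of opposite sign with equal products.\<close>

lemma pluecker_repeated:
  assumes kl: "k < m" "l < m" "k \<noteq> l" and c: "c k = c l"
  shows "pluecker m B c = 0"
proof -
  define \<tau> where "\<tau> = Transposition.transpose k l"
  have \<tau>: "\<tau> permutes {..<m}" unfolding \<tau>_def using kl by (intro permutes_swap_id) auto
  have c\<tau>: "c (\<tau> i) = c i" for i using c by (auto simp: \<tau>_def Transposition.transpose_def)
  have "pluecker m B c = (\<Sum>p | p permutes {..<m}. of_int (sign (\<tau> \<circ> p)) * (\<Prod>i<m. B i $ fst (c ((\<tau> \<circ> p) i)) $ snd (c ((\<tau> \<circ> p) i))))"
  proof -
    have \<tau>\<tau>: "\<tau> \<circ> (\<tau> \<circ> p) = p" for p by (simp add: \<tau>_def fun_eq_iff)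
    show ?thesis unfolding pluecker_def
      by (rule sum.reindex_bij_witness[where i="\<lambda>p. \<tau> \<circ> p" and j="\<lambda>p. \<tau> \<circ> p"])
        (simp_all only: \<tau>\<tau> mem_Collect_eq permutes_compose[OF _ \<tau>])
  qed
  also have "\<dots> = (\<Sum>p | p permutes {..<m}. - (of_int (sign p) * (\<Prod>i<m. B i $ fst (c (p i)) $ snd (c (p i)))))"
  proof (intro sum.cong refl)
    fix p assume "p \<in> {p. p permutes {..<m}}"
    then have "sign (\<tau> \<circ> p) = sign \<tau> * sign p"
      using \<tau> by (intro sign_compose) (auto intro: permutes_imp_permutation[of "{..<m}"])
    also have "sign \<tau> = - 1" using kl by (simp add: \<tau>_def sign_swap_id)
    finally have s: "sign (\<tau> \<circ> p) = - sign p" by (simp only: mult_minus1)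
    show "of_int (sign (\<tau> \<circ> p)) * (\<Prod>i<m. B i $ fst (c ((\<tau> \<circ> p) i)) $ snd (c ((\<tau> \<circ> p) i))) =
      - (of_int (sign p) * (\<Prod>i<m. B i $ fst (c (p i)) $ snd (c (p i))))" unfolding s by (simp add: c\<tau>)
  qed
  also have "\<dots> = - pluecker m B c" by (simp add: sum_negf pluecker_def)
  finally show ?thesis by simp
qed

section \<open>Bases, spans and reduced bases\<close>

lemma lin_comb_lin_comb:
  fixes P :: "complex^'m::finite^'m" and x :: "complex^'m"
  shows "vcomb (\<lambda>k. vcomb B (P $ k)) x = vcomb B (x v* P)"
proof -
  have "(\<Sum>k\<in>UNIV. x $ k * (\<Sum>j\<in>UNIV. P $ k $ j * B j $ r $ s)) = (\<Sum>j\<in>UNIV. (\<Sum>k\<in>UNIV. x $ k * P $ k $ j) * B j $ r $ s)" for r s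
    by (simp add: sum_distrib_left sum_distrib_right mult_ac) (rule sum.swap)
  then show ?thesis by (simp add: vec_eq_iff lin_comb_nth vector_matrix_mult_def mult.commute[of "x $ _"])
qed

lemma base_change:
  fixes P N :: "complex^'m::finite^'m" and B :: "'m => complex^'n::finite^'n"
  assumes P: "P ** N = mat 1"
  shows "range (vcomb (\<lambda>k. vcomb B (P $ k))) = range (vcomb B)"
    "inj (vcomb B) ==>
      inj (vcomb (\<lambda>k. vcomb B (P $ k)))"
proof -
  have N: "N ** P = mat 1" using P matrix_left_right_inverse by blast
  have "x = (x v* N) v* P" for x by (simp add: vector_matrix_mul_assoc N)
  then have "vcomb B x \<in> range (\<lambda>x :: complex^'m. vcomb B (x v* P))" for x by (metis rangeI)
  then show "range (vcomb (\<lambda>k. vcomb B (P $ k))) = range (vcomb B)"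
    unfolding lin_comb_lin_comb by auto
  have "x v* P v* N = x" for x by (simp add: vector_matrix_mul_assoc P)
  then have "inj (\<lambda>x. x v* P)" by (rule inj_on_inverseI)
  then show "inj (vcomb B) ==>
      inj (vcomb (\<lambda>k. vcomb B (P $ k)))"
    unfolding lin_comb_lin_comb by (simp add: inj_def)
qed

lemma lin_comb_axis: "vcomb B (axis k 1) = B k"
  by (simp add: vec_eq_iff lin_comb_nth axis_def if_distrib[of "\<lambda>c. c * _"] cong: if_cong)

lemma range_lin_comb: "range (vcomb B) = mat_cvs.span (range (B :: 'm::finite => complex^'n::finite^'n))"
proof
  show "range (vcomb B) \<subseteq> mat_cvs.span (range B)"
  proof clarify
    fix x :: "complex^'m"
    show "vcomb B x \<in> mat_cvs.span (range B)"
      unfolding lin_comb_def by (rule mat_cvs.span_sum, rule mat_cvs.span_scale, rule mat_cvs.span_base) simp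
  qed
  have "mat_cvs.subspace (range (vcomb B))"
  proof (rule mat_cvs.subspaceI)
    have "vcomb B (0 :: complex^'m) = 0" by (simp add: vec_eq_iff lin_comb_nth)
    then show "0 \<in> range (vcomb B)" by (metis rangeI)
    have "vcomb B x + vcomb B y = vcomb B (x + y)" for x y :: "complex^'m"
      by (simp add: vec_eq_iff lin_comb_nth sum.distrib distrib_right)
    then show "X + Y \<in> range (vcomb B)"
      if "X \<in> range (vcomb B)" "Y \<in> range (vcomb B)" for X Y
      using that by auto
    have "cscale c (vcomb B x) = vcomb B (c *s x)" for c and x :: "complex^'m"
      by (simp add: vec_eq_iff lin_comb_nth cscale_def sum_distrib_left mult.assoc)
    then show "cscale c X \<in> range (vcomb B)"
      if "X \<in> range (vcomb B)" for X c
      using that by auto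
  qed
  moreover have "range B \<subseteq> range (vcomb B)"
    using lin_comb_axis[of B] by (metis image_subsetI rangeI)
  ultimately show "mat_cvs.span (range B) \<subseteq> range (vcomb B)"
    by (intro mat_cvs.span_minimal)
qed

lemma dim_range_lin_comb:
  fixes B :: "'m::finite => complex^'n::finite^'n"
  assumes inj: "inj (vcomb B)"
  shows "mat_cvs.dim (mat_cvs.span (range B)) = CARD('m)"
proof -
  have injB: "inj B"
  proof (rule injI)
    fix k l assume "B k = B l"
    then have "vcomb B (axis k 1) = vcomb B (axis l 1)" by (simp add: lin_comb_axis)
    then have "axis k (1::complex) = axis l 1" using inj by (auto dest: injD)
    then show "k = l" by (simp add: axis_eq_axis)
  qed
  have "mat_cvs.independent (range B)"
  proof
    assume "mat_cvs.dependent (range B)"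
    then obtain u where u: "\<exists>v\<in>range B. u v \<noteq> 0" "(\<Sum>v\<in>range B. cscale (u v) v) = 0"
      unfolding mat_cvs.dependent_finite[OF finite_imageI[OF finite]] by blast
    have "vcomb B (\<chi> k. u (B k)) = 0"
      using u(2) injB by (simp add: lin_comb_def sum.reindex)
    also have "0 = vcomb B 0" by (simp add: vec_eq_iff lin_comb_nth)
    finally have "(\<chi> k. u (B k)) = 0" using inj by (auto dest: injD)
    then have "u (B k) = 0" for k by (simp add: vec_eq_iff)
    then show False using u(1) by auto
  qed
  then have "mat_cvs.dim (mat_cvs.span (range B)) = card (range B)" by (rule mat_cvs.dim_span_eq_card_independent)
  then show ?thesis using injB by (simp add: card_image)
qed

definition minor_matrix :: "('m::finite => complex^'n::finite^'n) => ('m => 'n \<times> 'n) => complex^'m^'m" where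
  "minor_matrix B c = (\<chi> k l. B k $ fst (c l) $ snd (c l))"

text \<open>The reduced basis with respect to the positions \<open>c\<close>: its entries are ratios of Pluecker coordinates.\<close>

lemma pluecker_reduce:
  fixes B :: "'m::finite => complex^'n::finite^'n"
  assumes \<kappa>: "bij_betw \<kappa> {..<CARD('m)} (UNIV :: 'm set)" and \<iota>: "\<And>k. \<iota> k < CARD('m)" "\<And>k. \<kappa> (\<iota> k) = k"
    and nz: "pluecker CARD('m) (B \<circ> \<kappa>) c \<noteq> 0"
  obtains N where "N ** minor_matrix B (c \<circ> \<iota>) = mat 1" "minor_matrix B (c \<circ> \<iota>) ** N = mat 1"
    "\<And>l r s. vcomb B (N $ l) $ r $ s =
      pluecker CARD('m) (B \<circ> \<kappa>) (c(\<iota> l := (r, s))) / pluecker CARD('m) (B \<circ> \<kappa>) c"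
proof -
  define y where "y = pluecker CARD('m) (B \<circ> \<kappa>)"
  define M where "M = minor_matrix B (c \<circ> \<iota>)"
  have "\<exists>C. \<forall>q. y (c(\<iota> l := q)) = (\<Sum>j<CARD('m). C j * (B \<circ> \<kappa>) j $ fst q $ snd q)" for l
    unfolding y_def by (rule pluecker_expand[OF \<iota>(1)])
  then have "\<exists>C. \<forall>l q. y (c(\<iota> l := q)) = (\<Sum>j<CARD('m). C l j * (B \<circ> \<kappa>) j $ fst q $ snd q)" by (intro choice allI)
  then obtain C where C: "\<And>l q. y (c(\<iota> l := q)) = (\<Sum>j<CARD('m). C l j * (B \<circ> \<kappa>) j $ fst q $ snd q)" by blast
  have C': "y (c(\<iota> l := q)) = (\<Sum>j\<in>UNIV. C l (\<iota> j) * B j $ fst q $ snd q)" for l q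
  proof -
    have "\<iota> (\<kappa> j) = j" if "j \<in> {..<CARD('m)}" for j
      using \<kappa> \<iota> that by (auto simp: bij_betw_def dest: inj_onD)
    then have "(\<Sum>j<CARD('m). C l j * (B \<circ> \<kappa>) j $ fst q $ snd q) = (\<Sum>j<CARD('m). C l (\<iota> (\<kappa> j)) * B (\<kappa> j) $ fst q $ snd q)"
      by (intro sum.cong refl) simp
    then show ?thesis unfolding C using sum.reindex_bij_betw[OF \<kappa>, of "\<lambda>j. C l (\<iota> j) * B j $ fst q $ snd q"] by simp
  qed
  define N :: "complex^'m^'m" where "N = (\<chi> l j. C l (\<iota> j) / y c)"
  have N: "vcomb B (N $ l) $ r $ s = y (c(\<iota> l := (r, s))) / y c" for l r s
    by (simp add: lin_comb_nth N_def C' sum_divide_distrib)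
  have "N ** M = mat 1"
  proof -
    have "(N ** M) $ l $ l' = mat 1 $ l $ l'" for l l'
    proof -
      have "(N ** M) $ l $ l' = y (c(\<iota> l := c (\<iota> l'))) / y c"
        by (simp add: matrix_matrix_mult_def N_def M_def minor_matrix_def C' sum_divide_distrib)
      also have "\<dots> = mat 1 $ l $ l'"
      proof (cases "l = l'")
        case True
        then show ?thesis using nz by (simp add: mat_def y_def)
      next
        case False
        then have neq: "\<iota> l \<noteq> \<iota> l'" using \<iota>(2) by metis
        then have "y (c(\<iota> l := c (\<iota> l'))) = 0"
          unfolding y_def by (intro pluecker_repeated[OF \<iota>(1)[of l] \<iota>(1)[of l'] neq]) (use neq in auto)
        then show ?thesis using False by (simp add: mat_def)
      qed
      finally show ?thesis .
    qed
    then show ?thesis by (simp add: vec_eq_iff)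
  qed
  moreover from this have "M ** N = mat 1" using matrix_left_right_inverse by blast
  ultimately show ?thesis using that N unfolding y_def M_def by blast
qed

lemma inj_lin_comb_minor:
  assumes "minor_matrix B c ** N = mat 1"
  shows "inj (vcomb B)"
proof (rule injI)
  have M: "x v* minor_matrix B c = (\<chi> l. vcomb B x $ fst (c l) $ snd (c l))" for x
    by (simp add: vec_eq_iff vector_matrix_mult_def minor_matrix_def lin_comb_nth mult.commute)
  fix x y :: "complex^'a" assume "vcomb B x = vcomb B y"
  then have "x v* minor_matrix B c v* N = y v* minor_matrix B c v* N" unfolding M by simp
  then show "x = y" using assms by (simp add: vector_matrix_mul_assoc)
qed

text \<open>\<open>g\<close> is a condition on bases and not on subspaces. In the chart given by
  \<open>c\<close>, a subspace has one distinguished reduced basis, whose entries are ratios of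
  Pluecker coordinates; \<open>g\<close> is evaluated at a fixed transform of that basis and made
  homogeneous. The hypothesis \<open>deg\<close> then applies because the ML-degree depends on the
  span only.\<close>

lemma has_generic_ml_degreeI:
  fixes g :: "('m::finite \<times> 'n::finite \<times> 'n) cfun" and B0 :: "'m => complex^'n^'n"
  assumes g: "poly_fun g" "g (entries B0) \<noteq> 0" and B0: "\<And>k. transpose (B0 k) = B0 k"
    and \<kappa>: "bij_betw \<kappa> {..<CARD('m)} (UNIV :: 'm set)" and c: "pluecker CARD('m) (B0 \<circ> \<kappa>) c \<noteq> 0"
    and deg: "\<And>B. (\<And>k. transpose (B k) = B k) ==> inj (vcomb B) ==> g (entries B) \<noteq> 0 ==>
      has_ml_degree (range (vcomb B)) d"
  shows "has_generic_ml_degree TYPE('n) CARD('m) d"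
proof -
  define m where "m = CARD('m)"
  define \<iota> where "\<iota> = inv_into {..<m} \<kappa>"
  have \<iota>: "\<iota> k < CARD('m)" "\<kappa> (\<iota> k) = k" for k
    using \<kappa> inv_into_into[of k \<kappa> "{..<m}"] f_inv_into_f[of k \<kappa> "{..<m}"] by (auto simp: \<iota>_def m_def bij_betw_def)
  define M0 where "M0 = minor_matrix B0 (c \<circ> \<iota>)"
  obtain N0 where N0: "N0 ** M0 = mat 1" "M0 ** N0 = mat 1"
    "\<And>l r s. vcomb B0 (N0 $ l) $ r $ s = pluecker CARD('m) (B0 \<circ> \<kappa>) (c(\<iota> l := (r, s))) / pluecker CARD('m) (B0 \<circ> \<kappa>) c"
    by (rule pluecker_reduce[OF \<kappa> \<iota> c, folded M0_def]) (rule that)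
  \<comment> \<open>\<open>M0\<close> leads from the reduced basis of the span of \<open>B0\<close>
    back to \<open>B0\<close>, so that \<open>g'\<close> does not vanish at this reference
    subspace.\<close>
  define g' where "g' w = g (\<lambda>(k, r, s). \<Sum>l\<in>UNIV. M0 $ k $ l * w (l, r, s))" for w
  have g': "poly_fun g'"
    unfolding g'_def case_prod_beta' by (intro poly_fun_subst[OF g(1)] poly_fun_intros)
  define \<sigma> where "\<sigma> = (\<lambda>(l, r, s). c(\<iota> l := (r, s)))"
  obtain e f where f: "hom_poly_fun e f" "\<And>y. y c \<noteq> 0 ==> f y = y c ^ e * g' (\<lambda>i. y (\<sigma> i) / y c)"
    using homogenize[OF g', of c \<sigma>] by blast
  define U where "U = {L \<in> grassmannian m. \<exists>B. mat_cvs.span (B ` {..<m}) = L \<and> pluecker m B c * f (pluecker m B) \<noteq> 0}"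
  have "zariski_closed_gr m (grassmannian m - U)"
    unfolding zariski_closed_gr_def
  proof (intro exI[of _ "{\<lambda>y. y c * f y}"] conjI)
    show "\<forall>f'\<in>{\<lambda>y. y c * f y}. \<exists>d. hom_poly_fun d f'" using hom_poly_fun.mult[OF hom_poly_fun.var f(1)] by auto
    show "grassmannian m - U = {L \<in> grassmannian m. \<forall>B. mat_cvs.span (B ` {..<m}) = L \<longrightarrow> (\<forall>f'\<in>{\<lambda>y. y c * f y}. f' (pluecker m B) = 0)}"
      by (auto simp: U_def)
  qed
  then have "zariski_open_gr m U" by (auto simp: zariski_open_gr_def U_def)
  have g_pluecker: "f (pluecker m (B \<circ> \<kappa>)) = pluecker m (B \<circ> \<kappa>) c ^ e *
      g (entries (\<lambda>k. vcomb B ((M0 ** N) $ k)))"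
    if nz: "pluecker m (B \<circ> \<kappa>) c \<noteq> 0"
      and N: "\<And>l r s. vcomb B (N $ l) $ r $ s = pluecker m (B \<circ> \<kappa>) (c(\<iota> l := (r, s))) / pluecker m (B \<circ> \<kappa>) c"
    for B N
  proof -
    have "vcomb B ((M0 ** N) $ k) $ r $ s = (\<Sum>l\<in>UNIV. M0 $ k $ l * (vcomb B (N $ l) $ r $ s))" for k r s
    proof -
      have "(\<Sum>j\<in>UNIV. (\<Sum>l\<in>UNIV. M0 $ k $ l * N $ l $ j) * B j $ r $ s) = (\<Sum>l\<in>UNIV. M0 $ k $ l * (\<Sum>j\<in>UNIV. N $ l $ j * B j $ r $ s))"
        by (simp add: sum_distrib_left sum_distrib_right mult_ac) (rule sum.swap)
      then show ?thesis by (simp add: lin_comb_nth matrix_matrix_mult_def)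
    qed
    then have "entries (\<lambda>k. vcomb B ((M0 ** N) $ k)) =
        (\<lambda>(k, r, s). \<Sum>l\<in>UNIV. M0 $ k $ l * (pluecker m (B \<circ> \<kappa>) (\<sigma> (l, r, s)) / pluecker m (B \<circ> \<kappa>) c))"
      by (simp add: entries_def \<sigma>_def N)
    then show ?thesis unfolding f(2)[of "pluecker m (B \<circ> \<kappa>)", OF nz] g'_def by simp
  qed
  have img: "(B \<circ> \<kappa>) ` {..<m} = range B" for B :: "'m => complex^'n^'n"
    using \<kappa> by (metis bij_betw_imp_surj_on image_comp m_def)
  have "mat_cvs.span (range B0) \<in> U"
  proof -
    have inj: "inj (vcomb B0)"
      by (rule inj_lin_comb_minor[OF N0(2)[unfolded M0_def]])
    have "mat_cvs.span (range B0) \<subseteq> sym_matrices"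
      unfolding range_lin_comb[symmetric] using transpose_lin_comb[of B0, OF B0] by (auto simp: sym_matrices_def)
    then have "mat_cvs.span (range B0) \<in> grassmannian m"
      using dim_range_lin_comb[OF inj] by (simp add: grassmannian_def m_def mat_cvs.subspace_span)
    moreover have "f (pluecker m (B0 \<circ> \<kappa>)) \<noteq> 0"
    proof -
      have "vcomb B0 ((M0 ** N0) $ k) = B0 k" for k
      proof -
        have "(M0 ** N0) $ k = axis k 1" unfolding N0(2) by (simp add: mat_def axis_def vec_eq_iff)
        then show ?thesis by (simp add: lin_comb_axis)
      qed
      then show ?thesis using g_pluecker[of B0 N0] c N0(3) g(2) by (simp add: m_def)
    qed
    moreover have "pluecker m (B0 \<circ> \<kappa>) c \<noteq> 0" using c by (simp add: m_def)
    ultimately show ?thesis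
      unfolding U_def by (intro CollectI conjI exI[of _ "B0 \<circ> \<kappa>"]) (simp_all only: img mult_eq_0_iff simp_thms)
  qed
  moreover have "has_ml_degree L d" if L: "L \<in> U" for L
  proof -
    obtain B' where B': "mat_cvs.span (B' ` {..<m}) = L" "pluecker m B' c \<noteq> 0" "f (pluecker m B') \<noteq> 0"
      and Lg: "L \<in> grassmannian m" using L by (auto simp: U_def)
    define B where "B = B' \<circ> \<iota>"
    have "\<iota> (\<kappa> j) = j" if "j < m" for j using \<kappa> that by (simp add: \<iota>_def bij_betw_def m_def inv_into_f_f)
    then have "pluecker m (B \<circ> \<kappa>) = pluecker m B'"
      unfolding pluecker_def B_def by (intro ext sum.cong refl arg_cong2[of _ _ _ _ "(*)"] prod.cong) auto
    then have B: "pluecker m (B \<circ> \<kappa>) c \<noteq> 0" "f (pluecker m (B \<circ> \<kappa>)) \<noteq> 0" using B' by simp_all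
    have "(B \<circ> \<kappa>) ` {..<m} = B' ` {..<m}"
      unfolding B_def using \<open>\<And>j. j < m ==> \<iota> (\<kappa> j) = j\<close> by (intro image_cong refl) simp
    then have LB: "L = range (vcomb B)"
      using B'(1) unfolding range_lin_comb img by simp
    define M where "M = minor_matrix B (c \<circ> \<iota>)"
    obtain N where N: "N ** M = mat 1" "M ** N = mat 1"
      "\<And>l r s. vcomb B (N $ l) $ r $ s = pluecker m (B \<circ> \<kappa>) (c(\<iota> l := (r, s))) / pluecker m (B \<circ> \<kappa>) c"
      by (rule pluecker_reduce[OF \<kappa> \<iota> B(1)[unfolded m_def], folded M_def m_def]) (rule that)
    have inj: "inj (vcomb B)"
      by (rule inj_lin_comb_minor[OF N(2)[unfolded M_def]])
    define R where "R k = vcomb B ((M0 ** N) $ k)" for k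
    have "M0 ** N ** (M ** N0) = M0 ** (N ** M) ** N0" by (simp only: matrix_mul_assoc)
    also have "\<dots> = mat 1" by (simp add: N N0)
    finally have P: "M0 ** N ** (M ** N0) = mat 1" .
    have "transpose (R k) = R k" for k
    proof -
      have "R k \<in> L" unfolding LB R_def by blast
      then show ?thesis using Lg by (auto simp: grassmannian_def sym_matrices_def)
    qed
    moreover have "g (entries R) \<noteq> 0" using g_pluecker[of B N, OF B(1) N(3)] B(2) by (auto simp: R_def[abs_def])
    ultimately have "has_ml_degree (range (vcomb R)) d"
      using base_change(2)[OF P inj] by (intro deg) (simp_all add: R_def[abs_def])
    then show ?thesis unfolding LB using base_change(1)[OF P, of B] by (simp add: R_def[abs_def])
  qed
  ultimately show ?thesis
    unfolding has_generic_ml_degree_def using \<open>zariski_open_gr m U\<close> by (auto simp: m_def)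
qed

text \<open>Every permutation other than the identity meets a zero entry.\<close>

lemma pluecker_unit:
  assumes "\<And>k l. k < m ==> l < m ==> B k $ fst (c l) $ snd (c l) = (if k = l then 1 else 0)"
  shows "pluecker m B c = 1"
proof -
  have "pluecker m B c = (\<Sum>p\<in>{id}. of_int (sign p) * (\<Prod>k<m. B k $ fst (c (p k)) $ snd (c (p k))))"
    unfolding pluecker_def
  proof (rule sum.mono_neutral_right)
    show "\<forall>p\<in>{p. p permutes {..<m}} - {id}. of_int (sign p) * (\<Prod>k<m. B k $ fst (c (p k)) $ snd (c (p k))) = 0"
    proof
      fix p assume "p \<in> {p. p permutes {..<m}} - {id}"
      then have p: "p permutes {..<m}" "p \<noteq> id" by auto
      then obtain k where k: "p k \<noteq> k" by (auto simp: fun_eq_iff)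
      then have "k < m" "p k < m" using p(1) permutes_not_in[OF p(1)] permutes_in_image[OF p(1)] by fastforce+
      then have "B k $ fst (c (p k)) $ snd (c (p k)) = 0" using assms[of k "p k"] k by simp
      then have "(\<Prod>k<m. B k $ fst (c (p k)) $ snd (c (p k))) = 0" using \<open>k < m\<close> by (intro prod_zero) auto
      then show "of_int (sign p) * (\<Prod>k<m. B k $ fst (c (p k)) $ snd (c (p k))) = 0" by simp
    qed
  qed (auto simp: finite_permutations permutes_id)
  also have "\<dots> = 1" using assms by (simp add: sign_id)
  finally show ?thesis .
qed

text \<open>The diagonal units and one off-diagonal unit are n + 1 symmetric matrices, each detected
  at its own position, which is enough for \<open>CARD('m) \<le> CARD('n) + 1\<close>.\<close>

lemma exists_pluecker_nonzero:
  assumes n: "CARD('n) \<ge> 2" and m: "CARD('m) \<le> CARD('n) + 1" and \<kappa>: "bij_betw \<kappa> {..<CARD('m)} (UNIV :: 'm set)"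
  shows "\<exists>(B :: 'm::finite => complex^'n::finite^'n) c. (\<forall>k. transpose (B k) = B k) \<and> pluecker CARD('m) (B \<circ> \<kappa>) c \<noteq> 0"
proof -
  obtain r0 s0 :: 'n where rs: "r0 \<noteq> s0"
    using n card_le_Suc0_iff_eq[of "UNIV :: 'n set"] by force
  define pos where "pos i = (case i of None => (r0, s0) | Some r => (r, r))" for i
  define E :: "'n option => complex^'n^'n" where
    "E i = (\<chi> r s. if pos i = (r, s) \<or> pos i = (s, r) then 1 else 0)" for i
  have E: "E i $ fst (pos j) $ snd (pos j) = (if i = j then 1 else 0)" for i j
    using rs by (auto simp: E_def pos_def split: option.split)
  have tE: "transpose (E i) = E i" for i by (auto simp: E_def transpose_def vec_eq_iff)
  obtain \<phi> :: "'m => 'n option" where \<phi>: "inj \<phi>"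
    using m card_le_inj[of "UNIV :: 'm set" "UNIV :: 'n option set"] by auto
  have "pluecker CARD('m) ((\<lambda>k. E (\<phi> k)) \<circ> \<kappa>) (\<lambda>l. pos (\<phi> (\<kappa> l))) = 1"
  proof (rule pluecker_unit)
    fix k l assume "k < CARD('m)" "l < CARD('m)"
    then have "\<phi> (\<kappa> k) = \<phi> (\<kappa> l) \<longleftrightarrow> k = l" using \<phi> \<kappa> by (auto simp: bij_betw_def inj_eq inj_on_eq_iff)
    then show "((\<lambda>k. E (\<phi> k)) \<circ> \<kappa>) k $ fst (pos (\<phi> (\<kappa> l))) $ snd (pos (\<phi> (\<kappa> l))) = (if k = l then 1 else 0)"
      by (simp add: E)
  qed
  then show ?thesis using tE by (intro exI[of _ "\<lambda>k. E (\<phi> k)"] exI[of _ "\<lambda>l. pos (\<phi> (\<kappa> l))"]) simp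
qed

text \<open>One basis must satisfy both the condition from \<open>exists_generic_count\<close> at
  the fixed \<open>A0\<close> and the nonvanishing of a Pluecker coordinate. After symmetrising,
  both are polynomial conditions on arbitrary tuples, and the product of the two polynomials is not
  identically zero.\<close>

theorem has_generic_ml_degree:
  assumes n: "CARD('n::finite) \<ge> 2" and m: "2 \<le> CARD('m::finite)" "CARD('m) \<le> 4" "CARD('m) \<le> CARD('n) + 1"
  shows "has_generic_ml_degree TYPE('n) CARD('m) (generic_degree CARD('m) CARD('n))"
proof -
  obtain h :: "('m option \<times> 'n \<times> 'n) cfun" and B0 :: "'m => complex^'n^'n" and A0 :: "complex^'n^'n"
    where h: "poly_fun h" and B0: "\<And>k. transpose (B0 k) = B0 k" and A0: "transpose A0 = A0" "h (entries (case_option A0 B0)) \<noteq> 0"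
    and count: "\<And>B A. (\<And>k. transpose (B k) = B k) ==> transpose A = A ==> h (entries (case_option A B)) \<noteq> 0 ==>
      finite (lik_solutions B A) \<and> card (lik_solutions B A) = generic_degree CARD('m) CARD('n)"
    using exists_generic_count[where 'm='m, OF n m] by blast
  obtain \<kappa> where \<kappa>: "bij_betw \<kappa> {..<CARD('m)} (UNIV :: 'm set)"
    using ex_bij_betw_nat_finite[of "UNIV :: 'm set"] by (auto simp: atLeast0LessThan)
  obtain B1 :: "'m => complex^'n^'n" and c where B1: "\<And>k. transpose (B1 k) = B1 k" "pluecker CARD('m) (B1 \<circ> \<kappa>) c \<noteq> 0"
    using exists_pluecker_nonzero[OF n m(3) \<kappa>] by blast
  define g where "g w = h (\<lambda>(i, r, s). case i of None => A0 $ r $ s | Some k => w (k, r, s))" for w :: "'m \<times> 'n \<times> 'n => complex"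
  have g: "poly_fun g"
    unfolding g_def
  proof (rule poly_fun_subst[OF h])
    fix i :: "'m option \<times> 'n \<times> 'n"
    obtain k r s where i: "i = (k, r, s)" by (cases i)
    show "poly_fun (\<lambda>w. case i of (i, r, s) => case i of None => A0 $ r $ s | Some k => w (k, r, s))"
      unfolding i by (cases k) (auto intro: poly_fun.intros)
  qed
  have gB: "g (entries B) = h (entries (case_option A0 B))" for B
    unfolding g_def entries_def by (intro arg_cong[of _ _ h]) (auto simp: fun_eq_iff split: option.split)
  define q1 where "q1 w = g (entries (\<lambda>k. sym_part w k))" for w :: "'m \<times> 'n \<times> 'n => complex"
  define q2 where "q2 w = pluecker CARD('m) ((\<lambda>k. sym_part w k) \<circ> \<kappa>) c" for w :: "'m \<times> 'n \<times> 'n => complex"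
  have sp: "poly_fun (\<lambda>w :: 'm \<times> 'n \<times> 'n => complex. sym_part w k $ r $ s)" for k r s
    unfolding sym_part_def divide_inverse vec_lambda_beta by (intro poly_fun_intros)
  have "poly_fun q1"
    unfolding q1_def entries_def case_prod_beta' by (intro poly_fun_subst[OF g] sp)
  moreover have "poly_fun q2"
    unfolding q2_def pluecker_def o_def by (intro poly_fun_intros sp)
  moreover have "q1 (entries B0) \<noteq> 0" using A0 B0 by (simp add: q1_def sym_part_entries gB)
  moreover have "q2 (entries B1) \<noteq> 0" using B1 by (simp add: q2_def sym_part_entries)
  ultimately obtain w where w: "q1 w * q2 w \<noteq> 0" using poly_fun_mult_nonzero[of q1 q2] by blast
  show ?thesis
  proof (rule has_generic_ml_degreeI[OF g, of "\<lambda>k. sym_part w k" \<kappa> c])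
    show "g (entries (\<lambda>k. sym_part w k)) \<noteq> 0" "pluecker CARD('m) ((\<lambda>k. sym_part w k) \<circ> \<kappa>) c \<noteq> 0"
      using w by (simp_all add: q1_def q2_def)
    show "transpose (sym_part w k) = sym_part w k" for k by (rule transpose_sym_part)
    show "bij_betw \<kappa> {..<CARD('m)} UNIV" by fact
    fix B :: "'m => complex^'n^'n"
    assume B: "\<And>k. transpose (B k) = B k" "inj (vcomb B)" "g (entries B) \<noteq> 0"
    show "has_ml_degree (range (vcomb B)) (generic_degree CARD('m) CARD('n))"
      by (rule has_ml_degreeI[OF n B(1,2) h A0(1)]) (use B(3) gB count[of B, OF B(1)] in auto)
  qed
qed

lemma generic_degree_values:
  assumes "n \<ge> 2"
  shows "real (generic_degree 2 n) = 2 * real n - 3" "real (generic_degree 3 n) = 3 * real n ^ 2 - 9 * real n + 7"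
    "n \<ge> 3 ==> real (generic_degree 4 n) = 11 / 3 * real n ^ 3 - 18 * real n ^ 2 + 85 / 3 * real n - 15"
proof -
  \<comment> \<open>With \<open>k = n - 2\<close> the differences inside the two powers become the
    ordinary numbers \<open>k + 1\<close> and \<open>k\<close>.\<close>
  obtain k where k: "n = k + 2" using assms by (metis le_iff_add add.commute)
  have le: "k ^ j \<le> (k + 1) ^ j" for j by (intro power_mono) auto
  have d: "real ((k + 1) ^ j - k ^ j) = (real k + 1) ^ j - real k ^ j" for j
    using le[of j] by (simp add: of_nat_diff add.commute)
  show "real (generic_degree 2 n) = 2 * real n - 3" "real (generic_degree 3 n) = 3 * real n ^ 2 - 9 * real n + 7"
    using d[of 2] d[of 3] by (simp_all add: generic_degree_def k algebra_simps power2_eq_square power3_eq_cube)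
  assume "n \<ge> 3"
  then have k1: "k \<ge> 1" by (simp add: k)
  define C where "C = (n + 1 choose 3)"
  have choose_3: "real (N choose 3) = real N * (real N - 1) * (real N - 2) / 6" for N
    by (simp add: binomial_gbinomial gbinomial_prod_rev numeral_3_eq_3)
  have C: "real C = (real k + 3) * (real k + 2) * (real k + 1) / 6"
    unfolding C_def choose_3 k by (simp add: add.commute)
  \<comment> \<open>Subtracting the nodal contribution does not truncate. For k = 0 it would, and
    this is where n \<ge> 3 enters.\<close>
  have "2 * real C \<le> (real k + 1) ^ 4 - real k ^ 4"
  proof -
    have "(real k + 1) ^ 4 - real k ^ 4 - 2 * real C = 11 / 3 * real k ^ 3 + 4 * real k ^ 2 + real k / 3 - 1"
      unfolding C by (simp add: field_simps power2_eq_square power3_eq_cube power4_eq_xxxx)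
    moreover have "real k ^ 2 \<ge> 1" using k1 by simp
    moreover have "real k ^ 3 \<ge> 0" by simp
    ultimately show ?thesis by linarith
  qed
  then have le_C: "2 * C \<le> (k + 1) ^ 4 - k ^ 4" unfolding d[symmetric] by (metis of_nat_le_iff of_nat_mult of_nat_numeral)
  have "generic_degree 4 n = (k + 1) ^ 4 - k ^ 4 - 2 * C" unfolding generic_degree_def C_def by (simp add: k)
  then have "real (generic_degree 4 n) = real ((k + 1) ^ 4 - k ^ 4) - 2 * real C" using le_C by (simp only: of_nat_diff of_nat_mult of_nat_numeral)
  then show "real (generic_degree 4 n) = 11 / 3 * real n ^ 3 - 18 * real n ^ 2 + 85 / 3 * real n - 15"
    unfolding d C k by (simp add: field_simps power2_eq_square power3_eq_cube power4_eq_xxxx)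
qed

text \<open>The index types for the bases are the numeral types 2, 3 and 4. The binomial conditions
  amount to n \<ge> 2, and to n \<ge> 3 in the last case, so that the bound
  \<open>CARD('m) \<le> CARD('n) + 1\<close> of \<open>has_generic_ml_degree\<close> is always
  met.\<close>

theorem theorem2:
  fixes n :: nat
  defines "n \<equiv> CARD('n::finite)"
  shows "(2 \<le> (n + 1) choose 2 \<longrightarrow>
            (\<exists>ML\<^sub>2. has_generic_ml_degree TYPE('n) 2 ML\<^sub>2 \<and>
               real ML\<^sub>2 = 2 * real n - 3)) \<and>
         (3 \<le> (n + 1) choose 2 \<longrightarrow>
            (\<exists>ML\<^sub>3. has_generic_ml_degree TYPE('n) 3 ML\<^sub>3 \<and>
               real ML\<^sub>3 = 3 * real n ^ 2 - 9 * real n + 7)) \<and>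
         (4 \<le> (n + 1) choose 2 \<longrightarrow>
            (\<exists>ML\<^sub>4. has_generic_ml_degree TYPE('n) 4 ML\<^sub>4 \<and>
               real ML\<^sub>4 = 11 / 3 * real n ^ 3 - 18 * real n ^ 2 + 85 / 3 * real n - 15))"
proof (intro conjI impI)
  have small: "n \<ge> 2" if "2 \<le> n + 1 choose 2"
  proof (rule ccontr)
    assume "\<not> n \<ge> 2"
    then have "n = 0 \<or> n = 1" by auto
    then show False using that by (auto simp: numeral_2_eq_2)
  qed
  show "\<exists>ML\<^sub>2. has_generic_ml_degree TYPE('n) 2 ML\<^sub>2 \<and> real ML\<^sub>2 = 2 * real n - 3" if "2 \<le> n + 1 choose 2"
    using has_generic_ml_degree[where 'n='n and 'm=2] small[OF that] generic_degree_values(1)[of n] by (auto simp: n_def)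
  show "\<exists>ML\<^sub>3. has_generic_ml_degree TYPE('n) 3 ML\<^sub>3 \<and> real ML\<^sub>3 = 3 * real n ^ 2 - 9 * real n + 7" if "3 \<le> n + 1 choose 2"
    using has_generic_ml_degree[where 'n='n and 'm=3] small that generic_degree_values(2)[of n] by (auto simp: n_def)
  show "\<exists>ML\<^sub>4. has_generic_ml_degree TYPE('n) 4 ML\<^sub>4 \<and> real ML\<^sub>4 = 11 / 3 * real n ^ 3 - 18 * real n ^ 2 + 85 / 3 * real n - 15"
    if "4 \<le> n + 1 choose 2"
  proof -
    have "n \<noteq> 2" using that by (auto simp: numeral_eq_Suc)
    then have "n \<ge> 3" using small that by simp
    then show ?thesis
      using has_generic_ml_degree[where 'n='n and 'm=4] generic_degree_values(3)[of n] by (auto simp: n_def)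
  qed
qed

end
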